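(* Let $(R,\mathfrak m)$ be a regular local ring of dimension $d>2$ and let $I\subset R$ be a Cohen-Macaulay ideal of height two generated by exactly $d$ elements, i.e. $\mu(I)=d$. Suppose $I$ is locally complete intersection. Then $I^{i}=I^{(i)}$ for all $i<d-1$ and $I^{n}\neq I^{(n)}$ for all $n\geq d-1$.
   Context: $\mu(I)$ is the minimal number of generators of $I$. An ideal $I$ is Cohen-Macaulay if the ring $R/I$ is Cohen-Macaulay. An ideal is a complete intersection if it is generated by a regular sequence of length equal to its height; $I$ is locally complete intersection if $I_{\mathfrak p}\subset R_{\mathfrak p}$ is a complete intersection for every $\mathfrak p\in V(I)\setminus\{\mathfrak m\}$ (only on the punctured spectrum). For $n\ge 1$ the $n$-th symbolic power of $I$ is $I^{(n)}:=\bigcap_{\mathfrak p\in \mathrm{Ass}(R/I)}(I^nR_{\mathfrak p}\cap R)$. Exponents are integers $\ge 1$. *)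

theory Defs
  imports "HOL-Algebra.Algebra" "HOL-Library.Extended_Nat"
begin

section \<open>Localization\<close>

text \<open>The localization \<open>S\<inverse>R\<close> of a commutative ring at a multiplicative set: equivalence classes
  \<open>a/s\<close> of pairs. The ring operations are defined on classes as unions over all representatives,
  in the same way as multiplication in the library's quotient ring.\<close>

definition loc_frac :: "('a, 'b) ring_scheme \<Rightarrow> 'a set \<Rightarrow> 'a \<Rightarrow> 'a \<Rightarrow> ('a \<times> 'a) set" where
  "loc_frac R S a s = {(b, t). b \<in> carrier R \<and> t \<in> S \<and>
     (\<exists>u\<in>S. u \<otimes>\<^bsub>R\<^esub> (a \<otimes>\<^bsub>R\<^esub> t) = u \<otimes>\<^bsub>R\<^esub> (b \<otimes>\<^bsub>R\<^esub> s))}"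

definition localization :: "('a, 'b) ring_scheme \<Rightarrow> 'a set \<Rightarrow> ('a \<times> 'a) set ring" where
  "localization R S =
    \<lparr>carrier = {loc_frac R S a s | a s. a \<in> carrier R \<and> s \<in> S},
     monoid.mult = (\<lambda>A B. \<Union>(a, s)\<in>A. \<Union>(b, t)\<in>B. loc_frac R S (a \<otimes>\<^bsub>R\<^esub> b) (s \<otimes>\<^bsub>R\<^esub> t)),
     monoid.one = loc_frac R S \<one>\<^bsub>R\<^esub> \<one>\<^bsub>R\<^esub>,
     ring.zero = loc_frac R S \<zero>\<^bsub>R\<^esub> \<one>\<^bsub>R\<^esub>,
     ring.add = (\<lambda>A B. \<Union>(a, s)\<in>A. \<Union>(b, t)\<in>B.
              loc_frac R S ((a \<otimes>\<^bsub>R\<^esub> t) \<oplus>\<^bsub>R\<^esub> (b \<otimes>\<^bsub>R\<^esub> s)) (s \<otimes>\<^bsub>R\<^esub> t))\<rparr>"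

abbreviation loc_at :: "('a, 'b) ring_scheme \<Rightarrow> 'a set \<Rightarrow> ('a \<times> 'a) set ring" where
  "loc_at R p \<equiv> localization R (carrier R - p)"

abbreviation loc_map :: "('a, 'b) ring_scheme \<Rightarrow> 'a set \<Rightarrow> 'a \<Rightarrow> ('a \<times> 'a) set" where
  "loc_map R p \<equiv> \<lambda>r. loc_frac R (carrier R - p) r \<one>\<^bsub>R\<^esub>"

definition ext_ideal :: "('a, 'b) ring_scheme \<Rightarrow> 'a set \<Rightarrow> 'a set \<Rightarrow> ('a \<times> 'a) set set" where
  "ext_ideal R p I = Idl\<^bsub>loc_at R p\<^esub> (loc_map R p ` I)"


section \<open>Dimension, height, number of generators\<close>

definition prime_chain :: "('a, 'b) ring_scheme \<Rightarrow> nat \<Rightarrow> (nat \<Rightarrow> 'a set) \<Rightarrow> bool" where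
  "prime_chain R n P \<longleftrightarrow> (\<forall>i\<le>n. primeideal (P i) R) \<and> (\<forall>i<n. P i \<subset> P (Suc i))"

text \<open>The zero ring receives dimension \<open>0\<close> rather than \<open>-\<infinity>\<close>.\<close>

definition krull_dim :: "('a, 'b) ring_scheme \<Rightarrow> enat" where
  "krull_dim R = Sup {enat n | n. \<exists>P. prime_chain R n P}"

definition prime_height :: "('a, 'b) ring_scheme \<Rightarrow> 'a set \<Rightarrow> enat" where
  "prime_height R p = Sup {enat n | n. \<exists>P. prime_chain R n P \<and> P n = p}"

text \<open>The unit ideal has height \<open>\<infinity>\<close>, so an ideal of finite height is proper.\<close>

definition height :: "('a, 'b) ring_scheme \<Rightarrow> 'a set \<Rightarrow> enat" where
  "height R I = Inf {prime_height R p | p. primeideal p R \<and> I \<subseteq> p}"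

definition min_gens :: "('a, 'b) ring_scheme \<Rightarrow> 'a set \<Rightarrow> enat" where
  "min_gens R I = Inf {enat (card A) | A. finite A \<and> A \<subseteq> carrier R \<and> Idl\<^bsub>R\<^esub> A = I}"


section \<open>Regular sequences and local rings\<close>

definition nonzerodivisor :: "('a, 'b) ring_scheme \<Rightarrow> 'a \<Rightarrow> bool" where
  "nonzerodivisor R a \<longleftrightarrow> a \<in> carrier R \<and> (\<forall>b\<in>carrier R. a \<otimes>\<^bsub>R\<^esub> b = \<zero>\<^bsub>R\<^esub> \<longrightarrow> b = \<zero>\<^bsub>R\<^esub>)"

definition regular_sequence :: "('a, 'b) ring_scheme \<Rightarrow> 'a list \<Rightarrow> bool" where
  "regular_sequence R xs \<longleftrightarrow>
     set xs \<subseteq> carrier R \<and> Idl\<^bsub>R\<^esub> (set xs) \<noteq> carrier R \<and>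
     (\<forall>i<length xs. let J = Idl\<^bsub>R\<^esub> (set (take i xs)) in nonzerodivisor (R Quot J) (J +>\<^bsub>R\<^esub> (xs ! i)))"

definition complete_intersection :: "('a, 'b) ring_scheme \<Rightarrow> 'a set \<Rightarrow> bool" where
  "complete_intersection R I \<longleftrightarrow>
     (\<exists>xs. regular_sequence R xs \<and> Idl\<^bsub>R\<^esub> (set xs) = I \<and> height R I = enat (length xs))"

locale noetherian_local_ring = noetherian_ring R + cring R for R (structure) +
  fixes m
  assumes m_maximal: "maximalideal m R"
    and m_unique: "maximalideal n R \<Longrightarrow> n = m"

locale regular_local_ring = noetherian_local_ring +
  assumes regular: "min_gens R m = krull_dim R"

definition depth :: "('a, 'b) ring_scheme \<Rightarrow> 'a set \<Rightarrow> enat" where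
  "depth R m = Sup {enat (length xs) | xs. regular_sequence R xs \<and> set xs \<subseteq> m}"

definition cohen_macaulay_local_ring :: "('a, 'b) ring_scheme \<Rightarrow> bool" where
  "cohen_macaulay_local_ring R \<longleftrightarrow>
     (\<exists>m. noetherian_local_ring R m \<and> depth R m = krull_dim R)"


section \<open>Properties of ideals in a local ring\<close>

text \<open>For a proper ideal \<open>I\<close> of a local ring, \<open>R/I\<close> is again local, so no further localization is
  needed to say that it is Cohen-Macaulay.\<close>

definition cohen_macaulay_ideal :: "('a, 'b) ring_scheme \<Rightarrow> 'a set \<Rightarrow> bool" where
  "cohen_macaulay_ideal R I \<longleftrightarrow> cohen_macaulay_local_ring (R Quot I)"

text \<open>Only the punctured spectrum is considered: nothing is required at the maximal ideal \<open>m\<close>.\<close>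

definition locally_complete_intersection :: "('a, 'b) ring_scheme \<Rightarrow> 'a set \<Rightarrow> 'a set \<Rightarrow> bool" where
  "locally_complete_intersection R m I \<longleftrightarrow>
     (\<forall>p. primeideal p R \<and> I \<subseteq> p \<and> p \<noteq> m \<longrightarrow>
        complete_intersection (loc_at R p) (ext_ideal R p I))"

text \<open>\<open>Ass(R/I)\<close>: the primes that are annihilators of elements \<open>c\<close> of the \<open>R\<close>-module \<open>R/I\<close>,
  on which \<open>r\<close> acts as multiplication by its residue class.\<close>

definition associated_primes :: "('a, 'b) ring_scheme \<Rightarrow> 'a set \<Rightarrow> 'a set set" where
  "associated_primes R I = {p. primeideal p R \<and>
     (\<exists>c\<in>carrier (R Quot I).
        p = {r \<in> carrier R. (I +>\<^bsub>R\<^esub> r) \<otimes>\<^bsub>R Quot I\<^esub> c = \<zero>\<^bsub>R Quot I\<^esub>})}"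

abbreviation ideal_power :: "('a, 'b) ring_scheme \<Rightarrow> 'a set \<Rightarrow> nat \<Rightarrow> 'a set" where
  "ideal_power R I n \<equiv> I [^]\<^bsub>ideals_set R\<^esub> n"

text \<open>\<open>I\<^sup>n R\<^sub>p \<inter> R\<close> is the contraction along the canonical map \<open>R \<rightarrow> R\<^sub>p\<close>.\<close>

definition symbolic_power :: "('a, 'b) ring_scheme \<Rightarrow> 'a set \<Rightarrow> nat \<Rightarrow> 'a set" where
  "symbolic_power R I n =
     {r \<in> carrier R. \<forall>p\<in>associated_primes R I. loc_map R p r \<in> ext_ideal R p (ideal_power R I n)}"

end

theory Submission
  imports Defs "HOL-Library.Poly_Mapping"
begin

text \<open>Let \<open>f\<^sub>1, \<dots>, f\<^sub>d\<close> generate \<open>I\<close>. Depth counting shows that the syzygies of \<open>f\<close> form a free module, with a basis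
  of \<open>d - 1\<close> linear forms \<open>l\<close> in \<open>R[T\<^sub>1, \<dots>, T\<^sub>d]\<close>. At a prime other than \<open>m\<close> the ideal has two generators, so there all
  but one of the \<open>l\<close> eliminate a variable; hence the \<open>l\<close> form a regular sequence and \<open>I\<^sup>n\<close> is the part of degree \<open>n\<close> of
  \<open>R[T]/(l)\<close>. Its Koszul resolution has length \<open>min n (d - 1)\<close>. For \<open>n < d - 1\<close> this leaves no room for an element of \<open>R/I\<^sup>n\<close>
  that is killed by \<open>m\<close>; for \<open>n \<ge> d - 1\<close> the wedge product of the coefficient vectors of the \<open>l\<close> yields one. All other
  associated primes of \<open>I\<^sup>n\<close> are associated to \<open>I\<close>, because \<open>I\<close> is locally generated by a regular sequence, so
  \<open>I\<^sup>n = I\<^bsup>(n)\<^esup>\<close> means that there is no such element.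

  To calculate in a type class, \<open>R\<close> is written as a quotient \<open>P/J\<close> of the free commutative ring \<open>P\<close> on its elements.
  Ideals of \<open>R\<close> become ideals of \<open>P\<close> that contain \<open>J\<close>.\<close>

section \<open>Ideals of a type class ring\<close>

text \<open>The threshold is a Koszul degree. R has homology only in degree 0, so the part of
  R/\<open>I^n\<close> killed by \<open>m\<close>, which is its homology in degree \<open>d\<close>,
  is the homology of \<open>I^n\<close> in degree \<open>d - 1\<close>: the boundary of a constant
  top chain with value in that part has entries in \<open>I^n\<close>. The resolution of
  \<open>I^n\<close> stops at \<open>min n (d - 1)\<close>, which is below \<open>d - 1\<close>
  exactly if \<open>n < d - 1\<close>. From \<open>n = d - 1\<close> on, a class in that degree can
  be written down. Minimality of the generators puts the coefficients of each \<open>l\<close> in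
  \<open>m\<close>, so \<open>l\<close> is a combination of the parameters whose coefficients form a
  column of linear forms; contraction with the parameters turns the column back into
  \<open>l\<close>, and the wedge of all columns is a cycle modulo the \<open>l\<close>. Depth
  enters only as vanishing of Koszul homology, because then every long exact sequence is an
  elementwise lifting argument on chains. Local statements are phrased with factors outside a prime
  instead of fractions, so one ring of scalars serves all primes; true localizations occur only
  where the hypotheses and symbolic powers are translated.\<close>

interpretation idl: Modules.module "(*) :: 'a::comm_ring_1 \<Rightarrow> 'a \<Rightarrow> 'a"
  by unfold_locales (simp_all add: algebra_simps)

declare idl.scale_scale [simp del]

lemma ideal_mult_right: "idl.subspace A \<Longrightarrow> x \<in> A \<Longrightarrow> x * c \<in> A"
  using idl.subspace_scale[of A x c] by (simp add: mult.commute)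

definition prime_id :: "'a::comm_ring_1 set \<Rightarrow> bool" where
  "prime_id p \<longleftrightarrow> idl.subspace p \<and> 1 \<notin> p \<and> (\<forall>a b. a * b \<in> p \<longrightarrow> a \<in> p \<or> b \<in> p)"

lemma prime_idD:
  assumes "prime_id p"
  shows "idl.subspace p" "1 \<notin> p" "\<And>a b. a * b \<in> p \<Longrightarrow> a \<in> p \<or> b \<in> p"
    "\<And>a b. a \<notin> p \<Longrightarrow> b \<notin> p \<Longrightarrow> a * b \<notin> p"
  using assms by (auto simp: prime_id_def)

lemma prime_id_prod:
  assumes "prime_id p" "finite F" "\<And>i. i \<in> F \<Longrightarrow> f i \<notin> p"
  shows "prod f F \<notin> p"
  using assms(2,3) by (induction F rule: finite_induct) (use prime_idD[OF assms(1)] in auto)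

lemma prime_id_power:
  assumes "prime_id p" "x ^ n \<in> p"
  shows "x \<in> p"
  using assms(2) by (induction n) (use prime_idD[OF assms(1)] in auto)

text \<open>The maximal condition is imposed on ideals above \<open>J\<close> only: the quotient by
  \<open>J\<close> is noetherian, while the ring itself, a free commutative ring in the application,
  need not be.\<close>

definition noeth :: "'a::comm_ring_1 set \<Rightarrow> bool" where
  "noeth J \<longleftrightarrow> (\<forall>F. F \<noteq> {} \<longrightarrow> (\<forall>A\<in>F. idl.subspace A \<and> J \<subseteq> A) \<longrightarrow>
     (\<exists>A\<in>F. \<forall>B\<in>F. A \<subseteq> B \<longrightarrow> B = A))"

lemma noethD:
  assumes "noeth J" "F \<noteq> {}" "\<And>A. A \<in> F \<Longrightarrow> idl.subspace A \<and> J \<subseteq> A"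
  obtains A where "A \<in> F" "\<And>B. B \<in> F \<Longrightarrow> A \<subseteq> B \<Longrightarrow> B = A"
  using assms unfolding noeth_def by metis

lemma noeth_mono: "noeth J \<Longrightarrow> J \<subseteq> K \<Longrightarrow> noeth K"
  unfolding noeth_def by (meson order_trans)

text \<open>A maximal member of the family of ideals generated over \<open>J\<close> by finite
  subsets of \<open>Y\<close> absorbs every further element of \<open>Y\<close>.\<close>

lemma noeth_span_finite:
  assumes "noeth J"
  obtains G where "finite G" "G \<subseteq> Y" "idl.span (J \<union> Y) = idl.span (J \<union> G)"
proof -
  define F where "F = {idl.span (J \<union> G) | G. finite G \<and> G \<subseteq> Y}"
  have "F \<noteq> {}" unfolding F_def by blast
  moreover have "\<And>A. A \<in> F \<Longrightarrow> idl.subspace A \<and> J \<subseteq> A"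
    unfolding F_def using idl.span_superset by blast
  ultimately obtain A where A: "A \<in> F" "\<And>B. B \<in> F \<Longrightarrow> A \<subseteq> B \<Longrightarrow> B = A"
    using noethD[OF assms] by metis
  then obtain G where G: "finite G" "G \<subseteq> Y" "A = idl.span (J \<union> G)" unfolding F_def by blast
  have "x \<in> A" if "x \<in> Y" for x
  proof -
    have "idl.span (J \<union> insert x G) \<in> F" unfolding F_def using G that by blast
    moreover have "A \<subseteq> idl.span (J \<union> insert x G)" unfolding G(3) by (rule idl.span_mono) auto
    ultimately have "idl.span (J \<union> insert x G) = A" using A(2) by blast
    thus ?thesis using idl.span_superset[of "J \<union> insert x G"] by blast
  qed
  hence "J \<union> Y \<subseteq> A" unfolding G(3) using idl.span_superset by blast
  hence "idl.span (J \<union> Y) \<subseteq> A" unfolding G(3) by (intro idl.span_minimal) auto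
  moreover have "A \<subseteq> idl.span (J \<union> Y)" unfolding G(3) using G(2) by (intro idl.span_mono) auto
  ultimately show ?thesis using that G by blast
qed

lemma noeth_fg:
  assumes "noeth J" "idl.subspace B" "J \<subseteq> B"
  obtains G where "finite G" "G \<subseteq> B" "B = idl.span (J \<union> G)"
proof -
  obtain G where "finite G" "G \<subseteq> B" "idl.span (J \<union> B) = idl.span (J \<union> G)"
    using noeth_span_finite[OF assms(1)] by metis
  moreover have "idl.span (J \<union> B) = B" using assms by (simp add: sup.absorb2)
  ultimately show ?thesis using that by metis
qed

text \<open>A family without maximal member contains a strictly increasing sequence; finitely many
  generators of its union already lie in one term.\<close>

lemma noethI_fg:
  assumes fg: "\<And>B. idl.subspace B \<Longrightarrow> J \<subseteq> B \<Longrightarrow> \<exists>G. finite G \<and> G \<subseteq> B \<and> B \<subseteq> idl.span (J \<union> G)"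
  shows "noeth J"
  unfolding noeth_def
proof (intro allI impI, rule ccontr)
  fix F :: "'a set set"
  assume ne: "F \<noteq> {}" and F: "\<forall>A\<in>F. idl.subspace A \<and> J \<subseteq> A"
    and no: "\<not> (\<exists>A\<in>F. \<forall>B\<in>F. A \<subseteq> B \<longrightarrow> B = A)"
  obtain A0 where A0: "A0 \<in> F" using ne by blast
  have "\<exists>c. \<forall>n. c n \<in> F \<and> c n \<subset> c (Suc n)"
    using dependent_nat_choice[of "\<lambda>_ A. A \<in> F" "\<lambda>_ A B. A \<subset> B"] A0 no by (metis psubsetI)
  then obtain c where c: "\<And>n. c n \<in> F" "\<And>n. c n \<subset> c (Suc n)" by blast
  have mono: "c i \<subseteq> c j" if "i \<le> j" for i j
    using lift_Suc_mono_le[of c, OF _ that] c(2) by blast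
  define B where "B = (\<Union>n. c n)"
  have ci: "idl.subspace (c n)" for n using c(1) F by blast
  have "idl.subspace B"
  proof (rule idl.subspaceI)
    show "0 \<in> B" unfolding B_def using idl.subspace_0[OF ci] by blast
    show "x + y \<in> B" if xy: "x \<in> B" "y \<in> B" for x y
    proof -
      obtain i j where ij: "x \<in> c i" "y \<in> c j" using xy unfolding B_def by blast
      have "x \<in> c (max i j)" "y \<in> c (max i j)" using ij mono[of i "max i j"] mono[of j "max i j"] by auto
      thus ?thesis unfolding B_def using idl.subspace_add[OF ci[of "max i j"]] by blast
    qed
    show "a * x \<in> B" if "x \<in> B" for x a
      using that idl.subspace_scale[OF ci] unfolding B_def by blast
  qed
  moreover have "J \<subseteq> B" unfolding B_def using c(1)[of 0] F by blast
  ultimately obtain G where G: "finite G" "G \<subseteq> B" "B \<subseteq> idl.span (J \<union> G)" using fg[of B] by blast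
  have "\<exists>n. G \<subseteq> c n" using G(1,2)
  proof (induction G rule: finite_induct)
    case (insert x G)
    then obtain n k where nk: "G \<subseteq> c n" "x \<in> c k" unfolding B_def by blast
    have "insert x G \<subseteq> c (max n k)" using nk mono[of n "max n k"] mono[of k "max n k"] by auto
    thus ?case by blast
  qed auto
  then obtain n where n: "G \<subseteq> c n" by blast
  have "idl.span (J \<union> G) \<subseteq> c n" using n c(1)[of n] F by (intro idl.span_minimal) auto
  hence "c (Suc n) \<subseteq> c n" using G(3) unfolding B_def by blast
  thus False using c(2)[of n] by blast
qed

lemma span_insert_ideal:
  assumes "idl.subspace J"
  shows "x \<in> idl.span (insert a J) \<longleftrightarrow> (\<exists>k. x - k * a \<in> J)"
  using assms idl.span_breakdown_eq[of x a J] by (simp add: idl.span_eq_iff[THEN iffD2])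

context Modules.module
begin

lemma ann_subspace: "subspace N \<Longrightarrow> idl.subspace {r. r *s v \<in> N}"
  by (rule idl.subspaceI)
    (auto simp: subspace_0 scale_left_distrib subspace_add scale_scale[symmetric] subspace_scale simp del: scale_scale)

text \<open>Among the annihilators of the multiples of \<open>v\<close> outside \<open>N\<close> a
  maximal one is prime, since multiplying by a factor outside it cannot enlarge it. Working with
  multiples of \<open>v\<close> preserves every property of \<open>v\<close> that is stable under
  scaling; the applications rely on this.\<close>

lemma ann_prime:
  assumes J: "noeth J" and N: "subspace N" and JN: "\<And>j. j \<in> J \<Longrightarrow> j *s v \<in> N" and v: "v \<notin> N"
  obtains s where "s *s v \<notin> N" "prime_id {r. r *s (s *s v) \<in> N}"
proof -
  define F where "F = {{r. r *s (s *s v) \<in> N} | s. s *s v \<notin> N}"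
  have "F \<noteq> {}" unfolding F_def using v scale_one by (auto intro!: exI[of _ 1])
  moreover have "idl.subspace A \<and> J \<subseteq> A" if A: "A \<in> F" for A
  proof -
    obtain s where s: "A = {r. r *s (s *s v) \<in> N}" using A unfolding F_def by blast
    have "j *s (s *s v) \<in> N" if "j \<in> J" for j
      using subspace_scale[OF N JN[OF that], of s] by (simp add: mult.commute)
    thus ?thesis unfolding s using ann_subspace[OF N] by blast
  qed
  ultimately obtain A where A: "A \<in> F" "\<And>B. B \<in> F \<Longrightarrow> A \<subseteq> B \<Longrightarrow> B = A"
    using noethD[OF J] by metis
  then obtain s where s: "A = {r. r *s (s *s v) \<in> N}" "s *s v \<notin> N" unfolding F_def by blast
  have "b \<in> A \<or> a \<in> A" if ab: "a * b \<in> A" for a b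
  proof (rule disjCI)
    assume "a \<notin> A"
    hence na: "(a * s) *s v \<notin> N" using s by simp
    have "{r. r *s ((a * s) *s v) \<in> N} \<in> F" unfolding F_def using na by blast
    moreover have "A \<subseteq> {r. r *s ((a * s) *s v) \<in> N}"
    proof
      fix r assume "r \<in> A"
      hence "r *s (s *s v) \<in> N" using s(1) by blast
      hence "a *s (r *s (s *s v)) \<in> N" by (rule subspace_scale[OF N])
      thus "r \<in> {r. r *s ((a * s) *s v) \<in> N}" by (simp add: mult_ac)
    qed
    ultimately have "{r. r *s ((a * s) *s v) \<in> N} = A" using A(2) by blast
    moreover have "b *s ((a * s) *s v) \<in> N" using ab s by (simp add: mult_ac)
    ultimately show "b \<in> A" by blast
  qed
  moreover have "1 \<notin> A" using s by simp
  moreover have "idl.subspace A" unfolding s using ann_subspace[OF N] .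
  ultimately have "prime_id A" unfolding prime_id_def by blast
  thus ?thesis using that s by blast
qed

text \<open>A local form of Nakayama's lemma that avoids localizing: ``at \<open>p\<close>'' means up to factors outside \<open>p\<close>.\<close>

lemma nakayama:
  assumes p: "prime_id p" and N: "subspace N" and "finite G"
    and "\<And>g. g \<in> G \<Longrightarrow> \<exists>t. t \<notin> p \<and> t *s g \<in> span (N \<union> {c *s h | c h. c \<in> p \<and> h \<in> G})"
  shows "\<exists>t. t \<notin> p \<and> (\<forall>g\<in>G. t *s g \<in> N)"
  using assms(3,4)
proof (induction G rule: finite_induct)
  case empty
  show ?case using prime_idD(2)[OF p] by blast
next
  case (insert g0 G)
  let ?M = "\<lambda>G. span (N \<union> {c *s h | c h. c \<in> p \<and> h \<in> G})"
  have split: "\<exists>c\<in>p. z - c *s g0 \<in> ?M G" if "z \<in> ?M (insert g0 G)" for z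
    using that
  proof (induction rule: span_induct)
    case base
    show ?case
    proof (rule subspaceI)
      show "0 \<in> {x. \<exists>c\<in>p. x - c *s g0 \<in> ?M G}"
        using idl.subspace_0[OF prime_idD(1)[OF p]] span_zero by (auto intro!: bexI[of _ 0])
      fix x y assume "x \<in> {x. \<exists>c\<in>p. x - c *s g0 \<in> ?M G}" "y \<in> {x. \<exists>c\<in>p. x - c *s g0 \<in> ?M G}"
      then obtain c d where cd: "c \<in> p" "d \<in> p" "x - c *s g0 \<in> ?M G" "y - d *s g0 \<in> ?M G" by blast
      have "x + y - (c + d) *s g0 \<in> ?M G"
        using span_add[OF cd(3,4)] by (simp add: scale_left_distrib algebra_simps)
      thus "x + y \<in> {x. \<exists>c\<in>p. x - c *s g0 \<in> ?M G}"
        using idl.subspace_add[OF prime_idD(1)[OF p] cd(1,2)] by blast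
    next
      fix x a assume "x \<in> {x. \<exists>c\<in>p. x - c *s g0 \<in> ?M G}"
      then obtain c where c: "c \<in> p" "x - c *s g0 \<in> ?M G" by blast
      have "a *s x - (a * c) *s g0 \<in> ?M G"
        using span_scale[OF c(2), of a] by (simp add: scale_right_diff_distrib)
      thus "a *s x \<in> {x. \<exists>c\<in>p. x - c *s g0 \<in> ?M G}"
        using idl.subspace_scale[OF prime_idD(1)[OF p] c(1)] by blast
    qed
  next
    case (step x)
    consider "x \<in> N" | c h where "c \<in> p" "h \<in> G" "x = c *s h" | c where "c \<in> p" "x = c *s g0"
      using step by auto
    thus ?case
    proof cases
      case 1
      thus ?thesis using idl.subspace_0[OF prime_idD(1)[OF p]]
        by (intro bexI[of _ 0]) (auto intro: span_base)
    next
      case (2 c h)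
      thus ?thesis using idl.subspace_0[OF prime_idD(1)[OF p]]
        by (intro bexI[of _ 0]) (auto intro!: span_base)
    next
      case (3 c)
      thus ?thesis by (intro bexI[of _ c]) (auto intro: span_zero)
    qed
  qed
  obtain t0 where t0: "t0 \<notin> p" "t0 *s g0 \<in> ?M (insert g0 G)" using insert.prems by blast
  obtain c0 where c0: "c0 \<in> p" "t0 *s g0 - c0 *s g0 \<in> ?M G" using split[OF t0(2)] by blast
  \<comment> \<open>The relation for \<open>g0\<close> contains \<open>g0\<close> itself with
    coefficient \<open>c0\<close> in \<open>p\<close>; collecting both terms leaves the factor
    \<open>t0 - c0\<close>, which is outside \<open>p\<close>.\<close>
  define t1 where "t1 = t0 - c0"
  have t1: "t1 \<notin> p" unfolding t1_def using t0(1) c0(1) idl.subspace_add[OF prime_idD(1)[OF p]] by force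
  have t1g: "t1 *s g0 \<in> ?M G" unfolding t1_def using c0(2) by (simp add: scale_left_diff_distrib)
  \<comment> \<open>Multiplying by \<open>t1\<close> removes \<open>g0\<close> from the relations of
    the other generators, so the induction hypothesis applies to \<open>G\<close>.\<close>
  have "\<exists>t. t \<notin> p \<and> t *s g \<in> ?M G" if g: "g \<in> G" for g
  proof -
    obtain t where t: "t \<notin> p" "t *s g \<in> ?M (insert g0 G)" using insert.prems[of g] g by blast
    obtain c where c: "c \<in> p" "t *s g - c *s g0 \<in> ?M G" using split[OF t(2)] by blast
    have "t1 *s (t *s g - c *s g0) + c *s (t1 *s g0) \<in> ?M G"
      using span_add[OF span_scale[OF c(2)] span_scale[OF t1g]] .
    hence "(t1 * t) *s g \<in> ?M G" by (simp add: scale_right_diff_distrib mult.commute)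
    thus ?thesis using prime_idD(4)[OF p t1 t(1)] by blast
  qed
  from insert.IH[OF this] obtain t where t: "t \<notin> p" "\<And>g. g \<in> G \<Longrightarrow> t *s g \<in> N" by blast
  have "t *s z \<in> N" if "z \<in> ?M G" for z
    using that
  proof (induction rule: span_induct)
    case base
    show ?case using N by (intro subspaceI)
      (auto simp: subspace_0 scale_right_distrib subspace_add scale_left_commute[of t] subspace_scale simp del: scale_scale)
  next
    case (step x)
    thus ?case using t(2) N by (auto simp: subspace_scale scale_left_commute[of t] simp del: scale_scale)
  qed
  hence "t *s (t1 *s g0) \<in> N" using t1g by blast
  moreover have "\<And>g. g \<in> G \<Longrightarrow> t1 *s (t *s g) \<in> N" using t(2) N subspace_scale by blast
  ultimately have "\<forall>g\<in>insert g0 G. (t * t1) *s g \<in> N" by (auto simp: mult.commute)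
  thus ?case using prime_idD(4)[OF p t(1) t1] by blast
qed

end

text \<open>If the element \<open>y\<close> that avoids the old primes lies in the new prime
  \<open>p\<close>, it is corrected by a summand \<open>e\<close> that lies in all old primes but
  not in \<open>p\<close>. Incomparability of the primes provides the factors of
  \<open>e\<close>.\<close>

lemma prime_avoidance:
  assumes "finite F" "\<And>p. p \<in> F \<Longrightarrow> prime_id p" "\<And>p q. p \<in> F \<Longrightarrow> q \<in> F \<Longrightarrow> p \<subseteq> q \<Longrightarrow> p = q"
    "idl.subspace A" "\<And>p. p \<in> F \<Longrightarrow> \<not> A \<subseteq> p"
  shows "\<exists>y\<in>A. \<forall>p\<in>F. y \<notin> p"
  using assms(1,2,3,5)
proof (induction F rule: finite_induct)
  case empty
  thus ?case using idl.subspace_0[OF assms(4)] by blast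
next
  case (insert p F)
  have "\<exists>y\<in>A. \<forall>p\<in>F. y \<notin> p" by (rule insert.IH) (use insert.prems in auto)
  then obtain y where y: "y \<in> A" "\<And>q. q \<in> F \<Longrightarrow> y \<notin> q" by blast
  show ?case
  proof (cases "y \<in> p")
    case False
    thus ?thesis using y by blast
  next
    case True
    have pp: "prime_id p" using insert.prems by blast
    obtain a where a: "a \<in> A" "a \<notin> p" using insert.prems by blast
    have "\<exists>z. z \<in> q \<and> z \<notin> p" if "q \<in> F" for q
      using insert.prems(2)[of q p] insert.hyps(2) that by blast
    then obtain z where z: "\<And>q. q \<in> F \<Longrightarrow> z q \<in> q \<and> z q \<notin> p" by metis
    define e where "e = a * prod z F"
    have e: "e \<notin> p" unfolding e_def
      using prime_idD(4)[OF pp a(2)] prime_id_prod[OF pp insert.hyps(1)] z by blast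
    have eA: "e \<in> A" unfolding e_def using ideal_mult_right[OF assms(4) a(1)] .
    have eq: "e \<in> q" if q: "q \<in> F" for q
    proof -
      have "prod z F = z q * prod z (F - {q})" using q insert.hyps(1) by (simp add: prod.remove)
      thus ?thesis unfolding e_def using z[OF q] insert.prems(1)[of q] q
        by (metis idl.subspace_scale ideal_mult_right insertI2 prime_idD(1))
    qed
    have "y + e \<notin> q" if "q \<in> insert p F" for q
    proof (cases "q = p")
      case True
      thus ?thesis using \<open>y \<in> p\<close> e idl.subspace_diff[OF prime_idD(1)[OF pp], of "y + e" y] by auto
    next
      case False
      hence q: "q \<in> F" using that by blast
      show ?thesis using y(2)[OF q] eq[OF q] insert.prems(1)[of q] q
          idl.subspace_diff[of q "y + e" e] prime_idD(1) by fastforce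
    qed
    thus ?thesis using idl.subspace_add[OF assms(4) y(1) eA] by blast
  qed
qed

text \<open>The maximal annihilators are finitely many primes whose union is the set of zero divisors, so prime avoidance applies.\<close>

lemma nzd_exists:
  assumes J: "noeth J" "idl.subspace J" and A: "idl.subspace A"
    and ann: "\<And>c. (\<And>a. a \<in> A \<Longrightarrow> a * c \<in> J) \<Longrightarrow> c \<in> J"
  shows "\<exists>y\<in>A. \<forall>c. y * c \<in> J \<longrightarrow> c \<in> J"
proof -
  define an where "an c = {r. r * c \<in> J}" for c
  have an: "idl.subspace (an c)" "J \<subseteq> an c" for c
    unfolding an_def using idl.ann_subspace[OF J(2)] ideal_mult_right[OF J(2)] by auto
  define C where "C = {c. c \<notin> J \<and> (\<forall>c'. c' \<notin> J \<longrightarrow> an c \<subseteq> an c' \<longrightarrow> an c' = an c)}"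
  define F where "F = an ` C"
  have below: "\<exists>c\<in>C. an c0 \<subseteq> an c" if "c0 \<notin> J" for c0
  proof -
    define F' where "F' = {an c | c. c \<notin> J \<and> an c0 \<subseteq> an c}"
    have "F' \<noteq> {}" unfolding F'_def using that by blast
    moreover have "\<And>A. A \<in> F' \<Longrightarrow> idl.subspace A \<and> J \<subseteq> A" unfolding F'_def using an by blast
    ultimately obtain A where A: "A \<in> F'" "\<And>B. B \<in> F' \<Longrightarrow> A \<subseteq> B \<Longrightarrow> B = A" using noethD[OF J(1)] by metis
    then obtain c where c: "A = an c" "c \<notin> J" "an c0 \<subseteq> an c" unfolding F'_def by blast
    have "c \<in> C" unfolding C_def using c A(2) unfolding F'_def by blast
    thus ?thesis using c(3) by blast
  qed
  have prime: "prime_id (an c)" if c: "c \<in> C" for c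
  proof -
    have "a \<in> an c \<or> b \<in> an c" if ab: "a * b \<in> an c" for a b
    proof (rule disjCI)
      assume "b \<notin> an c"
      hence b: "b * c \<notin> J" unfolding an_def by simp
      have "x * (b * c) \<in> J" if "x * c \<in> J" for x
        using idl.subspace_scale[OF J(2) that, of b] by (simp add: mult_ac)
      hence "an c \<subseteq> an (b * c)" unfolding an_def by blast
      hence "an (b * c) = an c" using c b unfolding C_def by blast
      thus "a \<in> an c" using ab unfolding an_def by (auto simp: mult.assoc)
    qed
    moreover have "1 \<notin> an c" using c unfolding C_def an_def by simp
    ultimately show ?thesis unfolding prime_id_def using an by blast
  qed
  have incomp: "p = q" if "p \<in> F" "q \<in> F" "p \<subseteq> q" for p q
    using that unfolding F_def C_def by blast
  have "finite F"
  proof -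
    define cc where "cc p = (SOME c. c \<in> C \<and> an c = p)" for p
    have cc: "cc p \<in> C \<and> an (cc p) = p" if p: "p \<in> F" for p
    proof -
      have "\<exists>c. c \<in> C \<and> an c = p" using p unfolding F_def by auto
      thus ?thesis unfolding cc_def by (rule someI_ex)
    qed
    obtain G where G: "finite G" "G \<subseteq> cc ` F" "idl.span (J \<union> cc ` F) = idl.span (J \<union> G)"
      by (rule noeth_span_finite[OF J(1)])
    obtain F0 where F0: "finite F0" "F0 \<subseteq> F" "G = cc ` F0" using finite_subset_image[OF G(1,2)] by blast
    \<comment> \<open>\<open>G\<close> consists of witnesses for the finitely many primes in
      \<open>F0\<close>. If \<open>p\<close> is not among them, a product of elements of these
      primes, none of them in \<open>p\<close>, kills \<open>G\<close> and hence the witness of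
      \<open>p\<close>; so it lies in \<open>p\<close>, a contradiction.\<close>
    have "p \<in> F0" if p: "p \<in> F" for p
    proof (rule ccontr)
      assume np: "p \<notin> F0"
      have "\<exists>z. z \<in> q \<and> z \<notin> p" if "q \<in> F0" for q using incomp[of q p] p that F0(2) np by blast
      then obtain z where z: "\<And>q. q \<in> F0 \<Longrightarrow> z q \<in> q \<and> z q \<notin> p" by metis
      have pp: "prime_id p" using prime[of "cc p"] cc[OF p] by simp
      have notin: "prod z F0 \<notin> p" using prime_id_prod[OF pp F0(1)] z by blast
      have "cc p \<in> idl.span (J \<union> G)" using G(3) p idl.span_superset[of "J \<union> cc ` F"] by blast
      hence "prod z F0 * cc p \<in> J"
      proof (induction rule: idl.span_induct)
        case base
        show ?case using J(2) by (intro idl.subspaceI)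
          (auto simp: idl.subspace_0 distrib_left idl.subspace_add mult.left_commute[of "prod z F0"] idl.subspace_scale)
      next
        case (step x)
        show ?case
        proof (cases "x \<in> J")
          case True thus ?thesis using idl.subspace_scale[OF J(2)] by blast
        next
          case False
          then obtain q where q: "q \<in> F0" "x = cc q" using step F0(3) by blast
          have "prod z F0 = z q * prod z (F0 - {q})" using q F0(1) by (simp add: prod.remove)
          moreover have "z q * x \<in> J" using z[OF q(1)] cc[of q] q F0(2) unfolding an_def by blast
          ultimately show ?thesis using ideal_mult_right[OF J(2), of "z q * x" "prod z (F0 - {q})"]
            by (simp add: mult_ac)
        qed
      qed
      hence "prod z F0 \<in> an (cc p)" unfolding an_def by simp
      thus False using notin cc[OF p] by simp
    qed
    hence "F \<subseteq> F0" by blast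
    thus ?thesis using F0(1) by (rule finite_subset)
  qed
  moreover have "\<not> A \<subseteq> p" if p: "p \<in> F" for p
  proof
    assume Ap: "A \<subseteq> p"
    obtain c where c: "c \<in> C" "p = an c" using p unfolding F_def by blast
    have "c \<in> J" by (rule ann) (use Ap c in \<open>auto simp: an_def\<close>)
    thus False using c(1) unfolding C_def by simp
  qed
  moreover have "prime_id p" if "p \<in> F" for p using that prime unfolding F_def by auto
  ultimately have "\<exists>y\<in>A. \<forall>p\<in>F. y \<notin> p" using incomp by (intro prime_avoidance[OF _ _ _ A]) auto
  then obtain y where y: "y \<in> A" "\<And>p. p \<in> F \<Longrightarrow> y \<notin> p" by blast
  have "c \<in> J" if "y * c \<in> J" for c
  proof (rule ccontr)
    assume "c \<notin> J"
    then obtain c' where c': "c' \<in> C" "an c \<subseteq> an c'" using below by blast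
    have "y \<in> an c" using that unfolding an_def by simp
    hence "y \<in> an c'" using c'(2) by blast
    thus False using y(2)[of "an c'"] c'(1) unfolding F_def by simp
  qed
  thus ?thesis using y(1) by blast
qed

section \<open>Nakayama's lemma and chains of primes\<close>

text \<open>A version for an ideal \<open>E\<close> that is finitely generated only above
  \<open>J\<close>: the generators are chosen inside the proof, and \<open>N\<close> absorbs
  \<open>J\<close>. The hypothesis may then be checked on arbitrary elements of
  \<open>E\<close>.\<close>

lemma nakayama_ideal:
  assumes p: "prime_id p" and J: "noeth J" and E: "idl.subspace E" "J \<subseteq> E" and N: "idl.subspace N" "J \<subseteq> N"
    and gen: "\<And>g. g \<in> E \<Longrightarrow> \<exists>t. t \<notin> p \<and> t * g \<in> idl.span (N \<union> {y * k | y k. y \<in> p \<and> k \<in> E})"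
  shows "\<exists>t. t \<notin> p \<and> (\<forall>g\<in>E. t * g \<in> N)"
proof -
  obtain G where G: "finite G" "G \<subseteq> E" "E = idl.span (J \<union> G)" using noeth_fg[OF J E] .
  define M where "M = idl.span (N \<union> {c * h | c h. c \<in> p \<and> h \<in> G})"
  have yk: "y * k \<in> M" if y: "y \<in> p" and k: "k \<in> E" for y k
  proof -
    have "k \<in> idl.span (J \<union> G)" using k G(3) by simp
    thus ?thesis
    proof (induction rule: idl.span_induct)
      case base
      show ?case unfolding M_def by (intro idl.subspaceI)
        (auto simp: idl.span_zero distrib_left idl.span_add mult.left_commute[of y] idl.span_scale)
    next
      case (step z)
      show ?case
      proof (cases "z \<in> G")
        case True
        thus ?thesis unfolding M_def using y by (intro idl.span_base) blast
      next
        case False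
        hence "z \<in> N" using step N by blast
        thus ?thesis unfolding M_def by (intro idl.span_scale idl.span_base) blast
      qed
    qed
  qed
  have sub: "idl.span (N \<union> {y * k | y k. y \<in> p \<and> k \<in> E}) \<subseteq> M"
    using yk idl.span_base[of _ "N \<union> {c * h | c h. c \<in> p \<and> h \<in> G}"]
    by (intro idl.span_minimal) (auto simp: M_def)
  have "\<exists>t. t \<notin> p \<and> (\<forall>g\<in>G. t * g \<in> N)"
  proof (rule idl.nakayama[OF p N(1) G(1)])
    fix g assume "g \<in> G"
    hence "g \<in> E" using G(2) by blast
    from gen[OF this] show "\<exists>t. t \<notin> p \<and> t * g \<in> idl.span (N \<union> {c * h | c h. c \<in> p \<and> h \<in> G})"
      using sub unfolding M_def by blast
  qed
  then obtain t where t: "t \<notin> p" "\<And>g. g \<in> G \<Longrightarrow> t * g \<in> N" by blast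
  have "t * g \<in> N" if "g \<in> E" for g
  proof -
    have "g \<in> idl.span (J \<union> G)" using that G(3) by simp
    thus ?thesis
    proof (induction rule: idl.span_induct)
      case base
      show ?case using N(1) by (intro idl.subspaceI)
        (auto simp: idl.subspace_0 distrib_left idl.subspace_add mult.left_commute[of t] idl.subspace_scale)
    next
      case (step z)
      thus ?case using t(2) N idl.subspace_scale[OF N(1)] by blast
    qed
  qed
  thus ?thesis using t(1) by blast
qed

section \<open>Saturated ideals and the principal ideal theorem\<close>

definition sat :: "'a::comm_ring_1 set \<Rightarrow> 'a set \<Rightarrow> bool" where
  "sat p A \<longleftrightarrow> (\<forall>s r. s \<notin> p \<longrightarrow> s * r \<in> A \<longrightarrow> r \<in> A)"

lemma satD: "sat p A \<Longrightarrow> s \<notin> p \<Longrightarrow> s * r \<in> A \<Longrightarrow> r \<in> A"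
  unfolding sat_def by blast

text \<open>Saturated ideals stand for ideals of the local ring at \<open>p\<close>. This one is the
  saturation of \<open>A + (x)\<close>; with \<open>x = 0\<close> it is the saturation of
  \<open>A\<close>.\<close>

definition sat_insert :: "'a::comm_ring_1 set \<Rightarrow> 'a \<Rightarrow> 'a set \<Rightarrow> 'a set" where
  "sat_insert p x A = {r. \<exists>t k. t \<notin> p \<and> t * r - k * x \<in> A}"

lemma sat_insert:
  assumes p: "prime_id p" and A: "idl.subspace A"
  shows "idl.subspace (sat_insert p x A)" "sat p (sat_insert p x A)" "A \<subseteq> sat_insert p x A" "x \<in> sat_insert p x A"
proof -
  have one: "1 \<notin> p" using prime_idD(2)[OF p] .
  show "A \<subseteq> sat_insert p x A"
  proof
    fix r assume "r \<in> A"
    hence "1 * r - 0 * x \<in> A" by simp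
    thus "r \<in> sat_insert p x A" unfolding sat_insert_def using one by blast
  qed
  show "x \<in> sat_insert p x A"
  proof -
    have "1 * x - 1 * x \<in> A" using idl.subspace_0[OF A] by simp
    thus ?thesis unfolding sat_insert_def using one by blast
  qed
  show "sat p (sat_insert p x A)"
    unfolding sat_def
  proof (intro allI impI)
    fix s r assume s: "s \<notin> p" "s * r \<in> sat_insert p x A"
    then obtain t k where t: "t \<notin> p" "t * (s * r) - k * x \<in> A" unfolding sat_insert_def by blast
    hence "(t * s) * r - k * x \<in> A" by (simp add: mult.assoc)
    thus "r \<in> sat_insert p x A" unfolding sat_insert_def using prime_idD(4)[OF p t(1) s(1)] by blast
  qed
  show "idl.subspace (sat_insert p x A)"
  proof (rule idl.subspaceI)
    show "0 \<in> sat_insert p x A" using idl.subspace_0[OF A] \<open>A \<subseteq> _\<close> by blast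
    fix r1 r2 assume "r1 \<in> sat_insert p x A" "r2 \<in> sat_insert p x A"
    then obtain t1 k1 t2 k2 where t: "t1 \<notin> p" "t1 * r1 - k1 * x \<in> A" "t2 \<notin> p" "t2 * r2 - k2 * x \<in> A"
      unfolding sat_insert_def by blast
    have "t2 * (t1 * r1 - k1 * x) + t1 * (t2 * r2 - k2 * x) \<in> A"
      using idl.subspace_add[OF A idl.subspace_scale[OF A t(2)] idl.subspace_scale[OF A t(4)]] .
    hence "(t1 * t2) * (r1 + r2) - (t2 * k1 + t1 * k2) * x \<in> A" by (simp add: algebra_simps)
    thus "r1 + r2 \<in> sat_insert p x A" unfolding sat_insert_def using prime_idD(4)[OF p t(1,3)] by blast
  next
    fix c r assume "r \<in> sat_insert p x A"
    then obtain t k where t: "t \<notin> p" "t * r - k * x \<in> A" unfolding sat_insert_def by blast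
    have "t * (c * r) - (c * k) * x \<in> A"
      using idl.subspace_scale[OF A t(2), of c] by (simp add: algebra_simps)
    thus "c * r \<in> sat_insert p x A" unfolding sat_insert_def using t(1) by blast
  qed
qed

lemma sat_insert_mono: "A \<subseteq> B \<Longrightarrow> sat_insert p x A \<subseteq> sat_insert p x B"
  unfolding sat_insert_def by blast

text \<open>Local ideals above \<open>a\<close> satisfy the descending chain condition if \<open>p\<close> is minimal over \<open>a\<close>.\<close>

lemma dcc:
  assumes J: "noeth J" and p: "prime_id p"
  shows "idl.subspace a \<Longrightarrow> J \<subseteq> a \<Longrightarrow> sat p a \<Longrightarrow> (\<And>q. prime_id q \<Longrightarrow> a \<subseteq> q \<Longrightarrow> q \<subseteq> p \<Longrightarrow> q = p) \<Longrightarrow>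
    (\<And>n. idl.subspace (C n) \<and> sat p (C n) \<and> a \<subseteq> C n) \<Longrightarrow> decseq C \<Longrightarrow> \<exists>n. \<forall>k\<ge>n. C k = C n"
proof (rule ccontr)
  \<comment> \<open>Noetherian induction: among all bases \<open>a\<close> of descending sequences
    that never become stationary, a maximal one is studied.\<close>
  define P where "P a C \<longleftrightarrow> idl.subspace a \<and> J \<subseteq> a \<and> sat p a \<and> (\<forall>q. prime_id q \<longrightarrow> a \<subseteq> q \<longrightarrow> q \<subseteq> p \<longrightarrow> q = p) \<and>
    (\<forall>n. idl.subspace (C n) \<and> sat p (C n) \<and> a \<subseteq> C n) \<and> decseq C \<and> \<not> (\<exists>n. \<forall>k\<ge>n. C k = C n)" for a and C :: "nat \<Rightarrow> 'a set"
  assume "idl.subspace a" "J \<subseteq> a" "sat p a" "\<And>q. prime_id q \<Longrightarrow> a \<subseteq> q \<Longrightarrow> q \<subseteq> p \<Longrightarrow> q = p"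
    "\<And>n. idl.subspace (C n) \<and> sat p (C n) \<and> a \<subseteq> C n" "decseq C" "\<not> (\<exists>n. \<forall>k\<ge>n. C k = C n)"
  hence "P a C" unfolding P_def by blast
  hence "{a. \<exists>C. P a C} \<noteq> {}" by blast
  moreover have "\<And>A. A \<in> {a. \<exists>C. P a C} \<Longrightarrow> idl.subspace A \<and> J \<subseteq> A" unfolding P_def by blast
  ultimately have "\<exists>a\<in>{a. \<exists>C. P a C}. \<forall>B\<in>{a. \<exists>C. P a C}. a \<subseteq> B \<longrightarrow> B = a"
    by (intro J[unfolded noeth_def, rule_format]) blast+
  then obtain a where a: "a \<in> {a. \<exists>C. P a C}" "\<And>B. B \<in> {a. \<exists>C. P a C} \<Longrightarrow> a \<subseteq> B \<Longrightarrow> B = a"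
    by blast
  then obtain C where C: "P a C" by blast
  have aI: "idl.subspace a" and Ja: "J \<subseteq> a" and sa: "sat p a"
    and amin: "\<And>q. prime_id q \<Longrightarrow> a \<subseteq> q \<Longrightarrow> q \<subseteq> p \<Longrightarrow> q = p"
    and CI: "\<And>n. idl.subspace (C n)" and Cs: "\<And>n. sat p (C n)" and aC: "\<And>n. a \<subseteq> C n" and dec: "decseq C"
    and no: "\<not> (\<exists>n. \<forall>k\<ge>n. C k = C n)"
    using C unfolding P_def by blast+
  have Cdec: "C k \<subseteq> C n" if "n \<le> k" for n k using dec that by (rule decseqD)
  have "1 \<notin> a"
  proof
    assume "1 \<in> a"
    hence "a = UNIV" using idl.subspace_scale[OF aI, of 1] by auto
    hence "C n = UNIV" for n using aC[of n] by auto
    thus False using no by auto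
  qed
  then obtain s where s: "s * 1 \<notin> a" "prime_id {r. r * (s * 1) \<in> a}"
    by (rule idl.ann_prime[OF J aI, rotated]) (use Ja in auto)
  \<comment> \<open>The annihilator prime lies between \<open>a\<close> and \<open>p\<close>, so
    minimality of \<open>p\<close> identifies it with \<open>p\<close>. Locally, adding
    \<open>s\<close> to \<open>a\<close> therefore adds a simple quotient.\<close>
  have "{r. r * (s * 1) \<in> a} = p"
  proof (rule amin[OF s(2)])
    show "a \<subseteq> {r. r * (s * 1) \<in> a}" using ideal_mult_right[OF aI] by auto
    show "{r. r * (s * 1) \<in> a} \<subseteq> p" using s(1) satD[OF sa] by auto
  qed
  hence ps: "r * s \<in> a \<longleftrightarrow> r \<in> p" for r by auto
  define b where "b = sat_insert p s a"
  define D where "D n = sat_insert p s (C n)" for n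
  have b: "idl.subspace b" "sat p b" "a \<subseteq> b" "s \<in> b" unfolding b_def using sat_insert[OF p aI] by blast+
  have "\<exists>n. \<forall>k\<ge>n. D k = D n"
  proof (rule ccontr)
    assume n: "\<not> (\<exists>n. \<forall>k\<ge>n. D k = D n)"
    have "decseq D" unfolding D_def by (rule decseq_SucI) (rule sat_insert_mono, rule Cdec, simp)
    moreover have "idl.subspace (D n) \<and> sat p (D n) \<and> b \<subseteq> D n" for n
      unfolding D_def b_def using sat_insert[OF p CI] sat_insert_mono[OF aC] by blast
    ultimately have "P b D" unfolding P_def using b Ja amin n by (metis order_trans)
    hence "b = a" using a(2) b(3) by blast
    thus False using b(4) s(1) by simp
  qed
  then obtain n where n: "\<And>k. k \<ge> n \<Longrightarrow> D k = D n" by blast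
  show False
  \<comment> \<open>With \<open>s\<close> added the sequence is stationary, by maximality of
    \<open>a\<close>. Either \<open>s\<close> was in every \<open>C n\<close> and nothing has
    changed, or \<open>s\<close> drops out at some point; from there on the coefficient
    \<open>c\<close> of \<open>s\<close> is forced into \<open>p\<close>, and \<open>c * s\<close>
    lies in \<open>a\<close> anyway.\<close>
  proof (cases "\<forall>n. s \<in> C n")
    case True
    have "D k = C k" for k
    proof
      show "C k \<subseteq> D k" unfolding D_def using sat_insert(3)[OF p CI] .
      show "D k \<subseteq> C k"
      proof
        fix r assume "r \<in> D k"
        then obtain t c where t: "t \<notin> p" "t * r - c * s \<in> C k" unfolding D_def sat_insert_def by blast
        have "c * s \<in> C k" using True idl.subspace_scale[OF CI] by blast
        hence "t * r \<in> C k" using idl.subspace_add[OF CI t(2)] by fastforce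
        thus "r \<in> C k" using satD[OF Cs t(1)] by blast
      qed
    qed
    thus False using n no by (metis (lifting))
  next
    case False
    then obtain n1 where n1: "s \<notin> C n1" by blast
    have ns: "s \<notin> C k" if "k \<ge> n1" for k using Cdec[OF that] n1 by blast
    have "C k = C (max n n1)" if k: "k \<ge> max n n1" for k
    proof
      show "C k \<subseteq> C (max n n1)" using Cdec[OF k] .
      show "C (max n n1) \<subseteq> C k"
      proof
        fix r assume r: "r \<in> C (max n n1)"
        hence "r \<in> D (max n n1)" unfolding D_def using sat_insert(3)[OF p CI] by blast
        hence "r \<in> D k" using n[of "max n n1"] n[of k] k by simp
        then obtain t c where t: "t \<notin> p" "t * r - c * s \<in> C k" unfolding D_def sat_insert_def by blast
        have "t * r - c * s \<in> C (max n n1)" using t(2) Cdec[OF k] by blast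
        hence "t * r - (t * r - c * s) \<in> C (max n n1)"
          by (rule idl.subspace_diff[OF CI idl.subspace_scale[OF CI r]])
        hence "c * s \<in> C (max n n1)" by simp
        hence "c \<in> p" using satD[OF Cs] ns[of "max n n1"] by (meson max.cobounded2)
        hence "c * s \<in> C k" using ps aC by blast
        hence "t * r \<in> C k" using idl.subspace_add[OF CI t(2)] by fastforce
        thus "r \<in> C k" using satD[OF Cs t(1)] by blast
      qed
    qed
    thus False using no by blast
  qed
qed

text \<open>The power of the image of \<open>A\<close> in the quotient by \<open>J\<close>, pulled
  back: \<open>J\<close> is added at each positive exponent.\<close>

fun ipow :: "'a::comm_ring_1 set \<Rightarrow> 'a set \<Rightarrow> nat \<Rightarrow> 'a set" where
  "ipow J A 0 = UNIV"
| "ipow J A (Suc n) = idl.span (J \<union> {a * b | a b. a \<in> A \<and> b \<in> ipow J A n})"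

lemma ipow_subspace: "idl.subspace (ipow J A n)"
  by (cases n) auto

lemma ipow_base: "J \<subseteq> ipow J A n"
  by (cases n) (auto intro: idl.span_base)

lemma ipow_mult: "a \<in> A \<Longrightarrow> b \<in> ipow J A n \<Longrightarrow> a * b \<in> ipow J A (Suc n)"
  by (auto intro!: idl.span_base)

lemma ipow_power: "a \<in> A \<Longrightarrow> a ^ n \<in> ipow J A n"
  by (induction n) (use ipow_mult in \<open>auto simp del: ipow.simps(2)\<close>)

lemma ipow_Suc_subset: "ipow J A (Suc n) \<subseteq> ipow J A n"
proof -
  have "a * b \<in> ipow J A n" if "b \<in> ipow J A n" for a b
    using idl.subspace_scale[OF ipow_subspace that] .
  thus ?thesis using ipow_base[of J A n] unfolding ipow.simps by (intro idl.span_minimal ipow_subspace) blast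
qed

text \<open>Krull's principal ideal theorem, in the form needed for chains of primes. The symbolic powers \<open>D n\<close> of
  \<open>q\<close> become stationary at \<open>p\<close> modulo \<open>x\<close>, hence stationary by Nakayama's lemma.\<close>

lemma prime_between:
  assumes J: "noeth p0" and p0: "prime_id p0" and q: "prime_id q" and p: "prime_id p"
    and lt: "p0 \<subset> q" "q \<subset> p" and x: "x \<in> p" "x \<notin> p0"
  obtains p' where "prime_id p'" "p0 \<subset> p'" "p' \<subset> p" "x \<in> p'"
proof (rule ccontr)
  assume nt: "\<not> thesis"
  note wit = that
  have no: False if "prime_id p'" "p0 \<subseteq> p'" "p' \<subset> p" "x \<in> p'" for p'
    using nt wit[of p'] x(2) that by blast
  have xq: "x \<notin> q" using no[OF q] lt by blast
  have p0I: "idl.subspace p0" using prime_idD(1)[OF p0] .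
  define Q where "Q = ipow p0 q"
  have QI: "idl.subspace (Q n)" and p0Q: "p0 \<subseteq> Q n" for n unfolding Q_def by (rule ipow_subspace ipow_base)+
  define D where "D n = sat_insert q 0 (Q n)" for n
  have DI: "idl.subspace (D n)" and Ds: "sat q (D n)" and QD: "Q n \<subseteq> D n" for n
    unfolding D_def using sat_insert[OF q QI] by blast+
  have D_iff: "r \<in> D n \<longleftrightarrow> (\<exists>s. s \<notin> q \<and> s * r \<in> Q n)" for r n
    unfolding D_def sat_insert_def by auto
  have Ddec: "D (Suc n) \<subseteq> D n" for n
    unfolding D_def by (intro sat_insert_mono) (simp add: Q_def ipow_Suc_subset del: ipow.simps)
  define a where "a = sat_insert p x p0"
  define C where "C n = sat_insert p x (D n)" for n
  have aI: "idl.subspace a" "sat p a" "p0 \<subseteq> a" "x \<in> a" unfolding a_def using sat_insert[OF p p0I] by blast+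
  have CI: "idl.subspace (C n)" "sat p (C n)" "D n \<subseteq> C n" for n unfolding C_def using sat_insert[OF p DI] by blast+
  have aC: "a \<subseteq> C n" for n unfolding a_def C_def by (rule sat_insert_mono) (use p0Q QD in blast)
  have "\<exists>n. \<forall>k\<ge>n. C k = C n"
  proof (rule dcc[OF J p aI(1,3,2)])
    show "q' = p" if "prime_id q'" "a \<subseteq> q'" "q' \<subseteq> p" for q' using no[OF that(1)] that aI by blast
    show "idl.subspace (C n) \<and> sat p (C n) \<and> a \<subseteq> C n" for n using CI aC by blast
    show "decseq C" unfolding decseq_Suc_iff C_def using sat_insert_mono[OF Ddec] by blast
  qed
  then obtain n where n: "C (Suc n) = C n" by (metis le_Suc_eq order_refl)
  \<comment> \<open>Stationarity modulo \<open>x\<close> places \<open>D n\<close> locally at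
    \<open>p\<close> in \<open>D (Suc n) + x D n\<close>: the multiplier of \<open>x\<close> is
    again in \<open>D n\<close> because \<open>x\<close> is outside \<open>q\<close>. Nakayama's
    lemma at \<open>p\<close> removes the second summand.\<close>
  have "D n \<subseteq> D (Suc n)"
  proof -
    have "\<exists>t. t \<notin> p \<and> (\<forall>g\<in>D n. t * g \<in> D (Suc n))"
    proof (rule nakayama_ideal[OF p J DI _ DI])
      show "p0 \<subseteq> D n" for n using p0Q QD by blast
      thus "p0 \<subseteq> D (Suc n)" .
      fix g assume g: "g \<in> D n"
      hence "g \<in> C (Suc n)" using CI(3)[of n] n by blast
      then obtain t k where t: "t \<notin> p" "t * g - k * x \<in> D (Suc n)" unfolding C_def sat_insert_def by blast
      have "t * g - k * x \<in> D n" using t(2) Ddec by blast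
      hence "t * g - (t * g - k * x) \<in> D n"
        by (rule idl.subspace_diff[OF DI idl.subspace_scale[OF DI g]])
      hence "x * k \<in> D n" by (simp add: mult.commute)
      hence kD: "k \<in> D n" using satD[OF Ds xq] by blast
      let ?M = "idl.span (D (Suc n) \<union> {y * k | y k. y \<in> p \<and> k \<in> D n})"
      have "x * k \<in> ?M" using x(1) kD by (intro idl.span_base) blast
      moreover have "t * g - k * x \<in> ?M" using t(2) by (intro idl.span_base) blast
      ultimately have "(t * g - k * x) + x * k \<in> ?M" using idl.span_add by blast
      thus "\<exists>t. t \<notin> p \<and> t * g \<in> ?M" using t(1) by (auto simp: mult.commute)
    qed
    then obtain t where t: "t \<notin> p" "\<And>g. g \<in> D n \<Longrightarrow> t * g \<in> D (Suc n)" by blast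
    have "t \<notin> q" using t(1) lt by blast
    thus ?thesis using t(2) satD[OF Ds] by blast
  qed
  hence QDS: "Q n \<subseteq> D (Suc n)" using QD by blast
  \<comment> \<open>Now Nakayama's lemma at \<open>q\<close>: locally \<open>Q n\<close> equals
    \<open>q\<close> times itself modulo \<open>p0\<close>, so it vanishes there. Then
    \<open>q\<close> is nilpotent modulo the prime \<open>p0\<close>.\<close>
  have "\<exists>t. t \<notin> q \<and> (\<forall>g\<in>Q n. t * g \<in> p0)"
  proof (rule nakayama_ideal[OF q J QI p0Q p0I order_refl])
    fix g assume "g \<in> Q n"
    then obtain s where s: "s \<notin> q" "s * g \<in> Q (Suc n)" using QDS D_iff by blast
    thus "\<exists>t. t \<notin> q \<and> t * g \<in> idl.span (p0 \<union> {y * k | y k. y \<in> q \<and> k \<in> Q n})"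
      unfolding Q_def ipow.simps by blast
  qed
  then obtain t where t: "t \<notin> q" "\<And>g. g \<in> Q n \<Longrightarrow> t * g \<in> p0" by blast
  have "Q n \<subseteq> p0" using t prime_idD(3)[OF p0] lt by blast
  hence "q \<subseteq> p0" using ipow_power[of _ q n p0] prime_id_power[OF p0] unfolding Q_def by blast
  thus False using lt by blast
qed

section \<open>Chains of primes with prescribed ends\<close>

inductive pchain :: "'a::comm_ring_1 set \<Rightarrow> nat \<Rightarrow> 'a set \<Rightarrow> bool" for A where
  pchain_refl: "prime_id A \<Longrightarrow> pchain A 0 A"
| pchain_step: "pchain A n B \<Longrightarrow> prime_id C \<Longrightarrow> B \<subset> C \<Longrightarrow> pchain A (Suc n) C"

lemma pchain_prime: "pchain A n B \<Longrightarrow> prime_id A \<and> prime_id B \<and> A \<subseteq> B"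
  by (induction rule: pchain.induct) auto

lemma pchain_0: "pchain A 0 B \<longleftrightarrow> A = B \<and> prime_id A"
  by (auto elim: pchain.cases intro: pchain_refl)

lemma pchain_SucE:
  assumes "pchain A (Suc n) C"
  obtains B where "pchain A n B" "prime_id C" "B \<subset> C"
  using assms by (cases rule: pchain.cases) auto

lemma pchain_strict: "pchain A (Suc n) B \<Longrightarrow> A \<subset> B"
  by (erule pchain_SucE) (use pchain_prime in blast)

lemma pchain_trans: "pchain B k C \<Longrightarrow> pchain A n B \<Longrightarrow> pchain A (n + k) C"
  by (induction rule: pchain.induct) (auto intro: pchain.intros)

lemma pchain_prepend: "prime_id A \<Longrightarrow> A \<subset> B \<Longrightarrow> pchain B n C \<Longrightarrow> pchain A (Suc n) C"
  using pchain_trans[of B n C A "Suc 0"] pchain_step[OF pchain_refl] pchain_prime by fastforce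

text \<open>The primes are exchanged from the top downwards for primes that contain
  \<open>x\<close>, each exchange being one use of \<open>prime_between\<close>. Only the bottom
  prime is lost.\<close>

lemma pchain_through:
  assumes J: "noeth J"
  shows "pchain A (Suc n) B \<Longrightarrow> J \<subseteq> A \<Longrightarrow> x \<in> B \<Longrightarrow> \<exists>A'. x \<in> A' \<and> A \<subset> A' \<and> pchain A' n B"
proof (induction n arbitrary: B)
  case 0
  thus ?case using pchain_strict[OF 0(1)] pchain_prime[OF 0(1)] pchain_refl by blast
next
  case (Suc n)
  obtain B1 where B1: "pchain A (Suc n) B1" "prime_id B" "B1 \<subset> B" using pchain_SucE[OF Suc.prems(1)] .
  obtain B0 where B0: "pchain A n B0" "prime_id B1" "B0 \<subset> B1" using pchain_SucE[OF B1(1)] .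
  have "\<exists>p'. prime_id p' \<and> B0 \<subset> p' \<and> p' \<subset> B \<and> x \<in> p'"
  proof (cases "x \<in> B0")
    case True
    thus ?thesis using B0 B1 by blast
  next
    case False
    have "noeth B0" using noeth_mono[OF J] pchain_prime[OF B0(1)] Suc.prems(2) by blast
    thus ?thesis using prime_between[of B0 B1 B x] pchain_prime[OF B0(1)] B0 B1 Suc.prems(3) False by metis
  qed
  then obtain p' where p': "prime_id p'" "B0 \<subset> p'" "p' \<subset> B" "x \<in> p'" by blast
  obtain A' where "x \<in> A'" "A \<subset> A'" "pchain A' n p'"
    using Suc.IH[OF pchain_step[OF B0(1) p'(1,2)] Suc.prems(2) p'(4)] by blast
  thus ?case using pchain_step B1(2) p'(3) by blast
qed

lemma span_insert_swap: "idl.span (insert x (idl.span A)) = idl.span (insert x A)"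
proof
  show "idl.span (insert x (idl.span A)) \<subseteq> idl.span (insert x A)"
    using idl.span_mono[of A "insert x A"] by (intro idl.span_minimal) (auto intro: idl.span_base)
  show "idl.span (insert x A) \<subseteq> idl.span (insert x (idl.span A))"
    using idl.span_superset by (intro idl.span_mono) auto
qed

lemma span_Un_insert: "idl.span (idl.span (insert x J) \<union> B) = idl.span (J \<union> insert x B)"
proof
  show "idl.span (idl.span (insert x J) \<union> B) \<subseteq> idl.span (J \<union> insert x B)"
    using idl.span_mono[of "insert x J" "J \<union> insert x B"] idl.span_superset[of "J \<union> insert x B"]
    by (intro idl.span_minimal) auto
  show "idl.span (J \<union> insert x B) \<subseteq> idl.span (idl.span (insert x J) \<union> B)"
    using idl.span_superset[of "insert x J"] by (intro idl.span_mono) auto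
qed

text \<open>Passing to the quotient by one generator shortens a chain by at most one, by
  \<open>pchain_through\<close>; when no generator is left, \<open>m = J\<close> and no proper step
  remains.\<close>

lemma pchain_length_le:
  assumes "noeth J" "idl.subspace J" "pchain A n m" "J \<subseteq> A" "m = idl.span (J \<union> set xs)"
  shows "n \<le> length xs"
  using assms
proof (induction xs arbitrary: J n A)
  case Nil
  hence "m = J" by simp
  hence "\<not> A \<subset> m" using Nil by blast
  thus ?case using Nil(3) pchain_strict[of A _ m] by (cases n) auto
next
  case (Cons x xs)
  show ?case
  proof (cases n)
    case (Suc k)
    have "x \<in> m" using Cons.prems(5) by (auto intro: idl.span_base)
    then obtain A' where A': "x \<in> A'" "A \<subset> A'" "pchain A' k m"
      using pchain_through[OF Cons.prems(1), of A k m x] Cons.prems(3,4) Suc by auto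
    have "J \<subseteq> idl.span (insert x J)" using idl.span_superset by blast
    hence "noeth (idl.span (insert x J))" using noeth_mono Cons.prems(1) by blast
    moreover have "idl.span (insert x J) \<subseteq> A'"
      using A' Cons.prems(4) prime_idD(1) pchain_prime[OF A'(3)] by (intro idl.span_minimal) auto
    moreover have "m = idl.span (idl.span (insert x J) \<union> set xs)"
      unfolding span_Un_insert using Cons.prems(5) by simp
    ultimately have "k \<le> length xs" using Cons.IH[OF _ _ A'(3)] by blast
    thus ?thesis using Suc by simp
  qed simp
qed

section \<open>Regular sequences and regular local rings\<close>

fun rseq :: "'a::comm_ring_1 set \<Rightarrow> 'a list \<Rightarrow> bool" where
  "rseq J [] \<longleftrightarrow> True"
| "rseq J (x # xs) \<longleftrightarrow> (\<forall>c. x * c \<in> J \<longrightarrow> c \<in> J) \<and> rseq (idl.span (insert x J)) xs"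

lemma local_unit_ideal:
  assumes "idl.subspace B" "J \<subseteq> B" "t * u - 1 \<in> J" "t * a \<in> B"
  shows "a \<in> B"
proof -
  have "u * (t * a) - (t * u - 1) * a \<in> B"
    using idl.subspace_diff[OF assms(1) idl.subspace_scale[OF assms(1,4), of u]
        ideal_mult_right[OF assms(1), of "t * u - 1" a]] assms(2,3) by blast
  thus ?thesis by (simp add: algebra_simps)
qed

lemma set_insert_remove1: "x \<in> set xs \<Longrightarrow> insert x (set (remove1 x xs)) = set xs"
  by (induction xs) auto

text \<open>A regular local ring is a domain. For a generator \<open>x\<close> of \<open>m\<close>
  outside \<open>A\<close>, the quotient by \<open>x\<close> is regular of smaller dimension, so
  \<open>(x) + J\<close> is a prime above \<open>A\<close>. An element \<open>k * x\<close> of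
  \<open>A\<close> has \<open>k\<close> in \<open>A\<close>, hence \<open>A = x A + J\<close>, and
  Nakayama's lemma gives \<open>A = J\<close>.\<close>

lemma regular_prime:
  assumes "noeth J" "idl.subspace J" "pchain A n m" "J \<subseteq> A" "m = idl.span (J \<union> set xs)" "length xs = n"
    and unit: "\<And>t. t \<notin> m \<Longrightarrow> \<exists>u. t * u - 1 \<in> J"
  shows "A = J"
  using assms
proof (induction n arbitrary: J A xs)
  case 0
  thus ?case by (simp add: pchain_0)
next
  case (Suc n)
  have AI: "idl.subspace A" "prime_id A" using pchain_prime[OF Suc.prems(3)] prime_idD by blast+
  have "\<not> set xs \<subseteq> A"
  proof
    assume "set xs \<subseteq> A"
    hence "m \<subseteq> A" unfolding Suc.prems(5) using Suc.prems(4) AI by (intro idl.span_minimal) auto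
    thus False using pchain_strict[OF Suc.prems(3)] by blast
  qed
  then obtain x where x: "x \<in> set xs" "x \<notin> A" by blast
  have "x \<in> m" using x Suc.prems(5) by (auto intro: idl.span_base)
  then obtain A' where A': "x \<in> A'" "A \<subset> A'" "pchain A' n m"
    using pchain_through[OF Suc.prems(1,3,4)] by blast
  let ?J = "idl.span (insert x J)"
  have JJ: "J \<subseteq> ?J" using idl.span_superset by blast
  have "A' = ?J"
  proof (rule Suc.IH)
    show "noeth ?J" using JJ noeth_mono Suc.prems(1) by blast
    show "?J \<subseteq> A'" using A' Suc.prems(4) prime_idD(1) pchain_prime[OF A'(3)] by (intro idl.span_minimal) auto
    show "m = idl.span (?J \<union> set (remove1 x xs))"
    proof -
      have "insert x (set (remove1 x xs)) = set xs" using set_insert_remove1[OF x(1)] .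
      thus ?thesis unfolding span_Un_insert using Suc.prems(5) by simp
    qed
    show "length (remove1 x xs) = n" using x(1) Suc.prems(6) by (simp add: length_remove1)
    show "\<exists>u. t * u - 1 \<in> ?J" if "t \<notin> m" for t using Suc.prems(7)[OF that] JJ by blast
  qed (use A' in auto)
  hence AJ: "A \<subseteq> ?J" using A' by blast
  have pm: "prime_id m" using pchain_prime[OF Suc.prems(3)] by blast
  have "\<exists>t. t \<notin> m \<and> (\<forall>g\<in>A. t * g \<in> J)"
  proof (rule nakayama_ideal[OF pm Suc.prems(1) AI(1) Suc.prems(4) Suc.prems(2) order_refl])
    fix g assume g: "g \<in> A"
    then obtain k where k: "g - k * x \<in> J" using AJ span_insert_ideal[OF Suc.prems(2)] by blast
    have "g - k * x \<in> A" using k Suc.prems(4) by blast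
    hence "g - (g - k * x) \<in> A" by (rule idl.subspace_diff[OF AI(1) g])
    hence kA: "k \<in> A" using x(2) prime_idD(3)[OF AI(2), of k x] by simp
    let ?M = "idl.span (J \<union> {y * k | y k. y \<in> m \<and> k \<in> A})"
    have "x * k \<in> ?M" using \<open>x \<in> m\<close> kA by (intro idl.span_base) blast
    moreover have "g - k * x \<in> ?M" using k by (intro idl.span_base) blast
    ultimately have "(g - k * x) + x * k \<in> ?M" using idl.span_add by blast
    hence "1 * g \<in> ?M" by (simp add: mult.commute)
    thus "\<exists>t. t \<notin> m \<and> t * g \<in> ?M" using prime_idD(2)[OF pm] by blast
  qed
  then obtain t where t: "t \<notin> m" "\<And>g. g \<in> A \<Longrightarrow> t * g \<in> J" by blast
  obtain u where "t * u - 1 \<in> J" using Suc.prems(7)[OF t(1)] by blast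
  hence "A \<subseteq> J" using local_unit_ideal[OF Suc.prems(2) order_refl] t(2) by blast
  thus ?case using Suc.prems(4) by blast
qed

text \<open>At each stage the quotient is a domain by \<open>regular_prime\<close>, so the next
  generator is a nonzerodivisor unless it vanishes. It cannot vanish: \<open>m\<close> would then
  have fewer generators than the chain has steps.\<close>

lemma regular_rseq:
  assumes "noeth J" "idl.subspace J" "pchain A (length xs) m" "J \<subseteq> A" "m = idl.span (J \<union> set xs)"
    and unit: "\<And>t. t \<notin> m \<Longrightarrow> \<exists>u. t * u - 1 \<in> J"
  shows "rseq J xs"
  using assms
proof (induction xs arbitrary: J A)
  case Nil
  thus ?case by simp
next
  case (Cons x xs)
  have A: "A = J" using regular_prime[OF Cons.prems(1-5) refl Cons.prems(6)] by blast
  hence pJ: "prime_id J" using pchain_prime[OF Cons.prems(3)] by blast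
  have "x \<in> m" using Cons.prems(5) by (auto intro: idl.span_base)
  then obtain A' where A': "x \<in> A'" "A \<subset> A'" "pchain A' (length xs) m"
    using pchain_through[OF Cons.prems(1), of A "length xs" m x] Cons.prems(3,4) by auto
  have "x \<notin> J"
  proof
    assume "x \<in> J"
    hence "m = idl.span (J \<union> set xs)" using Cons.prems(5) by (simp add: insert_absorb)
    thus False using pchain_length_le[OF Cons.prems(1-4), of xs] by simp
  qed
  hence "\<forall>c. x * c \<in> J \<longrightarrow> c \<in> J" using prime_idD(3)[OF pJ] by blast
  moreover have "rseq (idl.span (insert x J)) xs"
  proof (rule Cons.IH[OF _ _ A'(3)])
    have JJ: "J \<subseteq> idl.span (insert x J)" using idl.span_superset by blast
    show "noeth (idl.span (insert x J))" using JJ noeth_mono Cons.prems(1) by blast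
    show "idl.span (insert x J) \<subseteq> A'"
      using A' Cons.prems(4) prime_idD(1) pchain_prime[OF A'(3)] by (intro idl.span_minimal) auto
    show "m = idl.span (idl.span (insert x J) \<union> set xs)" unfolding span_Un_insert using Cons.prems(5) by simp
    show "\<exists>u. t * u - 1 \<in> idl.span (insert x J)" if "t \<notin> m" for t using Cons.prems(6)[OF that] JJ by blast
  qed auto
  ultimately show ?case by simp
qed

section \<open>Koszul homology\<close>

text \<open>Koszul chains are functions on finite sets of indices below \<open>d\<close>; a chain of degree \<open>i\<close> is only
  evaluated at sets of cardinality \<open>i\<close>. The differential is \<open>kd\<close>, the exterior product with the vector \<open>b\<close> is \<open>kw b\<close>.\<close>

definition ksgn :: "nat \<Rightarrow> nat set \<Rightarrow> 'c::comm_ring_1" where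
  "ksgn i A = (-1) ^ card {j \<in> A. j < i}"

definition kd :: "nat \<Rightarrow> (nat \<Rightarrow> 'c::comm_ring_1) \<Rightarrow> (nat set \<Rightarrow> 'c) \<Rightarrow> nat set \<Rightarrow> 'c" where
  "kd d x w A = (\<Sum>i\<in>{..<d} - A. ksgn i A * x i * w (insert i A))"

definition kw :: "(nat \<Rightarrow> 'c::comm_ring_1) \<Rightarrow> (nat set \<Rightarrow> 'c) \<Rightarrow> nat set \<Rightarrow> 'c" where
  "kw b w A = (\<Sum>i\<in>A. ksgn i (A - {i}) * b i * w (A - {i}))"

lemma ksgn_insert:
  assumes "finite A" "k \<notin> A"
  shows "ksgn i (insert k A) = (if k < i then - ksgn i A else (ksgn i A :: 'c::comm_ring_1))"
proof (cases "k < i")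
  case True
  hence "{j \<in> insert k A. j < i} = insert k {j \<in> A. j < i}" by auto
  thus ?thesis using assms True by (simp add: ksgn_def)
next
  case False
  hence "{j \<in> insert k A. j < i} = {j \<in> A. j < i}" by auto
  thus ?thesis using False by (simp add: ksgn_def)
qed

lemma ksgn_square: "ksgn i A * ksgn i A = (1 :: 'c::comm_ring_1)"
  unfolding ksgn_def by (metis left_minus_one_mult_self mult.right_neutral)

lemma sum_antisym:
  fixes g :: "nat \<Rightarrow> nat \<Rightarrow> 'c::comm_ring_1"
  assumes "finite I" and sym: "\<And>i j. g i j = g j i"
  shows "(\<Sum>i\<in>I. \<Sum>j\<in>I - {i}. (if i < j then - g i j else g i j)) = 0"
proof -
  have "(\<Sum>i\<in>I. \<Sum>j\<in>I - {i}. (if i < j then - g i j else g i j)) =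
    (\<Sum>i\<in>I. \<Sum>j\<in>I. (if j < i then g i j else 0) - (if i < j then g i j else 0))"
  proof (rule sum.cong[OF refl])
    fix i assume i: "i \<in> I"
    have "(\<Sum>j\<in>I. (if j < i then g i j else 0) - (if i < j then g i j else 0)) =
      (\<Sum>j\<in>I - {i}. (if j < i then g i j else 0) - (if i < j then g i j else 0))"
      using assms(1) i by (simp add: sum.remove[of I i])
    also have "\<dots> = (\<Sum>j\<in>I - {i}. (if i < j then - g i j else g i j))"
      by (rule sum.cong) auto
    finally show "(\<Sum>j\<in>I - {i}. (if i < j then - g i j else g i j)) =
      (\<Sum>j\<in>I. (if j < i then g i j else 0) - (if i < j then g i j else 0))" by simp
  qed
  also have "\<dots> = (\<Sum>i\<in>I. \<Sum>j\<in>I. if j < i then g i j else 0) - (\<Sum>i\<in>I. \<Sum>j\<in>I. if i < j then g i j else 0)"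
    by (simp add: sum_subtractf)
  also have "(\<Sum>i\<in>I. \<Sum>j\<in>I. if i < j then g i j else 0) = (\<Sum>j\<in>I. \<Sum>i\<in>I. if i < j then g i j else 0)"
    by (rule sum.swap)
  also have "\<dots> = (\<Sum>i\<in>I. \<Sum>j\<in>I. if j < i then g i j else 0)"
    by (intro sum.cong refl) (simp add: sym)
  finally show ?thesis by simp
qed

text \<open>Inserting two indices in either order gives the same set with opposite signs.\<close>

lemma kd_kd:
  assumes "A \<subseteq> {..<d}"
  shows "kd d x (kd d x w) A = (0 :: 'c::comm_ring_1)"
proof -
  define I where "I = {..<d} - A"
  have fA: "finite A" using assms finite_subset by blast
  define g where "g i j = ksgn i A * ksgn j A * x i * x j * w (insert i (insert j A))" for i j
  have "kd d x (kd d x w) A = (\<Sum>i\<in>I. \<Sum>j\<in>I - {i}. (if i < j then - g i j else g i j))"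
    unfolding kd_def I_def[symmetric]
  proof (rule sum.cong[OF refl])
    fix i assume i: "i \<in> I"
    have "{..<d} - insert i A = I - {i}" unfolding I_def by auto
    moreover have "ksgn i A * x i * (ksgn j (insert i A) * x j * w (insert j (insert i A))) =
      (if i < j then - g i j else g i j)" for j
      using i fA unfolding I_def g_def by (simp add: ksgn_insert insert_commute[of i j] mult_ac)
    ultimately show "ksgn i A * x i * (\<Sum>j\<in>{..<d} - insert i A. ksgn j (insert i A) * x j * w (insert j (insert i A))) =
      (\<Sum>j\<in>I - {i}. (if i < j then - g i j else g i j))"
      by (simp only: sum_distrib_left)
  qed
  also have "\<dots> = 0"
    by (rule sum_antisym) (simp_all add: I_def g_def insert_commute mult_ac)
  finally show ?thesis .
qed

text \<open>The Cartan formula: exterior multiplication by \<open>b\<close> is a homotopy between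
  zero and multiplication by the sum of the \<open>x i * b i\<close>.\<close>

lemma kd_kw:
  assumes "A \<subseteq> {..<d}"
  shows "kd d x (kw b w) A = (\<Sum>i<d. x i * b i) * w A - kw b (kd d x w) (A :: nat set)"
proof -
  define I where "I = {..<d} - A"
  have fA: "finite A" and fI: "finite I" using assms finite_subset unfolding I_def by blast+
  define c where "c i j = ksgn i (A - {j}) * ksgn j (A - {j}) * x i * b j * w (insert i (A - {j}))" for i j
  have 1: "kd d x (kw b w) A = (\<Sum>i\<in>I. x i * b i * w A - (\<Sum>j\<in>A. c i j))"
    unfolding kd_def I_def[symmetric]
  proof (rule sum.cong[OF refl])
    fix i assume i: "i \<in> I"
    hence iA: "i \<notin> A" unfolding I_def by blast
    have cross: "ksgn i A * (ksgn j (insert i A - {j}) * b j * w (insert i A - {j})) * x i = - c i j" if j: "j \<in> A" for j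
    proof -
      have ij: "insert i A - {j} = insert i (A - {j})" "i \<noteq> j" using iA j by auto
      have "ksgn i A = ksgn i (insert j (A - {j}))" using j by (simp add: insert_absorb)
      also have "\<dots> = (if j < i then - ksgn i (A - {j}) else ksgn i (A - {j}))"
        using fA by (subst ksgn_insert) auto
      finally have 1: "ksgn i A = (if j < i then - ksgn i (A - {j}) else ksgn i (A - {j}) :: 'a)" .
      have 2: "ksgn j (insert i (A - {j})) = (if i < j then - ksgn j (A - {j}) else ksgn j (A - {j}) :: 'a)"
        using fA iA by (subst ksgn_insert) auto
      show ?thesis unfolding ij(1) 1 2 c_def using ij(2) by (auto simp: mult_ac)
    qed
    have "kw b w (insert i A) = ksgn i A * b i * w A + (\<Sum>j\<in>A. ksgn j (insert i A - {j}) * b j * w (insert i A - {j}))"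
      unfolding kw_def using fA iA by simp
    hence "ksgn i A * x i * kw b w (insert i A) = ksgn i A * ksgn i A * (x i * b i * w A) +
      (\<Sum>j\<in>A. ksgn i A * (ksgn j (insert i A - {j}) * b j * w (insert i A - {j})) * x i)"
      by (simp add: sum_distrib_left distrib_left mult_ac)
    also have "\<dots> = x i * b i * w A - (\<Sum>j\<in>A. c i j)"
      using cross by (simp add: ksgn_square sum_negf)
    finally show "ksgn i A * x i * kw b w (insert i A) = x i * b i * w A - (\<Sum>j\<in>A. c i j)" .
  qed
  have 2: "kw b (kd d x w) A = (\<Sum>j\<in>A. x j * b j * w A + (\<Sum>i\<in>I. c i j))"
    unfolding kw_def
  proof (rule sum.cong[OF refl])
    fix j assume j: "j \<in> A"
    have "{..<d} - (A - {j}) = insert j I" using assms j unfolding I_def by auto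
    moreover have "j \<notin> I" using j unfolding I_def by blast
    moreover have "insert j (A - {j}) = A" using j by blast
    ultimately have "kd d x w (A - {j}) = ksgn j (A - {j}) * x j * w A + (\<Sum>i\<in>I. ksgn i (A - {j}) * x i * w (insert i (A - {j})))"
      unfolding kd_def using fI by simp
    hence "ksgn j (A - {j}) * b j * kd d x w (A - {j}) = ksgn j (A - {j}) * ksgn j (A - {j}) * (x j * b j * w A) +
       (\<Sum>i\<in>I. c i j)"
      unfolding c_def by (simp add: sum_distrib_left distrib_left mult_ac)
    thus "ksgn j (A - {j}) * b j * kd d x w (A - {j}) = x j * b j * w A + (\<Sum>i\<in>I. c i j)"
      by (simp add: ksgn_square)
  qed
  have "{..<d} = I \<union> A" "I \<inter> A = {}" using assms unfolding I_def by auto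
  hence 3: "(\<Sum>i<d. x i * b i) * w A = (\<Sum>i\<in>I. x i * b i * w A) + (\<Sum>i\<in>A. x i * b i * w A)"
    using fA fI by (simp add: sum.union_disjoint distrib_right sum_distrib_right)
  have 4: "(\<Sum>j\<in>A. \<Sum>i\<in>I. c i j) = (\<Sum>i\<in>I. \<Sum>j\<in>A. c i j)" by (rule sum.swap)
  show ?thesis unfolding 1 2 3 by (simp add: sum_subtractf sum.distrib 4)
qed

lemma kd_diff: "kd d x (\<lambda>A. w A - w' A) A = kd d x w A - kd d x w' A"
  unfolding kd_def by (simp add: right_diff_distrib sum_subtractf)

lemma kd_scale: "kd d x (\<lambda>A. c * w A) A = c * kd d x w A"
  unfolding kd_def by (simp add: sum_distrib_left mult_ac)

text \<open>Coefficients of the Koszul complex will be graded pieces of a polynomial ring, which are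
  not ideals. An additive group stable under the entries of \<open>x\<close> suffices for the
  differential.\<close>

definition kmod :: "nat \<Rightarrow> (nat \<Rightarrow> 'c::comm_ring_1) \<Rightarrow> 'c set \<Rightarrow> bool" where
  "kmod d x M \<longleftrightarrow> 0 \<in> M \<and> (\<forall>a\<in>M. \<forall>b\<in>M. a + b \<in> M) \<and> (\<forall>a\<in>M. - a \<in> M) \<and> (\<forall>i<d. \<forall>a\<in>M. x i * a \<in> M)"

lemma kmodD:
  assumes "kmod d x M"
  shows "0 \<in> M" "\<And>a b. a \<in> M \<Longrightarrow> b \<in> M \<Longrightarrow> a + b \<in> M" "\<And>a. a \<in> M \<Longrightarrow> - a \<in> M"
    "\<And>i a. i < d \<Longrightarrow> a \<in> M \<Longrightarrow> x i * a \<in> M" "\<And>a b. a \<in> M \<Longrightarrow> b \<in> M \<Longrightarrow> a - b \<in> M"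
proof -
  show "0 \<in> M" "\<And>a b. a \<in> M \<Longrightarrow> b \<in> M \<Longrightarrow> a + b \<in> M" "\<And>a. a \<in> M \<Longrightarrow> - a \<in> M"
    "\<And>i a. i < d \<Longrightarrow> a \<in> M \<Longrightarrow> x i * a \<in> M" using assms unfolding kmod_def by blast+
  show "a - b \<in> M" if "a \<in> M" "b \<in> M" for a b
    using assms that unfolding kmod_def by (metis add_uminus_conv_diff)
qed

lemma kmod_sum: "kmod d x M \<Longrightarrow> (\<And>i. i \<in> I \<Longrightarrow> f i \<in> M) \<Longrightarrow> sum f I \<in> M"
  by (induction I rule: infinite_finite_induct) (auto simp: kmodD)

lemma kmod_ksgn: "kmod d x M \<Longrightarrow> a \<in> M \<Longrightarrow> ksgn i A * a \<in> M"
  unfolding ksgn_def by (cases "even (card {j \<in> A. j < i})") (simp_all add: kmodD)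

lemma kmod_ksgn_iff: "kmod d x M \<Longrightarrow> ksgn i A * a \<in> M \<longleftrightarrow> a \<in> M"
  using kmod_ksgn[of d x M "ksgn i A * a" i A] kmod_ksgn[of d x M a i A] ksgn_square[of i A]
  by (metis mult.assoc mult_1)

lemma kd_in:
  assumes "kmod d x M" "A \<subseteq> {..<d}" "\<And>B. B \<subseteq> {..<d} \<Longrightarrow> card B = Suc (card A) \<Longrightarrow> w B \<in> M"
  shows "kd d x w A \<in> M"
  unfolding kd_def
proof (rule kmod_sum[OF assms(1)])
  fix i assume i: "i \<in> {..<d} - A"
  have "finite A" using assms(2) finite_subset by blast
  hence "w (insert i A) \<in> M" using i assms(2) by (intro assms(3)) auto
  hence "ksgn i A * (x i * w (insert i A)) \<in> M" using i by (intro kmod_ksgn[OF assms(1)] kmodD(4)[OF assms(1)]) auto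
  thus "ksgn i A * x i * w (insert i A) \<in> M" by (simp add: mult.assoc)
qed

lemma kw_in:
  assumes "kmod d x M" "A \<subseteq> {..<d}" "\<And>B i. i \<in> A \<Longrightarrow> B \<subseteq> {..<d} \<Longrightarrow> Suc (card B) = card A \<Longrightarrow> b i * w B \<in> M"
  shows "kw b w A \<in> M"
  unfolding kw_def
proof (rule kmod_sum[OF assms(1)])
  fix i assume i: "i \<in> A"
  have fA: "finite A" using assms(2) finite_subset by blast
  have "b i * w (A - {i}) \<in> M"
  proof (rule assms(3)[OF i])
    show "A - {i} \<subseteq> {..<d}" using assms(2) by blast
    show "Suc (card (A - {i})) = card A" using i fA by (metis card.remove)
  qed
  hence "ksgn i (A - {i}) * (b i * w (A - {i})) \<in> M" by (rule kmod_ksgn[OF assms(1)])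
  thus "ksgn i (A - {i}) * b i * w (A - {i}) \<in> M" by (simp add: mult.assoc)
qed

text \<open>Vanishing of the Koszul homology \<open>H\<^sub>i(x; M/N)\<close>.\<close>

definition kexact :: "nat \<Rightarrow> (nat \<Rightarrow> 'c::comm_ring_1) \<Rightarrow> 'c set \<Rightarrow> 'c set \<Rightarrow> nat \<Rightarrow> bool" where
  "kexact d x M N i \<longleftrightarrow> (\<forall>w. (\<forall>A. A \<subseteq> {..<d} \<and> card A = i \<longrightarrow> w A \<in> M) \<and>
      (\<forall>A. A \<subseteq> {..<d} \<and> Suc (card A) = i \<longrightarrow> kd d x w A \<in> N) \<longrightarrow>
      (\<exists>u. (\<forall>A. A \<subseteq> {..<d} \<and> card A = Suc i \<longrightarrow> u A \<in> M) \<and>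
        (\<forall>A. A \<subseteq> {..<d} \<and> card A = i \<longrightarrow> w A - kd d x u A \<in> N)))"

lemma kexactI:
  assumes "\<And>w. (\<And>A. A \<subseteq> {..<d} \<Longrightarrow> card A = i \<Longrightarrow> w A \<in> M) \<Longrightarrow>
      (\<And>A. A \<subseteq> {..<d} \<Longrightarrow> Suc (card A) = i \<Longrightarrow> kd d x w A \<in> N) \<Longrightarrow>
      \<exists>u. (\<forall>A. A \<subseteq> {..<d} \<and> card A = Suc i \<longrightarrow> u A \<in> M) \<and>
        (\<forall>A. A \<subseteq> {..<d} \<and> card A = i \<longrightarrow> w A - kd d x u A \<in> N)"
  shows "kexact d x M N i"
  using assms unfolding kexact_def by simp

lemma kexactD:
  assumes "kexact d x M N i" "\<And>A. A \<subseteq> {..<d} \<Longrightarrow> card A = i \<Longrightarrow> w A \<in> M"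
      "\<And>A. A \<subseteq> {..<d} \<Longrightarrow> Suc (card A) = i \<Longrightarrow> kd d x w A \<in> N"
  obtains u where "\<And>A. A \<subseteq> {..<d} \<Longrightarrow> card A = Suc i \<Longrightarrow> u A \<in> M"
     "\<And>A. A \<subseteq> {..<d} \<Longrightarrow> card A = i \<Longrightarrow> w A - kd d x u A \<in> N"
proof -
  have "\<exists>u. (\<forall>A. A \<subseteq> {..<d} \<and> card A = Suc i \<longrightarrow> u A \<in> M) \<and>
        (\<forall>A. A \<subseteq> {..<d} \<and> card A = i \<longrightarrow> w A - kd d x u A \<in> N)"
    using assms(1)[unfolded kexact_def, rule_format, of w] assms(2,3) by blast
  thus ?thesis using that by blast
qed

lemma kexact_large: "i > d \<Longrightarrow> kexact d x M N i"
proof (rule kexactI, rule exI[of _ "\<lambda>_. 0"])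
  assume i: "i > d"
  have no: "card A \<noteq> i \<and> card A \<noteq> Suc i" if "A \<subseteq> {..<d}" for A
    using card_mono[OF _ that] i by simp
  thus "(\<forall>A. A \<subseteq> {..<d} \<and> card A = Suc i \<longrightarrow> 0 \<in> M) \<and>
        (\<forall>A. A \<subseteq> {..<d} \<and> card A = i \<longrightarrow> w A - kd d x (\<lambda>_. 0) A \<in> N)" for w
    using no by blast
qed

text \<open>A piece of the long exact sequence of \<open>0 -> M'/N' -> M/N -> M/N2 -> 0\<close>,
  where the first map is multiplication by \<open>l\<close>: the homology of the cokernel in degree
  \<open>i + 1\<close> lies between the two groups assumed to vanish.\<close>

lemma kexact_quot:
  assumes kmN: "kmod d x N" and kmM: "kmod d x M" and kmM': "kmod d x M'"
    and lM: "\<And>u. u \<in> M' \<Longrightarrow> l * u \<in> M" and lN: "\<And>u. u \<in> N' \<Longrightarrow> l * u \<in> N"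
    and nzd: "\<And>u. u \<in> M' \<Longrightarrow> l * u \<in> N \<Longrightarrow> u \<in> N'"
    and N2: "\<And>z. z \<in> N2 \<Longrightarrow> \<exists>u\<in>M'. z - l * u \<in> N" "\<And>u z. u \<in> M' \<Longrightarrow> z - l * u \<in> N \<Longrightarrow> z \<in> N2"
    and ex: "kexact d x M' N' i" "kexact d x M N (Suc i)"
  shows "kexact d x M N2 (Suc i)"
proof (rule kexactI)
  fix w assume wM: "\<And>A. A \<subseteq> {..<d} \<Longrightarrow> card A = Suc i \<Longrightarrow> w A \<in> M"
    and wN: "\<And>A. A \<subseteq> {..<d} \<Longrightarrow> Suc (card A) = Suc i \<Longrightarrow> kd d x w A \<in> N2"
  have "\<exists>v. A \<subseteq> {..<d} \<and> card A = i \<longrightarrow> v \<in> M' \<and> kd d x w A - l * v \<in> N" for A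
    using wN[of A] N2(1) by (cases "A \<subseteq> {..<d} \<and> card A = i") auto
  then obtain v where v: "\<And>A. A \<subseteq> {..<d} \<Longrightarrow> card A = i \<Longrightarrow> v A \<in> M'"
     "\<And>A. A \<subseteq> {..<d} \<Longrightarrow> card A = i \<Longrightarrow> kd d x w A - l * v A \<in> N" by metis
  have "kd d x v A \<in> N'" if A: "A \<subseteq> {..<d}" "Suc (card A) = i" for A
  proof (rule nzd)
    show "kd d x v A \<in> M'" by (rule kd_in[OF kmM' A(1)]) (use v(1) A(2) in auto)
    have "kd d x (\<lambda>A. kd d x w A - l * v A) A \<in> N"
      by (rule kd_in[OF kmN A(1)]) (use v(2) A(2) in auto)
    hence "- (l * kd d x v A) \<in> N" by (simp add: kd_diff kd_scale kd_kd[OF A(1)])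
    thus "l * kd d x v A \<in> N" using kmodD(3)[OF kmN] by fastforce
  qed
  from kexactD[OF ex(1) v(1) this]
  obtain u where u: "\<And>A. A \<subseteq> {..<d} \<Longrightarrow> card A = Suc i \<Longrightarrow> u A \<in> M'"
     "\<And>A. A \<subseteq> {..<d} \<Longrightarrow> card A = i \<Longrightarrow> v A - kd d x u A \<in> N'" by blast
  define w' where "w' A = w A - l * u A" for A
  have w'M: "w' A \<in> M" if "A \<subseteq> {..<d}" "card A = Suc i" for A
    unfolding w'_def using wM u(1) lM kmodD(5)[OF kmM] that by blast
  have w'N: "kd d x w' A \<in> N" if A: "A \<subseteq> {..<d}" "Suc (card A) = Suc i" for A
  proof -
    have cA: "card A = i" using A(2) by simp
    have "(kd d x w A - l * v A) + l * (v A - kd d x u A) \<in> N"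
      using kmodD(2)[OF kmN v(2)[OF A(1) cA] lN[OF u(2)[OF A(1) cA]]] .
    thus ?thesis unfolding w'_def by (simp add: kd_diff kd_scale algebra_simps)
  qed
  from kexactD[OF ex(2) w'M w'N]
  obtain t where t: "\<And>A. A \<subseteq> {..<d} \<Longrightarrow> card A = Suc (Suc i) \<Longrightarrow> t A \<in> M"
     "\<And>A. A \<subseteq> {..<d} \<Longrightarrow> card A = Suc i \<Longrightarrow> w' A - kd d x t A \<in> N" by blast
  have "w A - kd d x t A \<in> N2" if "A \<subseteq> {..<d}" "card A = Suc i" for A
    using N2(2)[OF u(1)[OF that], of "w A - kd d x t A"] t(2)[OF that] unfolding w'_def
    by (simp add: algebra_simps)
  thus "\<exists>u. (\<forall>A. A \<subseteq> {..<d} \<and> card A = Suc (Suc i) \<longrightarrow> u A \<in> M) \<and>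
        (\<forall>A. A \<subseteq> {..<d} \<and> card A = Suc i \<longrightarrow> w A - kd d x u A \<in> N2)" using t(1) by blast
qed

text \<open>Multiplication by an element of the ideal \<open>(x)\<close> annihilates Koszul homology.\<close>

lemma kexact_lift:
  assumes kmN: "kmod d x N" and kmM: "kmod d x M"
    and eM: "\<And>k u. k < d \<Longrightarrow> u \<in> M \<Longrightarrow> e k * u \<in> M" and eN: "\<And>k u. k < d \<Longrightarrow> u \<in> N \<Longrightarrow> e k * u \<in> N"
    and y: "\<And>u. u \<in> M \<Longrightarrow> ((\<Sum>k<d. x k * e k) - y) * u \<in> N"
    and nzd: "\<And>u. u \<in> M \<Longrightarrow> y * u \<in> N \<Longrightarrow> u \<in> N"
    and N2: "\<And>z. z \<in> N2 \<Longrightarrow> \<exists>u\<in>M. z - y * u \<in> N" "\<And>u z. u \<in> M \<Longrightarrow> z - y * u \<in> N \<Longrightarrow> z \<in> N2"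
    and ex: "kexact d x M N2 (Suc i)"
  shows "kexact d x M N i"
proof (rule kexactI)
  fix v assume vM: "\<And>A. A \<subseteq> {..<d} \<Longrightarrow> card A = i \<Longrightarrow> v A \<in> M"
    and vN: "\<And>A. A \<subseteq> {..<d} \<Longrightarrow> Suc (card A) = i \<Longrightarrow> kd d x v A \<in> N"
  define w where "w = kw e v"
  have wM: "w A \<in> M" if A: "A \<subseteq> {..<d}" "card A = Suc i" for A
    unfolding w_def by (rule kw_in[OF kmM A(1)]) (use vM eM A in auto)
  have wy: "kd d x w A - y * v A \<in> N" if A: "A \<subseteq> {..<d}" "card A = i" for A
  proof -
    have "kw e (kd d x v) A \<in> N"
      by (rule kw_in[OF kmN A(1)]) (use vN eN A in auto)
    hence "((\<Sum>k<d. x k * e k) - y) * v A - kw e (kd d x v) A \<in> N"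
      using kmodD(5)[OF kmN y[OF vM[OF A]]] by blast
    thus ?thesis unfolding w_def kd_kw[OF A(1)] by (simp add: algebra_simps)
  qed
  have wN: "kd d x w A \<in> N2" if A: "A \<subseteq> {..<d}" "Suc (card A) = Suc i" for A
    using N2(2)[OF vM wy] A by simp
  from kexactD[OF ex wM wN]
  obtain u where u: "\<And>A. A \<subseteq> {..<d} \<Longrightarrow> card A = Suc (Suc i) \<Longrightarrow> u A \<in> M"
     "\<And>A. A \<subseteq> {..<d} \<Longrightarrow> card A = Suc i \<Longrightarrow> w A - kd d x u A \<in> N2" by blast
  have "\<exists>z. A \<subseteq> {..<d} \<and> card A = Suc i \<longrightarrow> z \<in> M \<and> w A - kd d x u A - y * z \<in> N" for A
    using N2(1) u(2)[of A] by (cases "A \<subseteq> {..<d} \<and> card A = Suc i") auto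
  then obtain z where z: "\<And>A. A \<subseteq> {..<d} \<Longrightarrow> card A = Suc i \<Longrightarrow> z A \<in> M"
    "\<And>A. A \<subseteq> {..<d} \<Longrightarrow> card A = Suc i \<Longrightarrow> w A - kd d x u A - y * z A \<in> N" by metis
  have "v A - kd d x z A \<in> N" if A: "A \<subseteq> {..<d}" "card A = i" for A
  proof (rule nzd)
    show "v A - kd d x z A \<in> M"
      by (rule kmodD(5)[OF kmM vM[OF A] kd_in[OF kmM A(1)]]) (use z(1) A in auto)
    have "kd d x (\<lambda>A. w A - kd d x u A - y * z A) A \<in> N"
      by (rule kd_in[OF kmN A(1)]) (use z(2) A in auto)
    hence "kd d x w A - y * kd d x z A \<in> N" by (simp add: kd_diff kd_scale kd_kd[OF A(1)])
    hence "kd d x w A - y * kd d x z A - (kd d x w A - y * v A) \<in> N" using kmodD(5)[OF kmN] wy[OF A] by blast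
    thus "y * (v A - kd d x z A) \<in> N" by (simp add: algebra_simps)
  qed
  thus "\<exists>u. (\<forall>A. A \<subseteq> {..<d} \<and> card A = Suc i \<longrightarrow> u A \<in> M) \<and>
        (\<forall>A. A \<subseteq> {..<d} \<and> card A = i \<longrightarrow> v A - kd d x u A \<in> N)" using z(1) by blast
qed

text \<open>A chain of top degree is a single element. It is a cycle if all \<open>x i\<close> kill
  it, and the only boundary in this degree is zero.\<close>

lemma kexact_socle:
  assumes kmN: "kmod d x N" and ex: "kexact d x M N d" and c: "c \<in> M" "\<And>i. i < d \<Longrightarrow> x i * c \<in> N"
  shows "c \<in> N"
proof -
  have N: "kd d x (\<lambda>_. c) A \<in> N" for A
    unfolding kd_def
    by (rule kmod_sum[OF kmN]) (use c(2) kmod_ksgn[OF kmN] in \<open>auto simp: mult.assoc\<close>)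
  obtain u where u: "\<And>A. A \<subseteq> {..<d} \<Longrightarrow> card A = d \<Longrightarrow> c - kd d x u A \<in> N"
    using kexactD[OF ex, of "\<lambda>_. c"] c(1) N by metis
  have "kd d x u {..<d} = 0" unfolding kd_def by simp
  thus ?thesis using u[of "{..<d}"] by simp
qed

lemma kmod_UNIV: "kmod d x UNIV"
  unfolding kmod_def by simp

lemma kmod_ideal: "idl.subspace J \<Longrightarrow> kmod d x J"
  unfolding kmod_def using idl.subspace_0 idl.subspace_add idl.subspace_neg idl.subspace_scale by blast

text \<open>The depth of \<open>R/J\<close> is at least \<open>s\<close>, measured by Koszul homology.\<close>

definition kdepth :: "nat \<Rightarrow> (nat \<Rightarrow> 'a::comm_ring_1) \<Rightarrow> 'a set \<Rightarrow> nat \<Rightarrow> bool" where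
  "kdepth d x J s \<longleftrightarrow> (\<forall>i. i + s > d \<longrightarrow> kexact d x UNIV J i)"

lemma kdepth_0: "kdepth d x J 0"
  unfolding kdepth_def by (simp add: kexact_large)

lemma kdepth_insert:
  assumes J: "idl.subspace J" and nzd: "\<And>c. y * c \<in> J \<Longrightarrow> c \<in> J" and dep: "kdepth d x J (Suc s)"
  shows "kdepth d x (idl.span (insert y J)) s"
  unfolding kdepth_def
proof (intro allI impI)
  fix i assume i: "i + s > d"
  show "kexact d x UNIV (idl.span (insert y J)) i"
  proof (cases i)
    \<comment> \<open>\<open>kexact_quot\<close> reaches positive degrees only; in degree 0
      exactness passes directly to a quotient.\<close>
    case 0
    show ?thesis
    proof (rule kexactI)
      fix w
      have "kexact d x UNIV J 0" using dep i 0 unfolding kdepth_def by simp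
      then obtain u where u: "\<And>A. A \<subseteq> {..<d} \<Longrightarrow> card A = 0 \<Longrightarrow> w A - kd d x u A \<in> J"
        using kexactD[of d x UNIV J 0 w] by (metis UNIV_I nat.distinct(1))
      thus "\<exists>u. (\<forall>A. A \<subseteq> {..<d} \<and> card A = Suc i \<longrightarrow> u A \<in> UNIV) \<and>
        (\<forall>A. A \<subseteq> {..<d} \<and> card A = i \<longrightarrow> w A - kd d x u A \<in> idl.span (insert y J))"
        using 0 idl.span_superset[of "insert y J"] by blast
    qed
  next
    case (Suc k)
    show ?thesis unfolding Suc
    proof (rule kexact_quot[of d x J UNIV UNIV y J])
      show "kexact d x UNIV J k" "kexact d x UNIV J (Suc k)" using dep i Suc unfolding kdepth_def by auto
      show "\<exists>u\<in>UNIV. z - y * u \<in> J" if "z \<in> idl.span (insert y J)" for z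
        using that span_insert_ideal[OF J] by (auto simp: mult.commute)
      show "z \<in> idl.span (insert y J)" if "z - y * u \<in> J" for u z
        using that span_insert_ideal[OF J] by (auto simp: mult.commute)
    qed (use J nzd kmod_ideal kmod_UNIV idl.subspace_scale in auto)
  qed
qed

lemma span_linear_combination:
  assumes "idl.subspace J" "y \<in> idl.span (J \<union> x ` {..<d})"
  shows "\<exists>e. (\<Sum>k<(d::nat). x k * e k) - y \<in> J"
  using assms(2)
proof (induction rule: idl.span_induct)
  case base
  show ?case
  proof (rule idl.subspaceI)
    show "0 \<in> {y. \<exists>e. (\<Sum>k<d. x k * e k) - y \<in> J}" using idl.subspace_0[OF assms(1)] by (auto intro!: exI[of _ "\<lambda>_. 0"])
    fix a b assume "a \<in> {y. \<exists>e. (\<Sum>k<d. x k * e k) - y \<in> J}" "b \<in> {y. \<exists>e. (\<Sum>k<d. x k * e k) - y \<in> J}"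
    then obtain e e' where "(\<Sum>k<d. x k * e k) - a \<in> J" "(\<Sum>k<d. x k * e' k) - b \<in> J" by blast
    hence "((\<Sum>k<d. x k * e k) - a) + ((\<Sum>k<d. x k * e' k) - b) \<in> J" by (rule idl.subspace_add[OF assms(1)])
    hence "(\<Sum>k<d. x k * (e k + e' k)) - (a + b) \<in> J" by (simp add: distrib_left sum.distrib algebra_simps)
    thus "a + b \<in> {y. \<exists>e. (\<Sum>k<d. x k * e k) - y \<in> J}" by (auto intro: exI[of _ "\<lambda>k. e k + e' k"])
  next
    fix c a assume "a \<in> {y. \<exists>e. (\<Sum>k<d. x k * e k) - y \<in> J}"
    then obtain e where "(\<Sum>k<d. x k * e k) - a \<in> J" by blast
    hence "c * ((\<Sum>k<d. x k * e k) - a) \<in> J" by (rule idl.subspace_scale[OF assms(1)])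
    hence "(\<Sum>k<d. x k * (c * e k)) - c * a \<in> J" by (simp add: sum_distrib_left mult_ac right_diff_distrib)
    thus "c * a \<in> {y. \<exists>e. (\<Sum>k<d. x k * e k) - y \<in> J}" by (auto intro: exI[of _ "\<lambda>k. c * e k"])
  qed
next
  case (step y)
  show ?case
  proof (cases "y \<in> J")
    case True
    thus ?thesis using idl.subspace_neg[OF assms(1)] by (intro exI[of _ "\<lambda>_. 0"]) simp
  next
    case False
    then obtain k where "k < d" "y = x k" using step by blast
    thus ?thesis using idl.subspace_0[OF assms(1)]
      by (intro exI[of _ "\<lambda>j. if j = k then 1 else 0"]) (simp add: if_distrib[of "\<lambda>t. _ * t"] sum.delta cong: if_cong)
  qed
qed

lemma kdepth_lift:
  assumes J: "idl.subspace J" and nzd: "\<And>c. y * c \<in> J \<Longrightarrow> c \<in> J" and y: "y \<in> idl.span (J \<union> x ` {..<d})"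
    and dep: "kdepth d x (idl.span (insert y J)) s"
  shows "kdepth d x J (Suc s)"
  unfolding kdepth_def
proof (intro allI impI)
  fix i assume i: "i + Suc s > d"
  obtain e where e: "(\<Sum>k<d. x k * e k) - y \<in> J" using span_linear_combination[OF J y] by blast
  show "kexact d x UNIV J i"
  proof (rule kexact_lift[of d x J UNIV e y])
    show "((\<Sum>k<d. x k * e k) - y) * u \<in> J" for u using ideal_mult_right[OF J e] .
    show "\<exists>u\<in>UNIV. z - y * u \<in> J" if "z \<in> idl.span (insert y J)" for z
      using that span_insert_ideal[OF J] by (auto simp: mult.commute)
    show "z \<in> idl.span (insert y J)" if "z - y * u \<in> J" for u z
      using that span_insert_ideal[OF J] by (auto simp: mult.commute)
    show "kexact d x UNIV (idl.span (insert y J)) (Suc i)" using dep i unfolding kdepth_def by simp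
  qed (use J nzd kmod_ideal kmod_UNIV idl.subspace_scale in auto)
qed

lemma kdepth_rseq:
  "idl.subspace J \<Longrightarrow> rseq J ys \<Longrightarrow> set ys \<subseteq> idl.span (J \<union> x ` {..<d}) \<Longrightarrow> kdepth d x J (length ys)"
proof (induction ys arbitrary: J)
  case (Cons y ys)
  have "idl.span (J \<union> x ` {..<d}) \<subseteq> idl.span (idl.span (insert y J) \<union> x ` {..<d})"
    using idl.span_superset[of "insert y J"] by (intro idl.span_mono) blast
  hence "kdepth d x (idl.span (insert y J)) (length ys)" using Cons by auto
  thus ?case using kdepth_lift[OF Cons.prems(1), of y] Cons.prems by auto
qed (simp add: kdepth_0)

text \<open>The depth is at most the dimension of the quotient by any associated prime
  \<open>Q\<close>. Vanishing top homology yields a nonzerodivisor \<open>y\<close> in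
  \<open>m\<close>; some associated prime of \<open>J + (y)\<close> contains both \<open>Q\<close>
  and \<open>y\<close>, so it is strictly larger, and the induction continues with it at depth one
  less.\<close>

lemma assoc_prime_chain:
  assumes J0: "noeth J0" and m: "prime_id m" and xm: "\<And>i. i < d \<Longrightarrow> x i \<in> m"
    and unit: "\<And>t. t \<notin> m \<Longrightarrow> \<exists>u. t * u - 1 \<in> J0"
  shows "idl.subspace J \<Longrightarrow> J0 \<subseteq> J \<Longrightarrow> kdepth d x J s \<Longrightarrow> prime_id Q \<Longrightarrow> Q = {r. r * c \<in> J} \<Longrightarrow> \<exists>B. pchain Q s B"
proof (induction s arbitrary: J Q c)
  case 0
  thus ?case using pchain_0 by blast
next
  case (Suc s)
  note J = Suc.prems(1)
  have nJ: "noeth J" using noeth_mono[OF J0 Suc.prems(2)] .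
  have "kexact d x UNIV J d" using Suc.prems(3) unfolding kdepth_def by simp
  hence soc: "c \<in> J" if "\<And>i. i < d \<Longrightarrow> x i * c \<in> J" for c
    using kexact_socle[OF kmod_ideal[OF J]] that by blast
  have soc': "c \<in> J" if "\<And>a. a \<in> m \<Longrightarrow> a * c \<in> J" for c by (rule soc) (rule that, rule xm)
  obtain y where y: "y \<in> m" "\<And>c. y * c \<in> J \<Longrightarrow> c \<in> J"
    using nzd_exists[OF nJ J prime_idD(1)[OF m] soc'] by blast
  let ?J = "idl.span (insert y J)"
  have JJ: "J \<subseteq> ?J" using idl.span_superset by blast
  have dep: "kdepth d x ?J s" using kdepth_insert[OF J y(2) Suc.prems(3)] .
  define E where "E = {r. \<forall>q\<in>Q. q * r \<in> J}"
  have E: "idl.subspace E" unfolding E_def using J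
    by (intro idl.subspaceI) (auto simp: idl.subspace_0 distrib_left idl.subspace_add mult.left_commute idl.subspace_scale)
  have JE: "J \<subseteq> E" unfolding E_def using idl.subspace_scale[OF J] by blast
  have QE: "c \<in> E" unfolding E_def using Suc.prems(5) by blast
  have cJ: "c \<notin> J" using prime_idD(2)[OF Suc.prems(4)] Suc.prems(5) by auto
  \<comment> \<open>\<open>E\<close> is the set of elements killed by \<open>Q\<close> modulo
    \<open>J\<close>. If it were inside \<open>J + (y)\<close>, then \<open>g = k * y\<close> with
    \<open>k\<close> again in \<open>E\<close>, because \<open>y\<close> cancels; so
    \<open>E = y E + J\<close>, and Nakayama's lemma would put \<open>c\<close> into
    \<open>J\<close>.\<close>
  have "\<not> E \<subseteq> ?J"
  proof
    assume EJ: "E \<subseteq> ?J"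
    have "\<exists>t. t \<notin> m \<and> (\<forall>g\<in>E. t * g \<in> J)"
    proof (rule nakayama_ideal[OF m nJ E JE J order_refl])
      fix g assume g: "g \<in> E"
      then obtain k where k: "g - k * y \<in> J" using EJ span_insert_ideal[OF J] by blast
      have "k \<in> E" unfolding E_def
      proof (rule CollectI, rule ballI)
        fix q assume q: "q \<in> Q"
        have "q * g - q * (g - k * y) \<in> J"
          using g q idl.subspace_diff[OF J _ idl.subspace_scale[OF J k]] unfolding E_def by blast
        hence "y * (q * k) \<in> J" by (simp add: algebra_simps)
        thus "q * k \<in> J" by (rule y(2))
      qed
      let ?M = "idl.span (J \<union> {y * k | y k. y \<in> m \<and> k \<in> E})"
      have "y * k \<in> ?M" using \<open>k \<in> E\<close> y(1) by (intro idl.span_base) blast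
      moreover have "g - k * y \<in> ?M" using k by (intro idl.span_base) blast
      ultimately have "(g - k * y) + y * k \<in> ?M" using idl.span_add by blast
      hence "1 * g \<in> ?M" by (simp add: mult.commute)
      thus "\<exists>t. t \<notin> m \<and> t * g \<in> ?M" using prime_idD(2)[OF m] by blast
    qed
    then obtain t where t: "t \<notin> m" "t * c \<in> J" using QE by blast
    obtain u where "t * u - 1 \<in> J" using unit[OF t(1)] Suc.prems(2) by blast
    hence "c \<in> J" using local_unit_ideal[OF J order_refl] t(2) by blast
    thus False using cJ by simp
  qed
  then obtain c' where c': "c' \<in> E" "c' \<notin> ?J" by blast
  have "noeth ?J" using noeth_mono[OF nJ JJ] .
  from idl.ann_prime[OF this, of ?J c'] c'(2) ideal_mult_right[OF idl.subspace_span]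
  obtain s' where s': "s' * c' \<notin> ?J" "prime_id {r. r * (s' * c') \<in> ?J}" by blast
  let ?Q = "{r. r * (s' * c') \<in> ?J}"
  have "Q \<subset> ?Q"
  proof
    show "Q \<subseteq> ?Q"
    proof
      fix q assume "q \<in> Q"
      hence "s' * (q * c') \<in> J" using c'(1) idl.subspace_scale[OF J] unfolding E_def by blast
      thus "q \<in> ?Q" using JJ by (auto simp: mult_ac)
    qed
    have "y \<in> ?J" by (rule idl.span_base) simp
    hence "y \<in> ?Q" using ideal_mult_right[OF idl.subspace_span] by blast
    moreover have "y \<notin> Q" using y(2) cJ Suc.prems(5) by blast
    ultimately show "Q \<noteq> ?Q" by blast
  qed
  moreover obtain B where "pchain ?Q s B"
    using Suc.IH[OF idl.subspace_span _ dep s'(2) refl] Suc.prems(2) JJ by blast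
  ultimately show ?case using pchain_prepend[OF Suc.prems(4)] by blast
qed

section \<open>Cohen-Macaulay ideals of height two\<close>

text \<open>An associated prime below \<open>p\<close> is found modulo the saturation of
  \<open>B\<close> at \<open>p\<close>, which keeps it inside \<open>p\<close>. It is then realized
  modulo \<open>B\<close> itself by clearing denominators.\<close>

lemma local_ann_prime:
  assumes p: "prime_id p" and J: "noeth J" "J \<subseteq> B" and B: "idl.subspace B" "B \<subseteq> p"
  shows "\<exists>c. prime_id {r. r * c \<in> B} \<and> {r. r * c \<in> B} \<subseteq> p \<and> c \<notin> B"
proof -
  define N where "N = sat_insert p 0 B"
  have N_iff: "r \<in> N \<longleftrightarrow> (\<exists>t. t \<notin> p \<and> t * r \<in> B)" for r unfolding N_def sat_insert_def by simp
  have N: "idl.subspace N" "sat p N" "B \<subseteq> N" unfolding N_def using sat_insert[OF p B(1)] by blast+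
  have N1: "1 \<notin> N" using N_iff[of 1] B(2) by auto
  have "j * 1 \<in> N" if "j \<in> J" for j using that J(2) N(3) by auto
  from idl.ann_prime[OF J(1) N(1) this N1]
  obtain s where s: "s * 1 \<notin> N" "prime_id {r. r * (s * 1) \<in> N}" by blast
  define Q where "Q = {r. r * s \<in> N}"
  have Q: "prime_id Q" unfolding Q_def using s(2) by simp
  have BQ: "B \<subseteq> Q" unfolding Q_def using ideal_mult_right[OF B(1)] N(3) by blast
  have Qp: "Q \<subseteq> p" unfolding Q_def using s(1) satD[OF N(2)] by auto
  have Bs: "idl.subspace {r. r * s \<in> B}" using idl.ann_subspace[OF B(1)] .
  \<comment> \<open>Nakayama's lemma serves here only to find one factor \<open>t\<close> for all
    elements of the finitely generated \<open>Q\<close>.\<close>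
  have "\<exists>t. t \<notin> p \<and> (\<forall>g\<in>Q. t * g \<in> {r. r * s \<in> B})"
  proof (rule nakayama_ideal[OF p J(1) prime_idD(1)[OF Q] _ Bs])
    show "J \<subseteq> Q" using J(2) BQ by blast
    show "J \<subseteq> {r. r * s \<in> B}" using J(2) ideal_mult_right[OF B(1)] by blast
    fix g assume "g \<in> Q"
    then obtain t where t: "t \<notin> p" "t * (g * s) \<in> B" unfolding Q_def N_iff by blast
    hence "t * g \<in> {r. r * s \<in> B}" by (simp add: mult.assoc)
    thus "\<exists>t. t \<notin> p \<and> t * g \<in> idl.span ({r. r * s \<in> B} \<union> {y * k | y k. y \<in> p \<and> k \<in> Q})"
      using t(1) by (blast intro: idl.span_base)
  qed
  then obtain t where t: "t \<notin> p" "\<And>g. g \<in> Q \<Longrightarrow> t * g * s \<in> B" by blast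
  have eq: "{r. r * (t * s) \<in> B} = Q"
  proof (intro Set.set_eqI iffI)
    fix r assume "r \<in> {r. r * (t * s) \<in> B}"
    hence "t * (r * s) \<in> B" by (simp add: mult_ac)
    thus "r \<in> Q" unfolding Q_def N_iff using t(1) by blast
  next
    fix r assume "r \<in> Q"
    thus "r \<in> {r. r * (t * s) \<in> B}" using t(2)[of r] by (simp add: mult_ac)
  qed
  have "t * s \<notin> B" using eq prime_idD(2)[OF Q] by auto
  thus ?thesis using eq Q Qp by metis
qed

text \<open>A regular sequence in \<open>p\<close> forces height. A nonzerodivisor modulo
  \<open>B\<close> avoids the associated primes of \<open>B\<close>, so one of these below the
  current bottom prime is strictly smaller, and each entry prolongs the chain downwards.\<close>

lemma rseq_chain:
  "noeth B \<Longrightarrow> idl.subspace B \<Longrightarrow> prime_id p \<Longrightarrow> rseq B ys \<Longrightarrow> B \<subseteq> p \<Longrightarrow> set ys \<subseteq> p \<Longrightarrow>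
    \<exists>A. B \<subseteq> A \<and> pchain A (length ys) p"
proof (induction ys arbitrary: B)
  case Nil
  thus ?case using pchain_refl by auto
next
  case (Cons y ys)
  let ?B = "idl.span (insert y B)"
  have BB: "B \<subseteq> ?B" using idl.span_superset by blast
  have "?B \<subseteq> p" using Cons.prems prime_idD(1) by (intro idl.span_minimal) auto
  then obtain A where A: "?B \<subseteq> A" "pchain A (length ys) p"
    using Cons.IH[of ?B] Cons.prems noeth_mono[OF Cons.prems(1) BB] by auto
  have pA: "prime_id A" using pchain_prime[OF A(2)] by blast
  obtain c where c: "prime_id {r. r * c \<in> B}" "{r. r * c \<in> B} \<subseteq> A" "c \<notin> B"
    using local_ann_prime[OF pA Cons.prems(1) order_refl Cons.prems(2)] A(1) BB by blast
  have "y \<notin> {r. r * c \<in> B}" using Cons.prems(4) c(3) by auto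
  moreover have "y \<in> A" using A(1) idl.span_base[of y "insert y B"] by blast
  ultimately have "{r. r * c \<in> B} \<subset> A" using c(2) by blast
  hence "pchain {r. r * c \<in> B} (length (y # ys)) p" using pchain_prepend[OF c(1) _ A(2)] by simp
  moreover have "B \<subseteq> {r. r * c \<in> B}" using ideal_mult_right[OF Cons.prems(2)] by blast
  ultimately show ?case by blast
qed

lemma kdepth_mono: "kdepth d x J s \<Longrightarrow> s' \<le> s \<Longrightarrow> kdepth d x J s'"
  unfolding kdepth_def by simp

text \<open>A regular local ring \<open>P/J\<close> of dimension \<open>d\<close>, presented as a quotient of a ring that is a type.\<close>

locale regular_quotient =
  fixes J m :: "'a::comm_ring_1 set" and d :: nat and x :: "nat \<Rightarrow> 'a"
  assumes J_noeth: "noeth J" and J_ideal: "idl.subspace J" and m_prime: "prime_id m" and J_m: "J \<subseteq> m"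
    and m_unit: "\<And>t. t \<notin> m \<Longrightarrow> \<exists>u. t * u - 1 \<in> J"
    and m_gen: "m = idl.span (J \<union> x ` {..<d})"
    and m_chain: "\<exists>A. J \<subseteq> A \<and> pchain A d m"
begin

lemma x_m: "i < d \<Longrightarrow> x i \<in> m"
  unfolding m_gen by (rule idl.span_base) blast

lemma x_list: "set (map x [0..<d]) = x ` {..<d}"
  by auto

lemma J_prime: "prime_id J"
proof -
  obtain A where A: "J \<subseteq> A" "pchain A d m" using m_chain by blast
  have "A = J"
    by (rule regular_prime[OF J_noeth J_ideal A(2,1), of "map x [0..<d]"]) (use m_gen m_unit x_list in auto)
  thus ?thesis using pchain_prime[OF A(2)] by blast
qed

lemma rseq_J: "rseq J (map x [0..<d])"
proof -
  obtain A where A: "J \<subseteq> A" "pchain A d m" using m_chain by blast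
  show ?thesis
    by (rule regular_rseq[OF J_noeth J_ideal, of A _ m]) (use A m_gen m_unit x_list in auto)
qed

lemma kdepth_J: "kdepth d x J d"
proof -
  have "kdepth d x J (length (map x [0..<d]))"
    by (rule kdepth_rseq[OF J_ideal rseq_J]) (auto intro: idl.span_base)
  thus ?thesis by simp
qed

lemma proper_le_m: "idl.subspace B \<Longrightarrow> J \<subseteq> B \<Longrightarrow> 1 \<notin> B \<Longrightarrow> B \<subseteq> m"
proof
  fix b assume B: "idl.subspace B" "J \<subseteq> B" "1 \<notin> B" "b \<in> B"
  show "b \<in> m"
  proof (rule ccontr)
    assume "b \<notin> m"
    then obtain u where "b * u - 1 \<in> J" using m_unit by blast
    hence "1 \<in> B" using local_unit_ideal[OF B(1,2), of b u 1] B(4) by simp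
    thus False using B(3) by blast
  qed
qed

lemma prime_le_m: "prime_id B \<Longrightarrow> J \<subseteq> B \<Longrightarrow> B \<subseteq> m"
  using proper_le_m prime_idD by blast

lemma dim_le:
  assumes "J \<subseteq> A" "pchain A n B"
  shows "n \<le> d"
proof -
  have le: "n \<le> d" if "pchain A n m" for n
    using pchain_length_le[OF J_noeth J_ideal that assms(1), of "map x [0..<d]"] m_gen x_list by simp
  show ?thesis
  proof (cases "B = m")
    case False
    hence "B \<subset> m" using prime_le_m pchain_prime[OF assms(2)] assms(1) by blast
    hence "Suc n \<le> d" using le pchain_step[OF assms(2) m_prime] by blast
    thus ?thesis by simp
  qed (use le assms in blast)
qed

lemma assoc_chain:
  "idl.subspace B \<Longrightarrow> J \<subseteq> B \<Longrightarrow> kdepth d x B s \<Longrightarrow> prime_id Q \<Longrightarrow> Q = {r. r * c \<in> B} \<Longrightarrow> \<exists>C. pchain Q s C"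
  by (rule assoc_prime_chain[of J m d x, OF J_noeth m_prime x_m m_unit])

end

text \<open>Height two is split into a chain of length two below each prime above \<open>I\<close>
  and one prime below which no chain is longer. The clause \<open>cm\<close> says that the depth
  reaches the length of any chain above \<open>I\<close>, so the dimension of the quotient need not
  be named.\<close>

locale cm_height_two = regular_quotient J m d x for J m :: "'a::comm_ring_1 set" and d x +
  fixes I :: "'a set"
  assumes I_ideal: "idl.subspace I" and J_I: "J \<subseteq> I" and d3: "d \<ge> 3"
    and height_ge: "\<And>q. prime_id q \<Longrightarrow> I \<subseteq> q \<Longrightarrow> \<exists>A. J \<subseteq> A \<and> pchain A 2 q"
    and height_le: "\<exists>p. prime_id p \<and> I \<subseteq> p \<and> (\<forall>A n. J \<subseteq> A \<longrightarrow> pchain A n p \<longrightarrow> n \<le> 2)"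
    and cm: "\<And>p n B. prime_id p \<Longrightarrow> I \<subseteq> p \<Longrightarrow> pchain p n B \<Longrightarrow> \<exists>ys. rseq I ys \<and> n \<le> length ys \<and> set ys \<subseteq> m"
begin

lemma J_prime_mult: "a \<notin> J \<Longrightarrow> a * c \<in> J \<Longrightarrow> c \<in> J"
  using prime_idD(3)[OF J_prime] by blast

lemma I_not_J: "\<exists>a\<in>I. a \<notin> J"
proof (rule ccontr)
  assume "\<not> ?thesis"
  hence "I \<subseteq> J" by blast
  then obtain A where A: "J \<subseteq> A" "pchain A 2 J" using height_ge[OF J_prime] by blast
  thus False using pchain_strict[of A 1 J] by (auto simp: numeral_2_eq_2)
qed

text \<open>\<open>I\<close> has grade at least two. Otherwise an associated prime of
  \<open>(a)\<close> contains \<open>I\<close>; it has a chain of length \<open>d - 1\<close> above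
  it, by depth, and one of length two below it, by height, which together exceed
  \<open>d\<close>.\<close>

lemma grade_two:
  assumes a: "a \<in> I" "a \<notin> J" and c: "\<And>g. g \<in> I \<Longrightarrow> g * c \<in> idl.span (insert a J)"
  shows "c \<in> idl.span (insert a J)"
proof (rule ccontr)
  let ?B = "idl.span (insert a J)"
  assume nc: "c \<notin> ?B"
  have JB: "J \<subseteq> ?B" using idl.span_superset by blast
  have "d = Suc (d - 1)" using d3 by simp
  hence dep: "kdepth d x ?B (d - 1)"
    using kdepth_insert[OF J_ideal, of a d x "d - 1"] J_prime_mult[OF a(2)] kdepth_J by metis
  have "j * c \<in> ?B" if "j \<in> J" for j using that JB ideal_mult_right[OF idl.subspace_span] by blast
  from idl.ann_prime[OF J_noeth idl.subspace_span this nc]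
  obtain s where s: "prime_id {r. r * (s * c) \<in> ?B}" by blast
  obtain C where C: "pchain {r. r * (s * c) \<in> ?B} (d - 1) C"
    using assoc_chain[OF idl.subspace_span JB dep s refl] by blast
  have "g * (s * c) \<in> ?B" if "g \<in> I" for g
    using idl.subspace_scale[OF idl.subspace_span c[OF that], of s] by (simp add: mult_ac)
  then obtain A where A: "J \<subseteq> A" "pchain A 2 {r. r * (s * c) \<in> ?B}" using height_ge[OF s] by blast
  have "2 + (d - 1) \<le> d" using dim_le[OF A(1) pchain_trans[OF C A(2)]] .
  thus False using d3 by simp
qed

text \<open>Choose \<open>a\<close>, \<open>b\<close> in \<open>I\<close> forming a regular
  sequence. A prime \<open>p\<close> of height two above \<open>I\<close> is killed into
  \<open>(a, b)\<close> by some element outside this ideal, so an associated prime of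
  \<open>(a, b)\<close> contains \<open>p\<close>; depth \<open>d - 2\<close> gives a chain of that
  length above it.\<close>

lemma dim_ge: "\<exists>Q B. prime_id Q \<and> I \<subseteq> Q \<and> pchain Q (d - 2) B"
proof -
  obtain p where p: "prime_id p" "I \<subseteq> p" "\<And>A n. J \<subseteq> A \<Longrightarrow> pchain A n p \<Longrightarrow> n \<le> 2" using height_le by blast
  obtain a where a: "a \<in> I" "a \<notin> J" using I_not_J by blast
  let ?A = "idl.span (insert a J)"
  have JA: "J \<subseteq> ?A" using idl.span_superset by blast
  have nA: "noeth ?A" using noeth_mono[OF J_noeth JA] .
  obtain b where b: "b \<in> I" "\<And>c. b * c \<in> ?A \<Longrightarrow> c \<in> ?A"
    using nzd_exists[OF nA idl.subspace_span I_ideal grade_two[OF a]] by blast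
  let ?B = "idl.span (insert b ?A)"
  have AB: "?A \<subseteq> ?B" using idl.span_superset by blast
  have nB: "noeth ?B" using noeth_mono[OF nA AB] .
  have Ap: "?A \<subseteq> p" using a p J_I prime_idD(1) by (intro idl.span_minimal) auto
  have "d = Suc (Suc (d - 2))" using d3 by simp
  hence "kdepth d x ?A (Suc (d - 2))"
    using kdepth_insert[OF J_ideal, of a d x "Suc (d - 2)"] J_prime_mult[OF a(2)] kdepth_J by metis
  hence dep: "kdepth d x ?B (d - 2)" using kdepth_insert[OF idl.subspace_span, of b] b(2) by blast
  \<comment> \<open>If no such \<open>c\<close> existed, \<open>p\<close> would contain a
    nonzerodivisor \<open>y\<close> modulo \<open>(a, b)\<close>, and the regular sequence
    \<open>a, b, y\<close> would give \<open>p\<close> height at least three.\<close>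
  have "\<exists>c. c \<notin> ?B \<and> (\<forall>r\<in>p. r * c \<in> ?B)"
  proof (rule ccontr)
    assume "\<not> ?thesis"
    hence "c \<in> ?B" if "\<And>r. r \<in> p \<Longrightarrow> r * c \<in> ?B" for c using that by blast
    from nzd_exists[OF nB idl.subspace_span prime_idD(1)[OF p(1)] this]
    obtain y where y: "y \<in> p" "\<And>c. y * c \<in> ?B \<Longrightarrow> c \<in> ?B" by blast
    have "rseq J [a, b, y]" using b(2) y(2) J_prime_mult[OF a(2)] by simp
    then obtain C where "J \<subseteq> C" "pchain C (length [a, b, y]) p"
      using rseq_chain[OF J_noeth J_ideal p(1), of "[a, b, y]"] a(1) b(1) y(1) p(2) J_I by auto
    hence "length [a, b, y] \<le> 2" using p(3) by blast
    thus False by simp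
  qed
  then obtain c where c: "c \<notin> ?B" "\<And>r. r \<in> p \<Longrightarrow> r * c \<in> ?B" by blast
  have "j * c \<in> ?B" if "j \<in> J" for j using that c(2) Ap JA by blast
  from idl.ann_prime[OF J_noeth idl.subspace_span this c(1)]
  obtain s where s: "prime_id {r. r * (s * c) \<in> ?B}" by blast
  have "J \<subseteq> ?B" using JA AB by blast
  then obtain C where C: "pchain {r. r * (s * c) \<in> ?B} (d - 2) C"
    using assoc_chain[OF idl.subspace_span _ dep s refl] by blast
  have "g * (s * c) \<in> ?B" if "g \<in> I" for g
    using idl.subspace_scale[OF idl.subspace_span c(2), of g s] that p(2) by (auto simp add: mult_ac)
  thus ?thesis using C s by blast
qed

lemma kdepth_I: "kdepth d x I (d - 2)"
proof -
  obtain Q B where "prime_id Q" "I \<subseteq> Q" "pchain Q (d - 2) B" using dim_ge by blast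
  then obtain ys where ys: "rseq I ys" "d - 2 \<le> length ys" "set ys \<subseteq> m" using cm by blast
  have "m \<subseteq> idl.span (I \<union> x ` {..<d})" unfolding m_gen using J_I by (intro idl.span_mono) auto
  hence "kdepth d x I (length ys)" using kdepth_rseq[OF I_ideal ys(1)] ys(3) by blast
  thus ?thesis using kdepth_mono ys(2) by blast
qed

text \<open>Unmixedness: the chain of length \<open>d - 2\<close> above an associated prime,
  supplied by the depth, leaves room for at most two steps below it.\<close>

lemma assoc_height:
  assumes Q: "prime_id Q" "Q = {r. r * c \<in> I}" and A: "J \<subseteq> A" "pchain A n Q"
  shows "n \<le> 2"
proof -
  obtain B where "pchain Q (d - 2) B" using assoc_chain[OF I_ideal J_I kdepth_I Q] by blast
  hence "n + (d - 2) \<le> d" using dim_le[OF A(1) pchain_trans[OF _ A(2)]] by blast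
  thus ?thesis using d3 by simp
qed

lemma assoc_not_m:
  assumes Q: "prime_id Q" "Q = {r. r * c \<in> I}"
  shows "Q \<noteq> m"
proof
  assume Qm: "Q = m"
  obtain B where B: "pchain Q (d - 2) B" using assoc_chain[OF I_ideal J_I kdepth_I Q] by blast
  moreover have "d - 2 = Suc (d - 3)" using d3 by simp
  ultimately have "m \<subset> B" using pchain_strict[of Q "d - 3" B] Qm by simp
  moreover have "B \<subseteq> m" using prime_le_m[of B] pchain_prime[OF B] Qm J_m by blast
  ultimately show False by blast
qed

lemma assoc_below:
  assumes "prime_id p" "I \<subseteq> p"
  shows "\<exists>c. prime_id {r. r * c \<in> I} \<and> {r. r * c \<in> I} \<subseteq> p"
  using local_ann_prime[OF assms(1) J_noeth J_I I_ideal assms(2)] by blast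

end

section \<open>Forms in several variables\<close>

type_synonym 'a mp = "(nat \<Rightarrow>\<^sub>0 nat) \<Rightarrow>\<^sub>0 'a"

definition Cst :: "'a::comm_ring_1 \<Rightarrow> 'a mp" where "Cst c = Poly_Mapping.single 0 c"
definition Tv :: "nat \<Rightarrow> 'a::comm_ring_1 mp" where "Tv i = Poly_Mapping.single (Poly_Mapping.single i 1) 1"
definition tdeg :: "(nat \<Rightarrow>\<^sub>0 nat) \<Rightarrow> nat" where "tdeg k = (\<Sum>i\<in>Poly_Mapping.keys k. Poly_Mapping.lookup k i)"

lemma Cst_simps [simp]:
  "Cst 0 = 0" "Cst 1 = 1" "Cst (a + b) = Cst a + Cst b" "Cst (a - b) = Cst a - Cst b" "Cst (- a) = - Cst a"
  "Cst (a * b) = Cst a * Cst b"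
  unfolding Cst_def by (simp_all add: single_add single_diff single_uminus mult_single)

lemma Cst_sum: "Cst (sum f A) = (\<Sum>i\<in>A. Cst (f i))"
  by (induction A rule: infinite_finite_induct) auto

lemma Cst_power: "Cst (a ^ n) = Cst a ^ n"
  by (induction n) auto

lemma tdeg_superset: "finite A \<Longrightarrow> Poly_Mapping.keys k \<subseteq> A \<Longrightarrow> tdeg k = (\<Sum>i\<in>A. Poly_Mapping.lookup k i)"
  unfolding tdeg_def by (intro sum.mono_neutral_left) (auto simp: in_keys_iff)

lemma tdeg_add: "tdeg (k + l) = tdeg k + tdeg l"
proof -
  let ?A = "Poly_Mapping.keys k \<union> Poly_Mapping.keys l"
  have "tdeg (k + l) = (\<Sum>i\<in>?A. Poly_Mapping.lookup (k + l) i)"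
    by (intro tdeg_superset Poly_Mapping.keys_add) auto
  also have "\<dots> = tdeg k + tdeg l"
    by (subst (1 2) tdeg_superset[of ?A]) (auto simp: lookup_add sum.distrib)
  finally show ?thesis .
qed

lemma tdeg_simps [simp]: "tdeg 0 = 0" "tdeg (Poly_Mapping.single i n) = n"
  unfolding tdeg_def by (auto simp: lookup_single)

lemma tdeg_eq_0: "tdeg k = 0 \<longleftrightarrow> k = 0"
  unfolding tdeg_def by (auto simp: in_keys_iff poly_mapping_eqI)

text \<open>Homogeneous polynomials, with zero in every degree. The number \<open>N\<close> of
  variables is a parameter because \<open>linear_forms_fg\<close> eliminates variables one at a
  time.\<close>

definition forms :: "nat \<Rightarrow> nat \<Rightarrow> 'a::comm_ring_1 mp set" where
  "forms N n = {F. \<forall>k\<in>Poly_Mapping.keys F. Poly_Mapping.keys k \<subseteq> {..<N} \<and> tdeg k = n}"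

lemma forms_0 [simp]: "0 \<in> forms N n" unfolding forms_def by simp

lemma forms_add: "F \<in> forms N n \<Longrightarrow> G \<in> forms N n \<Longrightarrow> F + G \<in> forms N n"
  unfolding forms_def using Poly_Mapping.keys_add[of F G] by blast

lemma forms_neg: "F \<in> forms N n \<Longrightarrow> - F \<in> forms N n"
  unfolding forms_def by (simp add: in_keys_iff)

lemma forms_diff: "F \<in> forms N n \<Longrightarrow> G \<in> forms N n \<Longrightarrow> F - G \<in> forms N n"
  using forms_add[of F N n "- G"] forms_neg[of G N n] by simp

lemma forms_sum: "(\<And>i. i \<in> A \<Longrightarrow> f i \<in> forms N n) \<Longrightarrow> sum f A \<in> forms N n"
  by (induction A rule: infinite_finite_induct) (auto simp: forms_add)

lemma forms_mult:
  assumes "F \<in> forms N a" "G \<in> forms N b"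
  shows "F * G \<in> forms N (a + b)"
  unfolding forms_def
proof (intro CollectI ballI)
  fix k assume "k \<in> Poly_Mapping.keys (F * G)"
  then obtain k1 k2 where k: "k = k1 + k2" "k1 \<in> Poly_Mapping.keys F" "k2 \<in> Poly_Mapping.keys G"
    using Poly_Mapping.keys_mult[of F G] by blast
  thus "Poly_Mapping.keys k \<subseteq> {..<N} \<and> tdeg k = a + b"
    using assms order_trans[OF Poly_Mapping.keys_add[of k1 k2], of "{..<N}"] unfolding forms_def by (auto simp: tdeg_add)
qed

lemma forms_Cst [simp]: "Cst c \<in> forms N 0"
  unfolding forms_def Cst_def by simp

lemma forms_Tv: "i < N \<Longrightarrow> Tv i \<in> forms N 1"
  unfolding forms_def Tv_def by simp

lemma forms_Cst_mult: "F \<in> forms N n \<Longrightarrow> Cst c * F \<in> forms N n"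
  using forms_mult[of "Cst c" N 0 F n] by simp

lemma forms_Tv_mult: "i < N \<Longrightarrow> F \<in> forms N n \<Longrightarrow> Tv i * F \<in> forms N (Suc n)"
  using forms_mult[OF forms_Tv, of i N F n] by simp

lemma forms_mono: "F \<in> forms N n \<Longrightarrow> N \<le> N' \<Longrightarrow> F \<in> forms N' n"
  unfolding forms_def by fastforce

lemma mp_sum_singles: "F = (\<Sum>k\<in>Poly_Mapping.keys F. Poly_Mapping.single k (Poly_Mapping.lookup F k))"
proof (rule poly_mapping_eqI)
  fix k
  have "(\<Sum>l\<in>Poly_Mapping.keys F. Poly_Mapping.lookup (Poly_Mapping.single l (Poly_Mapping.lookup F l)) k) =
    (\<Sum>l\<in>Poly_Mapping.keys F. if l = k then Poly_Mapping.lookup F l else 0)"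
    by (intro sum.cong) (auto simp: lookup_single when_def)
  thus "Poly_Mapping.lookup F k = Poly_Mapping.lookup (\<Sum>k\<in>Poly_Mapping.keys F. Poly_Mapping.single k (Poly_Mapping.lookup F k)) k"
    by (simp add: lookup_sum in_keys_iff)
qed

lemma forms_zero: "F \<in> forms N 0 \<Longrightarrow> F = Cst (Poly_Mapping.lookup F 0)"
  unfolding forms_def Cst_def
  by (rule poly_mapping_eqI) (auto simp: lookup_single when_def tdeg_eq_0 in_keys_iff)

lemma single_factor:
  fixes k :: "nat \<Rightarrow>\<^sub>0 nat"
  assumes "i \<in> Poly_Mapping.keys k"
  shows "\<exists>l. k = Poly_Mapping.single i 1 + l \<and> Poly_Mapping.keys l \<subseteq> Poly_Mapping.keys k"
proof -
  define l where "l = k - Poly_Mapping.single i 1"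
  have "k = Poly_Mapping.single i 1 + l"
    by (rule poly_mapping_eqI) (use assms in \<open>auto simp: l_def lookup_add lookup_minus lookup_single when_def in_keys_iff\<close>)
  moreover have "Poly_Mapping.keys l \<subseteq> Poly_Mapping.keys k"
    unfolding l_def by (auto simp: in_keys_iff lookup_minus)
  ultimately show ?thesis by blast
qed

text \<open>Each monomial is filed under one variable that divides it. This drives the inductions on
  the degree below.\<close>

lemma forms_Suc:
  assumes "F \<in> forms N (Suc n)"
  shows "\<exists>G. (\<forall>i<N. G i \<in> forms N n) \<and> F = (\<Sum>i<N. Tv i * G i)"
proof -
  define P where "P F \<longleftrightarrow> (\<exists>G. (\<forall>i<N. G i \<in> forms N n) \<and> F = (\<Sum>i<N. Tv i * G i))" for F :: "'a mp"
  have P0: "P 0" unfolding P_def by (rule exI[of _ "\<lambda>_. 0"]) simp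
  have Padd: "P (F + G)" if "P F" "P G" for F G
  proof -
    obtain A B where "\<forall>i<N. A i \<in> forms N n" "F = (\<Sum>i<N. Tv i * A i)" "\<forall>i<N. B i \<in> forms N n" "G = (\<Sum>i<N. Tv i * B i)"
      using \<open>P F\<close> \<open>P G\<close> unfolding P_def by blast
    thus ?thesis unfolding P_def
      by (intro exI[of _ "\<lambda>i. A i + B i"]) (auto simp: forms_add distrib_left sum.distrib)
  qed
  have Psingle: "P (Poly_Mapping.single k c)" if k: "Poly_Mapping.keys k \<subseteq> {..<N}" "tdeg k = Suc n" for k c
  proof -
    have "k \<noteq> 0" using k(2) by auto
    then obtain i where i: "i \<in> Poly_Mapping.keys k" by (metis all_not_in_conv keys_eq_empty)
    obtain l where l: "k = Poly_Mapping.single i 1 + l" "Poly_Mapping.keys l \<subseteq> Poly_Mapping.keys k"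
      using single_factor[OF i] by blast
    have "tdeg l = n" using k(2) l(1) by (simp add: tdeg_add)
    hence lf: "Poly_Mapping.single l c \<in> forms N n" using l(2) k(1) unfolding forms_def by auto
    have "Poly_Mapping.single k c = Tv i * Poly_Mapping.single l c" unfolding Tv_def l(1) by (simp add: mult_single)
    also have "\<dots> = (\<Sum>j<N. Tv j * (if j = i then Poly_Mapping.single l c else 0))"
      using i k(1) by (auto simp: if_distrib[of "\<lambda>t. _ * t"] sum.delta cong: if_cong)
    finally show ?thesis unfolding P_def using lf
      by (intro exI[of _ "\<lambda>j. if j = i then Poly_Mapping.single l c else 0"]) auto
  qed
  have "P (\<Sum>k\<in>K. Poly_Mapping.single k (Poly_Mapping.lookup F k))" if "K \<subseteq> Poly_Mapping.keys F" for K
  proof -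
    have "finite K" using that finite_subset by fastforce
    thus ?thesis using that
    proof (induction K rule: finite_induct)
      case (insert k K)
      thus ?case using assms Psingle Padd unfolding forms_def by simp
    qed (simp add: P0)
  qed
  from this[OF order_refl] show ?thesis using mp_sum_singles[of F] unfolding P_def by simp
qed

text \<open>The extension of the ideal \<open>A\<close> to the polynomial ring.\<close>

definition pcoef :: "'a::comm_ring_1 set \<Rightarrow> 'a mp set" where
  "pcoef A = {F. \<forall>k. Poly_Mapping.lookup F k \<in> A}"

lemma pcoef_simps:
  assumes "idl.subspace A"
  shows "0 \<in> pcoef A" "F \<in> pcoef A \<Longrightarrow> G \<in> pcoef A \<Longrightarrow> F + G \<in> pcoef A" "F \<in> pcoef A \<Longrightarrow> G \<in> pcoef A \<Longrightarrow> F - G \<in> pcoef A"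
    "F \<in> pcoef A \<Longrightarrow> - F \<in> pcoef A"
  using idl.subspace_0[OF assms] idl.subspace_add[OF assms] idl.subspace_diff[OF assms] idl.subspace_neg[OF assms]
  by (auto simp: pcoef_def lookup_add lookup_minus)

lemma pcoef_sum: "idl.subspace A \<Longrightarrow> (\<And>i. i \<in> I \<Longrightarrow> f i \<in> pcoef A) \<Longrightarrow> sum f I \<in> pcoef A"
  by (induction I rule: infinite_finite_induct) (auto simp: pcoef_simps)

lemma pcoef_mono: "A \<subseteq> B \<Longrightarrow> pcoef A \<subseteq> pcoef B"
  unfolding pcoef_def by auto

lemma lookup_single_mult:
  "Poly_Mapping.lookup (Poly_Mapping.single a c * Poly_Mapping.single b e) k = (c * e when k = a + b)"
  by (simp add: mult_single lookup_single when_def eq_commute)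

lemma mult_sum_singles:
  "F * G = (\<Sum>a\<in>Poly_Mapping.keys F. \<Sum>b\<in>Poly_Mapping.keys G.
     Poly_Mapping.single a (Poly_Mapping.lookup F a) * Poly_Mapping.single b (Poly_Mapping.lookup G b))"
  by (subst (1) mp_sum_singles[of F], subst (1) mp_sum_singles[of G]) (simp add: sum_product)

lemma lookup_mult_sum:
  "Poly_Mapping.lookup (F * G) k = (\<Sum>a\<in>Poly_Mapping.keys F. \<Sum>b\<in>Poly_Mapping.keys G.
     (Poly_Mapping.lookup F a * Poly_Mapping.lookup G b when k = a + b))"
  by (subst mult_sum_singles) (simp add: lookup_sum lookup_single_mult)

lemma pcoef_mult:
  assumes A: "idl.subspace A" and F: "F \<in> pcoef A"
  shows "F * G \<in> pcoef A" "G * F \<in> pcoef A"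
proof -
  have "Poly_Mapping.lookup (F * G) k \<in> A" for k
    unfolding lookup_mult_sum
    using F idl.subspace_0[OF A] ideal_mult_right[OF A]
    by (intro idl.subspace_sum[OF A]) (simp add: pcoef_def when_def)
  thus "F * G \<in> pcoef A" unfolding pcoef_def by blast
  thus "G * F \<in> pcoef A" by (simp add: mult.commute)
qed

lemma pcoef_Cst: "idl.subspace A \<Longrightarrow> Cst c \<in> pcoef A \<longleftrightarrow> c \<in> A"
  unfolding pcoef_def Cst_def by (auto simp: lookup_single when_def idl.subspace_0)

lemma lookup_Cst_mult: "Poly_Mapping.lookup (Cst c * F) k = c * Poly_Mapping.lookup F k"
proof -
  have "Cst c * F = Poly_Mapping.map ((*) c) F" unfolding Cst_def by (rule mult_map_scale_conv_mult[symmetric])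
  thus ?thesis by (simp add: Poly_Mapping.map.rep_eq when_def)
qed

text \<open>Let \<open>a\<close> and \<open>b\<close> be the largest monomials of the factors whose
  coefficients are outside \<open>p\<close>. In the coefficient of the product at
  \<open>a + b\<close> every other term lies in \<open>p\<close>.\<close>

lemma pcoef_prime:
  assumes p: "prime_id p" and F: "F \<notin> pcoef p" and G: "G \<notin> pcoef p"
  shows "F * G \<notin> pcoef p"
proof -
  have pI: "idl.subspace p" using prime_idD(1)[OF p] .
  define KF where "KF = {k \<in> Poly_Mapping.keys F. Poly_Mapping.lookup F k \<notin> p}"
  define KG where "KG = {k \<in> Poly_Mapping.keys G. Poly_Mapping.lookup G k \<notin> p}"
  have fin: "finite KF" "finite KG" unfolding KF_def KG_def by auto
  have in_p: "Poly_Mapping.lookup H k \<in> p" if "k \<notin> Poly_Mapping.keys H" for H and k :: "nat \<Rightarrow>\<^sub>0 nat"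
    using that idl.subspace_0[OF pI] by (simp add: in_keys_iff)
  have ne: "KF \<noteq> {}" "KG \<noteq> {}" using F G in_p unfolding pcoef_def KF_def KG_def by blast+
  define a where "a = Max KF"
  define b where "b = Max KG"
  have a: "a \<in> KF" "\<And>k. k \<in> KF \<Longrightarrow> k \<le> a" unfolding a_def using fin ne by auto
  have b: "b \<in> KG" "\<And>k. k \<in> KG \<Longrightarrow> k \<le> b" unfolding b_def using fin ne by auto
  let ?f = "\<lambda>k l. (Poly_Mapping.lookup F k * Poly_Mapping.lookup G l when a + b = k + l)"
  have other: "?f k l \<in> p" if kl: "k \<in> Poly_Mapping.keys F" "l \<in> Poly_Mapping.keys G" "(k, l) \<noteq> (a, b)" for k l
  proof (cases "a + b = k + l")
    case True
    have "k \<notin> KF \<or> l \<notin> KG"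
    proof (rule ccontr)
      assume "\<not> ?thesis"
      hence "k \<le> a" "l \<le> b" using a b by auto
      hence "k = a" using True by (metis add_le_cancel_right add_left_mono antisym order_trans add_le_cancel_left add.commute)
      thus False using True kl(3) by simp
    qed
    hence "Poly_Mapping.lookup F k \<in> p \<or> Poly_Mapping.lookup G l \<in> p" using kl unfolding KF_def KG_def by blast
    thus ?thesis using True idl.subspace_scale[OF pI] ideal_mult_right[OF pI] by auto
  qed (use idl.subspace_0[OF pI] in simp)
  have aF: "a \<in> Poly_Mapping.keys F" and bG: "b \<in> Poly_Mapping.keys G" using a b unfolding KF_def KG_def by auto
  have "Poly_Mapping.lookup (F * G) (a + b) = (\<Sum>z\<in>Poly_Mapping.keys F \<times> Poly_Mapping.keys G. ?f (fst z) (snd z))"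
    unfolding lookup_mult_sum by (simp add: sum.cartesian_product case_prod_beta)
  also have "\<dots> = ?f a b + (\<Sum>z\<in>Poly_Mapping.keys F \<times> Poly_Mapping.keys G - {(a, b)}. ?f (fst z) (snd z))"
    using aF bG by (subst sum.remove[of _ "(a, b)"]) auto
  finally have eq: "Poly_Mapping.lookup (F * G) (a + b) =
    ?f a b + (\<Sum>z\<in>Poly_Mapping.keys F \<times> Poly_Mapping.keys G - {(a, b)}. ?f (fst z) (snd z))" .
  have rest: "(\<Sum>z\<in>Poly_Mapping.keys F \<times> Poly_Mapping.keys G - {(a, b)}. ?f (fst z) (snd z)) \<in> p"
  proof (rule idl.subspace_sum[OF pI])
    fix z assume z: "z \<in> Poly_Mapping.keys F \<times> Poly_Mapping.keys G - {(a, b)}"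
    hence "(fst z, snd z) \<noteq> (a, b)" by auto
    thus "?f (fst z) (snd z) \<in> p" using z other[of "fst z" "snd z"] by auto
  qed
  have "?f a b \<notin> p" using a(1) b(1) prime_idD(4)[OF p] unfolding KF_def KG_def by simp
  hence "Poly_Mapping.lookup (F * G) (a + b) \<notin> p"
    unfolding eq using idl.subspace_diff[OF pI _ rest] by force
  thus ?thesis unfolding pcoef_def by blast
qed

lemma pcoef_lift:
  assumes J: "idl.subspace J" and F: "F \<in> forms N n" "F \<in> pcoef (idl.span (insert y J))"
  shows "\<exists>G\<in>forms N n. F - Cst y * G \<in> pcoef J"
proof -
  have "\<exists>c. Poly_Mapping.lookup F k - c * y \<in> J" for k
    using F(2) span_insert_ideal[OF J] unfolding pcoef_def by blast
  then obtain c where c: "\<And>k. Poly_Mapping.lookup F k - c k * y \<in> J" by metis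
  define G where "G = (\<Sum>k\<in>Poly_Mapping.keys F. Poly_Mapping.single k (c k))"
  have Gk: "Poly_Mapping.lookup G k = (if k \<in> Poly_Mapping.keys F then c k else 0)" for k
  proof -
    have "Poly_Mapping.lookup G k = (\<Sum>l\<in>Poly_Mapping.keys F. if l = k then c l else 0)"
      unfolding G_def lookup_sum by (intro sum.cong) (auto simp: lookup_single when_def)
    thus ?thesis by simp
  qed
  have "Poly_Mapping.keys G \<subseteq> Poly_Mapping.keys F" using Gk by (auto simp: in_keys_iff split: if_splits)
  hence "G \<in> forms N n" using F(1) unfolding forms_def by blast
  moreover have "F - Cst y * G \<in> pcoef J"
    unfolding pcoef_def
  proof (intro CollectI allI)
    fix k
    show "Poly_Mapping.lookup (F - Cst y * G) k \<in> J"
      using c[of k] idl.subspace_0[OF J]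
      by (cases "k \<in> Poly_Mapping.keys F") (simp_all add: lookup_minus lookup_Cst_mult Gk in_keys_iff mult.commute[of y])
  qed
  ultimately show ?thesis by blast
qed

section \<open>Evaluation and substitution\<close>

definition rhom :: "('a::comm_ring_1 \<Rightarrow> 'c::comm_ring_1) \<Rightarrow> bool" where
  "rhom h \<longleftrightarrow> h 1 = 1 \<and> (\<forall>a b. h (a + b) = h a + h b) \<and> (\<forall>a b. h (a * b) = h a * h b)"

lemma rhomD:
  assumes "rhom h"
  shows "h 1 = 1" "h (a + b) = h a + h b" "h (a * b) = h a * h b" "h 0 = 0"
proof -
  show "h 1 = 1" "h (a + b) = h a + h b" "h (a * b) = h a * h b" using assms unfolding rhom_def by blast+
  have "h (0 + 0) = h 0 + h 0" using assms unfolding rhom_def by blast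
  thus "h 0 = 0" by simp
qed

definition mono_eval :: "(nat \<Rightarrow> 'c::comm_ring_1) \<Rightarrow> (nat \<Rightarrow>\<^sub>0 nat) \<Rightarrow> 'c" where
  "mono_eval g k = (\<Prod>i\<in>Poly_Mapping.keys k. g i ^ Poly_Mapping.lookup k i)"

definition evalp :: "('a::comm_ring_1 \<Rightarrow> 'c::comm_ring_1) \<Rightarrow> (nat \<Rightarrow> 'c) \<Rightarrow> 'a mp \<Rightarrow> 'c" where
  "evalp h g F = (\<Sum>k\<in>Poly_Mapping.keys F. h (Poly_Mapping.lookup F k) * mono_eval g k)"

lemma mono_eval_superset:
  "finite A \<Longrightarrow> Poly_Mapping.keys k \<subseteq> A \<Longrightarrow> mono_eval g k = (\<Prod>i\<in>A. g i ^ Poly_Mapping.lookup k i)"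
  unfolding mono_eval_def by (intro prod.mono_neutral_left) (auto simp: in_keys_iff)

lemma mono_eval_add: "mono_eval g (k + l) = mono_eval g k * mono_eval g l"
proof -
  let ?A = "Poly_Mapping.keys k \<union> Poly_Mapping.keys l"
  have "mono_eval g (k + l) = (\<Prod>i\<in>?A. g i ^ Poly_Mapping.lookup (k + l) i)"
    by (intro mono_eval_superset Poly_Mapping.keys_add) auto
  also have "\<dots> = mono_eval g k * mono_eval g l"
    by (subst (1 2) mono_eval_superset[of ?A]) (auto simp: lookup_add power_add prod.distrib)
  finally show ?thesis .
qed

lemma evalp_superset:
  "rhom h \<Longrightarrow> finite A \<Longrightarrow> Poly_Mapping.keys F \<subseteq> A \<Longrightarrow> evalp h g F = (\<Sum>k\<in>A. h (Poly_Mapping.lookup F k) * mono_eval g k)"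
  unfolding evalp_def by (intro sum.mono_neutral_left) (auto simp: in_keys_iff rhomD)

lemma evalp_add:
  assumes "rhom h"
  shows "evalp h g (F + G) = evalp h g F + evalp h g G"
proof -
  let ?A = "Poly_Mapping.keys F \<union> Poly_Mapping.keys G"
  have "evalp h g (F + G) = (\<Sum>k\<in>?A. h (Poly_Mapping.lookup (F + G) k) * mono_eval g k)"
    using assms by (intro evalp_superset Poly_Mapping.keys_add) auto
  also have "\<dots> = evalp h g F + evalp h g G"
    using assms by (subst (1 2) evalp_superset[of h ?A]) (auto simp: lookup_add rhomD distrib_right sum.distrib)
  finally show ?thesis .
qed

lemma evalp_0 [simp]: "evalp h g 0 = 0"
  unfolding evalp_def by simp

lemma evalp_sum: "rhom h \<Longrightarrow> evalp h g (sum f A) = (\<Sum>i\<in>A. evalp h g (f i))"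
  by (induction A rule: infinite_finite_induct) (auto simp: evalp_add)

lemma evalp_uminus: "rhom h \<Longrightarrow> evalp h g (- F) = - evalp h g F"
  using evalp_add[of h g F "- F"] by (simp add: eq_neg_iff_add_eq_0 add.commute)

lemma evalp_diff: "rhom h \<Longrightarrow> evalp h g (F - G) = evalp h g F - evalp h g G"
  using evalp_add[of h g F "- G"] evalp_uminus[of h g G] by simp

lemma evalp_single: "rhom h \<Longrightarrow> evalp h g (Poly_Mapping.single k c) = h c * mono_eval g k"
  unfolding evalp_def by (cases "c = 0") (auto simp: rhomD)

lemma evalp_mult:
  assumes "rhom h"
  shows "evalp h g (F * G) = evalp h g F * evalp h g G"
proof -
  have "evalp h g (F * G) = (\<Sum>a\<in>Poly_Mapping.keys F. \<Sum>b\<in>Poly_Mapping.keys G.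
      h (Poly_Mapping.lookup F a) * mono_eval g a * (h (Poly_Mapping.lookup G b) * mono_eval g b))"
    unfolding mult_sum_singles[of F G] evalp_sum[OF assms] mult_single evalp_single[OF assms]
    by (simp only: rhomD(3)[OF assms] mono_eval_add mult_ac)
  also have "\<dots> = evalp h g F * evalp h g G" unfolding evalp_def sum_product ..
  finally show ?thesis .
qed

lemma evalp_Cst: "rhom h \<Longrightarrow> evalp h g (Cst c) = h c"
  unfolding Cst_def by (simp add: evalp_single mono_eval_def)

lemma evalp_Tv: "rhom h \<Longrightarrow> evalp h g (Tv i) = g i"
  unfolding Tv_def by (simp add: evalp_single mono_eval_def rhomD)

abbreviation subst :: "(nat \<Rightarrow> 'a mp) \<Rightarrow> 'a::comm_ring_1 mp \<Rightarrow> 'a mp" where "subst \<equiv> evalp Cst"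
abbreviation ev :: "(nat \<Rightarrow> 'a) \<Rightarrow> 'a::comm_ring_1 mp \<Rightarrow> 'a" where "ev \<equiv> evalp (\<lambda>c. c)"

lemma rhom_Cst [simp]: "rhom Cst" and rhom_id [simp]: "rhom (\<lambda>c. c)"
  unfolding rhom_def by simp_all

lemmas subst_simps = evalp_add[OF rhom_Cst] evalp_diff[OF rhom_Cst] evalp_mult[OF rhom_Cst] evalp_sum[OF rhom_Cst]
  evalp_Cst[OF rhom_Cst] evalp_Tv[OF rhom_Cst] evalp_uminus[OF rhom_Cst]
lemmas ev_simps = evalp_add[OF rhom_id] evalp_diff[OF rhom_id] evalp_mult[OF rhom_id] evalp_sum[OF rhom_id]
  evalp_Cst[OF rhom_id] evalp_Tv[OF rhom_id] evalp_uminus[OF rhom_id]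

lemma ev_power: "ev f (F ^ n) = ev f F ^ n"
  by (induction n) (auto simp: ev_simps evalp_Cst[of "\<lambda>c. c" f 1, simplified])

lemma subst_forms:
  assumes "\<And>i. i < N \<Longrightarrow> s i \<in> forms N 1"
  shows "F \<in> forms N n \<Longrightarrow> subst s F \<in> forms N n"
proof (induction n arbitrary: F)
  case 0
  show ?case by (subst forms_zero[OF 0]) (simp add: subst_simps)
next
  case (Suc n)
  obtain G where G: "\<forall>i<N. G i \<in> forms N n" "F = (\<Sum>i<N. Tv i * G i)" using forms_Suc[OF Suc.prems] by blast
  have "s i * subst s (G i) \<in> forms N (Suc n)" if "i < N" for i
    using forms_mult[OF assms[OF that] Suc.IH, of "G i"] G(1) that by simp
  thus ?case unfolding G(2) by (auto simp: subst_simps intro!: forms_sum)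
qed

lemma subst_pcoef: "idl.subspace A \<Longrightarrow> F \<in> pcoef A \<Longrightarrow> subst s F \<in> pcoef A"
  unfolding evalp_def by (intro pcoef_sum pcoef_mult(1)) (simp_all add: pcoef_Cst, simp add: pcoef_def)

lemma ev_pcoef: "idl.subspace A \<Longrightarrow> F \<in> pcoef A \<Longrightarrow> ev f F \<in> A"
  unfolding evalp_def by (intro idl.subspace_sum ideal_mult_right) (auto simp: pcoef_def)

lemma ev_ideal: "idl.subspace I \<Longrightarrow> (\<And>i. i < N \<Longrightarrow> f i \<in> I) \<Longrightarrow> F \<in> forms N (Suc n) \<Longrightarrow> ev f F \<in> I"
  using forms_Suc[of F N n] by (auto simp: ev_simps intro!: idl.subspace_sum ideal_mult_right)

definition cf :: "'a::comm_ring_1 mp \<Rightarrow> nat \<Rightarrow> 'a" where "cf F i = Poly_Mapping.lookup F (Poly_Mapping.single i 1)"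

lemma cf_simps [simp]:
  "cf 0 i = 0" "cf (F + G) i = cf F i + cf G i" "cf (F - G) i = cf F i - cf G i" "cf (Cst c * F) i = c * cf F i"
  "cf (- F) i = - cf F i" "cf (Tv j) i = (if i = j then 1 else 0)"
proof -
  have "Poly_Mapping.single j (Suc 0) = Poly_Mapping.single i (Suc 0) \<longleftrightarrow> i = j"
    by (metis One_nat_def keys_single singleton_inject zero_neq_one)
  thus "cf (Tv j) i = (if i = j then 1 else 0)" by (simp add: cf_def Tv_def lookup_single when_def)
qed (simp_all add: cf_def lookup_add lookup_minus lookup_Cst_mult)

lemma cf_sum: "cf (sum f A) i = (\<Sum>j\<in>A. cf (f j) i)"
  unfolding cf_def by (simp add: lookup_sum)

lemma linear_form:
  assumes "F \<in> forms N 1"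
  shows "F = (\<Sum>i<N. Cst (cf F i) * Tv i)"
proof -
  obtain G where G: "\<forall>i<N. G i \<in> forms N 0" "F = (\<Sum>i<N. Tv i * G i)" using forms_Suc[of F N 0] assms by auto
  define c where "c i = Poly_Mapping.lookup (G i) 0" for i
  have F: "F = (\<Sum>i<N. Cst (c i) * Tv i)"
    unfolding G(2) c_def
  proof (rule sum.cong[OF refl])
    fix i assume "i \<in> {..<N}"
    hence "G i = Cst (Poly_Mapping.lookup (G i) 0)" using G(1) forms_zero by blast
    thus "Tv i * G i = Cst (Poly_Mapping.lookup (G i) 0) * Tv i" by (metis mult.commute)
  qed
  have "cf F j = c j" if "j < N" for j
    unfolding F cf_sum using that by (simp add: if_distrib[of "\<lambda>t. _ * t"] cong: if_cong)
  thus ?thesis using F by simp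
qed

lemma linear_form_pcoef:
  assumes "F \<in> forms N 1" "idl.subspace A"
  shows "F \<in> pcoef A \<longleftrightarrow> (\<forall>i<N. cf F i \<in> A)"
proof
  show "F \<in> pcoef A \<Longrightarrow> \<forall>i<N. cf F i \<in> A" unfolding pcoef_def cf_def by blast
  assume "\<forall>i<N. cf F i \<in> A"
  thus "F \<in> pcoef A"
    by (subst linear_form[OF assms(1)]) (auto intro!: pcoef_sum pcoef_mult(1) simp: assms(2) pcoef_Cst)
qed

section \<open>Ideals generated by linear forms\<close>

text \<open>The multipliers that linear forms may have in degree \<open>n\<close>. In degree 0 only
  zero is allowed; truncated subtraction alone would admit constants.\<close>

definition pforms :: "nat \<Rightarrow> nat \<Rightarrow> 'a::comm_ring_1 mp set" where
  "pforms N n = (if n = 0 then {0} else forms N (n - 1))"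

text \<open>The degree \<open>n\<close> part of the ideal generated by \<open>L\<close> and \<open>J\<close>, for a finite set \<open>L\<close> of linear forms.\<close>

definition Lf :: "nat \<Rightarrow> 'a::comm_ring_1 set \<Rightarrow> 'a mp set \<Rightarrow> nat \<Rightarrow> 'a mp set" where
  "Lf N J L n = {F \<in> forms N n. \<exists>w. (\<forall>l\<in>L. w l \<in> pforms N n) \<and> F - (\<Sum>l\<in>L. l * w l) \<in> pcoef J}"

lemma pforms_simps:
  "0 \<in> pforms N n" "F \<in> pforms N n \<Longrightarrow> G \<in> pforms N n \<Longrightarrow> F + G \<in> pforms N n"
  "F \<in> pforms N n \<Longrightarrow> - F \<in> pforms N n" "pforms N (Suc n) = forms N n"
  unfolding pforms_def by (auto simp: forms_add forms_neg)

lemma pforms_mult: "G \<in> forms N a \<Longrightarrow> F \<in> pforms N n \<Longrightarrow> G * F \<in> pforms N (a + n)"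
  using forms_mult[of G N a F "n - 1"] unfolding pforms_def by (cases n) (auto split: if_splits)

lemma Lf_I: "F \<in> forms N n \<Longrightarrow> (\<And>l. l \<in> L \<Longrightarrow> w l \<in> pforms N n) \<Longrightarrow> F - (\<Sum>l\<in>L. l * w l) \<in> pcoef J \<Longrightarrow> F \<in> Lf N J L n"
  unfolding Lf_def by blast

lemma Lf_forms: "F \<in> Lf N J L n \<Longrightarrow> F \<in> forms N n"
  unfolding Lf_def by blast

context
  fixes N :: nat and J :: "'a::comm_ring_1 set"
  assumes J: "idl.subspace J"
begin

lemma Lf_J: "F \<in> forms N n \<Longrightarrow> F \<in> pcoef J \<Longrightarrow> F \<in> Lf N J L n"
  unfolding Lf_def using pforms_simps(1) by (auto intro!: exI[of _ "\<lambda>_. 0"])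

lemma Lf_0: "0 \<in> Lf N J L n"
  using Lf_J pcoef_simps(1)[OF J] by simp

lemma Lf_add:
  assumes "F \<in> Lf N J L n" "G \<in> Lf N J L n"
  shows "F + G \<in> Lf N J L n"
proof -
  obtain w w' where w: "\<forall>l\<in>L. w l \<in> pforms N n" "F - (\<Sum>l\<in>L. l * w l) \<in> pcoef J"
    "\<forall>l\<in>L. w' l \<in> pforms N n" "G - (\<Sum>l\<in>L. l * w' l) \<in> pcoef J"
    using assms unfolding Lf_def by blast
  have "(F - (\<Sum>l\<in>L. l * w l)) + (G - (\<Sum>l\<in>L. l * w' l)) \<in> pcoef J" using pcoef_simps(2)[OF J w(2,4)] .
  hence "F + G - (\<Sum>l\<in>L. l * (w l + w' l)) \<in> pcoef J" by (simp add: distrib_left sum.distrib algebra_simps)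
  thus ?thesis
    by (rule Lf_I[rotated 2]) (use assms forms_add Lf_forms w pforms_simps(2) in blast)+
qed

lemma Lf_mult:
  assumes "G \<in> forms N a" "F \<in> Lf N J L n"
  shows "G * F \<in> Lf N J L (a + n)"
proof -
  obtain w where w: "\<forall>l\<in>L. w l \<in> pforms N n" "F - (\<Sum>l\<in>L. l * w l) \<in> pcoef J"
    using assms unfolding Lf_def by blast
  have "G * (F - (\<Sum>l\<in>L. l * w l)) \<in> pcoef J" using pcoef_mult(2)[OF J w(2)] .
  hence "G * F - (\<Sum>l\<in>L. l * (G * w l)) \<in> pcoef J"
    by (simp add: right_diff_distrib sum_distrib_left mult.left_commute)
  thus ?thesis
    by (rule Lf_I[rotated 2]) (use forms_mult[OF assms(1) Lf_forms[OF assms(2)]] w pforms_mult[OF assms(1)] in blast)+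
qed

lemma Lf_Cst: "F \<in> Lf N J L n \<Longrightarrow> Cst c * F \<in> Lf N J L n"
  using Lf_mult[of "Cst c" 0 F L n] by simp

lemma Lf_neg: "F \<in> Lf N J L n \<Longrightarrow> - F \<in> Lf N J L n"
  using Lf_Cst[of F L n "-1"] by simp

lemma Lf_diff: "F \<in> Lf N J L n \<Longrightarrow> G \<in> Lf N J L n \<Longrightarrow> F - G \<in> Lf N J L n"
  using Lf_add[of F L n "- G"] Lf_neg by simp

lemma Lf_sum: "(\<And>i. i \<in> A \<Longrightarrow> f i \<in> Lf N J L n) \<Longrightarrow> sum f A \<in> Lf N J L n"
  by (induction A rule: infinite_finite_induct) (auto simp: Lf_add Lf_0)

lemma Lf_gen:
  assumes "finite L" "l \<in> L" "l \<in> forms N 1" "w \<in> forms N n"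
  shows "l * w \<in> Lf N J L (Suc n)"
proof -
  have "(\<Sum>k\<in>L. k * (if k = l then w else 0)) = l * w"
    using assms(1,2) by (simp add: if_distrib[of "\<lambda>t. _ * t"] cong: if_cong)
  hence "l * w - (\<Sum>k\<in>L. k * (if k = l then w else 0)) \<in> pcoef J" using pcoef_simps(1)[OF J] by simp
  thus ?thesis
    by (rule Lf_I[rotated 2]) (use forms_mult[OF assms(3,4)] assms(4) in \<open>simp_all add: pforms_simps\<close>)
qed

lemma Lf_mono:
  assumes "finite L'" "L \<subseteq> L'" "F \<in> Lf N J L n"
  shows "F \<in> Lf N J L' n"
proof -
  obtain w where w: "\<forall>l\<in>L. w l \<in> pforms N n" "F - (\<Sum>l\<in>L. l * w l) \<in> pcoef J"
    using assms unfolding Lf_def by blast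
  have "(\<Sum>l\<in>L. l * w l) = (\<Sum>l\<in>L'. l * (if l \<in> L then w l else 0))"
    using assms(1,2) by (intro sum.mono_neutral_cong_left) auto
  hence "F - (\<Sum>l\<in>L'. l * (if l \<in> L then w l else 0)) \<in> pcoef J" using w(2) by simp
  thus ?thesis
    by (rule Lf_I[rotated 2]) (use Lf_forms[OF assms(3)] w(1) in \<open>simp_all add: pforms_simps\<close>)
qed

lemma Lf_base: "F \<in> Lf N J {} n \<longleftrightarrow> F \<in> forms N n \<and> F \<in> pcoef J"
  unfolding Lf_def by simp

lemma Lf_degree_0: "F \<in> Lf N J L 0 \<longleftrightarrow> F \<in> forms N 0 \<and> F \<in> pcoef J"
proof
  assume "F \<in> Lf N J L 0"
  then obtain w where w: "\<forall>l\<in>L. w l = 0" "F - (\<Sum>l\<in>L. l * w l) \<in> pcoef J" "F \<in> forms N 0"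
    unfolding Lf_def pforms_def by auto
  hence "(\<Sum>l\<in>L. l * w l) = 0" by (intro sum.neutral) simp
  thus "F \<in> forms N 0 \<and> F \<in> pcoef J" using w by simp
qed (use Lf_J in blast)

lemma Lf_insert:
  assumes "finite L" "l \<notin> L" "F \<in> Lf N J (insert l L) (Suc n)" "l \<in> forms N 1"
  shows "\<exists>w\<in>forms N n. F - l * w \<in> Lf N J L (Suc n)"
proof -
  obtain w where w: "\<forall>k\<in>insert l L. w k \<in> forms N n" "F - (\<Sum>k\<in>insert l L. k * w k) \<in> pcoef J"
    using assms(3) unfolding Lf_def pforms_simps by blast
  have "F - l * w l \<in> forms N (Suc n)"
    using forms_diff[OF Lf_forms[OF assms(3)]] forms_mult[OF assms(4), of "w l" n] w(1) by simp
  moreover have "F - l * w l - (\<Sum>k\<in>L. k * w k) \<in> pcoef J"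
    using w(2) assms(1,2) by (simp add: diff_diff_add)
  ultimately have "F - l * w l \<in> Lf N J L (Suc n)" unfolding Lf_def pforms_simps using w(1) by blast
  thus ?thesis using w(1) by blast
qed

lemma Lf_one:
  assumes "F \<in> Lf N J L 1"
  shows "\<exists>c. F - (\<Sum>l\<in>L. Cst (c l) * l) \<in> pcoef J"
proof -
  obtain w where w: "\<forall>l\<in>L. w l \<in> forms N 0" "F - (\<Sum>l\<in>L. l * w l) \<in> pcoef J"
    using assms unfolding Lf_def pforms_def by auto
  have "(\<Sum>l\<in>L. l * w l) = (\<Sum>l\<in>L. Cst (Poly_Mapping.lookup (w l) 0) * l)"
  proof (rule sum.cong[OF refl])
    fix l assume "l \<in> L"
    hence "w l = Cst (Poly_Mapping.lookup (w l) 0)" using w(1) forms_zero by blast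
    thus "l * w l = Cst (Poly_Mapping.lookup (w l) 0) * l" by (metis mult.commute)
  qed
  thus ?thesis using w(2) by (intro exI[of _ "\<lambda>l. Poly_Mapping.lookup (w l) 0"]) simp
qed

lemma Lf_subst:
  assumes "\<And>l. l \<in> L \<Longrightarrow> subst s l \<in> pcoef J" "F \<in> Lf N J L n"
  shows "subst s F \<in> pcoef J"
proof -
  obtain w where w: "F - (\<Sum>l\<in>L. l * w l) \<in> pcoef J" using assms unfolding Lf_def by blast
  have "subst s (F - (\<Sum>l\<in>L. l * w l)) \<in> pcoef J" by (rule subst_pcoef[OF J w])
  moreover have "subst s (\<Sum>l\<in>L. l * w l) \<in> pcoef J"
    using assms(1) pcoef_mult(1)[OF J] by (auto simp: subst_simps intro!: pcoef_sum[OF J])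
  ultimately have "subst s (F - (\<Sum>l\<in>L. l * w l)) + subst s (\<Sum>l\<in>L. l * w l) \<in> pcoef J"
    using pcoef_simps(2)[OF J] by blast
  thus ?thesis by (simp add: subst_simps)
qed

lemma Lf_ev:
  assumes "\<And>l. l \<in> L \<Longrightarrow> ev f l \<in> J" "F \<in> Lf N J L n"
  shows "ev f F \<in> J"
proof -
  obtain w where w: "F - (\<Sum>l\<in>L. l * w l) \<in> pcoef J" using assms unfolding Lf_def by blast
  have "ev f (F - (\<Sum>l\<in>L. l * w l)) \<in> J" by (rule ev_pcoef[OF J w])
  moreover have "ev f (\<Sum>l\<in>L. l * w l) \<in> J"
    using assms(1) ideal_mult_right[OF J] by (auto simp: ev_simps intro!: idl.subspace_sum[OF J])
  ultimately have "ev f (F - (\<Sum>l\<in>L. l * w l)) + ev f (\<Sum>l\<in>L. l * w l) \<in> J"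
    using idl.subspace_add[OF J] by blast
  thus ?thesis by (simp add: ev_simps)
qed

lemma kmod_Lf: "kmod d (\<lambda>k. Cst (x k)) (Lf N J L n)"
  unfolding kmod_def using Lf_0 Lf_add Lf_neg Lf_Cst by blast

end

lemma kmod_forms: "kmod d (\<lambda>k. Cst (x k)) (forms N n)"
  unfolding kmod_def using forms_0 forms_add forms_neg forms_Cst_mult by blast

lemma Lf_vars_mono: "idl.subspace J \<Longrightarrow> N \<le> N' \<Longrightarrow> F \<in> Lf N J L n \<Longrightarrow> F \<in> Lf N' J L n"
  unfolding Lf_def pforms_def using forms_mono[of _ N _ N'] by (auto split: if_splits)

lemma forms_last:
  assumes "F \<in> forms (Suc N) 1" "cf F N = 0"
  shows "F \<in> forms N 1"
proof -
  have "F = (\<Sum>i<N. Cst (cf F i) * Tv i)" using linear_form[OF assms(1)] assms(2) by simp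
  moreover have "\<dots> \<in> forms N 1" by (intro forms_sum forms_Cst_mult forms_Tv) auto
  ultimately show ?thesis by simp
qed

text \<open>The coefficients of the last variable form an ideal, which is finitely generated above
  \<open>J\<close>. Subtracting a combination of lifts of its generators leaves forms in
  \<open>N\<close> variables.\<close>

lemma linear_forms_fg:
  assumes J: "noeth J" "idl.subspace J"
  shows "M \<subseteq> forms N 1 \<Longrightarrow> (\<And>F G. F \<in> M \<Longrightarrow> G \<in> M \<Longrightarrow> F + G \<in> M) \<Longrightarrow> (\<And>F c. F \<in> M \<Longrightarrow> Cst c * F \<in> M) \<Longrightarrow>
    forms N 1 \<inter> pcoef J \<subseteq> M \<Longrightarrow> \<exists>G. finite G \<and> G \<subseteq> M \<and> (\<forall>F\<in>M. F \<in> Lf N J G 1)"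
proof (induction N arbitrary: M)
  case 0
  have "F = 0" if "F \<in> M" for F using 0(1) that linear_form[of F 0] by auto
  thus ?case using Lf_0[OF J(2)] by (intro exI[of _ "{}"]) auto
next
  case (Suc N)
  note add = Suc.prems(2) and scale = Suc.prems(3)
  have neg: "- F \<in> M" if "F \<in> M" for F using scale[OF that, of "-1"] by simp
  have TJ: "Cst j * Tv N \<in> forms (Suc N) 1 \<inter> pcoef J" if "j \<in> J" for j
    using that J(2) forms_Tv[of N "Suc N"] by (auto intro!: forms_Cst_mult pcoef_mult(1) simp: pcoef_Cst)
  have zero: "0 \<in> M" using Suc.prems(4) pcoef_simps(1)[OF J(2)] by auto
  define A where "A = (\<lambda>F. cf F N) ` M"
  have A: "idl.subspace A"
  proof (rule idl.subspaceI)
    show "0 \<in> A" unfolding A_def using zero by (intro image_eqI[of _ _ 0]) auto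
    show "a + b \<in> A" if "a \<in> A" "b \<in> A" for a b
      using that add unfolding A_def by (auto intro!: image_eqI[of _ _ "_ + _"])
    show "c * a \<in> A" if "a \<in> A" for a c
      using that scale unfolding A_def by (auto intro!: image_eqI[of _ _ "Cst c * _"])
  qed
  have JA: "J \<subseteq> A"
  proof
    fix j assume "j \<in> J"
    hence "Cst j * Tv N \<in> M" using TJ Suc.prems(4) by blast
    thus "j \<in> A" unfolding A_def by (intro image_eqI[of _ _ "Cst j * Tv N"]) auto
  qed
  obtain G0 where G0: "finite G0" "G0 \<subseteq> A" "A = idl.span (J \<union> G0)" using noeth_fg[OF J(1) A JA] .
  obtain G1 where G1: "finite G1" "G1 \<subseteq> M" "G0 = (\<lambda>F. cf F N) ` G1"
    using finite_subset_image[OF G0(1)] G0(2) unfolding A_def by metis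
  define B where "B = (\<lambda>F. cf F N) ` (M \<inter> Lf (Suc N) J G1 1)"
  have "idl.span (J \<union> G0) \<subseteq> B"
  proof (rule idl.span_minimal)
    show "idl.subspace B"
    proof (rule idl.subspaceI)
      show "0 \<in> B" unfolding B_def using zero Lf_0[OF J(2)] by (intro image_eqI[of _ _ 0]) auto
      show "a + b \<in> B" if ab: "a \<in> B" "b \<in> B" for a b
      proof -
        obtain F G where "a = cf F N" "b = cf G N" "F \<in> M \<inter> Lf (Suc N) J G1 1" "G \<in> M \<inter> Lf (Suc N) J G1 1"
          using ab unfolding B_def by blast
        thus ?thesis unfolding B_def using add Lf_add[OF J(2)] by (intro image_eqI[of _ _ "F + G"]) auto
      qed
      show "c * a \<in> B" if a: "a \<in> B" for a c
      proof -
        obtain F where "a = cf F N" "F \<in> M \<inter> Lf (Suc N) J G1 1" using a unfolding B_def by blast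
        thus ?thesis unfolding B_def using scale Lf_Cst[OF J(2)] by (intro image_eqI[of _ _ "Cst c * F"]) auto
      qed
    qed
    show "J \<union> G0 \<subseteq> B"
    proof
      fix a assume "a \<in> J \<union> G0"
      thus "a \<in> B"
      proof
        assume a: "a \<in> J"
        hence "Cst a * Tv N \<in> M \<inter> Lf (Suc N) J G1 1" using TJ[OF a] Suc.prems(4) Lf_J[OF J(2)] by blast
        thus ?thesis unfolding B_def by (intro image_eqI[of _ _ "Cst a * Tv N"]) auto
      next
        assume "a \<in> G0"
        then obtain F where F: "F \<in> G1" "a = cf F N" using G1(3) by blast
        have "F * 1 \<in> Lf (Suc N) J G1 (Suc 0)"
          by (rule Lf_gen[OF J(2) G1(1) F(1)]) (use F G1(2) Suc.prems(1) forms_Cst[of 1] in auto)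
        thus ?thesis unfolding B_def using F G1(2) by auto
      qed
    qed
  qed
  hence AB: "A \<subseteq> B" using G0(3) by simp
  define M' where "M' = M \<inter> forms N 1"
  have "\<exists>G. finite G \<and> G \<subseteq> M' \<and> (\<forall>F\<in>M'. F \<in> Lf N J G 1)"
  proof (rule Suc.IH)
    show "forms N 1 \<inter> pcoef J \<subseteq> M'" unfolding M'_def using Suc.prems(4) forms_mono[of _ N 1 "Suc N"] by auto
  qed (auto simp: M'_def add scale forms_add forms_Cst_mult)
  then obtain G2 where G2: "finite G2" "G2 \<subseteq> M'" "\<forall>F\<in>M'. F \<in> Lf N J G2 1" by blast
  have "F \<in> Lf (Suc N) J (G1 \<union> G2) 1" if F: "F \<in> M" for F
  proof -
    have "cf F N \<in> B" using AB F unfolding A_def by blast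
    then obtain H where H: "H \<in> M" "H \<in> Lf (Suc N) J G1 1" "cf H N = cf F N" unfolding B_def by force
    have FH: "F - H \<in> M" using add[OF F neg[OF H(1)]] by simp
    hence "F - H \<in> forms (Suc N) 1" using Suc.prems(1) by blast
    moreover have "cf (F - H) N = 0" using H(3) by simp
    ultimately have "F - H \<in> forms N 1" by (rule forms_last)
    hence "F - H \<in> Lf N J G2 1" using FH G2(3) unfolding M'_def by blast
    hence "F - H \<in> Lf (Suc N) J G2 1" using Lf_vars_mono[OF J(2), of N "Suc N"] by simp
    hence "F - H \<in> Lf (Suc N) J (G1 \<union> G2) 1" using Lf_mono[OF J(2), of "G1 \<union> G2" G2] G1(1) G2(1) by blast
    moreover have "H \<in> Lf (Suc N) J (G1 \<union> G2) 1" using Lf_mono[OF J(2), of "G1 \<union> G2" G1] H(2) G1(1) G2(1) by blast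
    ultimately have "(F - H) + H \<in> Lf (Suc N) J (G1 \<union> G2) 1" by (rule Lf_add[OF J(2)])
    thus ?thesis by simp
  qed
  thus ?case using G1(1,2) G2(1,2) unfolding M'_def by (intro exI[of _ "G1 \<union> G2"]) auto
qed

section \<open>Linear independence and elimination modulo a prime\<close>

definition indep :: "'a::comm_ring_1 set \<Rightarrow> 'a mp set \<Rightarrow> bool" where
  "indep p L \<longleftrightarrow> (\<forall>c. (\<Sum>l\<in>L. Cst (c l) * l) \<in> pcoef p \<longrightarrow> (\<forall>l\<in>L. c l \<in> p))"

text \<open>Elimination at a prime \<open>p\<close>: modulo the forms in \<open>L\<close>, and up to the factor \<open>e\<close> outside \<open>p\<close>, the substitution \<open>s\<close>
  expresses all variables in terms of those indexed by \<open>V\<close>.\<close>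

definition solved :: "nat \<Rightarrow> 'a::comm_ring_1 set \<Rightarrow> 'a set \<Rightarrow> 'a mp set \<Rightarrow> 'a \<Rightarrow> (nat \<Rightarrow> 'a mp) \<Rightarrow> nat set \<Rightarrow> bool" where
  "solved N J p L e s V \<longleftrightarrow> e \<notin> p \<and> V \<subseteq> {..<N} \<and> card V + card L = N \<and>
     (\<forall>i<N. s i \<in> forms N 1 \<and> (\<forall>b. b \<notin> V \<longrightarrow> cf (s i) b = 0)) \<and> (\<forall>a\<in>V. s a = Cst e * Tv a) \<and>
     (\<forall>l\<in>L. subst s l \<in> pcoef J) \<and> (\<forall>i<N. Cst e * Tv i - s i \<in> Lf N J L 1)"

lemma solvedD:
  assumes "solved N J p L e s V"
  shows "e \<notin> p" "V \<subseteq> {..<N}" "card V + card L = N" "\<And>i. i < N \<Longrightarrow> s i \<in> forms N 1"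
    "\<And>i b. i < N \<Longrightarrow> b \<notin> V \<Longrightarrow> cf (s i) b = 0" "\<And>a. a \<in> V \<Longrightarrow> s a = Cst e * Tv a"
    "\<And>l. l \<in> L \<Longrightarrow> subst s l \<in> pcoef J" "\<And>i. i < N \<Longrightarrow> Cst e * Tv i - s i \<in> Lf N J L 1"
  using assms unfolding solved_def by blast+

lemma subst_linear: "F \<in> forms N 1 \<Longrightarrow> subst s F = (\<Sum>i<N. Cst (cf F i) * s i)"
  by (subst (1) linear_form[of F N]) (auto simp: subst_simps)

context
  fixes N :: nat and J p :: "'a::comm_ring_1 set"
  assumes J: "idl.subspace J" and Jp: "J \<subseteq> p" and p: "prime_id p"
begin

lemma solved_forms: "solved N J p L e s V \<Longrightarrow> F \<in> forms N n \<Longrightarrow> subst s F \<in> forms N n"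
  by (rule subst_forms) (rule solvedD(4))

text \<open>Modulo \<open>L\<close> the variable \<open>Tv i\<close>, multiplied by
  \<open>e\<close>, becomes \<open>s i\<close>, so a form of degree \<open>n\<close> costs
  \<open>n\<close> factors. The substitution is kept general because \<open>linear_type\<close> also
  inserts \<open>Cst (f j) * Tv i\<close> for \<open>Tv j\<close>.\<close>

lemma subst_cong:
  assumes sf: "\<And>i. i < N \<Longrightarrow> s i \<in> forms N 1" and sL: "\<And>i. i < N \<Longrightarrow> Cst e * Tv i - s i \<in> Lf N J L 1"
  shows "F \<in> forms N n \<Longrightarrow> Cst (e ^ n) * F - subst s F \<in> Lf N J L n"
proof (induction n arbitrary: F)
  case 0
  have "F = Cst (Poly_Mapping.lookup F 0)" using forms_zero[OF 0] .
  hence "subst s F = F" by (metis evalp_Cst rhom_Cst)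
  thus ?case using Lf_0[OF J] by simp
next
  case (Suc n)
  obtain G where G: "\<forall>i<N. G i \<in> forms N n" "F = (\<Sum>i<N. Tv i * G i)" using forms_Suc[OF Suc.prems] by blast
  have "Cst (e ^ Suc n) * (Tv i * G i) - s i * subst s (G i) \<in> Lf N J L (Suc n)" if i: "i < N" for i
  proof -
    have "Cst e * Tv i \<in> forms N 1" by (rule forms_Cst_mult[OF forms_Tv[OF i]])
    hence 1: "(Cst e * Tv i) * (Cst (e ^ n) * G i - subst s (G i)) \<in> Lf N J L (Suc n)"
      using Lf_mult[OF J _ Suc.IH, of "Cst e * Tv i" 1 "G i"] G(1) i by simp
    have "subst s (G i) \<in> forms N n" by (rule subst_forms) (use sf G(1) i in auto)
    hence 2: "subst s (G i) * (Cst e * Tv i - s i) \<in> Lf N J L (Suc n)"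
      using Lf_mult[OF J _ sL[OF i], of "subst s (G i)" n] by simp
    have "(Cst e * Tv i) * (Cst (e ^ n) * G i - subst s (G i)) + subst s (G i) * (Cst e * Tv i - s i)
      = Cst (e ^ Suc n) * (Tv i * G i) - s i * subst s (G i)"
      by (simp add: algebra_simps)
    thus ?thesis using Lf_add[OF J 1 2] by simp
  qed
  hence "(\<Sum>i<N. Cst (e ^ Suc n) * (Tv i * G i) - s i * subst s (G i)) \<in> Lf N J L (Suc n)"
    by (intro Lf_sum[OF J]) auto
  moreover have "(\<Sum>i<N. Cst (e ^ Suc n) * (Tv i * G i) - s i * subst s (G i)) = Cst (e ^ Suc n) * F - subst s F"
    unfolding G(2) by (simp add: subst_simps sum_subtractf sum_distrib_left)
  ultimately show ?case by simp
qed

lemma solved_cong: "solved N J p L e s V \<Longrightarrow> F \<in> forms N n \<Longrightarrow> Cst (e ^ n) * F - subst s F \<in> Lf N J L n"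
  by (rule subst_cong) (rule solvedD(4) solvedD(8), assumption+)+

text \<open>Together with \<open>Lf_subst\<close> this shows that at \<open>p\<close> the ideal of
  \<open>L\<close> is the kernel of the substitution: modulo \<open>L\<close> there remains,
  locally, a polynomial ring in the variables \<open>V\<close>.\<close>

lemma solved_zero:
  assumes s: "solved N J p L e s V" and F: "F \<in> forms N n" "subst s F \<in> pcoef J"
  shows "Cst (e ^ n) * F \<in> Lf N J L n"
proof -
  have "subst s F \<in> Lf N J L n" using Lf_J[OF J solved_forms[OF s F(1)] F(2)] .
  thus ?thesis using Lf_add[OF J solved_cong[OF s F(1)]] by fastforce
qed

lemma solved_vars:
  assumes s: "solved N J p L e s V" and F: "F \<in> forms N 1" and b: "b \<notin> V"
  shows "cf (subst s F) b = 0"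
  unfolding subst_linear[OF F] using solvedD(5)[OF s _ b] by (simp add: cf_sum)

lemma solved_empty: "solved N J p {} 1 Tv {..<N}"
  unfolding solved_def using prime_idD(2)[OF p] forms_Tv Lf_0[OF J] by auto

lemma solved_insert:
  assumes s: "solved N J p L e s V" and L: "finite L" "L \<subseteq> forms N 1" and l: "l \<in> forms N 1" "l \<notin> L"
    and a: "cf (subst s l) a \<notin> p"
  shows "\<exists>e s V. solved N J p (insert l L) e s V"
proof -
  note sD = solvedD[OF s]
  define S where "S = subst s l"
  define c where "c = cf S a"
  have p0: "0 \<in> p" using idl.subspace_0[OF prime_idD(1)[OF p]] .
  have aV: "a \<in> V" using a solved_vars[OF s l(1)] p0 by metis
  have Sf: "S \<in> forms N 1" unfolding S_def using solved_forms[OF s l(1)] .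
  \<comment> \<open>Fraction-free Gauss elimination with pivot \<open>c\<close> in the column of
    \<open>a\<close>: the other substitutions are multiplied by \<open>c\<close> instead of dividing
    \<open>S\<close> by it.\<close>
  define t where "t i = Cst c * s i - Cst (cf (s i) a) * S" for i
  have tl: "subst t k = Cst c * subst s k - Cst (cf (subst s k) a) * S" if k: "k \<in> forms N 1" for k
  proof -
    have "subst t k = (\<Sum>i<N. Cst c * (Cst (cf k i) * s i) - Cst (cf k i * cf (s i) a) * S)"
      unfolding subst_linear[OF k] t_def by (simp add: algebra_simps)
    thus ?thesis unfolding subst_linear[OF k]
      by (simp add: cf_sum Cst_sum sum_distrib_left sum_distrib_right sum_subtractf)
  qed
  have S_Lf: "S \<in> Lf N J (insert l L) 1"
  proof -
    have "Cst e * l - S \<in> Lf N J (insert l L) 1"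
      using Lf_mono[OF J, of "insert l L" L] solved_cong[OF s l(1)] L(1) unfolding S_def by auto
    moreover have "Cst e * l \<in> Lf N J (insert l L) 1"
      using Lf_gen[OF J, of "insert l L" l N "Cst e" 0] L(1) l(1) by (simp add: mult.commute)
    ultimately have "Cst e * l - (Cst e * l - S) \<in> Lf N J (insert l L) 1" using Lf_diff[OF J] by blast
    thus ?thesis by simp
  qed
  have "solved N J p (insert l L) (c * e) t (V - {a})"
    unfolding solved_def
  proof (intro conjI allI impI ballI)
    show "c * e \<notin> p" using prime_idD(4)[OF p] a sD(1) unfolding c_def S_def by blast
    show "V - {a} \<subseteq> {..<N}" using sD(2) by blast
    have "finite V" using sD(2) finite_subset by blast
    hence "Suc (card (V - {a})) = card V" using aV by (metis card.remove)
    thus "card (V - {a}) + card (insert l L) = N" using sD(3) L(1) l(2) by simp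
    show "t i \<in> forms N 1" if "i < N" for i
      unfolding t_def using sD(4)[OF that] Sf by (intro forms_diff forms_Cst_mult)
    show "cf (t i) b = 0" if i: "i < N" and b: "b \<notin> V - {a}" for i b
    proof (cases "b = a")
      case True
      thus ?thesis unfolding t_def c_def by simp
    next
      case False
      hence "b \<notin> V" using b by blast
      thus ?thesis unfolding t_def S_def using sD(5)[OF i] solved_vars[OF s l(1)] by simp
    qed
    show "t b = Cst (c * e) * Tv b" if b: "b \<in> V - {a}" for b
      unfolding t_def using sD(6)[of b] b by (simp add: mult.assoc)
    show "subst t k \<in> pcoef J" if k: "k \<in> insert l L" for k
    proof (cases "k = l")
      case True
      show ?thesis unfolding True tl[OF l(1)] using pcoef_simps(1)[OF J] by (simp add: S_def[symmetric] c_def)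
    next
      case False
      hence kL: "k \<in> L" using k by blast
      have "cf (subst s k) a \<in> J" using sD(7)[OF kL] unfolding pcoef_def cf_def by blast
      hence "Cst (cf (subst s k) a) * S \<in> pcoef J" using pcoef_mult(1)[OF J] pcoef_Cst[OF J] by blast
      moreover have "Cst c * subst s k \<in> pcoef J" using pcoef_mult(2)[OF J sD(7)[OF kL]] .
      moreover have "k \<in> forms N 1" using L(2) kL by blast
      ultimately show ?thesis using tl pcoef_simps(3)[OF J] by simp
    qed
    show "Cst (c * e) * Tv i - t i \<in> Lf N J (insert l L) 1" if i: "i < N" for i
    proof -
      have "Cst c * (Cst e * Tv i - s i) + Cst (cf (s i) a) * S \<in> Lf N J (insert l L) 1"
        using Lf_mono[OF J, of "insert l L" L] sD(8)[OF i] L(1) S_Lf by (intro Lf_add[OF J] Lf_Cst[OF J]) auto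
      thus ?thesis unfolding t_def by (simp add: algebra_simps)
    qed
  qed
  thus ?thesis by blast
qed

lemma indep_subset:
  assumes "finite L" "indep p (insert l L)" "l \<notin> L"
  shows "indep p L"
  unfolding indep_def
proof (intro allI impI)
  fix c assume c: "(\<Sum>l\<in>L. Cst (c l) * l) \<in> pcoef p"
  define c' where "c' k = (if k = l then 0 else c k)" for k
  have "(\<Sum>k\<in>L. Cst (c' k) * k) = (\<Sum>k\<in>L. Cst (c k) * k)" using assms(3) by (intro sum.cong) (auto simp: c'_def)
  hence "(\<Sum>k\<in>insert l L. Cst (c' k) * k) \<in> pcoef p" using c assms(1,3) by (simp add: c'_def)
  hence "\<forall>k\<in>insert l L. c' k \<in> p" using assms(2) unfolding indep_def by blast
  thus "\<forall>l\<in>L. c l \<in> p" using assms(3) unfolding c'_def by (metis insertCI)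
qed

text \<open>If \<open>S\<close> vanished modulo \<open>p\<close>, then \<open>Cst e * l\<close>
  would be a combination of \<open>L\<close> modulo \<open>p\<close>, a relation whose coefficient
  \<open>e\<close> is outside \<open>p\<close>.\<close>

lemma indep_not_solved:
  assumes L: "finite L" and ind: "indep p (insert l L)" "l \<notin> L" and e: "e \<notin> p"
    and S: "Cst e * l - S \<in> Lf N J L 1"
  shows "S \<notin> pcoef p"
proof
  assume Sp: "S \<in> pcoef p"
  have pI: "idl.subspace p" using prime_idD(1)[OF p] .
  obtain c where c: "Cst e * l - S - (\<Sum>k\<in>L. Cst (c k) * k) \<in> pcoef J" using Lf_one[OF J S] by blast
  hence "(Cst e * l - S - (\<Sum>k\<in>L. Cst (c k) * k)) + S \<in> pcoef p"
    using pcoef_simps(2)[OF pI _ Sp] pcoef_mono[OF Jp] by blast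
  hence cp: "Cst e * l - (\<Sum>k\<in>L. Cst (c k) * k) \<in> pcoef p" by (simp add: algebra_simps)
  define c' where "c' k = (if k = l then e else - c k)" for k
  have "(\<Sum>k\<in>L. Cst (c' k) * k) = - (\<Sum>k\<in>L. Cst (c k) * k)"
    unfolding sum_negf[symmetric] using ind(2) by (intro sum.cong) (auto simp: c'_def)
  hence "(\<Sum>k\<in>insert l L. Cst (c' k) * k) \<in> pcoef p" using cp L ind(2) by (simp add: c'_def)
  hence "c' l \<in> p" using ind(1) unfolding indep_def by blast
  thus False using e unfolding c'_def by simp
qed

lemma indep_solved:
  assumes "finite L" "L \<subseteq> forms N 1" "indep p L"
  shows "\<exists>e s V. solved N J p L e s V"
  using assms
proof (induction L rule: finite_induct)
  case empty
  thus ?case using solved_empty by blast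
next
  case (insert l L)
  obtain e s V where s: "solved N J p L e s V"
    using insert.IH indep_subset[OF insert.hyps(1) insert.prems(2) insert.hyps(2)] insert.prems(1) by blast
  have lf: "l \<in> forms N 1" using insert.prems(1) by blast
  have "Cst e * l - subst s l \<in> Lf N J L 1" using solved_cong[OF s lf] by simp
  hence "subst s l \<notin> pcoef p"
    using indep_not_solved[OF insert.hyps(1) insert.prems(2) insert.hyps(2) solvedD(1)[OF s]] by blast
  then obtain a where "cf (subst s l) a \<notin> p"
    using linear_form_pcoef[OF solved_forms[OF s lf] prime_idD(1)[OF p]] by blast
  thus ?case using solved_insert[OF s insert.hyps(1) _ lf insert.hyps(2)] insert.prems(1) by blast
qed

text \<open>Substitution kills \<open>L\<close> modulo \<open>p\<close>, so a relation reduces to a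
  multiple of \<open>subst s l\<close>; the coefficient at \<open>a\<close> shows that the
  multiplier is in \<open>p\<close>.\<close>

lemma solved_indep_insert:
  assumes s: "solved N J p L e s V" and L: "finite L" "L \<subseteq> forms N 1" and l: "l \<in> forms N 1" "l \<notin> L"
    and a: "cf (subst s l) a \<notin> p" and ind: "indep p L"
  shows "indep p (insert l L)"
  unfolding indep_def
proof (intro allI impI)
  fix c assume c: "(\<Sum>k\<in>insert l L. Cst (c k) * k) \<in> pcoef p"
  have pI: "idl.subspace p" using prime_idD(1)[OF p] .
  have sum: "(\<Sum>k\<in>insert l L. Cst (c k) * k) = Cst (c l) * l + (\<Sum>k\<in>L. Cst (c k) * k)" using L(1) l(2) by simp
  have "subst s (\<Sum>k\<in>L. Cst (c k) * k) \<in> pcoef p"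
    using solvedD(7)[OF s] pcoef_mono[OF Jp] by (auto simp: subst_simps intro!: pcoef_sum[OF pI] pcoef_mult(2)[OF pI])
  moreover have "subst s (Cst (c l) * l + (\<Sum>k\<in>L. Cst (c k) * k)) \<in> pcoef p"
    using subst_pcoef[OF pI c[unfolded sum]] .
  ultimately have "subst s (Cst (c l) * l + (\<Sum>k\<in>L. Cst (c k) * k)) - subst s (\<Sum>k\<in>L. Cst (c k) * k) \<in> pcoef p"
    using pcoef_simps(3)[OF pI] by blast
  hence "Cst (c l) * subst s l \<in> pcoef p" by (simp add: subst_simps)
  hence "cf (Cst (c l) * subst s l) a \<in> p" unfolding pcoef_def cf_def by blast
  hence cl: "c l \<in> p" using prime_idD(3)[OF p, of "c l"] a by auto
  have "Cst (c l) * l \<in> pcoef p" using cl by (intro pcoef_mult(1)[OF pI]) (simp add: pcoef_Cst[OF pI])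
  hence "(Cst (c l) * l + (\<Sum>k\<in>L. Cst (c k) * k)) - Cst (c l) * l \<in> pcoef p"
    using pcoef_simps(3)[OF pI c[unfolded sum]] by blast
  hence "(\<Sum>k\<in>L. Cst (c k) * k) \<in> pcoef p" by simp
  thus "\<forall>k\<in>insert l L. c k \<in> p" using ind cl unfolding indep_def by blast
qed

end

text \<open>Forms of fixed degree are a free module over the quotient by \<open>J\<close>, so a
  regular sequence stays regular on them, coefficient by coefficient.\<close>

lemma kexact_forms:
  "idl.subspace J \<Longrightarrow> rseq J ys \<Longrightarrow> set ys \<subseteq> idl.span (J \<union> x ` {..<d}) \<Longrightarrow> i + length ys > d \<Longrightarrow>
    kexact d (\<lambda>k. Cst (x k)) (forms N n) (forms N n \<inter> pcoef J) i"
proof (induction ys arbitrary: J i)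
  case Nil
  thus ?case by (simp add: kexact_large)
next
  case (Cons y ys)
  note J = Cons.prems(1)
  obtain e where e: "(\<Sum>k<d. x k * e k) - y \<in> J" using span_linear_combination[OF J, of y x d] Cons.prems(3) by auto
  have mono: "idl.span (J \<union> x ` {..<d}) \<subseteq> idl.span (idl.span (insert y J) \<union> x ` {..<d})"
    using idl.span_superset[of "insert y J"] by (intro idl.span_mono) blast
  have ysp: "J \<subseteq> idl.span (insert y J)" "y \<in> idl.span (insert y J)" using idl.span_superset by blast+
  show ?case
  proof (rule kexact_lift[where e = "\<lambda>k. Cst (e k)" and y = "Cst y"])
    show "kmod d (\<lambda>k. Cst (x k)) (forms N n)" by (rule kmod_forms)
    show "kmod d (\<lambda>k. Cst (x k)) (forms N n \<inter> pcoef J)"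
      unfolding kmod_def using forms_add forms_neg forms_Cst_mult pcoef_simps[OF J] pcoef_mult(2)[OF J] by auto
    show "((\<Sum>k<d. Cst (x k) * Cst (e k)) - Cst y) * u \<in> forms N n \<inter> pcoef J" if u: "u \<in> forms N n" for u
    proof -
      have eq: "(\<Sum>k<d. Cst (x k) * Cst (e k)) - Cst y = Cst ((\<Sum>k<d. x k * e k) - y)" by (simp add: Cst_sum)
      have "Cst ((\<Sum>k<d. x k * e k) - y) \<in> pcoef J" using e pcoef_Cst[OF J] by blast
      thus ?thesis unfolding eq using forms_Cst_mult[OF u] pcoef_mult(1)[OF J] by blast
    qed
    show "u \<in> forms N n \<inter> pcoef J" if "u \<in> forms N n" "Cst y * u \<in> forms N n \<inter> pcoef J" for u
      using that Cons.prems(2) unfolding pcoef_def by (auto simp: lookup_Cst_mult)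
    show "\<exists>u\<in>forms N n. z - Cst y * u \<in> forms N n \<inter> pcoef J" if z: "z \<in> forms N n \<inter> pcoef (idl.span (insert y J))" for z
      using pcoef_lift[OF J, of z N n y] z forms_diff forms_Cst_mult by blast
    show "z \<in> forms N n \<inter> pcoef (idl.span (insert y J))" if u: "u \<in> forms N n" and z: "z - Cst y * u \<in> forms N n \<inter> pcoef J" for u z
    proof -
      have "(z - Cst y * u) + Cst y * u \<in> forms N n" using z u by (intro forms_add forms_Cst_mult) auto
      moreover have "(z - Cst y * u) + Cst y * u \<in> pcoef (idl.span (insert y J))"
        using z pcoef_mono[OF ysp(1)] ysp(2)
        by (intro pcoef_simps(2) pcoef_mult(1)) (auto simp: pcoef_Cst)
      ultimately show ?thesis by simp
    qed
    show "kexact d (\<lambda>k. Cst (x k)) (forms N n) (forms N n \<inter> pcoef (idl.span (insert y J))) (Suc i)"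
      by (rule Cons.IH) (use Cons.prems mono in auto)
  qed (use forms_Cst_mult pcoef_mult(2)[OF J] in auto)
qed

lemma kd_ev: "ev f (kd d (\<lambda>k. Cst (x k)) u A) = kd d x (\<lambda>A. ev f (u A)) A"
  unfolding kd_def ksgn_def by (simp add: ev_simps ev_power evalp_Cst[of "\<lambda>c. c" f 1, simplified])

section \<open>Syzygies of the generators\<close>

lemma forms_one [simp]: "1 \<in> forms N 0"
  using forms_Cst[of 1 N] by simp

lemma Lf_member: "idl.subspace J \<Longrightarrow> finite L \<Longrightarrow> l \<in> L \<Longrightarrow> l \<in> forms N 1 \<Longrightarrow> l \<in> Lf N J L 1"
  using Lf_gen[of J L l N 1 0] by simp

lemma kmod_pcoef: "idl.subspace J \<Longrightarrow> kmod d x (pcoef J)"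
  unfolding kmod_def by (intro conjI ballI allI impI pcoef_simps pcoef_mult(2))

lemma ev_linear: "F \<in> forms N 1 \<Longrightarrow> ev f F = (\<Sum>i<N. cf F i * f i)"
  by (subst (1) linear_form[of F N]) (auto simp: ev_simps)

lemma linear_comb_forms: "(\<Sum>i<N. Cst (c i) * Tv i) \<in> forms N 1"
  by (intro forms_sum forms_Cst_mult forms_Tv) auto

lemma cf_linear_comb: "j < N \<Longrightarrow> cf (\<Sum>i<N. Cst (c i) * Tv i) j = c j"
  by (simp add: cf_sum if_distrib[of "\<lambda>t. _ * t"] cong: if_cong)

lemma mp_module: "Modules.module (\<lambda>c F. Cst c * (F :: 'a::comm_ring_1 mp))"
  by unfold_locales (simp_all add: algebra_simps)

locale height_two_gens = cm_height_two J m d x I for J m :: "'a::comm_ring_1 set" and d x I +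
  fixes f :: "nat \<Rightarrow> 'a"
  assumes gens: "I = idl.span (J \<union> f ` {..<d})"
    and minimal: "\<And>i. i < d \<Longrightarrow> f i \<notin> idl.span (J \<union> f ` ({..<d} - {i}))"
begin

abbreviation xC where "xC \<equiv> (\<lambda>k. Cst (x k))"

lemma f_I: "i < d \<Longrightarrow> f i \<in> I"
  unfolding gens by (intro idl.span_base) auto

definition Syz :: "'a mp set" where "Syz = {F \<in> forms d 1. ev f F \<in> J}"

lemma Syz_simps:
  "F \<in> Syz \<Longrightarrow> G \<in> Syz \<Longrightarrow> F + G \<in> Syz" "F \<in> Syz \<Longrightarrow> Cst c * F \<in> Syz" "forms d 1 \<inter> pcoef J \<subseteq> Syz" "Syz \<subseteq> forms d 1"
  "F \<in> Syz \<Longrightarrow> - F \<in> Syz"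
  unfolding Syz_def
  using forms_add forms_Cst_mult forms_neg idl.subspace_add[OF J_ideal] idl.subspace_scale[OF J_ideal] idl.subspace_neg[OF J_ideal]
    ev_pcoef[OF J_ideal]
  by (auto simp: ev_simps)

lemma Syz_sum: "(\<And>i. i \<in> A \<Longrightarrow> h i \<in> Syz) \<Longrightarrow> sum h A \<in> Syz"
  using Syz_simps(3) pcoef_simps(1)[OF J_ideal] by (induction A rule: infinite_finite_induct) (auto simp: Syz_simps(1))

text \<open>A coefficient outside \<open>m\<close> is a unit modulo \<open>J\<close> and would make
  the corresponding generator redundant.\<close>

lemma Syz_coeffs:
  assumes F: "F \<in> Syz"
  shows "F \<in> pcoef m"
proof -
  have Ff: "F \<in> forms d 1" and FJ: "ev f F \<in> J" using F unfolding Syz_def by blast+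
  have "cf F i \<in> m" if i: "i < d" for i
  proof (rule ccontr)
    assume "cf F i \<notin> m"
    then obtain u where u: "cf F i * u - 1 \<in> J" using m_unit by blast
    let ?S = "idl.span (J \<union> f ` ({..<d} - {i}))"
    have JS: "J \<subseteq> ?S" using idl.span_superset by blast
    have "ev f F = cf F i * f i + (\<Sum>j\<in>{..<d} - {i}. cf F j * f j)"
      unfolding ev_linear[OF Ff] using i by (simp add: sum.remove)
    moreover have "(\<Sum>j\<in>{..<d} - {i}. cf F j * f j) \<in> ?S"
      by (intro idl.span_sum idl.span_scale idl.span_base) auto
    ultimately have "cf F i * f i \<in> ?S"
      using idl.span_diff[of "ev f F" _ "\<Sum>j\<in>{..<d} - {i}. cf F j * f j"] FJ JS by auto
    hence "f i \<in> ?S" using local_unit_ideal[OF idl.subspace_span JS u] by blast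
    thus False using minimal[OF i] by blast
  qed
  thus ?thesis using linear_form_pcoef[OF Ff prime_idD(1)[OF m_prime]] by blast
qed

lemma ideal_lift: "a \<in> I \<Longrightarrow> \<exists>V\<in>forms d 1. ev f V - a \<in> J"
proof -
  assume "a \<in> I"
  then obtain c where c: "(\<Sum>k<d. f k * c k) - a \<in> J" using span_linear_combination[OF J_ideal, of a f d] gens by blast
  have "ev f (\<Sum>k<d. Cst (c k) * Tv k) = (\<Sum>k<d. f k * c k)" by (simp add: ev_simps mult.commute)
  thus ?thesis using c linear_comb_forms[of c d] by metis
qed

lemma kexact_forms_J: "i \<ge> 1 \<Longrightarrow> kexact d xC (forms N n) (forms N n \<inter> pcoef J) i"
  by (rule kexact_forms[OF J_ideal rseq_J]) (auto intro: idl.span_base)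

text \<open>Depth counting along \<open>0 \<rightarrow> Syz \<rightarrow> R\<^sup>d \<rightarrow> R \<rightarrow> R/I \<rightarrow> 0\<close>.\<close>

lemma kexact_Syz: "kexact d xC Syz (forms d 1 \<inter> pcoef J) 1"
proof (rule kexactI)
  fix w assume wS: "\<And>A. A \<subseteq> {..<d} \<Longrightarrow> card A = 1 \<Longrightarrow> w A \<in> Syz"
    and wJ: "\<And>A. A \<subseteq> {..<d} \<Longrightarrow> Suc (card A) = 1 \<Longrightarrow> kd d xC w A \<in> forms d 1 \<inter> pcoef J"
  have wf: "w A \<in> forms d 1" if "A \<subseteq> {..<d}" "card A = 1" for A using wS[OF that] Syz_simps(4) by blast
  from kexactD[OF kexact_forms_J[of 1 d 1] wf wJ]
  obtain u where u: "\<And>A. A \<subseteq> {..<d} \<Longrightarrow> card A = Suc 1 \<Longrightarrow> u A \<in> forms d 1"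
     "\<And>A. A \<subseteq> {..<d} \<Longrightarrow> card A = 1 \<Longrightarrow> w A - kd d xC u A \<in> forms d 1 \<inter> pcoef J" by auto
  define v where "v A = ev f (u A)" for A
  have vJ: "kd d x v A \<in> J" if A: "A \<subseteq> {..<d}" "Suc (card A) = 2" for A
  proof -
    have cA: "card A = 1" using A(2) by simp
    have "ev f (w A - kd d xC u A) \<in> J" using ev_pcoef[OF J_ideal] u(2)[OF A(1) cA] by blast
    moreover have "ev f (w A) \<in> J" using wS[OF A(1) cA] unfolding Syz_def by blast
    ultimately have "ev f (w A) - ev f (w A - kd d xC u A) \<in> J" using idl.subspace_diff[OF J_ideal] by blast
    thus ?thesis unfolding v_def by (simp add: ev_simps kd_ev)
  qed
  have vI: "v A \<in> I" if A: "A \<subseteq> {..<d}" "card A = 2" for A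
    unfolding v_def using ev_ideal[OF I_ideal, of d f "u A" 0] f_I u(1) A by simp
  have "kexact d x UNIV J 2" using kdepth_J unfolding kdepth_def by simp
  from kexactD[OF this _ vJ]
  obtain t where t: "\<And>A. A \<subseteq> {..<d} \<Longrightarrow> card A = 2 \<Longrightarrow> v A - kd d x t A \<in> J" by auto
  have tI: "kd d x t A \<in> I" if A: "A \<subseteq> {..<d}" "Suc (card A) = 3" for A
  proof -
    have cA: "card A = 2" using A(2) by simp
    have "v A - (v A - kd d x t A) \<in> I"
      using idl.subspace_diff[OF I_ideal vI[OF A(1) cA]] t[OF A(1) cA] J_I by blast
    thus ?thesis by simp
  qed
  \<comment> \<open>Depth \<open>d - 2\<close> of the quotient by \<open>I\<close> means that its
    homology vanishes from degree 3 on.\<close>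
  have "kexact d x UNIV I 3" using kdepth_I d3 unfolding kdepth_def by simp
  from kexactD[OF this _ tI]
  obtain q where q: "\<And>A. A \<subseteq> {..<d} \<Longrightarrow> card A = 3 \<Longrightarrow> t A - kd d x q A \<in> I" by auto
  have "\<exists>V. A \<subseteq> {..<d} \<and> card A = 3 \<longrightarrow> V \<in> forms d 1 \<and> ev f V - (t A - kd d x q A) \<in> J" for A
    using ideal_lift[OF q[of A]] by blast
  then obtain V where V: "\<And>A. A \<subseteq> {..<d} \<Longrightarrow> card A = 3 \<Longrightarrow> V A \<in> forms d 1"
     "\<And>A. A \<subseteq> {..<d} \<Longrightarrow> card A = 3 \<Longrightarrow> ev f (V A) - (t A - kd d x q A) \<in> J" by metis
  \<comment> \<open>Modulo \<open>J\<close>, \<open>v\<close> is the boundary of \<open>t\<close>,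
    and \<open>V\<close> lifts \<open>t\<close> to forms up to a boundary. Subtracting the boundary
    of \<open>V\<close> therefore makes the values of \<open>u\<close> vanish and leaves the
    boundary of \<open>u\<close> as it was.\<close>
  define u' where "u' A = u A - kd d xC V A" for A
  have "u' A \<in> Syz" if A: "A \<subseteq> {..<d}" "card A = Suc 1" for A
  proof -
    have cA: "card A = 2" using A(2) by simp
    have "kd d xC V A \<in> forms d 1" by (rule kd_in[OF kmod_forms A(1)]) (use V(1) cA in auto)
    hence 1: "u' A \<in> forms d 1" unfolding u'_def using u(1)[OF A] forms_diff by blast
    have "kd d x (\<lambda>A. ev f (V A) - (t A - kd d x q A)) A \<in> J"
      by (rule kd_in[OF kmod_ideal[OF J_ideal] A(1)]) (use V(2) cA in auto)
    hence "kd d x (\<lambda>A. ev f (V A)) A - kd d x t A \<in> J" by (simp add: kd_diff kd_kd[OF A(1)])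
    hence "(v A - kd d x t A) - (kd d x (\<lambda>A. ev f (V A)) A - kd d x t A) \<in> J"
      by (rule idl.subspace_diff[OF J_ideal t[OF A(1) cA]])
    hence "ev f (u' A) \<in> J" unfolding u'_def v_def by (simp add: ev_simps kd_ev)
    thus ?thesis using 1 unfolding Syz_def by blast
  qed
  moreover have "w A - kd d xC u' A \<in> forms d 1 \<inter> pcoef J" if A: "A \<subseteq> {..<d}" "card A = 1" for A
    using u(2)[OF A] unfolding u'_def by (simp add: kd_diff kd_kd[OF A(1)])
  ultimately show "\<exists>u. (\<forall>A. A \<subseteq> {..<d} \<and> card A = Suc 1 \<longrightarrow> u A \<in> Syz) \<and>
        (\<forall>A. A \<subseteq> {..<d} \<and> card A = 1 \<longrightarrow> w A - kd d xC u A \<in> forms d 1 \<inter> pcoef J)" by blast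
qed

definition syz_gen :: "'a mp set \<Rightarrow> bool" where
  "syz_gen L \<longleftrightarrow> finite L \<and> L \<subseteq> Syz \<and> (\<forall>F\<in>Syz. F \<in> Lf d J L 1)"

lemma syz_gen_minimal: "\<exists>L. syz_gen L \<and> (\<forall>L'. syz_gen L' \<longrightarrow> card L \<le> card L')"
proof -
  have "\<exists>G. finite G \<and> G \<subseteq> Syz \<and> (\<forall>F\<in>Syz. F \<in> Lf d J G 1)"
    by (rule linear_forms_fg[OF J_noeth J_ideal]) (use Syz_simps in auto)
  hence "\<exists>L. syz_gen L" unfolding syz_gen_def .
  thus ?thesis using ex_has_least_nat[of syz_gen _ card] by blast
qed

text \<open>A coefficient outside \<open>m\<close> is a unit and would allow \<open>l0\<close> to be
  dropped from the generating set.\<close>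

lemma relation_in_m:
  assumes L: "syz_gen L" "\<And>L'. syz_gen L' \<Longrightarrow> card L \<le> card L'"
    and c: "(\<Sum>l\<in>L. Cst (c l) * l) \<in> pcoef J" and l0: "l0 \<in> L"
  shows "c l0 \<in> m"
proof (rule ccontr)
  assume "c l0 \<notin> m"
  then obtain u where u: "c l0 * u - 1 \<in> J" using m_unit by blast
  have fin: "finite L" and LS: "L \<subseteq> Syz" and gen: "\<And>F. F \<in> Syz \<Longrightarrow> F \<in> Lf d J L 1"
    using L(1) unfolding syz_gen_def by blast+
  have Lf1: "L \<subseteq> forms d 1" using LS Syz_simps(4) by blast
  define L' where "L' = L - {l0}"
  have fin': "finite L'" and ins: "L = insert l0 L'" and nin: "l0 \<notin> L'" unfolding L'_def using fin l0 by auto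
  define S where "S = (\<Sum>l\<in>L. Cst (c l) * l)"
  define T where "T = (\<Sum>l\<in>L'. Cst (c l) * l)"
  have ST: "S = Cst (c l0) * l0 + T" unfolding S_def T_def ins using fin' nin by simp
  have Tl: "T \<in> Lf d J L' 1"
    unfolding T_def using Lf1 ins by (intro Lf_sum[OF J_ideal] Lf_Cst[OF J_ideal] Lf_member[OF J_ideal fin']) auto
  have l0f: "l0 \<in> forms d 1" using Lf1 l0 by blast
  have Sf: "S \<in> forms d 1" unfolding S_def using Lf1 by (intro forms_sum forms_Cst_mult) auto
  have SL: "S \<in> Lf d J L' 1" using Lf_J[OF J_ideal Sf] c unfolding S_def by blast
  have "Cst (c l0 * u - 1) * l0 \<in> Lf d J L' 1"
    using u by (intro Lf_J[OF J_ideal] forms_Cst_mult l0f pcoef_mult(1)[OF J_ideal]) (simp add: pcoef_Cst[OF J_ideal] del: Cst_simps)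
  hence "Cst u * (S - T) - Cst (c l0 * u - 1) * l0 \<in> Lf d J L' 1"
    using Lf_diff[OF J_ideal Lf_Cst[OF J_ideal Lf_diff[OF J_ideal SL Tl]]] by blast
  hence l0L: "l0 \<in> Lf d J L' 1" unfolding ST by (simp add: algebra_simps)
  have "F \<in> Lf d J L' 1" if F: "F \<in> Syz" for F
  proof -
    have "F \<in> Lf d J (insert l0 L') (Suc 0)" using gen[OF F] ins by simp
    then obtain w where w: "w \<in> forms d 0" "F - l0 * w \<in> Lf d J L' (Suc 0)"
      using Lf_insert[OF J_ideal fin' nin _ l0f] by blast
    have "w * l0 \<in> Lf d J L' (Suc 0)" using Lf_mult[OF J_ideal w(1) l0L] by simp
    hence "(F - l0 * w) + w * l0 \<in> Lf d J L' (Suc 0)" by (rule Lf_add[OF J_ideal w(2)])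
    thus ?thesis by (simp add: mult.commute)
  qed
  hence "syz_gen L'" unfolding syz_gen_def using fin' LS ins by blast
  hence "card L \<le> card L'" by (rule L(2))
  thus False unfolding ins using fin' nin by simp
qed

text \<open>Vanishing first Koszul homology is vanishing of the first Tor with the residue field.
  Here it says that every relation between minimal generators is a combination, with coefficients
  \<open>x k\<close>, of relations.\<close>

lemma relation_step:
  assumes L: "syz_gen L" "\<And>L'. syz_gen L' \<Longrightarrow> card L \<le> card L'"
    and c: "(\<Sum>l\<in>L. Cst (c l) * l) \<in> pcoef J"
  shows "\<exists>c'. (\<forall>k<d. (\<Sum>l\<in>L. Cst (c' k l) * l) \<in> pcoef J) \<and> (\<forall>l\<in>L. (\<Sum>k<d. x k * c' k l) - c l \<in> J)"
proof -
  have fin: "finite L" and LS: "L \<subseteq> Syz" and gen: "\<And>F. F \<in> Syz \<Longrightarrow> F \<in> Lf d J L 1"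
    using L(1) unfolding syz_gen_def by blast+
  have Lf1: "L \<subseteq> forms d 1" using LS Syz_simps(4) by blast
  have "\<exists>e. l \<in> L \<longrightarrow> (\<Sum>k<d. x k * e k) - c l \<in> J" for l
  proof (cases "l \<in> L")
    case True
    have "c l \<in> idl.span (J \<union> x ` {..<d})" using relation_in_m[OF L c True] m_gen by simp
    thus ?thesis using span_linear_combination[OF J_ideal] by blast
  qed simp
  then obtain e where e: "\<And>l. l \<in> L \<Longrightarrow> (\<Sum>k<d. x k * e l k) - c l \<in> J" by metis
  define z where "z k = (\<Sum>l\<in>L. Cst (e l k) * l)" for k
  have zS: "z k \<in> Syz" for k unfolding z_def using LS by (intro Syz_sum Syz_simps(2)) auto
  \<comment> \<open>On singletons this is the 1-chain with entries \<open>z k\<close>. The relation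
    \<open>c\<close> says that it is a cycle.\<close>
  define w where "w A = (\<Sum>k\<in>A. z k)" for A
  have kw0: "kd d xC w {} = (\<Sum>k<d. xC k * z k)" unfolding kd_def w_def ksgn_def by simp
  have "(\<Sum>k<d. xC k * z k) = (\<Sum>l\<in>L. Cst (\<Sum>k<d. x k * e l k) * l)"
    unfolding z_def by (simp add: Cst_sum sum_distrib_left sum_distrib_right mult.assoc) (rule sum.swap)
  also have "\<dots> = (\<Sum>l\<in>L. Cst ((\<Sum>k<d. x k * e l k) - c l) * l) + (\<Sum>l\<in>L. Cst (c l) * l)"
    by (simp add: left_diff_distrib sum_subtractf)
  also have "\<dots> \<in> pcoef J"
  proof (rule pcoef_simps(2)[OF J_ideal _ c])
    show "(\<Sum>l\<in>L. Cst ((\<Sum>k<d. x k * e l k) - c l) * l) \<in> pcoef J"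
    proof (intro pcoef_sum[OF J_ideal] pcoef_mult(1)[OF J_ideal])
      fix l assume "l \<in> L"
      thus "Cst ((\<Sum>k<d. x k * e l k) - c l) \<in> pcoef J" using e pcoef_Cst[OF J_ideal] by blast
    qed
  qed
  finally have "kd d xC w {} \<in> pcoef J" unfolding kw0 .
  moreover have "kd d xC w {} \<in> forms d 1" unfolding kw0 using zS Syz_simps(4) by (intro forms_sum forms_Cst_mult) blast
  ultimately have wJ: "kd d xC w A \<in> forms d 1 \<inter> pcoef J" if "A \<subseteq> {..<d}" "Suc (card A) = 1" for A
    using that finite_subset[OF that(1)] by simp
  have wS: "w A \<in> Syz" if "A \<subseteq> {..<d}" "card A = 1" for A unfolding w_def by (rule Syz_sum) (rule zS)
  from kexactD[OF kexact_Syz wS wJ]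
  obtain u where u: "\<And>A. A \<subseteq> {..<d} \<Longrightarrow> card A = Suc 1 \<Longrightarrow> u A \<in> Syz"
    "\<And>A. A \<subseteq> {..<d} \<Longrightarrow> card A = 1 \<Longrightarrow> w A - kd d xC u A \<in> forms d 1 \<inter> pcoef J" by auto
  have "\<exists>q. A \<subseteq> {..<d} \<and> card A = Suc 1 \<longrightarrow> u A - (\<Sum>l\<in>L. Cst (q l) * l) \<in> pcoef J" for A
  proof (cases "A \<subseteq> {..<d} \<and> card A = Suc 1")
    case True
    thus ?thesis using Lf_one[OF J_ideal gen[OF u(1)]] by blast
  qed blast
  hence "\<exists>q. \<forall>A. A \<subseteq> {..<d} \<and> card A = Suc 1 \<longrightarrow> u A - (\<Sum>l\<in>L. Cst (q A l) * l) \<in> pcoef J"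
    by (intro choice allI)
  then obtain q where q: "\<And>A. A \<subseteq> {..<d} \<Longrightarrow> card A = Suc 1 \<Longrightarrow> u A - (\<Sum>l\<in>L. Cst (q A l) * l) \<in> pcoef J"
    by blast
  \<comment> \<open>Subtracting the boundary of the coefficient chain \<open>q\<close> turns the
    coefficients \<open>e\<close> into relations, while \<open>kd_kd\<close> keeps their combination
    with the \<open>x k\<close> equal to \<open>c\<close>.\<close>
  define c' where "c' k l = e l k - kd d x (\<lambda>A. q A l) {k}" for k l
  have kdq: "(\<Sum>l\<in>L. Cst (kd d x (\<lambda>A. q A l) A) * l) = kd d xC (\<lambda>A. \<Sum>l\<in>L. Cst (q A l) * l) A" for A
  proof -
    have ks: "Cst (ksgn i A) = ksgn i A" for i by (simp add: ksgn_def Cst_power)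
    show ?thesis unfolding kd_def
      by (simp add: Cst_sum ks sum_distrib_left sum_distrib_right mult.assoc) (rule sum.swap)
  qed
  have "(\<Sum>l\<in>L. Cst (c' k l) * l) \<in> pcoef J" if k: "k < d" for k
  proof -
    have kk: "{k} \<subseteq> {..<d}" "card {k} = 1" using k by auto
    have "kd d xC (\<lambda>A. u A - (\<Sum>l\<in>L. Cst (q A l) * l)) {k} \<in> pcoef J"
    proof (rule kd_in[OF _ kk(1)])
      show "kmod d xC (pcoef J)" by (rule kmod_pcoef[OF J_ideal])
    qed (use q in auto)
    hence "(w {k} - kd d xC u {k}) + kd d xC (\<lambda>A. u A - (\<Sum>l\<in>L. Cst (q A l) * l)) {k} \<in> pcoef J"
      using u(2)[OF kk] pcoef_simps(2)[OF J_ideal] by blast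
    hence "z k - kd d xC (\<lambda>A. \<Sum>l\<in>L. Cst (q A l) * l) {k} \<in> pcoef J" by (simp add: kd_diff w_def)
    thus ?thesis unfolding c'_def by (simp add: left_diff_distrib sum_subtractf kdq z_def)
  qed
  moreover have "(\<Sum>k<d. x k * c' k l) - c l \<in> J" if l: "l \<in> L" for l
  proof -
    have "kd d x (kd d x (\<lambda>A. q A l)) {} = 0" by (rule kd_kd) simp
    hence "(\<Sum>k<d. x k * kd d x (\<lambda>A. q A l) {k}) = 0"
      by (subst (asm) kd_def) (simp add: ksgn_def)
    thus ?thesis unfolding c'_def using e[OF l] by (simp add: right_diff_distrib sum_subtractf)
  qed
  ultimately show ?thesis by blast
qed

text \<open>The relations between minimal generators of \<open>Syz\<close> form a module \<open>M\<close> with \<open>M = m M\<close>.\<close>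

lemma syz_free:
  assumes L: "syz_gen L" "\<And>L'. syz_gen L' \<Longrightarrow> card L \<le> card L'"
  shows "indep J L"
proof -
  interpret pm: Modules.module "\<lambda>c F. Cst c * (F :: 'a mp)" by (rule mp_module)
  note pm.scale_scale [simp del]
  have fin: "finite L" using L(1) unfolding syz_gen_def by blast
  define r where "r = card L"
  obtain b where b: "bij_betw b {..<r} L" using fin unfolding r_def by (metis bij_betw_from_nat_into_finite)
  have sum_b: "(\<Sum>j<r. h (b j)) = (\<Sum>l\<in>L. h l)" for h :: "'a mp \<Rightarrow> 'a mp" using sum.reindex_bij_betw[OF b] .
  \<comment> \<open>Relations are encoded as linear forms in \<open>r\<close> variables, one for
    each generator, so that \<open>linear_forms_fg\<close> makes \<open>M\<close> finitely
    generated.\<close>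
  define M where "M = {C \<in> forms r 1. (\<Sum>j<r. Cst (cf C j) * b j) \<in> pcoef J}"
  have sub: "idl.subspace J" by (rule J_ideal)
  have "\<exists>G. finite G \<and> G \<subseteq> M \<and> (\<forall>F\<in>M. F \<in> Lf r J G 1)"
  proof (rule linear_forms_fg[OF J_noeth J_ideal])
    show "M \<subseteq> forms r 1" unfolding M_def by blast
    show "F + G \<in> M" if "F \<in> M" "G \<in> M" for F G
      using that pcoef_simps(2)[OF sub] unfolding M_def by (auto simp: forms_add distrib_right sum.distrib)
    show "Cst c * F \<in> M" if "F \<in> M" for F c
    proof -
      have F: "F \<in> forms r 1" "(\<Sum>j<r. Cst (cf F j) * b j) \<in> pcoef J" using that unfolding M_def by blast+
      have eq: "(\<Sum>j<r. Cst (cf (Cst c * F) j) * b j) = Cst c * (\<Sum>j<r. Cst (cf F j) * b j)"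
        by (simp add: sum_distrib_left mult.assoc)
      show ?thesis unfolding M_def mem_Collect_eq eq by (intro conjI forms_Cst_mult F pcoef_mult(2)[OF sub])
    qed
    show "forms r 1 \<inter> pcoef J \<subseteq> M"
    proof
      fix F assume F: "F \<in> forms r 1 \<inter> pcoef J"
      hence "\<forall>j<r. cf F j \<in> J" using linear_form_pcoef[OF _ sub] by blast
      thus "F \<in> M" using F unfolding M_def by (auto intro!: pcoef_sum[OF sub] pcoef_mult(1)[OF sub] simp: pcoef_Cst[OF sub])
    qed
  qed
  then obtain G where G: "finite G" "G \<subseteq> M" "\<And>F. F \<in> M \<Longrightarrow> F \<in> Lf r J G 1" by blast
  have pJ: "pm.subspace (pcoef J)"
    by (rule pm.subspaceI) (use pcoef_simps[OF sub] pcoef_mult(2)[OF sub] in auto)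
  have "\<exists>t. t \<notin> m \<and> (\<forall>g\<in>G. Cst t * g \<in> pcoef J)"
  proof (rule pm.nakayama[OF m_prime pJ G(1)])
    fix C assume "C \<in> G"
    hence C: "C \<in> forms r 1" "(\<Sum>j<r. Cst (cf C j) * b j) \<in> pcoef J" using G(2) unfolding M_def by blast+
    define c where "c l = cf C (inv_into {..<r} b l)" for l
    have cb: "c (b j) = cf C j" if "j < r" for j
      unfolding c_def using b that by (simp add: bij_betw_def inv_into_f_f)
    have "(\<Sum>l\<in>L. Cst (c l) * l) = (\<Sum>j<r. Cst (cf C j) * b j)"
      unfolding sum_b[symmetric] using cb by (intro sum.cong) auto
    hence "(\<Sum>l\<in>L. Cst (c l) * l) \<in> pcoef J" using C(2) by simp
    from relation_step[OF L this]
    obtain c' where "(\<forall>k<d. (\<Sum>l\<in>L. Cst (c' k l) * l) \<in> pcoef J) \<and> (\<forall>l\<in>L. (\<Sum>k<d. x k * c' k l) - c l \<in> J)"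
      by (rule exE)
    hence c': "\<And>k. k < d \<Longrightarrow> (\<Sum>l\<in>L. Cst (c' k l) * l) \<in> pcoef J"
        "\<And>l. l \<in> L \<Longrightarrow> (\<Sum>k<d. x k * c' k l) - c l \<in> J"
      by simp_all
    define D where "D k = (\<Sum>j<r. Cst (c' k (b j)) * Tv j)" for k
    have DM: "D k \<in> M" if k: "k < d" for k
    proof -
      have "(\<Sum>j<r. Cst (cf (D k) j) * b j) = (\<Sum>j<r. Cst (c' k (b j)) * b j)"
        unfolding D_def by (intro sum.cong) (auto simp: cf_linear_comb)
      also have "\<dots> = (\<Sum>l\<in>L. Cst (c' k l) * l)" by (rule sum_b)
      finally show ?thesis unfolding M_def using c'(1)[OF k] linear_comb_forms unfolding D_def by auto
    qed
    let ?M = "pm.span (pcoef J \<union> {Cst c * h | c h. c \<in> m \<and> h \<in> G})"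
    have Jm: "z \<in> ?M" if "z \<in> pcoef J" for z using that by (intro pm.span_base) blast
    have XD: "xC k * D k \<in> ?M" if k: "k < d" for k
    proof -
      obtain a where a: "D k - (\<Sum>h\<in>G. Cst (a h) * h) \<in> pcoef J" using Lf_one[OF sub G(3)[OF DM[OF k]]] by blast
      have "xC k * (D k - (\<Sum>h\<in>G. Cst (a h) * h)) \<in> ?M" by (rule Jm[OF pcoef_mult(2)[OF sub a]])
      moreover have "(\<Sum>h\<in>G. Cst (a h) * (Cst (x k) * h)) \<in> ?M"
        using x_m[OF k] by (intro pm.span_sum pm.span_scale pm.span_base) blast
      ultimately have "xC k * (D k - (\<Sum>h\<in>G. Cst (a h) * h)) + (\<Sum>h\<in>G. Cst (a h) * (Cst (x k) * h)) \<in> ?M"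
        by (rule pm.span_add)
      thus ?thesis by (simp add: right_diff_distrib sum_distrib_left mult.left_commute)
    qed
    have "(\<Sum>k<d. xC k * D k) - C \<in> pcoef J"
    proof -
      have "(\<Sum>k<d. xC k * D k) - C = (\<Sum>j<r. Cst ((\<Sum>k<d. x k * c' k (b j)) - c (b j)) * Tv j)"
      proof -
        have "(\<Sum>k<d. xC k * D k) = (\<Sum>j<r. Cst (\<Sum>k<d. x k * c' k (b j)) * Tv j)"
          unfolding D_def by (simp add: Cst_sum sum_distrib_left sum_distrib_right mult.assoc) (rule sum.swap)
        moreover have "C = (\<Sum>j<r. Cst (c (b j)) * Tv j)" using linear_form[OF C(1)] cb by simp
        ultimately show ?thesis by (simp add: left_diff_distrib sum_subtractf)
      qed
      also have "\<dots> \<in> pcoef J"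
      proof (intro pcoef_sum[OF sub] pcoef_mult(1)[OF sub])
        fix j assume "j \<in> {..<r}"
        hence "b j \<in> L" using b bij_betwE by blast
        thus "Cst ((\<Sum>k<d. x k * c' k (b j)) - c (b j)) \<in> pcoef J" using c'(2) pcoef_Cst[OF sub] by blast
      qed
      finally show ?thesis .
    qed
    hence CM: "(\<Sum>k<d. xC k * D k) - C \<in> ?M" by (rule Jm)
    have "(\<Sum>k<d. xC k * D k) \<in> ?M" using XD by (intro pm.span_sum) simp
    from pm.span_diff[OF this CM] have "Cst 1 * C \<in> ?M" by simp
    thus "\<exists>t. t \<notin> m \<and> Cst t * C \<in> ?M" using prime_idD(2)[OF m_prime] by blast
  qed
  then obtain t where t: "t \<notin> m" "\<And>g. g \<in> G \<Longrightarrow> Cst t * g \<in> pcoef J" by blast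
  have "t \<notin> J" using t(1) J_m by blast
  have GJ: "g \<in> pcoef J" if "g \<in> G" for g
    using t(2)[OF that] J_prime_mult[OF \<open>t \<notin> J\<close>] unfolding pcoef_def by (auto simp: lookup_Cst_mult)
  show ?thesis unfolding indep_def
  proof (intro allI impI ballI)
    fix c l assume c: "(\<Sum>l\<in>L. Cst (c l) * l) \<in> pcoef J" and l: "l \<in> L"
    define C where "C = (\<Sum>j<r. Cst (c (b j)) * Tv j)"
    have "(\<Sum>j<r. Cst (cf C j) * b j) = (\<Sum>j<r. Cst (c (b j)) * b j)"
      unfolding C_def by (intro sum.cong) (auto simp: cf_linear_comb)
    also have "\<dots> = (\<Sum>l\<in>L. Cst (c l) * l)" by (rule sum_b)
    finally have "C \<in> M" unfolding M_def using c linear_comb_forms unfolding C_def by auto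
    then obtain a where "C - (\<Sum>h\<in>G. Cst (a h) * h) \<in> pcoef J" using Lf_one[OF sub G(3)] by blast
    hence "(C - (\<Sum>h\<in>G. Cst (a h) * h)) + (\<Sum>h\<in>G. Cst (a h) * h) \<in> pcoef J"
      using GJ by (intro pcoef_simps(2)[OF sub] pcoef_sum[OF sub] pcoef_mult(2)[OF sub]) auto
    hence CJ: "C \<in> pcoef J" by simp
    obtain j where j: "j < r" "l = b j" using l b unfolding bij_betw_def by auto
    have "cf C j \<in> J" using CJ unfolding pcoef_def cf_def by blast
    thus "c l \<in> J" unfolding C_def using j by (simp add: cf_linear_comb)
  qed
qed

lemma f_not_J: "i < d \<Longrightarrow> f i \<notin> J"
  using minimal idl.span_superset by blast

text \<open>Elimination over the domain leaves free variables \<open>V\<close>. There is one, since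
  otherwise \<open>e * f 0\<close> would vanish. There are not two, since the Koszul syzygy of
  \<open>f a\<close> and \<open>f b\<close> would survive the substitution with coefficient
  \<open>f b * e\<close> at \<open>a\<close>.\<close>

lemma syz_rank:
  assumes L: "syz_gen L" "indep J L"
  shows "card L = d - 1"
proof -
  have fin: "finite L" and LS: "L \<subseteq> Syz" and gen: "\<And>F. F \<in> Syz \<Longrightarrow> F \<in> Lf d J L 1"
    using L(1) unfolding syz_gen_def by blast+
  have Lf1: "L \<subseteq> forms d 1" using LS Syz_simps(4) by blast
  obtain e s V where s: "solved d J J L e s V"
    using indep_solved[OF J_ideal order_refl J_prime fin Lf1 L(2)] by blast
  note sD = solvedD[OF s]
  have evL: "ev f l \<in> J" if "l \<in> L" for l using that LS unfolding Syz_def by blast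
  have "V \<noteq> {}"
  proof
    assume "V = {}"
    have d0: "0 < d" using d3 by simp
    have "s 0 = 0" using linear_form[OF sD(4)[OF d0]] sD(5)[OF d0] \<open>V = {}\<close> by simp
    hence "Cst e * Tv 0 \<in> Lf d J L 1" using sD(8)[OF d0] by simp
    hence "e * f 0 \<in> J" using Lf_ev[OF J_ideal evL] by (fastforce simp: ev_simps)
    thus False using J_prime_mult[OF sD(1)] f_not_J[OF d0] by blast
  qed
  moreover have "a = b" if ab: "a \<in> V" "b \<in> V" for a b
  proof (rule ccontr)
    assume ne: "a \<noteq> b"
    have lt: "a < d" "b < d" using ab sD(2) by auto
    define F where "F = Cst (f b) * Tv a - Cst (f a) * Tv b"
    have "F \<in> forms d 1" unfolding F_def using lt by (intro forms_diff forms_Cst_mult forms_Tv)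
    moreover have "ev f F = 0" unfolding F_def by (simp add: ev_simps mult.commute)
    ultimately have "F \<in> Syz" unfolding Syz_def using idl.subspace_0[OF J_ideal] by simp
    hence "subst s F \<in> pcoef J" using Lf_subst[OF J_ideal sD(7) gen] by blast
    hence "cf (subst s F) a \<in> J" unfolding pcoef_def cf_def by blast
    hence "f b * e \<in> J" unfolding F_def using ab ne by (simp add: subst_simps sD(6))
    hence "f b \<in> J" using J_prime_mult[OF sD(1)] by (simp add: mult.commute)
    thus False using f_not_J[OF lt(2)] by blast
  qed
  ultimately obtain a where "V = {a}" by blast
  thus ?thesis using sD(3) by simp
qed

end

section \<open>Linear type\<close>

text \<open>A sum of two matrices of rank one has vanishing 3 by 3 determinant; if it agrees with
  \<open>q\<close> times the identity modulo \<open>p\<close>, that determinant is the cube of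
  \<open>q\<close> modulo \<open>p\<close>.\<close>

lemma rank_two_determinant:
  fixes q :: "'a::comm_ring_1"
  assumes p: "idl.subspace p"
    and P: "\<And>i j. i < (3::nat) \<Longrightarrow> j < 3 \<Longrightarrow> (if i = j then q else 0) - (a i * u j + b i * v j) \<in> p"
  shows "q * q * q \<in> p"
proof -
  define P where "P i j = (if i = j then q else 0) - (a i * u j + b i * v j)" for i j :: nat
  have Pp: "P i j \<in> p" if "i < 3" "j < 3" for i j unfolding P_def using assms(2)[OF that] .
  define M where "M i j = a i * u j + b i * v j" for i j :: nat
  have det: "M 0 0 * (M 1 1 * M 2 2 - M 1 2 * M 2 1) - M 0 1 * (M 1 0 * M 2 2 - M 1 2 * M 2 0)
    + M 0 2 * (M 1 0 * M 2 1 - M 1 1 * M 2 0) = 0"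
    unfolding M_def by (simp add: algebra_simps)
  have MP: "M 0 0 = q - P 0 0" "M 1 1 = q - P 1 1" "M 2 2 = q - P 2 2" "M 0 1 = - P 0 1" "M 0 2 = - P 0 2"
     "M 1 0 = - P 1 0" "M 1 2 = - P 1 2" "M 2 0 = - P 2 0" "M 2 1 = - P 2 1"
    unfolding M_def P_def by simp_all
  have "q * q * q = ((q - P 1 1) * (q - P 2 2) - P 1 2 * P 2 1) * P 0 0 + (q * (q - P 2 2)) * P 1 1 + (q * q) * P 2 2
     + (q * P 2 1) * P 1 2 + (P 1 0 * (q - P 2 2) + P 1 2 * P 2 0) * P 0 1 + (P 1 0 * P 2 1 + (q - P 1 1) * P 2 0) * P 0 2"
    using det unfolding MP by (simp add: algebra_simps)
  also have "\<dots> \<in> p"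
    by (intro idl.subspace_add[OF p] idl.subspace_scale[OF p] Pp) auto
  finally show ?thesis .
qed

lemma pcoef_lift_gens:
  assumes J: "idl.subspace J"
  shows "F \<in> forms N n \<Longrightarrow> F \<in> pcoef (idl.span (J \<union> x ` {..<k::nat})) \<Longrightarrow>
    \<exists>B. (\<forall>i. B i \<in> forms N n) \<and> F - (\<Sum>i<k. Cst (x i) * B i) \<in> pcoef J"
proof (induction k arbitrary: F)
  case 0
  have "idl.span (J \<union> x ` {..<0}) = J" using J by simp
  hence "F \<in> pcoef J" using 0(2) by (simp only:)
  thus ?case by (intro exI[of _ "\<lambda>_. 0"]) simp
next
  case (Suc k)
  let ?K = "idl.span (J \<union> x ` {..<k})"
  have "J \<union> x ` {..<Suc k} = insert (x k) (J \<union> x ` {..<k})" by (auto simp: lessThan_Suc)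
  hence "F \<in> pcoef (idl.span (insert (x k) ?K))" using Suc.prems(2) by (simp add: span_insert_swap)
  then obtain G where G: "G \<in> forms N n" "F - Cst (x k) * G \<in> pcoef ?K"
    using pcoef_lift[OF idl.subspace_span Suc.prems(1)] by blast
  then obtain B where B: "\<And>i. B i \<in> forms N n" "(F - Cst (x k) * G) - (\<Sum>i<k. Cst (x i) * B i) \<in> pcoef J"
    using Suc.IH[of "F - Cst (x k) * G"] forms_diff[OF Suc.prems(1) forms_Cst_mult] by blast
  have "(\<Sum>i<k. Cst (x i) * (if i < k then B i else G)) = (\<Sum>i<k. Cst (x i) * B i)" by (intro sum.cong) auto
  hence "F - (\<Sum>i<Suc k. Cst (x i) * (if i < k then B i else G)) \<in> pcoef J" using B(2) by (simp add: algebra_simps)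
  thus ?case using B(1) G(1) by (intro exI[of _ "\<lambda>i. if i < k then B i else G"]) auto
qed

text \<open>The coordinates of the wedge product of the vectors \<open>B l\<close>.\<close>

fun Wd :: "('a mp \<Rightarrow> nat \<Rightarrow> 'a::comm_ring_1 mp) \<Rightarrow> 'a mp list \<Rightarrow> nat set \<Rightarrow> 'a mp" where
  "Wd B [] = (\<lambda>A. if A = {} then 1 else 0)"
| "Wd B (l # ls) = kw (B l) (Wd B ls)"

lemma card_le_one_singleton: "z \<in> Z \<Longrightarrow> finite Z \<Longrightarrow> card Z \<le> 1 \<Longrightarrow> Z = {z}"
  using card_le_Suc0_iff_eq[of Z] by auto

lemma corank_one_subset:
  assumes "A \<subseteq> {..<d::nat}" "card A = d - 1" "d > 0"
  shows "\<exists>k<d. A = {..<d} - {k} \<and> {..<d} - A = {k} \<and> insert k A = {..<d}"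
proof -
  have "card ({..<d} - A) = 1" using assms by (subst card_Diff_subset) (auto intro: finite_subset)
  then obtain k where "{..<d} - A = {k}" by (auto simp: card_1_singleton_iff)
  thus ?thesis using assms(1) by (intro exI[of _ k]) auto
qed

text \<open>The clause \<open>lci\<close> is the local complete intersection condition with
  denominators cleared: at \<open>p\<close> the ideal is generated by \<open>g1\<close> and
  \<open>g2\<close>, where \<open>g1\<close> is nonzero in the domain and \<open>g2\<close> is a
  nonzerodivisor modulo \<open>g1\<close>.\<close>

locale lci_gens = height_two_gens J m d x I f for J m :: "'a::comm_ring_1 set" and d x I f +
  fixes L :: "'a mp set"
  assumes L_gen: "syz_gen L" and L_indep: "indep J L"
    and lci: "\<And>p. prime_id p \<Longrightarrow> I \<subseteq> p \<Longrightarrow> p \<noteq> m \<Longrightarrow> \<exists>g1\<in>I. \<exists>g2\<in>I. g1 \<notin> J \<and>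
      (\<forall>a\<in>I. \<exists>s. s \<notin> p \<and> s * a \<in> idl.span (insert g2 (insert g1 J))) \<and>
      (\<forall>c. c * g2 \<in> idl.span (insert g1 J) \<longrightarrow> (\<exists>s. s \<notin> p \<and> s * c \<in> idl.span (insert g1 J)))"
begin

lemma L_finite: "finite L" and L_Syz: "L \<subseteq> Syz" and Syz_Lf: "F \<in> Syz \<Longrightarrow> F \<in> Lf d J L 1"
  using L_gen unfolding syz_gen_def by blast+

lemma L_forms: "L \<subseteq> forms d 1"
  using L_Syz Syz_simps(4) by blast

lemma L_card: "card L = d - 1"
  by (rule syz_rank[OF L_gen L_indep])

lemma L_ev: "l \<in> L \<Longrightarrow> ev f l \<in> J"
  using L_Syz unfolding Syz_def by blast

lemma two_gens:
  assumes p: "prime_id p" "p \<noteq> m" "J \<subseteq> p"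
  shows "\<exists>s g1 g2. s \<notin> p \<and> g1 \<in> I \<and> g2 \<in> I \<and> (\<forall>i<d. \<exists>a b. s * f i - (a * g1 + b * g2) \<in> J)"
proof (cases "I \<subseteq> p")
  case True
  then obtain g1 g2 where g: "g1 \<in> I" "g2 \<in> I" "\<And>a. a \<in> I \<Longrightarrow> \<exists>s. s \<notin> p \<and> s * a \<in> idl.span (insert g2 (insert g1 J))"
    using lci[OF p(1) True p(2)] by blast
  have "\<exists>s. i < d \<longrightarrow> s \<notin> p \<and> s * f i \<in> idl.span (insert g2 (insert g1 J))" for i using g(3)[OF f_I[of i]] by blast
  then obtain s where s: "\<And>i. i < d \<Longrightarrow> s i \<notin> p" "\<And>i. i < d \<Longrightarrow> s i * f i \<in> idl.span (insert g2 (insert g1 J))" by metis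
  define t where "t = (\<Prod>i<d. s i)"
  have "t \<notin> p" unfolding t_def using prime_id_prod[OF p(1), of "{..<d}" s] s(1) by simp
  moreover have "\<exists>a b. t * f i - (a * g1 + b * g2) \<in> J" if i: "i < d" for i
  proof -
    have "t = (\<Prod>j\<in>{..<d} - {i}. s j) * s i" unfolding t_def using i by (simp add: prod.remove[of "{..<d}" i] mult.commute)
    hence "t * f i \<in> idl.span (insert g2 (insert g1 J))"
      using idl.span_scale[OF s(2)[OF i], of "\<Prod>j\<in>{..<d} - {i}. s j"] by (simp add: mult.assoc)
    then obtain b where "t * f i - b * g2 \<in> idl.span (insert g1 J)" using idl.span_breakdown_eq by blast
    then obtain a where "(t * f i - b * g2) - a * g1 \<in> J" using span_insert_ideal[OF J_ideal] by blast
    moreover have "(t * f i - b * g2) - a * g1 = t * f i - (a * g1 + b * g2)" by simp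
    ultimately show ?thesis by metis
  qed
  ultimately show ?thesis using g by blast
next
  \<comment> \<open>Where \<open>I\<close> is not inside \<open>p\<close> it is locally the unit
    ideal. A generator outside \<open>p\<close> serves both as the factor and as \<open>g1\<close>,
    with \<open>g2 = 0\<close>.\<close>
  case False
  have "\<exists>i<d. f i \<notin> p"
  proof (rule ccontr)
    assume "\<not> ?thesis"
    hence "I \<subseteq> p" unfolding gens using p(3) by (intro idl.span_minimal prime_idD(1)[OF p(1)]) auto
    thus False using False by blast
  qed
  then obtain i0 where i0: "i0 < d" "f i0 \<notin> p" by blast
  have "f i0 * f i - (f i * f i0 + 0 * 0) \<in> J" for i using idl.subspace_0[OF J_ideal] by (simp add: mult.commute)
  thus ?thesis using i0 f_I[OF i0(1)] idl.subspace_0[OF I_ideal] by blast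
qed

text \<open>At a prime \<open>p \<noteq> m\<close> the ideal has two generators, so all but one of the syzygies remain independent modulo \<open>p\<close>.\<close>

lemma local_rank:
  assumes p: "prime_id p" "p \<noteq> m" "J \<subseteq> p"
  shows "\<exists>L'. L' \<subseteq> L \<and> indep p L' \<and> card (L - L') \<le> 1"
proof -
  have pI: "idl.subspace p" using prime_idD(1)[OF p(1)] .
  define Q where "Q = {L'. L' \<subseteq> L \<and> indep p L'}"
  have "finite Q" unfolding Q_def using L_finite by simp
  moreover have "{} \<in> Q" unfolding Q_def indep_def by simp
  ultimately have "Max (card ` Q) \<in> card ` Q" by (intro Max_in) auto
  then obtain L' where L': "L' \<in> Q" "card L' = Max (card ` Q)" by auto
  have max: "card L'' \<le> card L'" if "L'' \<in> Q" for L'' using L'(2) \<open>finite Q\<close> that by simp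
  have sub: "L' \<subseteq> L" "indep p L'" using L'(1) unfolding Q_def by auto
  have fin: "finite L'" using sub(1) L_finite finite_subset by blast
  have L'f: "L' \<subseteq> forms d 1" using sub L_forms by blast
  obtain e s V where s: "solved d J p L' e s V" using indep_solved[OF J_ideal p(3,1) fin L'f sub(2)] by blast
  note sD = solvedD[OF s]
  \<comment> \<open>\<open>L'\<close> has the largest possible size. A form of \<open>L\<close> that
    survives the substitution modulo \<open>p\<close> could be added to it, so none does; hence all
    syzygies die modulo \<open>p\<close>.\<close>
  have sl: "subst s l \<in> pcoef p" if l: "l \<in> L" for l
  proof (cases "l \<in> L'")
    case True
    thus ?thesis using sD(7) pcoef_mono[OF p(3)] by blast
  next
    case False
    have lf: "l \<in> forms d 1" using l L_forms by blast
    show ?thesis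
    proof (rule ccontr)
      assume "subst s l \<notin> pcoef p"
      then obtain a where "cf (subst s l) a \<notin> p"
        using linear_form_pcoef[OF solved_forms[OF J_ideal p(3,1) s lf] pI] by blast
      hence "indep p (insert l L')" using solved_indep_insert[OF J_ideal p(3,1) s fin L'f lf False] sub(2) by blast
      hence "insert l L' \<in> Q" unfolding Q_def using sub l by blast
      thus False using max[of "insert l L'"] fin False by simp
    qed
  qed
  have sSyz: "subst s F \<in> pcoef p" if F: "F \<in> Syz" for F
  proof -
    have "F \<in> Lf d p L 1" using Syz_Lf[OF F] pcoef_mono[OF p(3)] unfolding Lf_def by blast
    thus ?thesis using Lf_subst[OF pI sl] by blast
  qed
  \<comment> \<open>With three free variables, each of them is, up to a factor outside
    \<open>p\<close> and modulo syzygies, a combination of the lifts of the two local generators.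
    Comparing coefficients at the three variables modulo \<open>p\<close> writes a nonzero scalar
    matrix as a sum of two matrices of rank one.\<close>
  have "card V \<le> 2"
  proof (rule ccontr)
    assume "\<not> card V \<le> 2"
    then obtain T where T: "T \<subseteq> V" "card T = 3" using obtain_subset_with_card_n[of 3 V] by auto
    obtain h where h: "bij_betw h {..<3::nat} T" using T(2) by (metis bij_betw_from_nat_into_finite card.infinite zero_neq_numeral)
    have hV: "h i \<in> V" "h i < d" if "i < 3" for i
    proof -
      show "h i \<in> V" using bij_betwE[OF h] T(1) that by blast
      thus "h i < d" using sD(2) by blast
    qed
    have hinj: "h i = h j \<longleftrightarrow> i = j" if "i < 3" "j < 3" for i j
      using h that unfolding bij_betw_def inj_on_def by auto
    obtain t g1 g2 where g: "t \<notin> p" "g1 \<in> I" "g2 \<in> I" "\<And>i. i < d \<Longrightarrow> \<exists>a b. t * f i - (a * g1 + b * g2) \<in> J"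
      using two_gens[OF p] by blast
    obtain G1 G2 where G: "G1 \<in> forms d 1" "ev f G1 - g1 \<in> J" "G2 \<in> forms d 1" "ev f G2 - g2 \<in> J"
      using ideal_lift[OF g(2)] ideal_lift[OF g(3)] by blast
    have "\<exists>a b. i < d \<longrightarrow> t * f i - (a * g1 + b * g2) \<in> J" for i using g(4) by blast
    then obtain a b where ab: "\<And>i. i < d \<Longrightarrow> t * f i - (a i * g1 + b i * g2) \<in> J" by metis
    have evs: "e * ev f F - ev f (subst s F) \<in> J" if F: "F \<in> forms d 1" for F
    proof -
      have "Cst e * F - subst s F \<in> Lf d J L' 1" using solved_cong[OF J_ideal p(3,1) s F] by simp
      hence "ev f (Cst e * F - subst s F) \<in> J" using Lf_ev[OF J_ideal] L_ev sub(1) by blast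
      thus ?thesis by (simp add: ev_simps)
    qed
    have ss: "subst s (subst s F) = Cst e * subst s F" if F: "F \<in> forms d 1" for F
    proof -
      have sf: "subst s F \<in> forms d 1" by (rule solved_forms[OF J_ideal p(3,1) s F])
      have "subst s (subst s F) = (\<Sum>i<d. Cst e * (Cst (cf (subst s F) i) * Tv i))"
        unfolding subst_linear[OF sf]
      proof (rule sum.cong[OF refl])
        fix i show "Cst (cf (subst s F) i) * s i = Cst e * (Cst (cf (subst s F) i) * Tv i)"
          using sD(6)[of i] solved_vars[OF J_ideal p(3,1) s F, of i] by (cases "i \<in> V") (auto simp: mult_ac)
      qed
      thus ?thesis using linear_form[OF sf] by (simp add: sum_distrib_left[symmetric])
    qed
    note sc = idl.subspace_scale[OF J_ideal]
    \<comment> \<open>\<open>W i\<close> is a syzygy: its factor \<open>e\<close> accounts for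
      replacing \<open>G1\<close> and \<open>G2\<close> by their substitutions. It involves free
      variables only, so a further substitution multiplies it by \<open>e\<close>.\<close>
    define W where "W i = Cst (t * e) * Tv (h i) - (Cst (a (h i)) * subst s G1 + Cst (b (h i)) * subst s G2)" for i
    have cfp: "cf (W i) (h j) \<in> p" if ij: "i < 3" "j < 3" for i j
    proof -
      have hd: "h i < d" using hV ij by blast
      have Wf: "W i \<in> forms d 1"
        unfolding W_def using solved_forms[OF J_ideal p(3,1) s] G(1,3) hd
        by (intro forms_diff forms_add forms_Cst_mult forms_Tv)
      have "ev f (W i) \<in> J"
      proof -
        have "e * (t * f (h i) - (a (h i) * g1 + b (h i) * g2))
          - e * (a (h i) * (ev f G1 - g1)) + a (h i) * (e * ev f G1 - ev f (subst s G1))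
          - e * (b (h i) * (ev f G2 - g2)) + b (h i) * (e * ev f G2 - ev f (subst s G2)) \<in> J"
          by (rule idl.subspace_add[OF J_ideal idl.subspace_diff[OF J_ideal idl.subspace_add[OF J_ideal
              idl.subspace_diff[OF J_ideal sc[OF ab[OF hd]] sc[OF sc[OF G(2)]]] sc[OF evs[OF G(1)]]] sc[OF sc[OF G(4)]]]
              sc[OF evs[OF G(3)]]])
        thus ?thesis unfolding W_def by (simp add: ev_simps evalp_Cst[of "\<lambda>c. c"] algebra_simps)
      qed
      hence "subst s (W i) \<in> pcoef p" using Wf sSyz unfolding Syz_def by blast
      moreover have "subst s (W i) = Cst e * W i"
        unfolding W_def using ss[OF G(1)] ss[OF G(3)] sD(6)[OF hV(1)[OF ij(1)]]
        by (simp add: subst_simps algebra_simps)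
      ultimately have "cf (Cst e * W i) (h j) \<in> p" unfolding pcoef_def cf_def by simp
      thus ?thesis using prime_idD(3)[OF p(1), of e] sD(1) by auto
    qed
    have "(if i = j then t * e else 0) - (a (h i) * cf (subst s G1) (h j) + b (h i) * cf (subst s G2) (h j)) \<in> p"
      if "i < 3" "j < 3" for i j using hinj[OF that] cfp[OF that] unfolding W_def by (auto simp del: Cst_simps)
    hence "(t * e) * (t * e) * (t * e) \<in> p" by (rule rank_two_determinant[OF pI])
    thus False using prime_idD(4)[OF p(1)] g(1) sD(1) by metis
  qed
  moreover have "card (L - L') = card L - card L'" using card_Diff_subset[OF fin sub(1)] .
  ultimately have "card (L - L') \<le> 1" using sD(3) L_card by linarith
  thus ?thesis using sub by blast
qed

lemma indep_sub: "finite B \<Longrightarrow> indep p B \<Longrightarrow> A \<subseteq> B \<Longrightarrow> prime_id p \<Longrightarrow> indep p A"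
proof -
  assume B: "finite B" "indep p B" "A \<subseteq> B" "prime_id p"
  show "indep p A" unfolding indep_def
  proof (intro allI impI)
    fix c assume c: "(\<Sum>l\<in>A. Cst (c l) * l) \<in> pcoef p"
    have "(\<Sum>l\<in>B. Cst (if l \<in> A then c l else 0) * l) = (\<Sum>l\<in>A. Cst (c l) * l)"
      using B(1,3) by (intro sum.mono_neutral_cong_right) auto
    hence "\<forall>l\<in>B. (if l \<in> A then c l else 0) \<in> p" using c B(2)[unfolded indep_def, rule_format, of "\<lambda>l. if l \<in> A then c l else 0"] by simp
    thus "\<forall>l\<in>A. c l \<in> p" using B(3) by fastforce
  qed
qed

lemma subst_nonzero:
  assumes p: "prime_id p" "J \<subseteq> p" and s: "solved d J p L1 e s V" and L1: "L1 \<subseteq> L" and l: "l \<in> L" "l \<notin> L1"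
  shows "subst s l \<notin> pcoef J"
proof (rule indep_not_solved[OF J_ideal order_refl J_prime _ _ l(2)])
  have "finite L1" using L1 L_finite finite_subset by blast
  thus "finite L1" .
  show "indep J (insert l L1)" by (rule indep_sub[OF L_finite L_indep _ J_prime]) (use L1 l in blast)
  show "e \<notin> J" using solvedD(1)[OF s] p(2) by blast
  have "l \<in> forms d 1" using l L_forms by blast
  thus "Cst e * l - subst s l \<in> Lf d J L1 1" using solved_cong[OF J_ideal p(2,1) s, of l 1] by simp
qed

text \<open>After substitution the product lies in a polynomial ring over a domain, where the
  nonzero factor \<open>subst s l\<close> cancels; \<open>solved_zero\<close> leads back at the cost
  of a power of \<open>e\<close>.\<close>

lemma subst_cancel:
  assumes p: "prime_id p" "J \<subseteq> p" and s: "solved d J p L1 e s V" and L1: "L1 \<subseteq> L" and l: "l \<in> L" "l \<notin> L1"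
    and u: "u \<in> forms d n" "l * u \<in> Lf d J L1 (Suc n)"
  shows "Cst (e ^ n) * u \<in> Lf d J L1 n"
proof (rule solved_zero[OF J_ideal p(2,1) s u(1)])
  have "subst s (l * u) \<in> pcoef J" using Lf_subst[OF J_ideal solvedD(7)[OF s] u(2)] by blast
  thus "subst s u \<in> pcoef J"
    using pcoef_prime[OF J_prime subst_nonzero[OF p s L1 l]] by (auto simp: subst_simps)
qed

text \<open>Away from \<open>m\<close> all forms of \<open>L\<close> but one can be eliminated. If
  the exceptional form \<open>l0\<close> is not in \<open>L1\<close>, \<open>subst_cancel\<close>
  applies directly. If it is, then \<open>l\<close> can be eliminated, and \<open>l0\<close> and
  \<open>l\<close> are exchanged as in a regular sequence: \<open>l * u = l0 * w\<close> forces
  \<open>w = l * w'\<close>, and \<open>l\<close> then cancels from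
  \<open>l * (u - l0 * w')\<close>; denominators are cleared throughout.\<close>

lemma annihilator_prime_eq_m:
  assumes L1: "L1 \<subseteq> L" and l: "l \<in> L" "l \<notin> L1" and u: "u \<in> forms d n" "l * u \<in> Lf d J L1 (Suc n)"
    and p: "prime_id {r. Cst r * u \<in> Lf d J L1 n}"
  shows "{r. Cst r * u \<in> Lf d J L1 n} = m"
proof (rule ccontr)
  define p where "p = {r. Cst r * u \<in> Lf d J L1 n}"
  assume "{r. Cst r * u \<in> Lf d J L1 n} \<noteq> m"
  hence pm: "p \<noteq> m" unfolding p_def .
  have pp: "prime_id p" using p unfolding p_def .
  have Jp: "J \<subseteq> p" unfolding p_def
    using Lf_J[OF J_ideal forms_Cst_mult[OF u(1)] pcoef_mult(1)[OF J_ideal]] pcoef_Cst[OF J_ideal] by blast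
  have fin1: "finite L1" using L1 L_finite finite_subset by blast
  obtain L' where L': "L' \<subseteq> L" "indep p L'" "card (L - L') \<le> 1" using local_rank[OF pp pm Jp] by blast
  have fin': "finite L'" using L' L_finite finite_subset by blast
  have Lfo: "A \<subseteq> forms d 1" if "A \<subseteq> L" for A using that L_forms by blast
  have sol: "\<exists>e s V. solved d J p A e s V" if A: "A \<subseteq> L'" for A
  proof (rule indep_solved[OF J_ideal Jp pp])
    show "finite A" using A fin' finite_subset by blast
    show "A \<subseteq> forms d 1" using A L'(1) L_forms by blast
    show "indep p A" by (rule indep_sub[OF fin' L'(2) A pp])
  qed
  show False
  proof (cases "L1 \<subseteq> L'")
    case True
    obtain e s V where s: "solved d J p L1 e s V" using sol[OF True] by blast
    have "e ^ n \<in> p" using subst_cancel[OF pp Jp s L1 l u] unfolding p_def by simp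
    thus False using prime_id_power[OF pp] solvedD(1)[OF s] by blast
  next
    case False
    then obtain l0 where l0: "l0 \<in> L1" "l0 \<notin> L'" by blast
    have "L - L' = {l0}"
    proof -
      have "l0 \<in> L - L'" "finite (L - L')" using l0 L1 L_finite by auto
      thus ?thesis using card_le_one_singleton[of l0 "L - L'"] L'(3) by blast
    qed
    hence LL': "z \<in> L'" if "z \<in> L" "z \<noteq> l0" for z using that by blast
    define L2 where "L2 = L1 - {l0}"
    have L2: "L2 \<subseteq> L" "L2 \<subseteq> L'" "insert l L2 \<subseteq> L'" "insert l L2 \<subseteq> L" "L1 = insert l0 L2" "l0 \<notin> L2" "l0 \<noteq> l" "l \<notin> L2" "finite L2"
      unfolding L2_def using L1 l l0 LL' fin1 by auto
    have l0L: "l0 \<in> L" "l0 \<in> forms d 1" "l \<in> forms d 1" using l0 l L1 L_forms by auto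
    obtain e s V where s: "solved d J p L2 e s V" using sol[OF L2(2)] by blast
    obtain e' t V' where t: "solved d J p (insert l L2) e' t V'" using sol[OF L2(3)] by blast
    obtain w where w: "w \<in> forms d n" "l * u - l0 * w \<in> Lf d J L2 (Suc n)"
      using Lf_insert[OF J_ideal L2(9,6) _ l0L(2)] u(2) L2(5) by blast
    have mono: "F \<in> Lf d J (insert l L2) k" if "F \<in> Lf d J L2 k" for F k
      using Lf_mono[OF J_ideal _ _ that, of "insert l L2"] L2(9) by blast
    have lu: "l * u \<in> Lf d J (insert l L2) (Suc n)"
      using Lf_gen[OF J_ideal _ _ l0L(3) u(1), of "insert l L2"] L2(9) by simp
    have "l * u - (l * u - l0 * w) \<in> Lf d J (insert l L2) (Suc n)"
      using Lf_diff[OF J_ideal lu mono[OF w(2)]] .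
    hence "l0 * w \<in> Lf d J (insert l L2) (Suc n)" by simp
    hence e'w: "Cst (e' ^ n) * w \<in> Lf d J (insert l L2) n"
      using subst_cancel[OF pp Jp t L2(4) l0L(1) _ w(1)] L2(6,7) by blast
    have "\<exists>w'. l0 * w' \<in> Lf d J L1 n \<and> Cst (e' ^ n) * w - l * w' \<in> Lf d J L2 n"
    proof (cases n)
      \<comment> \<open>In degree 0 multiples of \<open>l\<close> cannot occur, so the multiplier is
        zero.\<close>
      case 0
      hence "Cst (e' ^ n) * w - l * 0 \<in> Lf d J L2 n" using e'w Lf_degree_0[OF J_ideal] by simp
      moreover have "l0 * 0 \<in> Lf d J L1 n" using Lf_0[OF J_ideal] by simp
      ultimately show ?thesis by blast
    next
      case (Suc k)
      obtain w' where w': "w' \<in> forms d k" "Cst (e' ^ n) * w - l * w' \<in> Lf d J L2 n"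
        using Lf_insert[OF J_ideal L2(9,8) _ l0L(3)] e'w Suc by blast
      moreover have "l0 * w' \<in> Lf d J L1 n" using Lf_gen[OF J_ideal fin1 l0(1) l0L(2) w'(1)] Suc by simp
      ultimately show ?thesis by blast
    qed
    then obtain w' where w': "l0 * w' \<in> Lf d J L1 n" "Cst (e' ^ n) * w - l * w' \<in> Lf d J L2 n" by blast
    define u' where "u' = Cst (e' ^ n) * u - l0 * w'"
    have u'f: "u' \<in> forms d n" unfolding u'_def using forms_diff[OF forms_Cst_mult[OF u(1)] Lf_forms[OF w'(1)]] .
    have "Cst (e' ^ n) * (l * u - l0 * w) + l0 * (Cst (e' ^ n) * w - l * w') \<in> Lf d J L2 (Suc n)"
      using Lf_mult[OF J_ideal l0L(2) w'(2)] by (intro Lf_add[OF J_ideal] Lf_Cst[OF J_ideal] w(2)) simp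
    hence "l * u' \<in> Lf d J L2 (Suc n)" unfolding u'_def by (simp add: algebra_simps)
    hence "Cst (e ^ n) * u' \<in> Lf d J L2 n" by (rule subst_cancel[OF pp Jp s L2(1) l(1) L2(8) u'f])
    hence "Cst (e ^ n) * u' \<in> Lf d J L1 n" using Lf_mono[OF J_ideal fin1] L2(5) by blast
    hence "Cst (e ^ n) * u' + Cst (e ^ n) * (l0 * w') \<in> Lf d J L1 n"
      by (rule Lf_add[OF J_ideal _ Lf_Cst[OF J_ideal w'(1)]])
    hence "Cst (e ^ n * e' ^ n) * u \<in> Lf d J L1 n" unfolding u'_def by (simp add: algebra_simps)
    hence "e ^ n * e' ^ n \<in> p" unfolding p_def by blast
    thus False using prime_idD(3)[OF pp] prime_id_power[OF pp] solvedD(1)[OF s] solvedD(1)[OF t] by blast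
  qed
qed

lemma annihilator:
  assumes u: "u \<in> forms d n" "u \<notin> Lf d J L1 n"
  obtains s where "Cst s * u \<notin> Lf d J L1 n" "prime_id {r. Cst r * (Cst s * u) \<in> Lf d J L1 n}"
proof -
  interpret pm: Modules.module "\<lambda>c F. Cst c * (F :: 'a mp)" by (rule mp_module)
  note pm.scale_scale [simp del]
  have "pm.subspace (Lf d J L1 n)"
    by (rule pm.subspaceI) (use Lf_0[OF J_ideal] Lf_add[OF J_ideal] Lf_Cst[OF J_ideal] in auto)
  moreover have "Cst j * u \<in> Lf d J L1 n" if "j \<in> J" for j
    using Lf_J[OF J_ideal forms_Cst_mult[OF u(1)] pcoef_mult(1)[OF J_ideal]] pcoef_Cst[OF J_ideal] that by blast
  ultimately show ?thesis using pm.ann_prime[OF J_noeth _ _ u(2)] that by metis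
qed

text \<open>A nonzero class killed by \<open>l\<close> has a multiple whose annihilator is
  \<open>m\<close>, and vanishing top homology excludes such a class.\<close>

lemma nonzerodivisor_form:
  assumes L1: "L1 \<subseteq> L" and l: "l \<in> L" "l \<notin> L1" and u: "u \<in> forms d n" "l * u \<in> Lf d J L1 (Suc n)"
    and ex: "kexact d xC (forms d n) (Lf d J L1 n) d"
  shows "u \<in> Lf d J L1 n"
proof (rule ccontr)
  assume "u \<notin> Lf d J L1 n"
  then obtain s where s: "Cst s * u \<notin> Lf d J L1 n" "prime_id {r. Cst r * (Cst s * u) \<in> Lf d J L1 n}"
    using annihilator[OF u(1)] by blast
  have sf: "Cst s * u \<in> forms d n" using forms_Cst_mult[OF u(1)] .
  have "l * (Cst s * u) \<in> Lf d J L1 (Suc n)" using Lf_Cst[OF J_ideal u(2)] by (simp add: mult.left_commute)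
  hence eq: "{r. Cst r * (Cst s * u) \<in> Lf d J L1 n} = m" using annihilator_prime_eq_m[OF L1 l sf _ s(2)] by blast
  have "Cst s * u \<in> Lf d J L1 n"
    by (rule kexact_socle[OF kmod_Lf[OF J_ideal] ex sf]) (use eq x_m in blast)
  thus False using s(1) by blast
qed

text \<open>Multiplication by \<open>l\<close> embeds degree \<open>n - 1\<close> into degree
  \<open>n\<close> modulo \<open>L1\<close>, with the quotient by \<open>insert l L1\<close> as
  cokernel. Each form moves the last possible homology one degree up and lowers the degree of the
  forms by one; this gives the two bounds in \<open>min n (card L1)\<close>.\<close>

lemma kexact_Lf:
  assumes "finite L1"
  shows "L1 \<subseteq> L \<Longrightarrow> i > min n (card L1) \<Longrightarrow> kexact d xC (forms d n) (Lf d J L1 n) i"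
  using assms
proof (induction L1 arbitrary: n i rule: finite_induct)
  case empty
  have "Lf d J {} n = forms d n \<inter> pcoef J" using Lf_base[OF J_ideal] by blast
  thus ?case using kexact_forms_J[of i d n] empty by simp
next
  case (insert l L1)
  have sub: "L1 \<subseteq> L" and lL: "l \<in> L" using insert.prems by auto
  have lf: "l \<in> forms d 1" using lL L_forms by blast
  have "card (insert l L1) \<le> d - 1" using card_mono[OF L_finite insert.prems(1)] L_card by simp
  hence cd: "card L1 < d" using insert.hyps by simp
  show ?case
  proof (cases n)
    case 0
    have "Lf d J (insert l L1) 0 = forms d 0 \<inter> pcoef J" using Lf_degree_0[OF J_ideal] by blast
    thus ?thesis using kexact_forms_J[of i d 0] insert.prems 0 by simp
  next
    case (Suc k)
    have "i > 0" using insert.prems by simp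
    then obtain j where j: "i = Suc j" by (cases i) auto
    have jk: "j > min k (card L1)" using insert.prems(2) insert.hyps Suc j by simp
    \<comment> \<open>The embedding and the vanishing are obtained in one induction: cancelling
      \<open>l\<close> uses the vanishing at index \<open>d\<close>, which exceeds
      \<open>card L1\<close>.\<close>
    have nzd: "u \<in> Lf d J L1 k" if "u \<in> forms d k" "l * u \<in> Lf d J L1 (Suc k)" for u
      by (rule nonzerodivisor_form[OF sub lL insert.hyps(2) that insert.IH[OF sub]]) (use cd in simp)
    show ?thesis unfolding Suc j
    proof (rule kexact_quot[where M' = "forms d k" and N = "Lf d J L1 (Suc k)" and N' = "Lf d J L1 k" and l = l])
      show "kmod d xC (Lf d J L1 (Suc k))" by (rule kmod_Lf[OF J_ideal])
      show "kmod d xC (forms d (Suc k))" "kmod d xC (forms d k)" by (rule kmod_forms)+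
      show "l * u \<in> forms d (Suc k)" if "u \<in> forms d k" for u using forms_mult[OF lf that] by simp
      show "l * u \<in> Lf d J L1 (Suc k)" if "u \<in> Lf d J L1 k" for u using Lf_mult[OF J_ideal lf that] by simp
      show "u \<in> Lf d J L1 k" if "u \<in> forms d k" "l * u \<in> Lf d J L1 (Suc k)" for u by (rule nzd[OF that])
      show "\<exists>u\<in>forms d k. z - l * u \<in> Lf d J L1 (Suc k)" if "z \<in> Lf d J (insert l L1) (Suc k)" for z
        by (rule Lf_insert[OF J_ideal insert.hyps that lf])
      show "z \<in> Lf d J (insert l L1) (Suc k)" if u: "u \<in> forms d k" "z - l * u \<in> Lf d J L1 (Suc k)" for u z
      proof -
        have "(z - l * u) + l * u \<in> Lf d J (insert l L1) (Suc k)"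
          using Lf_mono[OF J_ideal _ _ u(2), of "insert l L1"] Lf_gen[OF J_ideal _ _ lf u(1), of "insert l L1"] insert.hyps(1)
          by (intro Lf_add[OF J_ideal]) auto
        thus ?thesis by simp
      qed
      show "kexact d xC (forms d k) (Lf d J L1 k) j" by (rule insert.IH[OF sub jk])
      show "kexact d xC (forms d (Suc k)) (Lf d J L1 (Suc k)) (Suc j)" by (rule insert.IH[OF sub]) (use jk in simp)
    qed
  qed
qed

lemma form_cancel:
  assumes L1: "L1 \<subseteq> L" and l: "l \<in> L" "l \<notin> L1" and u: "u \<in> forms d n" "l * u \<in> Lf d J L1 (Suc n)"
  shows "u \<in> Lf d J L1 n"
proof (rule nonzerodivisor_form[OF assms])
  have fin: "finite L1" using L1 L_finite finite_subset by blast
  have "card L1 \<le> d - 1" using card_mono[OF L_finite L1] L_card by simp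
  thus "kexact d xC (forms d n) (Lf d J L1 n) d" using d3 by (intro kexact_Lf[OF fin L1]) simp
qed

lemma subst_rees: "F \<in> forms d n \<Longrightarrow> subst (\<lambda>j. Cst (f j) * Tv i) F = Cst (ev f F) * Tv i ^ n"
proof (induction n arbitrary: F)
  case 0
  have F: "F = Cst (Poly_Mapping.lookup F 0)" using forms_zero[OF 0] .
  show ?case by (subst (1 2) F) (simp add: subst_simps ev_simps)
next
  case (Suc n)
  obtain G where G: "\<forall>i<d. G i \<in> forms d n" "F = (\<Sum>i<d. Tv i * G i)" using forms_Suc[OF Suc.prems] by blast
  show ?case unfolding G(2) using Suc.IH G(1)
    by (auto simp: subst_simps ev_simps Cst_sum sum_distrib_left mult_ac intro!: sum.cong)
qed

text \<open>The symmetric algebra is the Rees algebra: \<open>I\<close> is of linear type.\<close>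

lemma linear_type:
  assumes u: "u \<in> forms d n" "ev f u \<in> J"
  shows "u \<in> Lf d J L n"
proof (rule ccontr)
  assume "u \<notin> Lf d J L n"
  then obtain c where c: "Cst c * u \<notin> Lf d J L n" "prime_id {r. Cst r * (Cst c * u) \<in> Lf d J L n}"
    using annihilator[OF u(1)] by blast
  define v where "v = Cst c * u"
  define p where "p = {r. Cst r * v \<in> Lf d J L n}"
  have vf: "v \<in> forms d n" unfolding v_def using forms_Cst_mult[OF u(1)] .
  have vL: "v \<notin> Lf d J L n" using c(1) unfolding v_def .
  have evv: "ev f v \<in> J" unfolding v_def using idl.subspace_scale[OF J_ideal u(2)] by (simp add: ev_simps)
  have pp: "prime_id p" using c(2) unfolding p_def v_def .
  have JC: "Cst r * F \<in> pcoef J" if "r \<in> J" for r F using pcoef_mult(1)[OF J_ideal] pcoef_Cst[OF J_ideal] that by blast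
  have Jp: "J \<subseteq> p" unfolding p_def using Lf_J[OF J_ideal forms_Cst_mult[OF vf] JC] by blast
  \<comment> \<open>Modulo \<open>L\<close> the Koszul syzygies identify \<open>f i * Tv j\<close>
    with \<open>f j * Tv i\<close>, so \<open>f i ^ n * v\<close> becomes \<open>ev f v\<close>
    times a power of \<open>Tv i\<close>, which is zero modulo \<open>J\<close>.\<close>
  have "f i \<in> p" if i: "i < d" for i
  proof -
    let ?s = "\<lambda>j. Cst (f j) * Tv i"
    have "Cst (f i ^ n) * v - subst ?s v \<in> Lf d J L n"
    proof (rule subst_cong[OF J_ideal Jp pp _ _ vf])
      show "?s j \<in> forms d 1" for j using forms_Cst_mult[OF forms_Tv[OF i]] .
      show "Cst (f i) * Tv j - ?s j \<in> Lf d J L 1" if j: "j < d" for j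
      proof (rule Syz_Lf)
        have "Cst (f i) * Tv j - ?s j \<in> forms d 1" using i j by (intro forms_diff forms_Cst_mult forms_Tv)
        moreover have "ev f (Cst (f i) * Tv j - ?s j) = 0" by (simp add: ev_simps mult.commute)
        ultimately show "Cst (f i) * Tv j - ?s j \<in> Syz" unfolding Syz_def using idl.subspace_0[OF J_ideal] by simp
      qed
    qed
    moreover have "subst ?s v \<in> Lf d J L n"
    proof (rule Lf_J[OF J_ideal])
      show "subst ?s v \<in> forms d n" by (rule subst_forms[OF _ vf]) (rule forms_Cst_mult[OF forms_Tv[OF i]])
      show "subst ?s v \<in> pcoef J" unfolding subst_rees[OF vf] by (rule JC[OF evv])
    qed
    ultimately have "(Cst (f i ^ n) * v - subst ?s v) + subst ?s v \<in> Lf d J L n" by (rule Lf_add[OF J_ideal])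
    hence "f i ^ n \<in> p" unfolding p_def by simp
    thus ?thesis by (rule prime_id_power[OF pp])
  qed
  hence Ip: "I \<subseteq> p" unfolding gens using Jp by (intro idl.span_minimal prime_idD(1)[OF pp]) auto
  have "p \<noteq> m"
  proof
    assume pm: "p = m"
    have "v \<in> Lf d J L n"
    proof (rule kexact_socle[OF kmod_Lf[OF J_ideal] _ vf])
      show "kexact d xC (forms d n) (Lf d J L n) d"
        using d3 L_card by (intro kexact_Lf[OF L_finite order_refl]) simp
      show "xC i * v \<in> Lf d J L n" if "i < d" for i using x_m[OF that] pm unfolding p_def by blast
    qed
    thus False using vL by blast
  qed
  then obtain L' where L': "L' \<subseteq> L" "indep p L'" "card (L - L') \<le> 1" using local_rank[OF pp _ Jp] by blast
  have fin': "finite L'" using L' L_finite finite_subset by blast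
  obtain e s V where s: "solved d J p L' e s V"
    using indep_solved[OF J_ideal Jp pp fin' _ L'(2)] L'(1) L_forms by blast
  have en: "Cst (e ^ n) * v \<notin> Lf d J L n"
    using prime_id_power[OF pp] solvedD(1)[OF s] unfolding p_def by blast
  have mono: "F \<in> Lf d J L k" if "F \<in> Lf d J L' k" for F k using Lf_mono[OF J_ideal L_finite L'(1) that] .
  obtain a where a: "a \<in> I" "a \<notin> J" using I_not_J by blast
  have cancel: "F \<in> pcoef J" if "Cst a * F \<in> pcoef J" for F
    using that J_prime_mult[OF a(2)] unfolding pcoef_def by (auto simp: lookup_Cst_mult)
  have gv: "Cst g * v \<in> Lf d J L n" if "g \<in> I" for g using that Ip unfolding p_def by blast
  show False
  \<comment> \<open>If every form is eliminated, \<open>v\<close> lives locally in a polynomial ring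
    over a domain, where the nonzero \<open>a\<close> cannot kill it; degree 0 is similar. Otherwise
    exactly one form \<open>l0\<close> is left.\<close>
  proof (cases "L' = L \<or> n = 0")
    case True
    have "subst s v \<in> pcoef J"
    proof (cases "L' = L")
      case True
      have "subst s (Cst a * v) \<in> pcoef J" using Lf_subst[OF J_ideal solvedD(7)[OF s]] gv[OF a(1)] True by blast
      thus ?thesis by (rule cancel[OF back_subst[of "\<lambda>z. z \<in> pcoef J"]]) (simp add: subst_simps)
    next
      case False
      hence "Cst a * v \<in> pcoef J" using gv[OF a(1)] True Lf_degree_0[OF J_ideal] by simp
      thus ?thesis by (rule subst_pcoef[OF J_ideal cancel])
    qed
    hence "Cst (e ^ n) * v \<in> Lf d J L' n" by (rule solved_zero[OF J_ideal Jp pp s vf])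
    thus False using en mono by blast
  next
    case False
    then obtain k where n: "n = Suc k" by (cases n) auto
    obtain l0 where l0: "l0 \<in> L" "l0 \<notin> L'" using False L'(1) by blast
    have "L = insert l0 L'"
    proof -
      have "l0 \<in> L - L'" "finite (L - L')" using l0 L_finite by auto
      hence "L - L' = {l0}" using card_le_one_singleton[of l0 "L - L'"] L'(3) by blast
      thus ?thesis using L'(1) by blast
    qed
    note Lins = this
    have l0f: "l0 \<in> forms d 1" using l0 L_forms by blast
    have "\<exists>w. g \<in> I \<longrightarrow> w \<in> forms d k \<and> Cst g * v - l0 * w \<in> Lf d J L' n" for g
    proof (cases "g \<in> I")
      case True
      hence "Cst g * v \<in> Lf d J (insert l0 L') (Suc k)" using gv Lins n by simp
      thus ?thesis using Lf_insert[OF J_ideal fin' l0(2) _ l0f] n by blast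
    qed blast
    hence "\<exists>w. \<forall>g. g \<in> I \<longrightarrow> w g \<in> forms d k \<and> Cst g * v - l0 * w g \<in> Lf d J L' n" by (intro choice allI)
    then obtain w where w: "\<And>g. g \<in> I \<Longrightarrow> w g \<in> forms d k" "\<And>g. g \<in> I \<Longrightarrow> Cst g * v - l0 * w g \<in> Lf d J L' n" by blast
    define la where "la = subst s l0"
    have la: "la \<notin> pcoef J" unfolding la_def by (rule subst_nonzero[OF pp Jp s L'(1) l0])
    define om where "om g = subst s (w g)" for g
    have om: "Cst g * subst s v - la * om g \<in> pcoef J" if g: "g \<in> I" for g
    proof -
      have "subst s (Cst g * v - l0 * w g) \<in> pcoef J" using Lf_subst[OF J_ideal solvedD(7)[OF s] w(2)[OF g]] by blast
      thus ?thesis unfolding om_def la_def by (simp add: subst_simps)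
    qed
    have omf: "om a \<in> forms d k" unfolding om_def by (rule solved_forms[OF J_ideal Jp pp s w(1)[OF a(1)]])
    have cross: "Cst g * om a - Cst a * om g \<in> pcoef J" if g: "g \<in> I" for g
    proof -
      have "Cst a * (Cst g * subst s v - la * om g) - Cst g * (Cst a * subst s v - la * om a) \<in> pcoef J"
        by (rule pcoef_simps(3)[OF J_ideal pcoef_mult(2)[OF J_ideal om[OF g]] pcoef_mult(2)[OF J_ideal om[OF a(1)]]])
      hence "la * (Cst g * om a - Cst a * om g) \<in> pcoef J" by (simp add: algebra_simps)
      thus ?thesis using pcoef_prime[OF J_prime la] by blast
    qed
    \<comment> \<open>Each coefficient of \<open>om a\<close> is multiplied by all of
      \<open>I\<close> into the ideal of \<open>a\<close>. As \<open>I\<close> has grade two,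
      \<open>om a\<close> is divisible by \<open>a\<close>, and so the substituted \<open>v\<close>
      is divisible by \<open>la\<close>.\<close>
    have "om a \<in> pcoef (idl.span (insert a J))"
      unfolding pcoef_def
    proof (intro CollectI allI, rule grade_two[OF a])
      fix q g assume g: "g \<in> I"
      have "Poly_Mapping.lookup (Cst g * om a - Cst a * om g) q \<in> J" using cross[OF g] unfolding pcoef_def by blast
      hence "g * Poly_Mapping.lookup (om a) q - Poly_Mapping.lookup (om g) q * a \<in> J"
        by (simp add: lookup_minus lookup_Cst_mult mult.commute)
      thus "g * Poly_Mapping.lookup (om a) q \<in> idl.span (insert a J)" using span_insert_ideal[OF J_ideal] by blast
    qed
    then obtain G where G: "G \<in> forms d k" "om a - Cst a * G \<in> pcoef J" using pcoef_lift[OF J_ideal omf] by blast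
    have "(Cst a * subst s v - la * om a) + la * (om a - Cst a * G) \<in> pcoef J"
      by (rule pcoef_simps(2)[OF J_ideal om[OF a(1)] pcoef_mult(2)[OF J_ideal G(2)]])
    hence "Cst a * (subst s v - la * G) \<in> pcoef J" by (simp add: algebra_simps)
    hence svG: "subst s v - la * G \<in> pcoef J" by (rule cancel)
    have "Cst e * l0 - la \<in> Lf d J L 1" unfolding la_def using solved_cong[OF J_ideal Jp pp s l0f] mono by simp
    moreover have "Cst e * l0 \<in> Lf d J L 1" using Lf_Cst[OF J_ideal Lf_member[OF J_ideal L_finite l0(1) l0f]] .
    ultimately have "Cst e * l0 - (Cst e * l0 - la) \<in> Lf d J L 1" using Lf_diff[OF J_ideal] by blast
    hence laL: "la \<in> Lf d J L 1" by simp
    have laG: "la * G \<in> Lf d J L n" using Lf_mult[OF J_ideal G(1) laL] n by (simp add: mult.commute)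
    have "subst s v - la * G \<in> forms d n"
      using solved_forms[OF J_ideal Jp pp s vf] Lf_forms[OF laG] by (rule forms_diff)
    hence svL: "subst s v - la * G \<in> Lf d J L n" using Lf_J[OF J_ideal] svG by blast
    have "(Cst (e ^ n) * v - subst s v) + ((subst s v - la * G) + la * G) \<in> Lf d J L n"
      by (rule Lf_add[OF J_ideal mono[OF solved_cong[OF J_ideal Jp pp s vf]] Lf_add[OF J_ideal svL laG]])
    thus False using en by simp
  qed
qed

section \<open>Socles of the quotients by powers\<close>

definition Ipow :: "nat \<Rightarrow> 'a set" where "Ipow n = {r. \<exists>F\<in>forms d n. ev f F - r \<in> J}"

lemma x0_not_J: "x 0 \<notin> J"
proof -
  have "map x [0..<d] = x 0 # map x [1..<d]" using d3 by (simp add: upt_conv_Cons)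
  hence "x 0 * c \<in> J \<longrightarrow> c \<in> J" for c using rseq_J by simp
  hence "x 0 \<in> J \<longrightarrow> 1 \<in> J" by (metis mult.right_neutral)
  thus ?thesis using prime_idD(2)[OF J_prime] by blast
qed

lemma kd_top:
  assumes "{..<d} - A = {k}" "insert k A = {..<d}"
  shows "kd d y u A = ksgn k A * y k * u {..<d}"
  unfolding kd_def using assms by simp

lemma ev_ksgn: "ev f (ksgn i A) = ksgn i A"
  unfolding ksgn_def by (simp add: ev_simps ev_power evalp_Cst[of "\<lambda>c. c" f 1, simplified])

text \<open>Below degree \<open>d - 1\<close> the depth count leaves no socle in \<open>R/I\<^sup>n\<close>.\<close>

lemma no_socle:
  assumes n: "n < d - 1" and g: "\<And>i. i < d \<Longrightarrow> x i * g \<in> Ipow n"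
  shows "g \<in> Ipow n"
proof -
  have d0: "d > 0" using d3 by simp
  have "\<exists>F. i < d \<longrightarrow> F \<in> forms d n \<and> ev f F - x i * g \<in> J" for i using g[of i] unfolding Ipow_def by blast
  then obtain F where F: "\<And>i. i < d \<Longrightarrow> F i \<in> forms d n" "\<And>i. i < d \<Longrightarrow> ev f (F i) - x i * g \<in> J" by metis
  \<comment> \<open>A lift to forms of the boundary of the top chain with value \<open>g\<close>.
    Its own boundary evaluates to zero, so by linear type it vanishes modulo
    \<open>L\<close>.\<close>
  define w where "w A = (\<Sum>k\<in>{..<d} - A. ksgn k A * F k)" for A
  have wf: "w A \<in> forms d n" for A
    unfolding w_def using F(1) by (intro forms_sum kmod_ksgn[OF kmod_forms[of d x]]) auto
  have wev: "ev f (w A) - kd d x (\<lambda>_. g) A \<in> J" for A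
  proof -
    have "ev f (w A) - kd d x (\<lambda>_. g) A = (\<Sum>k\<in>{..<d} - A. ksgn k A * (ev f (F k) - x k * g))"
      unfolding w_def kd_def by (simp add: ev_simps ev_ksgn sum_subtractf right_diff_distrib mult.assoc)
    also have "\<dots> \<in> J" using F(2) by (intro idl.subspace_sum[OF J_ideal] idl.subspace_scale[OF J_ideal]) auto
    finally show ?thesis .
  qed
  have wL: "kd d xC w A \<in> Lf d J L n" if A: "A \<subseteq> {..<d}" "Suc (card A) = d - 1" for A
  proof (rule linear_type)
    show "kd d xC w A \<in> forms d n" by (rule kd_in[OF kmod_forms A(1)]) (rule wf)
    have "kd d x (\<lambda>A. ev f (w A) - kd d x (\<lambda>_. g) A) A \<in> J" by (rule kd_in[OF kmod_ideal[OF J_ideal] A(1)]) (rule wev)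
    thus "ev f (kd d xC w A) \<in> J" by (simp add: kd_ev kd_diff kd_kd[OF A(1)])
  qed
  \<comment> \<open>The hypothesis on \<open>n\<close> enters here: \<open>min n (d - 1)\<close> is
    below the degree \<open>d - 1\<close> of \<open>w\<close>.\<close>
  have "kexact d xC (forms d n) (Lf d J L n) (d - 1)"
    using n L_card by (intro kexact_Lf[OF L_finite order_refl]) simp
  from kexactD[OF this wf wL]
  obtain u where u: "\<And>A. A \<subseteq> {..<d} \<Longrightarrow> card A = Suc (d - 1) \<Longrightarrow> u A \<in> forms d n"
     "\<And>A. A \<subseteq> {..<d} \<Longrightarrow> card A = d - 1 \<Longrightarrow> w A - kd d xC u A \<in> Lf d J L n" by blast
  \<comment> \<open>At a set missing one index the boundary of a top chain is a single term, so
    \<open>x 0\<close> can be cancelled in the domain.\<close>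
  define A where "A = {..<d} - {0}"
  have A: "A \<subseteq> {..<d}" "card A = d - 1" "{..<d} - A = {0}" "insert 0 A = {..<d}" unfolding A_def using d0 by auto
  have "ev f (w A - kd d xC u A) \<in> J" using Lf_ev[OF J_ideal L_ev u(2)[OF A(1,2)]] by blast
  hence "ev f (w A) - kd d x (\<lambda>A. ev f (u A)) A \<in> J" by (simp add: ev_simps kd_ev)
  hence "(ev f (w A) - kd d x (\<lambda>A. ev f (u A)) A) - (ev f (w A) - kd d x (\<lambda>_. g) A) \<in> J"
    using wev idl.subspace_diff[OF J_ideal] by blast
  hence "ksgn 0 A * (x 0 * (g - ev f (u {..<d}))) \<in> J" by (simp add: kd_top[OF A(3,4)] algebra_simps)
  hence "x 0 * (g - ev f (u {..<d})) \<in> J" using kmod_ksgn_iff[OF kmod_ideal[OF J_ideal, of 0 "\<lambda>_. 0"]] by blast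
  hence "g - ev f (u {..<d}) \<in> J" using J_prime_mult[OF x0_not_J] by blast
  hence "- (g - ev f (u {..<d})) \<in> J" by (rule idl.subspace_neg[OF J_ideal])
  hence "ev f (u {..<d}) - g \<in> J" by simp
  thus ?thesis unfolding Ipow_def using u(1)[of "{..<d}"] d0 by auto
qed

context
  fixes B :: "'a mp \<Rightarrow> nat \<Rightarrow> 'a mp"
  assumes B: "\<And>l i. l \<in> L \<Longrightarrow> B l i \<in> forms d 1" "\<And>l. l \<in> L \<Longrightarrow> l - (\<Sum>i<d. xC i * B l i) \<in> pcoef J"
begin

lemma Wd_forms: "set ls \<subseteq> L \<Longrightarrow> A \<subseteq> {..<d} \<Longrightarrow> card A = length ls \<Longrightarrow> Wd B ls A \<in> forms d (length ls)"
proof (induction ls arbitrary: A)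
  case (Cons l ls)
  show ?case unfolding Wd.simps
  proof (rule kw_in[OF kmod_forms[of d x] Cons.prems(2)])
    fix C i assume "C \<subseteq> {..<d}" "Suc (card C) = card A"
    thus "B l i * Wd B ls C \<in> forms d (length (l # ls))"
      using forms_mult[OF B(1)[of l i] Cons.IH[of C]] Cons.prems by simp
  qed
qed simp

lemma kw_kd_Wd:
  assumes "l \<in> L" "A \<subseteq> {..<d}" and "\<And>C. C \<subseteq> {..<d} \<Longrightarrow> Suc (card C) = card A \<Longrightarrow> kd d xC w C \<in> Lf d J L1 n"
  shows "kw (B l) (kd d xC w) A \<in> Lf d J L1 (Suc n)"
proof (rule kw_in[OF kmod_Lf[OF J_ideal, of d x] assms(2)])
  fix C i assume C: "C \<subseteq> {..<d}" "Suc (card C) = card A"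
  show "B l i * kd d xC w C \<in> Lf d J L1 (Suc n)"
    using Lf_mult[OF J_ideal B(1)[OF assms(1)] assms(3)[OF C]] by simp
qed

text \<open>Contracting the column \<open>B l\<close> with \<open>x\<close> gives back
  \<open>l\<close> modulo \<open>J\<close>, so by \<open>kd_kw\<close> each wedge factor changes the
  boundary only by multiples of its form.\<close>

lemma kd_Wd: "set ls \<subseteq> L \<Longrightarrow> A \<subseteq> {..<d} \<Longrightarrow> Suc (card A) = length ls \<Longrightarrow> kd d xC (Wd B ls) A \<in> Lf d J (set ls) (length ls)"
proof (induction ls arbitrary: A)
  case (Cons l ls)
  have lL: "l \<in> L" and lf: "l \<in> forms d 1" using Cons.prems(1) L_forms by auto
  have W: "Wd B ls A \<in> forms d (length ls)" using Wd_forms Cons.prems by simp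
  have "l * Wd B ls A \<in> Lf d J (set (l # ls)) (Suc (length ls))"
    by (rule Lf_gen[OF J_ideal _ _ lf W]) auto
  moreover have "(l - (\<Sum>i<d. xC i * B l i)) * Wd B ls A \<in> Lf d J (set (l # ls)) (Suc (length ls))"
  proof (rule Lf_J[OF J_ideal])
    have "l - (\<Sum>i<d. xC i * B l i) \<in> forms d 1"
      using lf B(1)[OF lL] by (intro forms_diff forms_sum forms_Cst_mult)
    thus "(l - (\<Sum>i<d. xC i * B l i)) * Wd B ls A \<in> forms d (Suc (length ls))" using forms_mult[OF _ W] by fastforce
    show "(l - (\<Sum>i<d. xC i * B l i)) * Wd B ls A \<in> pcoef J" using pcoef_mult(1)[OF J_ideal B(2)[OF lL]] .
  qed
  moreover have "kw (B l) (kd d xC (Wd B ls)) A \<in> Lf d J (set (l # ls)) (Suc (length ls))"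
  proof (rule Lf_mono[OF J_ideal, of _ "set ls"])
    show "kw (B l) (kd d xC (Wd B ls)) A \<in> Lf d J (set ls) (Suc (length ls))"
      by (rule kw_kd_Wd[OF lL Cons.prems(2)]) (use Cons in auto)
  qed auto
  ultimately have "l * Wd B ls A - (l - (\<Sum>i<d. xC i * B l i)) * Wd B ls A - kw (B l) (kd d xC (Wd B ls)) A
     \<in> Lf d J (set (l # ls)) (Suc (length ls))" using Lf_diff[OF J_ideal] by blast
  thus ?case by (simp add: kd_kw[OF Cons.prems(2)] algebra_simps)
qed simp

text \<open>The class of the wedge product of the columns of \<open>B\<close> in Koszul homology has annihilator \<open>m\<close>: applying
  the differential and cancelling \<open>l\<close> removes one factor.\<close>

lemma wedge_nonboundary:
  "distinct ls \<Longrightarrow> set ls \<subseteq> L \<Longrightarrow> c \<in> forms d e \<Longrightarrow>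
    (\<And>A. A \<subseteq> {..<d} \<Longrightarrow> card A = Suc (length ls) \<Longrightarrow> u A \<in> forms d (e + length ls)) \<Longrightarrow>
    (\<And>A. A \<subseteq> {..<d} \<Longrightarrow> card A = length ls \<Longrightarrow> c * Wd B ls A - kd d xC u A \<in> Lf d J (set ls) (e + length ls)) \<Longrightarrow>
    c \<in> pcoef m"
proof (induction ls arbitrary: u)
  case Nil
  have mI: "idl.subspace m" using prime_idD(1)[OF m_prime] .
  have "c - kd d xC u {} \<in> pcoef J" using Nil(5)[of "{}"] Lf_base[OF J_ideal] by simp
  hence "c - kd d xC u {} \<in> pcoef m" using pcoef_mono[OF J_m] by blast
  moreover have "kd d xC u {} \<in> pcoef m"
    unfolding kd_def using x_m
    by (intro pcoef_sum[OF mI] pcoef_mult(1)[OF mI] pcoef_mult(2)[OF mI]) (auto simp: pcoef_Cst[OF mI])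
  ultimately have "(c - kd d xC u {}) + kd d xC u {} \<in> pcoef m" by (rule pcoef_simps(2)[OF mI])
  thus ?case by simp
next
  case (Cons l ls)
  define k where "k = e + length ls"
  have ek: "e + length (l # ls) = Suc k" unfolding k_def by simp
  have lL: "l \<in> L" and lf: "l \<in> forms d 1" and lsL: "set ls \<subseteq> L" and nin: "l \<notin> set ls" and dis: "distinct ls"
    using Cons.prems(1,2) L_forms by auto
  define y where "y A = c * Wd B (l # ls) A - kd d xC u A" for A
  \<comment> \<open>Modulo the remaining forms the boundary relation is off by a multiple of
    \<open>l\<close>; the multipliers \<open>v\<close> are the chain for the shorter wedge.\<close>
  have "\<exists>v. A \<subseteq> {..<d} \<and> card A = Suc (length ls) \<longrightarrow> v \<in> forms d k \<and> y A - l * v \<in> Lf d J (set ls) (Suc k)" for A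
  proof (cases "A \<subseteq> {..<d} \<and> card A = Suc (length ls)")
    case True
    hence "y A \<in> Lf d J (insert l (set ls)) (Suc k)" using Cons.prems(5)[of A] unfolding y_def ek by simp
    thus ?thesis using Lf_insert[OF J_ideal _ nin _ lf] by blast
  qed blast
  hence "\<exists>v. \<forall>A. A \<subseteq> {..<d} \<and> card A = Suc (length ls) \<longrightarrow> v A \<in> forms d k \<and> y A - l * v A \<in> Lf d J (set ls) (Suc k)"
    by (intro choice allI)
  then obtain v where v: "\<And>A. A \<subseteq> {..<d} \<Longrightarrow> card A = Suc (length ls) \<Longrightarrow> v A \<in> forms d k"
    "\<And>A. A \<subseteq> {..<d} \<Longrightarrow> card A = Suc (length ls) \<Longrightarrow> y A - l * v A \<in> Lf d J (set ls) (Suc k)" by blast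
  show ?case
  proof (rule Cons.IH[OF dis lsL Cons.prems(3), of v])
    show "v A \<in> forms d (e + length ls)" if "A \<subseteq> {..<d}" "card A = Suc (length ls)" for A
      using v(1)[OF that] unfolding k_def .
    fix A assume A: "A \<subseteq> {..<d}" "card A = length ls"
    have W: "Wd B ls A \<in> forms d (length ls)" using Wd_forms lsL A by simp
    have cW: "c * Wd B ls A \<in> forms d k" unfolding k_def using forms_mult[OF Cons.prems(3) W] .
    have "kd d xC (\<lambda>A. y A - l * v A) A \<in> Lf d J (set ls) (Suc k)"
      by (rule kd_in[OF kmod_Lf[OF J_ideal] A(1)]) (use v(2) A(2) in auto)
    hence 1: "c * kd d xC (Wd B (l # ls)) A - l * kd d xC v A \<in> Lf d J (set ls) (Suc k)"
      unfolding y_def by (simp add: kd_diff kd_scale kd_kd[OF A(1)] del: Wd.simps)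
    have "kw (B l) (kd d xC (Wd B ls)) A \<in> Lf d J (set ls) (Suc (length ls))"
      by (rule kw_kd_Wd[OF lL A(1)]) (use kd_Wd lsL A(2) in auto)
    hence 2: "c * kw (B l) (kd d xC (Wd B ls)) A \<in> Lf d J (set ls) (Suc k)"
      unfolding k_def using Lf_mult[OF J_ideal Cons.prems(3)] by fastforce
    have 3: "(l - (\<Sum>i<d. xC i * B l i)) * (c * Wd B ls A) \<in> Lf d J (set ls) (Suc k)"
    proof (rule Lf_J[OF J_ideal])
      have "l - (\<Sum>i<d. xC i * B l i) \<in> forms d 1"
        using lf B(1)[OF lL] by (intro forms_diff forms_sum forms_Cst_mult)
      thus "(l - (\<Sum>i<d. xC i * B l i)) * (c * Wd B ls A) \<in> forms d (Suc k)" using forms_mult[OF _ cW] by fastforce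
      show "(l - (\<Sum>i<d. xC i * B l i)) * (c * Wd B ls A) \<in> pcoef J" using pcoef_mult(1)[OF J_ideal B(2)[OF lL]] .
    qed
    have "c * kd d xC (Wd B (l # ls)) A - l * kd d xC v A + c * kw (B l) (kd d xC (Wd B ls)) A
        + (l - (\<Sum>i<d. xC i * B l i)) * (c * Wd B ls A) \<in> Lf d J (set ls) (Suc k)"
      using Lf_add[OF J_ideal Lf_add[OF J_ideal 1 2] 3] .
    hence "l * (c * Wd B ls A - kd d xC v A) \<in> Lf d J (set ls) (Suc k)"
      by (simp add: kd_kw[OF A(1)] algebra_simps)
    moreover have "kd d xC v A \<in> forms d k" by (rule kd_in[OF kmod_forms A(1)]) (use v(1) A(2) in auto)
    ultimately have "c * Wd B ls A - kd d xC v A \<in> Lf d J (set ls) k"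
      using form_cancel[OF lsL lL nin forms_diff[OF cW]] by blast
    thus "c * Wd B ls A - kd d xC v A \<in> Lf d J (set ls) (e + length ls)" unfolding k_def .
  qed
qed

end

text \<open>The values of the wedge \<open>W\<close> under \<open>ev f\<close> are a cycle modulo
  \<open>J\<close>, hence the boundary of a top chain with some value \<open>g0\<close>: up to sign
  they are the products \<open>x k * g0\<close>, so these lie in the power with exponent
  \<open>d - 1\<close>. The factor \<open>f 0 ^ e\<close> reaches larger exponents.\<close>

lemma socle:
  assumes n: "d - 1 \<le> n"
  shows "\<exists>g. (\<forall>i<d. x i * g \<in> Ipow n) \<and> g \<notin> Ipow n"
proof -
  have d0: "d > 0" using d3 by simp
  have "\<exists>B. l \<in> L \<longrightarrow> (\<forall>i. B i \<in> forms d 1) \<and> l - (\<Sum>i<d. xC i * B i) \<in> pcoef J" for l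
  proof (cases "l \<in> L")
    case True
    hence "l \<in> pcoef (idl.span (J \<union> x ` {..<d}))" using Syz_coeffs L_Syz m_gen by blast
    thus ?thesis using pcoef_lift_gens[OF J_ideal] True L_forms by blast
  qed blast
  hence "\<exists>B. \<forall>l. l \<in> L \<longrightarrow> (\<forall>i. B l i \<in> forms d 1) \<and> l - (\<Sum>i<d. xC i * B l i) \<in> pcoef J" by (intro choice allI)
  then obtain B where B: "\<And>l i. l \<in> L \<Longrightarrow> B l i \<in> forms d 1" "\<And>l. l \<in> L \<Longrightarrow> l - (\<Sum>i<d. xC i * B l i) \<in> pcoef J" by blast
  obtain ls where ls: "set ls = L" "distinct ls" using finite_distinct_list[OF L_finite] by blast
  have len: "length ls = d - 1" using distinct_card[OF ls(2)] ls(1) L_card by simp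
  have lsL: "set ls \<subseteq> L" using ls by simp
  define W where "W = Wd B ls"
  have W: "W A \<in> forms d (d - 1)" if "A \<subseteq> {..<d}" "card A = d - 1" for A
    using Wd_forms[OF B lsL that(1)] that(2) len unfolding W_def by simp
  have kW: "kd d x (\<lambda>A. ev f (W A)) A \<in> J" if A: "A \<subseteq> {..<d}" "Suc (card A) = d - 1" for A
  proof -
    have "kd d xC W A \<in> Lf d J L (d - 1)" using kd_Wd[OF B lsL A(1)] A(2) len ls(1) unfolding W_def by simp
    hence "ev f (kd d xC W A) \<in> J" using Lf_ev[OF J_ideal L_ev] by blast
    thus ?thesis by (simp add: kd_ev)
  qed
  have "kexact d x UNIV J (d - 1)" using kdepth_J d3 unfolding kdepth_def by simp
  from kexactD[OF this _ kW]
  obtain u where u: "\<And>A. A \<subseteq> {..<d} \<Longrightarrow> card A = d - 1 \<Longrightarrow> ev f (W A) - kd d x u A \<in> J" by auto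
  define g0 where "g0 = u {..<d}"
  define e where "e = n - (d - 1)"
  have ne: "e + (d - 1) = n" unfolding e_def using n by simp
  have Te: "Tv 0 ^ e \<in> forms d e"
  proof (induction e)
    case (Suc e)
    thus ?case using forms_Tv_mult[OF d0] by simp
  qed simp
  define y where "y = f 0 ^ e * g0"
  have xy: "x k * y \<in> Ipow n" if k: "k < d" for k
  proof -
    define A where "A = {..<d} - {k}"
    have A: "A \<subseteq> {..<d}" "card A = d - 1" "{..<d} - A = {k}" "insert k A = {..<d}" unfolding A_def using k by auto
    have "ksgn k A * (Tv 0 ^ e * W A) \<in> forms d n"
      using kmod_ksgn[OF kmod_forms[of d x] forms_mult[OF Te W[OF A(1,2)]]] ne by simp
    moreover have "ksgn k A * f 0 ^ e * (ev f (W A) - kd d x u A) \<in> J" by (rule idl.subspace_scale[OF J_ideal u[OF A(1,2)]])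
    hence "ksgn k A * f 0 ^ e * ev f (W A) - ksgn k A * ksgn k A * (x k * y) \<in> J"
      unfolding kd_top[OF A(3,4)] y_def g0_def by (simp add: algebra_simps)
    hence "ev f (ksgn k A * (Tv 0 ^ e * W A)) - x k * y \<in> J"
      by (simp add: ksgn_square ev_simps ev_ksgn ev_power mult.assoc)
    ultimately show ?thesis unfolding Ipow_def by blast
  qed
  have "y \<notin> Ipow n"
  proof
    assume "y \<in> Ipow n"
    then obtain G where G: "G \<in> forms d n" "ev f G - y \<in> J" unfolding Ipow_def by blast
    \<comment> \<open>If \<open>y\<close> were the value of a form \<open>G\<close>, linear type
      would make \<open>Tv 0 ^ e * W\<close> the boundary of the constant chain \<open>G\<close>
      modulo \<open>L\<close>. By \<open>wedge_nonboundary\<close> the coefficient 1 of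
      \<open>Tv 0 ^ e\<close> would then lie in \<open>m\<close>.\<close>
    have "Tv 0 ^ e \<in> pcoef m"
    proof (rule wedge_nonboundary[OF B ls(2) lsL Te, of "\<lambda>_. G"])
      show "G \<in> forms d (e + length ls)" using G(1) len ne by simp
      fix A assume A: "A \<subseteq> {..<d}" "card A = length ls"
      have cA: "card A = d - 1" using A(2) len by simp
      obtain k where k: "k < d" "{..<d} - A = {k}" "insert k A = {..<d}"
        using corank_one_subset[OF A(1) cA d0] by blast
      have "Tv 0 ^ e * W A - kd d xC (\<lambda>_. G) A \<in> Lf d J L n"
      proof (rule linear_type)
        have "kd d xC (\<lambda>_. G) A \<in> forms d n" by (rule kd_in[OF kmod_forms A(1)]) (rule G(1))
        thus "Tv 0 ^ e * W A - kd d xC (\<lambda>_. G) A \<in> forms d n"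
          using forms_mult[OF Te W[OF A(1) cA]] ne by (intro forms_diff) simp_all
        have "f 0 ^ e * (ev f (W A) - kd d x u A) - ksgn k A * x k * (ev f G - y) \<in> J"
          by (rule idl.subspace_diff[OF J_ideal idl.subspace_scale[OF J_ideal u[OF A(1) cA]] idl.subspace_scale[OF J_ideal G(2)]])
        thus "ev f (Tv 0 ^ e * W A - kd d xC (\<lambda>_. G) A) \<in> J"
          by (simp add: ev_simps ev_power ev_ksgn kd_top[OF k(2,3)] y_def g0_def algebra_simps)
      qed
      thus "Tv 0 ^ e * Wd B ls A - kd d xC (\<lambda>_. G) A \<in> Lf d J (set ls) (e + length ls)"
        using ls(1) len ne unfolding W_def by simp
    qed
    moreover have "Tv 0 \<notin> pcoef m"
    proof
      assume "Tv 0 \<in> pcoef m"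
      hence "cf (Tv 0) 0 \<in> m" unfolding pcoef_def cf_def by blast
      thus False using prime_idD(2)[OF m_prime] by simp
    qed
    hence "Tv 0 ^ e \<notin> pcoef m"
    proof (induction e)
      case 0
      show ?case using pcoef_Cst[OF prime_idD(1)[OF m_prime], of 1] prime_idD(2)[OF m_prime] by simp
    next
      case (Suc e)
      thus ?case using pcoef_prime[OF m_prime] by simp
    qed
    ultimately show False by blast
  qed
  thus ?thesis using xy by blast
qed

end

section \<open>Associated primes of powers\<close>

lemma ipow_mult_general: "a \<in> ipow J A i \<Longrightarrow> g \<in> A \<Longrightarrow> g ^ k * a \<in> ipow J A (i + k)"
proof (induction k)
  case (Suc k)
  thus ?case using ipow_mult[of g A "g ^ k * a" J "i + k"] by (simp add: mult.assoc del: ipow.simps)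
qed simp

context lci_gens
begin

lemma Ipow_eq: "Ipow n = ipow J I n"
proof (induction n)
  case 0
  have "r \<in> Ipow 0" for r
    unfolding Ipow_def using idl.subspace_0[OF J_ideal] by (intro CollectI bexI[of _ "Cst r"]) (auto simp: ev_simps)
  thus ?case by auto
next
  case (Suc n)
  show ?case
  proof
    show "Ipow (Suc n) \<subseteq> ipow J I (Suc n)"
    proof
      fix r assume "r \<in> Ipow (Suc n)"
      then obtain F where F: "F \<in> forms d (Suc n)" "ev f F - r \<in> J" unfolding Ipow_def by blast
      obtain G where G: "\<forall>i<d. G i \<in> forms d n" "F = (\<Sum>i<d. Tv i * G i)" using forms_Suc[OF F(1)] by blast
      have "ev f (G i) \<in> Ipow n" if "i < d" for i
        unfolding Ipow_def using G(1) that idl.subspace_0[OF J_ideal] by (intro CollectI bexI[of _ "G i"]) auto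
      hence "f i * ev f (G i) \<in> ipow J I (Suc n)" if "i < d" for i
        using ipow_mult[OF f_I[OF that]] Suc.IH that by blast
      hence "ev f F \<in> ipow J I (Suc n)"
        unfolding G(2) ev_simps by (intro idl.subspace_sum[OF ipow_subspace]) auto
      moreover have "ev f F - r \<in> ipow J I (Suc n)" using F(2) ipow_base by blast
      ultimately have "ev f F - (ev f F - r) \<in> ipow J I (Suc n)" by (rule idl.subspace_diff[OF ipow_subspace])
      thus "r \<in> ipow J I (Suc n)" by simp
    qed
    have S: "idl.subspace (Ipow (Suc n))"
    proof (rule idl.subspaceI)
      show "0 \<in> Ipow (Suc n)" unfolding Ipow_def using idl.subspace_0[OF J_ideal] by (intro CollectI bexI[of _ 0]) auto
      fix a b assume "a \<in> Ipow (Suc n)" "b \<in> Ipow (Suc n)"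
      then obtain F G where FG: "F \<in> forms d (Suc n)" "ev f F - a \<in> J" "G \<in> forms d (Suc n)" "ev f G - b \<in> J"
        unfolding Ipow_def by blast
      have "ev f (F + G) - (a + b) \<in> J" using idl.subspace_add[OF J_ideal FG(2,4)] by (simp add: ev_simps algebra_simps)
      thus "a + b \<in> Ipow (Suc n)" unfolding Ipow_def using forms_add[OF FG(1,3)] by blast
    next
      fix c a assume "a \<in> Ipow (Suc n)"
      then obtain F where F: "F \<in> forms d (Suc n)" "ev f F - a \<in> J" unfolding Ipow_def by blast
      have "ev f (Cst c * F) - c * a \<in> J" using idl.subspace_scale[OF J_ideal F(2), of c] by (simp add: ev_simps algebra_simps)
      thus "c * a \<in> Ipow (Suc n)" unfolding Ipow_def using forms_Cst_mult[OF F(1)] by blast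
    qed
    have JI: "r \<in> Ipow (Suc n)" if "r \<in> J" for r
      unfolding Ipow_def using that idl.subspace_neg[OF J_ideal] by (intro CollectI bexI[of _ 0]) auto
    have "a * b \<in> Ipow (Suc n)" if a: "a \<in> I" and b: "b \<in> ipow J I n" for a b
    proof -
      obtain V where V: "V \<in> forms d 1" "ev f V - a \<in> J" using ideal_lift[OF a] by blast
      obtain F where F: "F \<in> forms d n" "ev f F - b \<in> J" using b Suc.IH unfolding Ipow_def by blast
      have "ev f F * (ev f V - a) + a * (ev f F - b) \<in> J"
        by (rule idl.subspace_add[OF J_ideal idl.subspace_scale[OF J_ideal V(2)] idl.subspace_scale[OF J_ideal F(2)]])
      hence "ev f (V * F) - a * b \<in> J" by (simp add: ev_simps algebra_simps)
      thus ?thesis unfolding Ipow_def using forms_mult[OF V(1) F(1)] by auto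
    qed
    thus "ipow J I (Suc n) \<subseteq> Ipow (Suc n)" unfolding ipow.simps using JI by (intro idl.span_minimal[OF _ S]) blast
  qed
qed

lemma ipow_subset_I: "ipow J I (Suc n) \<subseteq> I"
  unfolding ipow.simps using J_I ideal_mult_right[OF I_ideal] by (intro idl.span_minimal I_ideal) blast

section \<open>Powers at a prime where the ideal is generated by a regular sequence of length
  two\<close>

context
  fixes q :: "'a set" and g1 g2 :: 'a
  assumes q: "prime_id q" and g: "g1 \<in> I" "g2 \<in> I" "g1 \<notin> J"
    and two: "\<And>a. a \<in> I \<Longrightarrow> \<exists>s. s \<notin> q \<and> s * a \<in> idl.span (insert g2 (insert g1 J))"
    and reg: "\<And>c. c * g2 \<in> idl.span (insert g1 J) \<Longrightarrow> \<exists>s. s \<notin> q \<and> s * c \<in> idl.span (insert g1 J)"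
begin

definition bin :: "nat \<Rightarrow> (nat \<Rightarrow> 'a) \<Rightarrow> 'a" where "bin j c = (\<Sum>i\<le>j. c i * g1 ^ i * g2 ^ (j - i))"

lemma bin_add: "bin j (\<lambda>i. a i + b i) = bin j a + bin j b"
  unfolding bin_def by (simp add: distrib_right sum.distrib)

lemma bin_diff: "bin j (\<lambda>i. a i - b i) = bin j a - bin j b"
  unfolding bin_def by (simp add: left_diff_distrib sum_subtractf)

lemma bin_scale: "bin j (\<lambda>i. t * a i) = t * bin j a"
  unfolding bin_def by (simp add: sum_distrib_left mult.assoc)

lemma bin_Suc: "bin (Suc j) c = c 0 * g2 ^ Suc j + g1 * bin j (\<lambda>i. c (Suc i))"
  unfolding bin_def by (subst sum.atMost_Suc_shift) (simp add: sum_distrib_left mult_ac)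

lemma bin_mult_g1: "g1 * bin j c = bin (Suc j) (\<lambda>i. if i = 0 then 0 else c (i - 1))"
  unfolding bin_Suc by simp

lemma bin_mult_g2: "g2 * bin j c = bin (Suc j) (\<lambda>i. if i \<le> j then c i else 0)"
proof -
  have "g2 * bin j c = (\<Sum>i\<le>j. (if i \<le> j then c i else 0) * g1 ^ i * g2 ^ (Suc j - i))"
    unfolding bin_def sum_distrib_left by (intro sum.cong) (auto simp: Suc_diff_le mult_ac)
  thus ?thesis unfolding bin_def by simp
qed

abbreviation loc where "loc B \<equiv> sat_insert q 0 B"

lemma loc_iff: "r \<in> loc B \<longleftrightarrow> (\<exists>s. s \<notin> q \<and> s * r \<in> B)"
  unfolding sat_insert_def by simp

lemma reg_power: "c * g2 ^ k \<in> idl.span (insert g1 J) \<Longrightarrow> \<exists>s. s \<notin> q \<and> s * c \<in> idl.span (insert g1 J)"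
proof (induction k arbitrary: c)
  case 0
  thus ?case using prime_idD(2)[OF q] by (intro exI[of _ 1]) simp
next
  case (Suc k)
  have "(c * g2 ^ k) * g2 \<in> idl.span (insert g1 J)" using Suc.prems by (simp add: mult_ac)
  then obtain s where s: "s \<notin> q" "s * (c * g2 ^ k) \<in> idl.span (insert g1 J)" using reg by blast
  hence "(s * c) * g2 ^ k \<in> idl.span (insert g1 J)" by (simp add: mult.assoc)
  then obtain t where t: "t \<notin> q" "t * (s * c) \<in> idl.span (insert g1 J)" using Suc.IH by blast
  thus ?case using prime_idD(4)[OF q t(1) s(1)] by (intro exI[of _ "t * s"]) (simp add: mult.assoc)
qed

text \<open>Regular sequences are quasi-regular (here of length two and locally at \<open>q\<close>).\<close>

lemma quasi_regular: "bin j c \<in> J \<Longrightarrow> i \<le> j \<Longrightarrow> c i \<in> loc I"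
proof (induction j arbitrary: c i)
  case 0
  hence "c 0 \<in> J" unfolding bin_def by simp
  thus ?case using 0(2) J_I sat_insert(3)[OF q I_ideal] by auto
next
  case (Suc j)
  have locI: "idl.subspace (loc I)" "sat q (loc I)" "I \<subseteq> loc I" using sat_insert[OF q I_ideal] by blast+
  have "c 0 * g2 ^ Suc j \<in> idl.span (insert g1 J)"
  proof -
    have "c 0 * g2 ^ Suc j - (- bin j (\<lambda>i. c (Suc i))) * g1 \<in> J" using Suc.prems(1) unfolding bin_Suc by (simp add: mult.commute)
    thus ?thesis using span_insert_ideal[OF J_ideal] by blast
  qed
  then obtain s where s: "s \<notin> q" "s * c 0 \<in> idl.span (insert g1 J)" using reg_power by blast
  then obtain c' where c': "s * c 0 - c' * g1 \<in> J" using span_insert_ideal[OF J_ideal] by blast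
  have "c' * g1 \<in> I" using g(1) idl.subspace_scale[OF I_ideal] by blast
  hence "(s * c 0 - c' * g1) + c' * g1 \<in> I" using c' J_I idl.subspace_add[OF I_ideal] by blast
  hence c0: "c 0 \<in> loc I" using s(1) unfolding loc_iff by auto
  \<comment> \<open>Modulo \<open>g1\<close> only the pure power of \<open>g2\<close> remains, so
    \<open>s * c 0\<close> is a multiple \<open>c' * g1\<close>. Moving this term to the part
    divisible by \<open>g1\<close> and cancelling \<open>g1\<close> leaves a form of degree
    \<open>j\<close>.\<close>
  define c2 where "c2 i = s * c (Suc i) + (if i = 0 then c' * g2 else 0)" for i
  have "bin j c2 = s * bin j (\<lambda>i. c (Suc i)) + bin j (\<lambda>i. if i = 0 then c' * g2 else 0)"
    unfolding c2_def bin_add bin_scale ..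
  also have "bin j (\<lambda>i. if i = 0 then c' * g2 else 0) = (\<Sum>i\<le>j. if i = 0 then c' * g2 * g2 ^ j else 0)"
    unfolding bin_def by (intro sum.cong) auto
  also have "\<dots> = c' * g2 ^ Suc j" by (simp add: mult.assoc)
  finally have c2: "bin j c2 = s * bin j (\<lambda>i. c (Suc i)) + c' * g2 ^ Suc j" .
  have "s * bin (Suc j) c - g2 ^ Suc j * (s * c 0 - c' * g1) \<in> J"
    by (rule idl.subspace_diff[OF J_ideal idl.subspace_scale[OF J_ideal Suc.prems(1)] idl.subspace_scale[OF J_ideal c']])
  hence "g1 * bin j c2 \<in> J" unfolding c2 bin_Suc by (simp add: algebra_simps)
  hence binJ: "bin j c2 \<in> J" using J_prime_mult[OF g(3)] by blast
  show ?case
  proof (cases i)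
    case 0
    thus ?thesis using c0 by simp
  next
    case (Suc k)
    hence c2k: "c2 k \<in> loc I" using Suc.IH[OF binJ, of k] Suc.prems(2) by simp
    have "(if k = 0 then c' * g2 else 0) \<in> I"
      using idl.subspace_scale[OF I_ideal g(2)] idl.subspace_0[OF I_ideal] by simp
    hence "c2 k - (if k = 0 then c' * g2 else 0) \<in> loc I" using idl.subspace_diff[OF locI(1) c2k] locI(3) by blast
    hence "s * c (Suc k) \<in> loc I" unfolding c2_def by simp
    thus ?thesis using satD[OF locI(2) s(1)] Suc by simp
  qed
qed

text \<open>Elements that at \<open>q\<close> are forms of degree \<open>j\<close> in
  \<open>g1\<close> and \<open>g2\<close> with coefficients in \<open>K\<close>. The choices
  \<open>UNIV\<close> and \<open>I\<close> for \<open>K\<close> describe the powers with exponents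
  \<open>j\<close> and \<open>j + 1\<close>.\<close>

definition binform :: "'a set \<Rightarrow> nat \<Rightarrow> 'a set" where
  "binform K j = {a. \<exists>s c. s \<notin> q \<and> (\<forall>i. c i \<in> K) \<and> s * a - bin j c \<in> J}"

lemma binform_I: "s \<notin> q \<Longrightarrow> (\<And>i. c i \<in> K) \<Longrightarrow> s * a - bin j c \<in> J \<Longrightarrow> a \<in> binform K j"
  unfolding binform_def by blast

lemma binform_ideal:
  assumes K: "idl.subspace K"
  shows "idl.subspace (binform K j)" "J \<subseteq> binform K j"
proof -
  have bin0: "bin j (\<lambda>_. 0) = 0" unfolding bin_def by simp
  show JB: "J \<subseteq> binform K j"
    unfolding binform_def using prime_idD(2)[OF q] idl.subspace_0[OF K] bin0
    by (auto intro!: exI[of _ 1] exI[of _ "\<lambda>_. 0"])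
  show "idl.subspace (binform K j)"
  proof (rule idl.subspaceI)
    show "0 \<in> binform K j" using JB idl.subspace_0[OF J_ideal] by blast
    fix a b assume "a \<in> binform K j" "b \<in> binform K j"
    then obtain s c t e where st: "s \<notin> q" "\<forall>i. c i \<in> K" "s * a - bin j c \<in> J" "t \<notin> q" "\<forall>i. e i \<in> K" "t * b - bin j e \<in> J"
      unfolding binform_def by blast
    have "t * (s * a - bin j c) + s * (t * b - bin j e) \<in> J"
      by (rule idl.subspace_add[OF J_ideal idl.subspace_scale[OF J_ideal st(3)] idl.subspace_scale[OF J_ideal st(6)]])
    hence "(s * t) * (a + b) - bin j (\<lambda>i. t * c i + s * e i) \<in> J"
      unfolding bin_add bin_scale by (simp add: algebra_simps)
    thus "a + b \<in> binform K j"
      by (rule binform_I[OF prime_idD(4)[OF q st(1,4)], rotated])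
        (use st(2,5) idl.subspace_add[OF K] idl.subspace_scale[OF K] in blast)
  next
    fix r a assume "a \<in> binform K j"
    then obtain s c where s: "s \<notin> q" "\<forall>i. c i \<in> K" "s * a - bin j c \<in> J" unfolding binform_def by blast
    have "r * (s * a - bin j c) \<in> J" by (rule idl.subspace_scale[OF J_ideal s(3)])
    hence "s * (r * a) - bin j (\<lambda>i. r * c i) \<in> J" unfolding bin_scale by (simp add: algebra_simps)
    thus "r * a \<in> binform K j"
      by (rule binform_I[OF s(1), rotated]) (use s(2) idl.subspace_scale[OF K] in blast)
  qed
qed

lemma binform_mult:
  assumes K: "idl.subspace K" and a: "a \<in> I" and b: "b \<in> binform K j"
  shows "a * b \<in> binform K (Suc j)"
proof -
  obtain s c where s: "s \<notin> q" "\<forall>i. c i \<in> K" "s * b - bin j c \<in> J" using b unfolding binform_def by blast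
  obtain t where t: "t \<notin> q" "t * a \<in> idl.span (insert g2 (insert g1 J))" using two[OF a] by blast
  obtain v where "t * a - v * g2 \<in> idl.span (insert g1 J)" using t(2) idl.span_breakdown_eq by blast
  then obtain u where u: "(t * a - v * g2) - u * g1 \<in> J" using span_insert_ideal[OF J_ideal] by blast
  define e where "e i = u * (if i = 0 then 0 else c (i - 1)) + v * (if i \<le> j then c i else 0)" for i
  have "bin (Suc j) e = u * (g1 * bin j c) + v * (g2 * bin j c)"
    unfolding e_def bin_add bin_scale bin_mult_g1 bin_mult_g2 ..
  moreover have "t * a * (s * b - bin j c) + bin j c * ((t * a - v * g2) - u * g1) \<in> J"
    by (rule idl.subspace_add[OF J_ideal idl.subspace_scale[OF J_ideal s(3)] idl.subspace_scale[OF J_ideal u]])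
  ultimately have "(t * s) * (a * b) - bin (Suc j) e \<in> J" by (simp add: algebra_simps)
  moreover have "e i \<in> K" for i
    unfolding e_def using s(2) idl.subspace_0[OF K] idl.subspace_add[OF K] idl.subspace_scale[OF K] by simp
  ultimately show ?thesis by (intro binform_I[OF prime_idD(4)[OF q t(1) s(1)]])
qed

lemma ipow_binform:
  assumes K: "idl.subspace K"
  shows "ipow J I k \<subseteq> binform K i \<Longrightarrow> ipow J I (k + j) \<subseteq> binform K (i + j)"
proof (induction j)
  case (Suc j)
  have "a * b \<in> binform K (Suc (i + j))" if "a \<in> I" "b \<in> ipow J I (k + j)" for a b
    using binform_mult[OF K that(1)] Suc that(2) by blast
  moreover have "J \<subseteq> binform K (Suc (i + j))" by (rule binform_ideal(2)[OF K])
  ultimately have "ipow J I (Suc (k + j)) \<subseteq> binform K (Suc (i + j))"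
    unfolding ipow.simps by (intro idl.span_minimal binform_ideal(1)[OF K]) blast
  thus ?case by simp
qed simp

lemma binform_0: "K \<subseteq> binform K 0"
proof
  fix a assume a: "a \<in> K"
  have "1 * a - bin 0 (\<lambda>_. a) \<in> J" using idl.subspace_0[OF J_ideal] unfolding bin_def by simp
  thus "a \<in> binform K 0" by (rule binform_I[OF prime_idD(2)[OF q] a])
qed

lemma ipow_binform_UNIV: "ipow J I j \<subseteq> binform UNIV j"
  using ipow_binform[of UNIV 0 0 j] binform_0[of UNIV] by simp

lemma ipow_binform_I: "ipow J I (Suc j) \<subseteq> binform I j"
  using ipow_binform[OF I_ideal, of 1 0 j] binform_0[of I] ipow_subset_I[of 0] by simp

text \<open>Locally at \<open>q\<close> the quotient \<open>I\<^sup>j / I\<^bsup>j+1\<^esup>\<close> is free over \<open>R/I\<close>, so \<open>q\<close> can only be associated to \<open>I\<^sup>n\<close> if it is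
  associated to \<open>I\<close>.\<close>

lemma assoc_power_assoc:
  assumes eq: "q = {t. t * y \<in> ipow J I n}"
  shows "\<exists>c. q = {r. r * c \<in> I}"
proof -
  have qI: "idl.subspace q" using prime_idD(1)[OF q] .
  have locI: "idl.subspace (loc I)" "sat q (loc I)" "I \<subseteq> loc I" using sat_insert[OF q I_ideal] by blast+
  have "y \<notin> loc (ipow J I n)" unfolding loc_iff using eq by blast
  moreover have "y \<in> loc (ipow J I 0)" unfolding loc_iff using prime_idD(2)[OF q] by auto
  \<comment> \<open>The number \<open>j\<close> is the order of \<open>y\<close> in the
    \<open>I\<close>-adic filtration at \<open>q\<close>.\<close>
  ultimately obtain j where j: "j < n" "y \<in> loc (ipow J I j)" "y \<notin> loc (ipow J I (Suc j))"
  proof -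
    assume *: "\<And>j. j < n \<Longrightarrow> y \<in> loc (ipow J I j) \<Longrightarrow> y \<notin> loc (ipow J I (Suc j)) \<Longrightarrow> thesis"
    assume "y \<notin> loc (ipow J I n)" "y \<in> loc (ipow J I 0)"
    moreover have "y \<in> loc (ipow J I k)" if "k \<le> n" "\<not> thesis" for k
      using that(1)
    proof (induction k)
      case 0
      show ?case by (rule \<open>y \<in> loc (ipow J I 0)\<close>)
    next
      case (Suc k)
      thus ?case using *[of k] that(2) by auto
    qed
    ultimately show thesis by blast
  qed
  obtain s1 where s1: "s1 \<notin> q" "s1 * y \<in> ipow J I j" using j(2) unfolding loc_iff by blast
  then obtain s2 c where s2: "s2 \<notin> q" "s2 * (s1 * y) - bin j c \<in> J"
    using ipow_binform_UNIV[of j] unfolding binform_def by blast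
  define s where "s = s2 * s1"
  have s: "s \<notin> q" "s * y - bin j c \<in> J" unfolding s_def using prime_idD(4)[OF q s2(1) s1(1)] s2(2) by (auto simp: mult.assoc)
  \<comment> \<open>Otherwise a common denominator \<open>T\<close> would move \<open>y\<close>
    locally into the next power.\<close>
  have "\<exists>i\<le>j. c i \<notin> loc I"
  proof (rule ccontr)
    assume "\<not> ?thesis"
    hence "\<forall>i\<in>{..j}. \<exists>t. t \<notin> q \<and> t * c i \<in> I" unfolding loc_iff by auto
    then obtain t where t: "\<And>i. i \<le> j \<Longrightarrow> t i \<notin> q \<and> t i * c i \<in> I" by (metis atMost_iff)
    define T where "T = (\<Prod>i\<le>j. t i)"
    have Tq: "T \<notin> q" unfolding T_def using prime_id_prod[OF q, of "{..j}" t] t by simp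
    have Tc: "T * c i \<in> I" if "i \<le> j" for i
    proof -
      have "T = (\<Prod>k\<in>{..j} - {i}. t k) * t i" unfolding T_def using that by (simp add: prod.remove[of "{..j}" i] mult.commute)
      thus ?thesis using idl.subspace_scale[OF I_ideal, of "t i * c i"] t[OF that] by (simp add: mult.assoc)
    qed
    have "T * c i * g1 ^ i * g2 ^ (j - i) \<in> ipow J I (Suc j)" if "i \<le> j" for i
    proof -
      have "1 \<in> ipow J I 0" by simp
      hence "g2 ^ (j - i) * (g1 ^ i * 1) \<in> ipow J I (0 + i + (j - i))"
        by (intro ipow_mult_general g(1,2))
      hence "(T * c i) * (g2 ^ (j - i) * (g1 ^ i * 1)) \<in> ipow J I (Suc j)"
        using ipow_mult[OF Tc[OF that], of _ J j] that by simp
      thus ?thesis by (simp add: mult_ac)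
    qed
    hence "(\<Sum>i\<le>j. T * c i * g1 ^ i * g2 ^ (j - i)) \<in> ipow J I (Suc j)"
      by (intro idl.subspace_sum[OF ipow_subspace]) auto
    moreover have "T * bin j c = (\<Sum>i\<le>j. T * c i * g1 ^ i * g2 ^ (j - i))"
      unfolding bin_def by (simp add: sum_distrib_left mult.assoc)
    ultimately have "T * bin j c \<in> ipow J I (Suc j)" by (simp only:)
    moreover have "T * (s * y - bin j c) \<in> ipow J I (Suc j)"
      using idl.subspace_scale[OF J_ideal s(2)] ipow_base by blast
    ultimately have "T * (s * y - bin j c) + T * bin j c \<in> ipow J I (Suc j)"
      using idl.subspace_add[OF ipow_subspace] by blast
    hence "(T * s) * y \<in> ipow J I (Suc j)" by (simp add: algebra_simps)
    hence "y \<in> loc (ipow J I (Suc j))" unfolding loc_iff using prime_idD(4)[OF q Tq s(1)] by blast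
    thus False using j(3) by blast
  qed
  then obtain i where i: "i \<le> j" "c i \<notin> loc I" by blast
  \<comment> \<open>Multiplication by an element of \<open>q\<close> raises the order of
    \<open>y\<close>. Comparing the two resulting forms of degree \<open>j\<close> by
    quasi-regularity puts \<open>h * c i\<close> locally into \<open>I\<close>.\<close>
  have hq: "h * c i \<in> loc I" if h: "h \<in> q" for h
  proof -
    have "h * y \<in> ipow J I n" using h eq by blast
    moreover have "ipow J I n \<subseteq> ipow J I (Suc j)"
      using lift_Suc_antimono_le[of "ipow J I" "Suc j" n] ipow_Suc_subset j(1) by (metis Suc_leI)
    ultimately have "h * y \<in> binform I j" using ipow_binform_I by blast
    then obtain t e where t: "t \<notin> q" "\<forall>i. e i \<in> I" "t * (h * y) - bin j e \<in> J" unfolding binform_def by blast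
    have "s * (t * (h * y) - bin j e) - t * h * (s * y - bin j c) \<in> J"
      by (rule idl.subspace_diff[OF J_ideal idl.subspace_scale[OF J_ideal t(3)] idl.subspace_scale[OF J_ideal s(2)]])
    hence "bin j (\<lambda>i. t * h * c i - s * e i) \<in> J"
      unfolding bin_diff bin_scale by (simp add: algebra_simps)
    hence "t * h * c i - s * e i \<in> loc I" using quasi_regular i(1) by blast
    moreover have "s * e i \<in> loc I" using t(2) idl.subspace_scale[OF I_ideal] locI(3) by blast
    ultimately have "(t * h * c i - s * e i) + s * e i \<in> loc I" by (rule idl.subspace_add[OF locI(1)])
    hence "t * (h * c i) \<in> loc I" by (simp add: mult.assoc)
    thus ?thesis using satD[OF locI(2) t(1)] by blast
  qed
  have Bs: "idl.subspace {r. r * c i \<in> I}" using idl.ann_subspace[OF I_ideal] .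
  have "\<exists>t. t \<notin> q \<and> (\<forall>h\<in>q. t * h \<in> {r. r * c i \<in> I})"
  proof (rule nakayama_ideal[OF q J_noeth qI _ Bs])
    show "J \<subseteq> q" unfolding eq using ipow_base ideal_mult_right[OF J_ideal] by blast
    show "J \<subseteq> {r. r * c i \<in> I}" using J_I ideal_mult_right[OF I_ideal] by blast
    fix h assume "h \<in> q"
    then obtain t where t: "t \<notin> q" "t * (h * c i) \<in> I" using hq unfolding loc_iff by blast
    hence "t * h \<in> {r. r * c i \<in> I}" by (simp add: mult.assoc)
    thus "\<exists>t. t \<notin> q \<and> t * h \<in> idl.span ({r. r * c i \<in> I} \<union> {y * k | y k. y \<in> q \<and> k \<in> q})"
      using t(1) by (blast intro: idl.span_base)
  qed
  then obtain t where t: "t \<notin> q" "\<And>h. h \<in> q \<Longrightarrow> t * h * c i \<in> I" by blast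
  have "q = {r. r * (t * c i) \<in> I}"
  proof (intro Set.set_eqI iffI)
    fix h assume "h \<in> q"
    thus "h \<in> {r. r * (t * c i) \<in> I}" using t(2)[of h] by (simp add: mult_ac)
  next
    fix h assume "h \<in> {r. r * (t * c i) \<in> I}"
    hence I: "(h * t) * c i \<in> I" by (simp add: mult_ac)
    have "h * t \<in> q"
    proof (rule ccontr)
      assume "h * t \<notin> q"
      thus False using i(2) I unfolding loc_iff by blast
    qed
    thus "h \<in> q" using prime_idD(3)[OF q] t(1) by blast
  qed
  thus ?thesis by blast
qed

end

text \<open>A prime annihilating a multiple of \<open>r\<close> modulo the power contains
  \<open>I\<close> and differs from \<open>m\<close> by \<open>no_socle\<close>. It is therefore
  associated to \<open>I\<close>, where the assumption on \<open>r\<close> provides an annihilating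
  factor outside it.\<close>

theorem symbolic_power_equal:
  assumes n: "n < d - 1" and r: "\<And>Q c. prime_id Q \<Longrightarrow> Q = {r. r * c \<in> I} \<Longrightarrow> \<exists>s. s \<notin> Q \<and> s * r \<in> ipow J I n"
  shows "r \<in> ipow J I n"
proof (rule ccontr)
  assume nr: "r \<notin> ipow J I n"
  have "j * r \<in> ipow J I n" if "j \<in> J" for j using that ipow_base ideal_mult_right[OF J_ideal] by blast
  from idl.ann_prime[OF J_noeth ipow_subspace this nr]
  obtain s where s: "s * r \<notin> ipow J I n" "prime_id {t. t * (s * r) \<in> ipow J I n}" by blast
  define q where "q = {t. t * (s * r) \<in> ipow J I n}"
  have q: "prime_id q" unfolding q_def by (rule s(2))
  have "q \<noteq> m"
  proof
    assume "q = m"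
    hence "x i * (s * r) \<in> Ipow n" if "i < d" for i using x_m[OF that] unfolding q_def Ipow_eq by blast
    hence "s * r \<in> Ipow n" by (rule no_socle[OF n])
    thus False using s(1) unfolding Ipow_eq by blast
  qed
  moreover have "I \<subseteq> q"
  proof
    fix g assume "g \<in> I"
    hence "g ^ n * (s * r) \<in> ipow J I n" using ideal_mult_right[OF ipow_subspace ipow_power] by blast
    thus "g \<in> q" using prime_id_power[OF q] unfolding q_def by blast
  qed
  ultimately obtain g1 g2 where g: "g1 \<in> I" "g2 \<in> I" "g1 \<notin> J"
      "\<forall>a\<in>I. \<exists>s. s \<notin> q \<and> s * a \<in> idl.span (insert g2 (insert g1 J))"
      "\<forall>c. c * g2 \<in> idl.span (insert g1 J) \<longrightarrow> (\<exists>s. s \<notin> q \<and> s * c \<in> idl.span (insert g1 J))"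
    using lci[OF q] by blast
  obtain c where "q = {r. r * c \<in> I}"
    using assoc_power_assoc[OF q g(1-3) g(4)[rule_format] g(5)[rule_format] q_def] by blast
  then obtain t where t: "t \<notin> q" "t * r \<in> ipow J I n" using r[OF q] by blast
  have "s * (t * r) \<in> ipow J I n" by (rule idl.subspace_scale[OF ipow_subspace t(2)])
  hence "t * (s * r) \<in> ipow J I n" by (simp only: mult.left_commute)
  thus False using t(1) unfolding q_def by blast
qed

text \<open>The element from \<open>socle\<close> is multiplied into the power by every
  \<open>x i\<close>, and a prime associated to \<open>I\<close>, being different from
  \<open>m\<close>, misses one of them.\<close>

theorem symbolic_power_larger:
  assumes n: "d - 1 \<le> n"
  shows "\<exists>r. r \<notin> ipow J I n \<and> (\<forall>Q c. prime_id Q \<longrightarrow> Q = {r. r * c \<in> I} \<longrightarrow> (\<exists>s. s \<notin> Q \<and> s * r \<in> ipow J I n))"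
proof -
  obtain g where g: "\<And>i. i < d \<Longrightarrow> x i * g \<in> ipow J I n" "g \<notin> ipow J I n"
    using socle[OF n] unfolding Ipow_eq by blast
  have "\<exists>s. s \<notin> Q \<and> s * g \<in> ipow J I n" if Q: "prime_id Q" "Q = {r. r * c \<in> I}" for Q c
  proof -
    have JQ: "J \<subseteq> Q" unfolding Q(2) using J_I ideal_mult_right[OF I_ideal] by blast
    have "\<exists>i<d. x i \<notin> Q"
    proof (rule ccontr)
      assume "\<not> ?thesis"
      hence "m \<subseteq> Q" unfolding m_gen using JQ by (intro idl.span_minimal prime_idD(1)[OF Q(1)]) auto
      thus False using assoc_not_m[OF Q] prime_le_m[OF Q(1) JQ] by blast
    qed
    thus ?thesis using g(1) by blast
  qed
  thus ?thesis using g(2) by blast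
qed

end

section \<open>Rings with a carrier as quotients of type class rings\<close>

datatype 'a rterm = RVar 'a | RZero | ROne | RNeg "'a rterm"
  | RAdd "'a rterm" "'a rterm" | RMul "'a rterm" "'a rterm"

inductive req :: "'a rterm \<Rightarrow> 'a rterm \<Rightarrow> bool" where
  req_rfl: "req s s"
| req_sym: "req s t \<Longrightarrow> req t s"
| req_trans: "req s t \<Longrightarrow> req t u \<Longrightarrow> req s u"
| req_neg: "req s t \<Longrightarrow> req (RNeg s) (RNeg t)"
| req_add: "req s t \<Longrightarrow> req u v \<Longrightarrow> req (RAdd s u) (RAdd t v)"
| req_mul: "req s t \<Longrightarrow> req u v \<Longrightarrow> req (RMul s u) (RMul t v)"
| req_add_assoc: "req (RAdd (RAdd s t) u) (RAdd s (RAdd t u))"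
| req_add_comm: "req (RAdd s t) (RAdd t s)"
| req_zero: "req (RAdd RZero s) s"
| req_minus: "req (RAdd (RNeg s) s) RZero"
| req_mul_assoc: "req (RMul (RMul s t) u) (RMul s (RMul t u))"
| req_mul_comm: "req (RMul s t) (RMul t s)"
| req_one: "req (RMul ROne s) s"
| req_distrib: "req (RMul (RAdd s t) u) (RAdd (RMul s u) (RMul t u))"

quotient_type 'a fring = "'a rterm" / req
proof (rule equivpI)
  show "reflp req" by (rule reflpI) (rule req_rfl)
  show "symp req" by (rule sympI) (rule req_sym)
  show "transp req" by (rule transpI) (rule req_trans)
qed

text \<open>A model in the integers; it separates 0 from 1, as the type class demands.\<close>

primrec rint :: "'a rterm \<Rightarrow> int" where
  "rint (RVar a) = 0" | "rint RZero = 0" | "rint ROne = 1" | "rint (RNeg s) = - rint s"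
| "rint (RAdd s t) = rint s + rint t" | "rint (RMul s t) = rint s * rint t"

lemma req_rint: "req s t \<Longrightarrow> rint s = rint t"
  by (induction rule: req.induct) (simp_all add: algebra_simps)

instantiation fring :: (type) comm_ring_1
begin

lift_definition zero_fring :: "'a fring" is RZero .
lift_definition one_fring :: "'a fring" is ROne .
lift_definition uminus_fring :: "'a fring \<Rightarrow> 'a fring" is RNeg by (rule req_neg)
lift_definition plus_fring :: "'a fring \<Rightarrow> 'a fring \<Rightarrow> 'a fring" is RAdd by (rule req_add)
lift_definition times_fring :: "'a fring \<Rightarrow> 'a fring \<Rightarrow> 'a fring" is RMul by (rule req_mul)
definition minus_fring :: "'a fring \<Rightarrow> 'a fring \<Rightarrow> 'a fring" where
  "minus_fring s t = s + (- t)"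

instance
proof
  fix s t u :: "'a fring"
  show "s + t + u = s + (t + u)" by transfer (rule req_add_assoc)
  show "s + t = t + s" by transfer (rule req_add_comm)
  show "0 + s = s" by transfer (rule req_zero)
  show "- s + s = 0" by transfer (rule req_minus)
  show "s - t = s + (- t)" by (rule minus_fring_def)
  show "s * t * u = s * (t * u)" by transfer (rule req_mul_assoc)
  show "s * t = t * s" by transfer (rule req_mul_comm)
  show "1 * s = s" by transfer (rule req_one)
  show "(s + t) * u = s * u + t * u" by transfer (rule req_distrib)
  show "(0::'a fring) \<noteq> 1" by transfer (use req_rint in fastforce)
qed

end

text \<open>Variables are all elements of the type, so those outside the carrier are sent to
  zero.\<close>

primrec reval :: "('a, 'b) ring_scheme \<Rightarrow> 'a rterm \<Rightarrow> 'a" where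
  "reval R (RVar a) = (if a \<in> carrier R then a else \<zero>\<^bsub>R\<^esub>)"
| "reval R RZero = \<zero>\<^bsub>R\<^esub>" | "reval R ROne = \<one>\<^bsub>R\<^esub>"
| "reval R (RNeg s) = \<ominus>\<^bsub>R\<^esub> reval R s"
| "reval R (RAdd s t) = reval R s \<oplus>\<^bsub>R\<^esub> reval R t"
| "reval R (RMul s t) = reval R s \<otimes>\<^bsub>R\<^esub> reval R t"

definition fring_map :: "('a, 'b) ring_scheme \<Rightarrow> 'a fring \<Rightarrow> 'a" where
  "fring_map R x = reval R (rep_fring x)"

context cring
begin

lemma reval_closed [simp]: "reval R s \<in> carrier R"
  by (induction s) auto

lemma req_reval: "req s t \<Longrightarrow> reval R s = reval R t"
  by (induction rule: req.induct)
    (simp_all add: a_assoc m_assoc l_distr l_neg, simp_all add: a_comm m_comm)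

lemma fring_map_abs: "fring_map R (abs_fring s) = reval R s"
  unfolding fring_map_def
  by (rule req_reval) (rule Quotient3_rep_abs[OF Quotient3_fring], rule req_rfl)

end

text \<open>Stated for an arbitrary surjection from a type class ring, so that the same ring also
  covers every quotient of \<open>R\<close>, with a larger kernel.\<close>

locale ring_cover = cring R for R (structure) +
  fixes h :: "'p::comm_ring_1 \<Rightarrow> 'a"
  assumes h_surj: "range h = carrier R"
    and h_add: "h (x + y) = h x \<oplus> h y"
    and h_mult: "h (x * y) = h x \<otimes> h y"
    and h_one: "h 1 = \<one>"

lemma (in cring) ring_cover_fring: "ring_cover R (fring_map R)"
proof (intro ring_cover.intro ring_cover_axioms.intro is_cring)
  show "range (fring_map R) = carrier R"
  proof
    show "range (fring_map R) \<subseteq> carrier R" by (auto simp: fring_map_def)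
    show "carrier R \<subseteq> range (fring_map R)"
    proof
      fix a assume "a \<in> carrier R"
      hence "a = fring_map R (abs_fring (RVar a))" by (simp add: fring_map_abs)
      thus "a \<in> range (fring_map R)" by blast
    qed
  qed
  fix x y :: "'a fring"
  obtain s t where st: "x = abs_fring s" "y = abs_fring t" by (metis Quotient3_abs_rep[OF Quotient3_fring])
  show "fring_map R (x + y) = fring_map R x \<oplus> fring_map R y"
    unfolding st plus_fring.abs_eq fring_map_abs by simp
  show "fring_map R (x * y) = fring_map R x \<otimes> fring_map R y"
    unfolding st times_fring.abs_eq fring_map_abs by simp
  show "fring_map R 1 = \<one>" unfolding one_fring.abs_eq fring_map_abs by simp
qed

lemma rseq_nth:
  "idl.subspace J \<Longrightarrow> rseq J zs \<longleftrightarrow> (\<forall>i<length zs. \<forall>c. zs ! i * c \<in> idl.span (J \<union> set (take i zs)) \<longrightarrow>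
     c \<in> idl.span (J \<union> set (take i zs)))"
proof (induction zs arbitrary: J)
  case (Cons z zs)
  have "rseq (idl.span (insert z J)) zs \<longleftrightarrow> (\<forall>i<length zs. \<forall>c.
      (z # zs) ! Suc i * c \<in> idl.span (J \<union> set (take (Suc i) (z # zs))) \<longrightarrow>
      c \<in> idl.span (J \<union> set (take (Suc i) (z # zs))))"
    by (subst Cons.IH[OF idl.subspace_span]) (simp add: span_Un_insert)
  thus ?case
    using Cons.prems by (simp only: rseq.simps length_Cons All_less_Suc2) (simp add: idl.span_eq_iff[THEN iffD2])
qed simp

text \<open>The alternative \<open>n = 0\<close> accounts for the empty supremum, which is
  0.\<close>

lemma Sup_enat_ge:
  assumes "enat n \<le> Sup {enat k | k. Q k}"
  shows "n = 0 \<or> (\<exists>k\<ge>n. Q k)"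
proof (cases n)
  case (Suc l)
  hence "enat l < Sup {enat k | k. Q k}" using assms by (metis enat_ord_simps(2) lessI less_le_trans)
  then obtain k where "Q k" "enat l < enat k" unfolding less_Sup_iff by blast
  thus ?thesis using Suc by (intro disjI2 exI[of _ k]) auto
qed simp

lemma Sup_enat_le: "Sup {enat k | k. Q k} \<le> enat n \<Longrightarrow> Q k \<Longrightarrow> k \<le> n"
  by (metis (mono_tags, lifting) Sup_upper enat_ord_simps(1) mem_Collect_eq order_trans)

context ring_cover
begin

abbreviation hker :: "'p set" where "hker \<equiv> h -` {\<zero>}"

lemma h_closed [simp]: "h x \<in> carrier R"
  using h_surj by blast

lemma h_obtain: "a \<in> carrier R \<Longrightarrow> \<exists>x. h x = a"
  using h_surj by (metis imageE)

lemma h_zero [simp]: "h 0 = \<zero>"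
proof -
  have "h 0 \<oplus> h 0 = h 0" using h_add[of 0 0] by simp
  thus ?thesis by simp
qed

lemma h_uminus: "h (- x) = \<ominus> h x"
proof -
  have "h (- x) \<oplus> h x = \<zero>" using h_add[of "- x" x] by simp
  thus ?thesis by (simp add: minus_equality)
qed

lemma h_diff_zero: "h (x - y) = \<zero> \<longleftrightarrow> h x = h y"
proof -
  have "h (x - y) = h x \<ominus> h y" using h_add[of x "- y"] h_uminus[of y] by (simp add: a_minus_def)
  thus ?thesis by (simp add: r_right_minus_eq)
qed

lemma preimage_subspace:
  assumes "ideal A R"
  shows "idl.subspace (h -` A)" "hker \<subseteq> h -` A"
proof -
  interpret A: ideal A R by fact
  show "idl.subspace (h -` A)"
    by (rule idl.subspaceI) (auto simp: h_add h_mult A.I_l_closed)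
  show "hker \<subseteq> h -` A" by auto
qed

lemma hker_subspace: "idl.subspace hker"
  by (rule preimage_subspace(1)) (rule zeroideal)

lemma image_preimage: "A \<subseteq> carrier R \<Longrightarrow> h ` (h -` A) = A"
  by (simp add: image_vimage_eq h_surj inf.absorb1)

lemma preimage_image:
  assumes "idl.subspace B" "hker \<subseteq> B"
  shows "h -` (h ` B) = B"
proof -
  have "x \<in> B" if "h x = h b" "b \<in> B" for x b
  proof -
    have "x - b \<in> B" using that(1) assms(2) h_diff_zero by auto
    hence "(x - b) + b \<in> B" using idl.subspace_add[OF assms(1)] that(2) by blast
    thus ?thesis by simp
  qed
  thus ?thesis by (force simp: vimage_def)
qed

lemma image_ideal:
  assumes B: "idl.subspace B"
  shows "ideal (h ` B) R"
proof (rule idealI[OF ring_axioms])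
  show "subgroup (h ` B) (add_monoid R)"
  proof (rule add.subgroupI)
    show "h ` B \<subseteq> carrier R" by auto
    show "h ` B \<noteq> {}" using idl.subspace_0[OF B] by blast
    show "\<ominus> a \<in> h ` B" if "a \<in> h ` B" for a
      using that idl.subspace_neg[OF B] by (auto simp flip: h_uminus)
    show "a \<oplus> b \<in> h ` B" if "a \<in> h ` B" "b \<in> h ` B" for a b
      using that idl.subspace_add[OF B] by (auto simp flip: h_add)
  qed
  fix a x assume "a \<in> h ` B" "x \<in> carrier R"
  then obtain b y where eqs: "a = h b" "b \<in> B" "x = h y" using h_obtain by blast
  show "x \<otimes> a \<in> h ` B" using idl.subspace_scale[OF B eqs(2)] eqs(1,3) by (auto simp flip: h_mult)
  show "a \<otimes> x \<in> h ` B" using ideal_mult_right[OF B eqs(2)] eqs(1,3) by (auto simp flip: h_mult)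
qed

lemma preimage_Idl: "h -` (Idl (h ` S)) = idl.span (hker \<union> S)"
proof
  have S: "h ` S \<subseteq> carrier R" by auto
  have "ideal (h ` idl.span (hker \<union> S)) R" by (rule image_ideal) simp
  moreover have "h ` S \<subseteq> h ` idl.span (hker \<union> S)" using idl.span_superset by blast
  ultimately have "Idl (h ` S) \<subseteq> h ` idl.span (hker \<union> S)" by (rule genideal_minimal)
  hence "h -` (Idl (h ` S)) \<subseteq> h -` (h ` idl.span (hker \<union> S))" by blast
  also have "\<dots> = idl.span (hker \<union> S)" using idl.span_superset[of "hker \<union> S"] by (intro preimage_image) auto
  finally show "h -` (Idl (h ` S)) \<subseteq> idl.span (hker \<union> S)" .
  show "idl.span (hker \<union> S) \<subseteq> h -` (Idl (h ` S))"
    using preimage_subspace[OF genideal_ideal[OF S]] genideal_self[OF S] by (intro idl.span_minimal) auto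
qed

lemma preimage_eq_iff:
  assumes "A \<subseteq> carrier R" "B \<subseteq> carrier R"
  shows "h -` A \<subseteq> h -` B \<longleftrightarrow> A \<subseteq> B" "h -` A = h -` B \<longleftrightarrow> A = B"
proof -
  show "h -` A \<subseteq> h -` B \<longleftrightarrow> A \<subseteq> B"
    using image_preimage[OF assms(1)] image_preimage[OF assms(2)] by (metis image_mono vimage_mono)
  show "h -` A = h -` B \<longleftrightarrow> A = B"
    using image_preimage[OF assms(1)] image_preimage[OF assms(2)] by metis
qed

lemma ideal_sub: "ideal A R \<Longrightarrow> A \<subseteq> carrier R"
  by (rule additive_subgroup.a_subset[OF ideal.axioms(1)])

lemma prime_preimage:
  assumes "primeideal p R"
  shows "prime_id (h -` p)" "hker \<subseteq> h -` p" "p \<subseteq> carrier R"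
proof -
  interpret p: primeideal p R by fact
  have "\<one> \<notin> p" using p.one_imp_carrier p.I_notcarr by blast
  thus "prime_id (h -` p)" unfolding prime_id_def
    using preimage_subspace(1)[OF p.is_ideal] p.I_prime by (auto simp: h_one h_mult)
  show "hker \<subseteq> h -` p" "p \<subseteq> carrier R"
    using preimage_subspace[OF p.is_ideal] ideal_sub[OF p.is_ideal] by auto
qed

lemma prime_image:
  assumes B: "prime_id B" "hker \<subseteq> B"
  shows "primeideal (h ` B) R"
proof -
  have *: "h x \<in> h ` B \<longleftrightarrow> x \<in> B" for x
    using preimage_image[OF prime_idD(1)[OF B(1)] B(2)] by blast
  show ?thesis
  proof (rule primeidealI[OF image_ideal is_cring])
    show "idl.subspace B" using prime_idD(1)[OF B(1)] .
    show "carrier R \<noteq> h ` B" using *[of 1] prime_idD(2)[OF B(1)] h_closed by metis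
    fix a b assume ab: "a \<in> carrier R" "b \<in> carrier R" "a \<otimes> b \<in> h ` B"
    obtain x y where xy: "a = h x" "b = h y" using h_obtain ab by metis
    show "a \<in> h ` B \<or> b \<in> h ` B"
      using ab(3) prime_idD(3)[OF B(1)] unfolding xy h_mult[symmetric] * by blast
  qed
qed

lemma pchain_preimage:
  "prime_chain R n P \<Longrightarrow> pchain (h -` P 0) n (h -` P n)"
proof (induction n)
  case 0
  thus ?case using prime_preimage by (auto simp: prime_chain_def intro: pchain_refl)
next
  case (Suc n)
  hence p: "primeideal (P n) R" "primeideal (P (Suc n)) R" "P n \<subset> P (Suc n)" "prime_chain R n P"
    by (auto simp: prime_chain_def)
  have "h -` P n \<subset> h -` P (Suc n)"
    using preimage_eq_iff[of "P n" "P (Suc n)"] p prime_preimage(3) by blast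
  thus ?case using pchain_step[OF Suc.IH[OF p(4)] prime_preimage(1)[OF p(2)]] by blast
qed

lemma pchain_image:
  "pchain A n B \<Longrightarrow> hker \<subseteq> A \<Longrightarrow> \<exists>P. prime_chain R n P \<and> P 0 = h ` A \<and> P n = h ` B"
proof (induction rule: pchain.induct)
  case pchain_refl
  thus ?case by (intro exI[of _ "\<lambda>_. h ` A"]) (auto simp: prime_chain_def prime_image)
next
  case (pchain_step n B C)
  then obtain P where P: "prime_chain R n P" "P 0 = h ` A" "P n = h ` B" by blast
  have B: "idl.subspace B" "hker \<subseteq> B" and C: "idl.subspace C" "hker \<subseteq> C"
    using pchain_prime[OF pchain_step(1)] pchain_step prime_idD(1) by blast+
  have "h ` B \<subset> h ` C"
    using pchain_step(3) preimage_image[OF B] preimage_image[OF C] by blast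
  moreover have "primeideal (h ` C) R" using prime_image pchain_step(2) C(2) by blast
  ultimately have "prime_chain R (Suc n) (P(Suc n := h ` C))"
    using P unfolding prime_chain_def by (auto simp: less_Suc_eq le_Suc_eq)
  thus ?case using P by (intro exI[of _ "P(Suc n := h ` C)"]) (simp del: fun_upd_apply, simp)
qed

lemma noeth_hker:
  assumes "noetherian_ring R"
  shows "noeth hker"
proof (rule noethI_fg)
  interpret N: noetherian_ring R by fact
  fix B :: "'p set" assume B: "idl.subspace B" "hker \<subseteq> B"
  obtain A where A: "A \<subseteq> carrier R" "finite A" "h ` B = Idl A"
    using N.finetely_gen[OF image_ideal[OF B(1)]] by blast
  have "A \<subseteq> h ` B" using A genideal_self by auto
  then obtain G where G: "G \<subseteq> B" "finite G" "A = h ` G" using finite_subset_image[OF A(2)] by metis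
  have "B = h -` (Idl (h ` G))" using preimage_image[OF B] A(3) G(3) by simp
  thus "\<exists>G. finite G \<and> G \<subseteq> B \<and> B \<subseteq> idl.span (hker \<union> G)" using G(1,2) preimage_Idl by auto
qed

lemma nonzerodivisor_iff: "nonzerodivisor R (h a) \<longleftrightarrow> (\<forall>c. a * c \<in> hker \<longrightarrow> c \<in> hker)"
  unfolding nonzerodivisor_def using h_surj by (auto simp: h_mult) (metis h_obtain)

lemma quotient_zero_iff: "ideal A R \<Longrightarrow> A +> h x = \<zero>\<^bsub>R Quot A\<^esub> \<longleftrightarrow> h x \<in> A"
proof -
  assume A: "ideal A R"
  interpret A: ideal A R by fact
  show ?thesis
    unfolding FactRing_def using a_rcos_zero[OF A, of "h x"] A.a_rcos_self[OF h_closed[of x]] by auto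
qed

lemma quotient_cover:
  assumes A: "ideal A R"
  shows "ring_cover (R Quot A) (\<lambda>x. A +> h x)" "(\<lambda>x. A +> h x) -` {\<zero>\<^bsub>R Quot A\<^esub>} = h -` A"
proof -
  interpret A: ideal A R by fact
  interpret q: ring_hom_ring R "R Quot A" "(+>) A" by (rule A.rcos_ring_hom_ring)
  show "ring_cover (R Quot A) (\<lambda>x. A +> h x)"
  proof (intro ring_cover.intro ring_cover_axioms.intro A.quotient_is_cring is_cring)
    have "carrier (R Quot A) = (+>) A ` range h"
      unfolding h_surj FactRing_simps by auto
    thus "range (\<lambda>x. A +> h x) = carrier (R Quot A)" by auto
  qed (simp_all add: h_add h_mult h_one)
  show "(\<lambda>x. A +> h x) -` {\<zero>\<^bsub>R Quot A\<^esub>} = h -` A"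
    using quotient_zero_iff[OF A] by auto
qed

lemma regular_sequence_rseq:
  assumes "regular_sequence R (map h zs)"
  shows "rseq hker zs"
  unfolding rseq_nth[OF hker_subspace]
proof (intro allI impI)
  fix i c assume i: "i < length zs" and c: "zs ! i * c \<in> idl.span (hker \<union> set (take i zs))"
  let ?J = "Idl (h ` set (take i zs))"
  have J: "ideal ?J R" by (rule genideal_ideal) auto
  interpret Q: ring_cover "R Quot ?J" "\<lambda>x. ?J +> h x" by (rule quotient_cover[OF J])
  have eq: "h -` ?J = idl.span (hker \<union> set (take i zs))" by (rule preimage_Idl)
  have "nonzerodivisor (R Quot ?J) (?J +> h (zs ! i))"
    using assms i unfolding regular_sequence_def by (auto simp: Let_def take_map)
  hence "zs ! i * c \<in> h -` ?J \<longrightarrow> c \<in> h -` ?J"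
    unfolding Q.nonzerodivisor_iff quotient_cover(2)[OF J] by blast
  thus "c \<in> idl.span (hker \<union> set (take i zs))" unfolding eq using c by blast
qed

lemma preimage_ideal_power:
  assumes I: "ideal I R"
  shows "h -` (ideal_power R I n) = ipow hker (h -` I) n \<and> ideal (ideal_power R I n) R"
proof (induction n)
  case 0
  show ?case by (auto simp: nat_pow_def ideals_set_def oneideal)
next
  case (Suc n)
  let ?B = "ideal_power R I n" and ?C = "ideal_power R I (Suc n)"
  have eq: "?C = ?B \<cdot> I" by (simp add: nat_pow_def ideals_set_def)
  have B: "ideal ?B R" "h -` ?B = ipow hker (h -` I) n" using Suc by auto
  have C: "ideal ?C R" unfolding eq using ideal_prod_is_ideal[OF B(1) I] .
  let ?S = "{a * b | a b. a \<in> h -` I \<and> b \<in> ipow hker (h -` I) n}"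
  have "h -` ?C \<subseteq> idl.span (hker \<union> ?S)"
  proof
    fix x assume "x \<in> h -` ?C"
    hence "h x \<in> ?B \<cdot> I" using eq by simp
    moreover have "\<forall>x. h x = r \<longrightarrow> x \<in> idl.span (hker \<union> ?S)" if "r \<in> ?B \<cdot> I" for r
      using that
    proof (induction rule: ideal_prod.induct)
      case (prod i j)
      obtain b a where ab: "i = h b" "j = h a" using prod h_obtain ideal_sub[OF B(1)] ideal_sub[OF I] by (metis subsetD)
      show ?case
      proof (intro allI impI)
        fix x assume "h x = i \<otimes> j"
        hence "x - a * b \<in> hker" using ab by (simp add: h_diff_zero h_mult m_comm)
        moreover have "a * b \<in> ?S" using prod ab B(2) by blast
        ultimately have "(x - a * b) + a * b \<in> idl.span (hker \<union> ?S)"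
          by (intro idl.span_add) (auto intro: idl.span_base)
        thus "x \<in> idl.span (hker \<union> ?S)" by simp
      qed
    next
      case (sum s1 s2)
      have "?B \<cdot> I \<subseteq> carrier R" using ideal_prod_in_carrier[OF B(1) I] .
      then obtain a b where ab: "s1 = h a" "s2 = h b" using sum h_obtain by (metis subsetD)
      show ?case
      proof (intro allI impI)
        fix x assume "h x = s1 \<oplus> s2"
        hence "x - (a + b) \<in> hker" using ab by (simp add: h_diff_zero h_add)
        hence "x - (a + b) \<in> idl.span (hker \<union> ?S)" by (auto intro: idl.span_base)
        moreover have "a \<in> idl.span (hker \<union> ?S)" "b \<in> idl.span (hker \<union> ?S)" using sum.IH ab by auto
        ultimately have "(x - (a + b)) + (a + b) \<in> idl.span (hker \<union> ?S)"
          by (intro idl.span_add)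
        thus "x \<in> idl.span (hker \<union> ?S)" by simp
      qed
    qed
    ultimately show "x \<in> idl.span (hker \<union> ?S)" by blast
  qed
  moreover have "?S \<subseteq> h -` ?C"
  proof
    fix y assume "y \<in> ?S"
    then obtain a b where ab: "y = a * b" "h a \<in> I" "h b \<in> ?B" using B(2) by blast
    have "h y = h b \<otimes> h a" unfolding ab(1) h_mult by (rule m_comm) simp_all
    thus "y \<in> h -` ?C" unfolding eq using ideal_prod.prod[of "h b" ?B "h a" I R] ab by simp
  qed
  hence "idl.span (hker \<union> ?S) \<subseteq> h -` ?C"
    using preimage_subspace[OF C] by (intro idl.span_minimal) auto
  ultimately have "h -` ?C = idl.span (hker \<union> ?S)" by (rule equalityI)
  thus ?case using C unfolding ipow.simps by (rule conjI)
qed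

lemma associated_primes_preimage:
  assumes I: "ideal I R"
  shows "p \<in> associated_primes R I \<longleftrightarrow>
    (\<exists>Q c. prime_id Q \<and> Q = {r. r * c \<in> h -` I} \<and> p = h ` Q)"
proof -
  interpret I: ideal I R by fact
  interpret Q: ring_cover "R Quot I" "\<lambda>x. I +> h x" by (rule quotient_cover[OF I])
  have *: "(I +> h r) \<otimes>\<^bsub>R Quot I\<^esub> (I +> h c) = \<zero>\<^bsub>R Quot I\<^esub> \<longleftrightarrow> r * c \<in> h -` I" for r c
    using quotient_cover(2)[OF I] Q.h_mult[of r c] by auto
  show ?thesis
  proof
    assume p: "p \<in> associated_primes R I"
    then obtain c where c: "primeideal p R" "c \<in> carrier (R Quot I)"
      "p = {r \<in> carrier R. (I +> r) \<otimes>\<^bsub>R Quot I\<^esub> c = \<zero>\<^bsub>R Quot I\<^esub>}"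
      unfolding associated_primes_def by blast
    obtain c' where c': "c = I +> h c'" using Q.h_obtain c(2) by metis
    have "h -` p = {r. r * c' \<in> h -` I}" using *[of _ c'] unfolding c(3) c' by auto
    moreover have "p = h ` (h -` p)" using image_preimage prime_preimage(3)[OF c(1)] by auto
    ultimately show "\<exists>Q c. prime_id Q \<and> Q = {r. r * c \<in> h -` I} \<and> p = h ` Q"
      using prime_preimage(1)[OF c(1)] by blast
  next
    assume "\<exists>Q c. prime_id Q \<and> Q = {r. r * c \<in> h -` I} \<and> p = h ` Q"
    then obtain Q c where Q: "prime_id Q" "Q = {r. r * c \<in> h -` I}" "p = h ` Q" by blast
    have ker: "hker \<subseteq> Q"
      unfolding Q(2) using preimage_subspace[OF I] ideal_mult_right[OF hker_subspace] by blast
    have "p = {r \<in> carrier R. (I +> r) \<otimes>\<^bsub>R Quot I\<^esub> (I +> h c) = \<zero>\<^bsub>R Quot I\<^esub>}"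
    proof (rule Set.set_eqI)
      fix r
      show "r \<in> p \<longleftrightarrow> r \<in> {r \<in> carrier R. (I +> r) \<otimes>\<^bsub>R Quot I\<^esub> (I +> h c) = \<zero>\<^bsub>R Quot I\<^esub>}"
      proof (cases "r \<in> carrier R")
        case True
        then obtain x where x: "r = h x" using h_obtain by blast
        have "h x \<in> p \<longleftrightarrow> x \<in> Q" using preimage_image[OF prime_idD(1)[OF Q(1)] ker] Q(3) by blast
        thus ?thesis unfolding x using *[of x c] Q(2) by auto
      next
        case False
        thus ?thesis using Q(3) by auto
      qed
    qed
    moreover have "primeideal p R" unfolding Q(3) by (rule prime_image[OF Q(1) ker])
    ultimately show "p \<in> associated_primes R I" unfolding associated_primes_def using Q.h_closed[of c] by blast
  qed
qed

end

section \<open>Localization\<close>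

context cm_height_two
begin

text \<open>Suppose \<open>I\<close> is generated by \<open>g\<close> at \<open>p\<close>, and write
  \<open>s * a = a' * g\<close>. Then \<open>t * a'\<close> is multiplied by \<open>I\<close> into
  the ideal of \<open>a\<close>, so grade two gives \<open>t * a' = c * a\<close>. Cancelling
  \<open>a\<close> yields \<open>t * s = c * g\<close> modulo \<open>J\<close>, an element of
  \<open>p\<close> although \<open>t\<close> and \<open>s\<close> are not.\<close>

lemma not_locally_principal:
  assumes g: "g \<in> I" and p: "prime_id p" "I \<subseteq> p"
    and pr: "\<And>a. a \<in> I \<Longrightarrow> \<exists>s. s \<notin> p \<and> s * a \<in> idl.span (insert g J)"
  shows False
proof -
  have span_iff: "x \<in> idl.span (insert b J) \<longleftrightarrow> (\<exists>c. x - c * b \<in> J)" for x b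
    using span_insert_ideal[OF J_ideal] by auto
  obtain a where a: "a \<in> I" "a \<notin> J" using I_not_J by blast
  obtain s where s: "s \<notin> p" "s * a \<in> idl.span (insert g J)" using pr[OF a(1)] by blast
  obtain a' where a': "s * a - a' * g \<in> J" using s(2) span_iff by blast
  have "\<exists>t. t \<notin> p \<and> (\<forall>f\<in>I. t * f \<in> idl.span (insert g J))"
  proof (rule nakayama_ideal[OF p(1) J_noeth I_ideal J_I idl.subspace_span])
    show "J \<subseteq> idl.span (insert g J)" using idl.span_superset by blast
    fix f assume "f \<in> I"
    then obtain t where "t \<notin> p" "t * f \<in> idl.span (insert g J)" using pr by blast
    thus "\<exists>t. t \<notin> p \<and> t * f \<in> idl.span (idl.span (insert g J) \<union> {y * k | y k. y \<in> p \<and> k \<in> I})"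
      by (blast intro: idl.span_base)
  qed
  then obtain t where t: "t \<notin> p" "\<And>f. f \<in> I \<Longrightarrow> t * f \<in> idl.span (insert g J)" by blast
  have "t * a' \<in> idl.span (insert a J)"
  proof (rule grade_two[OF a])
    fix f assume "f \<in> I"
    then obtain f' where f': "t * f - f' * g \<in> J" using t(2) span_iff by blast
    have "a' * (t * f - f' * g) - f' * (s * a - a' * g) \<in> J"
      by (rule idl.subspace_diff[OF J_ideal idl.subspace_scale[OF J_ideal f'] idl.subspace_scale[OF J_ideal a']])
    hence "f * (t * a') - (f' * s) * a \<in> J" by (simp add: algebra_simps)
    thus "f * (t * a') \<in> idl.span (insert a J)" using span_iff by blast
  qed
  then obtain c where c: "t * a' - c * a \<in> J" using span_iff by blast
  have "t * (s * a - a' * g) + g * (t * a' - c * a) \<in> J"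
    by (rule idl.subspace_add[OF J_ideal idl.subspace_scale[OF J_ideal a'] idl.subspace_scale[OF J_ideal c]])
  hence "a * (t * s - c * g) \<in> J" by (simp add: algebra_simps)
  hence "t * s - c * g \<in> I" using J_prime_mult[OF a(2)] J_I by blast
  hence "(t * s - c * g) + c * g \<in> I" by (rule idl.subspace_add[OF I_ideal _ idl.subspace_scale[OF I_ideal g]])
  hence "t * s \<in> p" using p(2) by auto
  thus False using prime_idD(4)[OF p(1) t(1) s(1)] by blast
qed

end

lemma (in cring) nonzerodivisor_quotD:
  assumes A: "ideal A R" and a: "a \<in> carrier R" and nz: "nonzerodivisor (R Quot A) (A +> a)"
    and b: "b \<in> carrier R" "a \<otimes> b \<in> A"
  shows "b \<in> A"
proof -
  interpret A: ideal A R by fact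
  note hom = A.rcos_ring_hom
  have zero: "\<zero>\<^bsub>R Quot A\<^esub> = A" unfolding FactRing_def by (rule ring.select_convs)
  have "(A +> a) \<otimes>\<^bsub>R Quot A\<^esub> (A +> b) = \<zero>\<^bsub>R Quot A\<^esub>"
    using ring_hom_mult[OF hom a b(1)] a_rcos_zero[OF A b(2)] unfolding zero by metis
  hence "A +> b = A"
    using nz ring_hom_closed[OF hom b(1)] unfolding nonzerodivisor_def zero by blast
  thus ?thesis using A.a_rcos_self[OF b(1)] by simp
qed

text \<open>Fractions are represented by numerators and denominators in the covering ring, where the
  ring axioms and equality tests reduce to polynomial identities.\<close>

locale ring_cover_prime = ring_cover R h for R (structure) and h :: "'p::comm_ring_1 \<Rightarrow> 'a" +
  fixes p :: "'a set"
  assumes p_prime: "primeideal p R"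
begin

definition hp :: "'p set" where "hp = h -` p"

abbreviation L where "L \<equiv> loc_at R p"

definition frac where "frac a s = loc_frac R (carrier R - p) (h a) (h s)"

lemmas hp = prime_preimage[OF p_prime, folded hp_def]
lemmas S_one [simp] = prime_idD(2)[OF hp(1)] and S_mult [simp] = prime_idD(4)[OF hp(1)]

definition frel where "frel a s b t \<longleftrightarrow> (\<exists>u. u \<notin> hp \<and> u * (a * t - b * s) \<in> hker)"

lemma frac_mem:
  "(x, y) \<in> frac a s \<longleftrightarrow> (\<exists>b t. x = h b \<and> y = h t \<and> t \<notin> hp \<and> frel a s b t)"
proof -
  have *: "u * (a * t - b * s) \<in> hker \<longleftrightarrow> h u \<otimes> (h a \<otimes> h t) = h u \<otimes> (h b \<otimes> h s)" for u b t
    using h_diff_zero[of "u * (a * t)" "u * (b * s)"] by (simp add: right_diff_distrib h_mult)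
  have S: "(\<exists>u\<in>carrier R - p. Q u) \<longleftrightarrow> (\<exists>u. u \<notin> hp \<and> Q (h u))" for Q
    unfolding hp_def using h_obtain by (auto; metis)
  have mem: "(x, y) \<in> frac a s \<longleftrightarrow> x \<in> carrier R \<and> y \<in> carrier R - p \<and>
      (\<exists>u. u \<notin> hp \<and> h u \<otimes> (h a \<otimes> y) = h u \<otimes> (x \<otimes> h s))"
    unfolding frac_def loc_frac_def S by simp
  show ?thesis
  proof
    assume xy: "(x, y) \<in> frac a s"
    then obtain b t where bt: "x = h b" "y = h t" using mem h_obtain[of x] h_obtain[of y] by auto
    thus "\<exists>b t. x = h b \<and> y = h t \<and> t \<notin> hp \<and> frel a s b t"
      using xy unfolding mem frel_def * by (intro exI[of _ b] exI[of _ t]) (simp add: hp_def)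
  next
    assume "\<exists>b t. x = h b \<and> y = h t \<and> t \<notin> hp \<and> frel a s b t"
    then obtain b t where "x = h b" "y = h t" "t \<notin> hp" "frel a s b t" by blast
    thus "(x, y) \<in> frac a s" unfolding mem frel_def * by (simp add: hp_def)
  qed
qed

lemma frel_sym: "frel a s b t \<Longrightarrow> frel b t a s"
proof -
  assume "frel a s b t"
  then obtain u where u: "u \<notin> hp" "u * (a * t - b * s) \<in> hker" unfolding frel_def by blast
  have "- (u * (a * t - b * s)) \<in> hker" by (rule idl.subspace_neg[OF hker_subspace u(2)])
  thus ?thesis using u(1) unfolding frel_def by (intro exI[of _ u]) (simp add: algebra_simps)
qed

lemma frel_trans:
  assumes "frel a s b t" "frel b t c w" "t \<notin> hp"
  shows "frel a s c w"
proof -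
  obtain u where u: "u \<notin> hp" "u * (a * t - b * s) \<in> hker" using assms(1) unfolding frel_def by blast
  obtain v where v: "v \<notin> hp" "v * (b * w - c * t) \<in> hker" using assms(2) unfolding frel_def by blast
  have "v * w * (u * (a * t - b * s)) + u * s * (v * (b * w - c * t)) \<in> hker"
    by (rule idl.subspace_add[OF hker_subspace idl.subspace_scale[OF hker_subspace u(2)]
          idl.subspace_scale[OF hker_subspace v(2)]])
  hence "(u * v * t) * (a * w - c * s) \<in> hker" by (simp add: algebra_simps)
  thus ?thesis using u(1) v(1) assms(3) unfolding frel_def by (intro exI[of _ "u * v * t"]) simp
qed

lemma frelI: "a * t - b * s \<in> hker \<Longrightarrow> frel a s b t"
  unfolding frel_def by (intro exI[of _ 1]) simp

lemma frel_eqI: "a * t = b * s \<Longrightarrow> frel a s b t"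
  by (rule frelI) simp

lemma frac_eq:
  assumes "s \<notin> hp" "t \<notin> hp"
  shows "frac a s = frac b t \<longleftrightarrow> frel a s b t"
proof
  assume "frac a s = frac b t"
  moreover have "(h b, h t) \<in> frac b t"
    unfolding frac_mem using assms frel_eqI[of b t b t] by blast
  ultimately obtain b' t' where b': "h b = h b'" "h t = h t'" "t' \<notin> hp" "frel a s b' t'"
    unfolding frac_mem[symmetric] using frac_mem by blast
  have "frel b' t' b t"
  proof (rule frelI)
    show "b' * t - b * t' \<in> hker" using b'(1,2) by (simp add: h_diff_zero h_mult)
  qed
  thus "frel a s b t" using frel_trans b' by blast
next
  assume r: "frel a s b t"
  show "frac a s = frac b t"
  proof (rule Set.set_eqI)
    fix z :: "'a \<times> 'a"
    obtain x y where z: "z = (x, y)" by fastforce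
    show "z \<in> frac a s \<longleftrightarrow> z \<in> frac b t"
      unfolding z frac_mem using frel_trans[OF r] frel_trans[OF frel_sym[OF r]] assms by blast
  qed
qed

lemma frac_self: "s \<notin> hp \<Longrightarrow> (h a, h s) \<in> frac a s"
  unfolding frac_mem using frel_eqI[of a s a s] by blast

lemma L_carrier: "carrier L = {frac a s | a s. s \<notin> hp}"
proof -
  have eq: "carrier L = {loc_frac R (carrier R - p) a s | a s. a \<in> carrier R \<and> s \<in> carrier R - p}"
    by (simp add: localization_def)
  have "\<exists>a' s'. loc_frac R (carrier R - p) a s = frac a' s' \<and> s' \<notin> hp"
    if as: "a \<in> carrier R" "s \<in> carrier R - p" for a s
  proof -
    obtain a' s' where "a = h a'" "s = h s'" using as h_obtain[of a] h_obtain[of s] by auto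
    thus ?thesis using as(2) unfolding frac_def hp_def by auto
  qed
  moreover have "\<exists>a' s'. frac a s = loc_frac R (carrier R - p) a' s' \<and> a' \<in> carrier R \<and> s' \<in> carrier R - p"
    if s: "s \<notin> hp" for a s
    using s unfolding frac_def hp_def by (intro exI[of _ "h a"] exI[of _ "h s"]) simp
  ultimately show ?thesis unfolding eq by blast
qed

lemma L_one: "\<one>\<^bsub>L\<^esub> = frac 1 1" and L_zero: "\<zero>\<^bsub>L\<^esub> = frac 0 1"
  by (simp_all add: localization_def frac_def h_one)

lemma loc_map_frac: "loc_map R p (h a) = frac a 1"
  by (simp add: frac_def h_one)

lemma frel_closed:
  assumes "frel a s a' s'" "frel b t b' t'"
  shows "frel (a * b) (s * t) (a' * b') (s' * t')" "frel (a * t + b * s) (s * t) (a' * t' + b' * s') (s' * t')"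
proof -
  obtain u where u: "u \<notin> hp" "u * (a * s' - a' * s) \<in> hker" using assms(1) unfolding frel_def by blast
  obtain v where v: "v \<notin> hp" "v * (b * t' - b' * t) \<in> hker" using assms(2) unfolding frel_def by blast
  have *: "c * (u * (a * s' - a' * s)) + e * (v * (b * t' - b' * t)) \<in> hker" for c e
    by (rule idl.subspace_add[OF hker_subspace idl.subspace_scale[OF hker_subspace u(2)]
          idl.subspace_scale[OF hker_subspace v(2)]])
  show "frel (a * b) (s * t) (a' * b') (s' * t')"
    using *[of "v * b * t'" "u * a' * s"] u(1) v(1) unfolding frel_def
    by (intro exI[of _ "u * v"]) (simp add: algebra_simps)
  show "frel (a * t + b * s) (s * t) (a' * t' + b' * s') (s' * t')"
    using *[of "v * t * t'" "u * s * s'"] u(1) v(1) unfolding frel_def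
    by (intro exI[of _ "u * v"]) (simp add: algebra_simps)
qed

lemma L_ops:
  assumes s: "s \<notin> hp" and t: "t \<notin> hp"
  shows "frac a s \<otimes>\<^bsub>L\<^esub> frac b t = frac (a * b) (s * t)"
    and "frac a s \<oplus>\<^bsub>L\<^esub> frac b t = frac (a * t + b * s) (s * t)"
proof -
  have U: "(\<Union>(x, y)\<in>frac a s. \<Union>(z, w)\<in>frac b t. F x y z w) = C"
    if F: "\<And>a' s' b' t'. s' \<notin> hp \<Longrightarrow> t' \<notin> hp \<Longrightarrow> frel a s a' s' \<Longrightarrow> frel b t b' t' \<Longrightarrow>
      F (h a') (h s') (h b') (h t') = C" for F :: "'a \<Rightarrow> 'a \<Rightarrow> 'a \<Rightarrow> 'a \<Rightarrow> ('a \<times> 'a) set" and C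
  proof
    show "(\<Union>(x, y)\<in>frac a s. \<Union>(z, w)\<in>frac b t. F x y z w) \<subseteq> C"
      using F by (fastforce simp: frac_mem)
    show "C \<subseteq> (\<Union>(x, y)\<in>frac a s. \<Union>(z, w)\<in>frac b t. F x y z w)"
      using F[OF s t frel_eqI frel_eqI, of a b] frac_self[OF s, of a] frac_self[OF t, of b] by fastforce
  qed
  show "frac a s \<otimes>\<^bsub>L\<^esub> frac b t = frac (a * b) (s * t)"
    unfolding localization_def monoid.simps
  proof (rule U)
    fix a' s' b' t' assume r: "s' \<notin> hp" "t' \<notin> hp" "frel a s a' s'" "frel b t b' t'"
    have "frac (a * b) (s * t) = frac (a' * b') (s' * t')"
      by (subst frac_eq) (use s t r in \<open>auto intro: frel_closed\<close>)
    thus "loc_frac R (carrier R - p) (h a' \<otimes> h b') (h s' \<otimes> h t') = frac (a * b) (s * t)"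
      by (simp add: frac_def h_mult)
  qed
  show "frac a s \<oplus>\<^bsub>L\<^esub> frac b t = frac (a * t + b * s) (s * t)"
    unfolding localization_def ring.simps
  proof (rule U)
    fix a' s' b' t' assume r: "s' \<notin> hp" "t' \<notin> hp" "frel a s a' s'" "frel b t b' t'"
    have "frac (a * t + b * s) (s * t) = frac (a' * t' + b' * s') (s' * t')"
      by (subst frac_eq) (use s t r in \<open>auto intro: frel_closed\<close>)
    thus "loc_frac R (carrier R - p) (h a' \<otimes> h t' \<oplus> h b' \<otimes> h s') (h s' \<otimes> h t') = frac (a * t + b * s) (s * t)"
      by (simp add: frac_def h_mult h_add)
  qed
qed

lemma L_E:
  assumes "x \<in> carrier L"
  obtains a s where "s \<notin> hp" "x = frac a s"
  using assms unfolding L_carrier by blast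

lemma L_I [simp]: "s \<notin> hp \<Longrightarrow> frac a s \<in> carrier L"
  unfolding L_carrier by blast

lemma L_cring: "cring L"
proof (rule cringI)
  show "abelian_group L"
  proof (rule abelian_groupI)
    show "\<zero>\<^bsub>L\<^esub> \<in> carrier L" unfolding L_zero by simp
    fix x assume x: "x \<in> carrier L"
    obtain a s where a: "s \<notin> hp" "x = frac a s" using x by (rule L_E)
    show "\<zero>\<^bsub>L\<^esub> \<oplus>\<^bsub>L\<^esub> x = x" unfolding L_zero a(2) using a(1) by (simp add: L_ops)
    show "\<exists>y\<in>carrier L. y \<oplus>\<^bsub>L\<^esub> x = \<zero>\<^bsub>L\<^esub>"
    proof (rule bexI)
      show "frac (- a) s \<in> carrier L" using a(1) by simp
      show "frac (- a) s \<oplus>\<^bsub>L\<^esub> x = \<zero>\<^bsub>L\<^esub>"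
        unfolding L_zero a(2) L_ops[OF a(1) a(1)] by (subst frac_eq) (use a(1) frel_eqI in auto)
    qed
    fix y assume y: "y \<in> carrier L"
    obtain b t where b: "t \<notin> hp" "y = frac b t" using y by (rule L_E)
    show "x \<oplus>\<^bsub>L\<^esub> y \<in> carrier L" unfolding a(2) b(2) using a(1) b(1) by (simp add: L_ops)
    show "x \<oplus>\<^bsub>L\<^esub> y = y \<oplus>\<^bsub>L\<^esub> x"
      unfolding a(2) b(2) using a(1) b(1) by (simp add: L_ops algebra_simps)
    fix z assume z: "z \<in> carrier L"
    obtain c w where c: "w \<notin> hp" "z = frac c w" using z by (rule L_E)
    show "x \<oplus>\<^bsub>L\<^esub> y \<oplus>\<^bsub>L\<^esub> z = x \<oplus>\<^bsub>L\<^esub> (y \<oplus>\<^bsub>L\<^esub> z)"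
      unfolding a(2) b(2) c(2) using a(1) b(1) c(1) by (simp add: L_ops) (simp add: algebra_simps)
  qed
  show "comm_monoid L"
  proof (rule comm_monoidI)
    show "\<one>\<^bsub>L\<^esub> \<in> carrier L" unfolding L_one by simp
    fix x assume x: "x \<in> carrier L"
    obtain a s where a: "s \<notin> hp" "x = frac a s" using x by (rule L_E)
    show "\<one>\<^bsub>L\<^esub> \<otimes>\<^bsub>L\<^esub> x = x" unfolding L_one a(2) using a(1) by (simp add: L_ops)
    fix y assume y: "y \<in> carrier L"
    obtain b t where b: "t \<notin> hp" "y = frac b t" using y by (rule L_E)
    show "x \<otimes>\<^bsub>L\<^esub> y \<in> carrier L" unfolding a(2) b(2) using a(1) b(1) by (simp add: L_ops)
    show "x \<otimes>\<^bsub>L\<^esub> y = y \<otimes>\<^bsub>L\<^esub> x"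
      unfolding a(2) b(2) using a(1) b(1) by (simp add: L_ops mult.commute)
    fix z assume z: "z \<in> carrier L"
    obtain c w where c: "w \<notin> hp" "z = frac c w" using z by (rule L_E)
    show "x \<otimes>\<^bsub>L\<^esub> y \<otimes>\<^bsub>L\<^esub> z = x \<otimes>\<^bsub>L\<^esub> (y \<otimes>\<^bsub>L\<^esub> z)"
      unfolding a(2) b(2) c(2) using a(1) b(1) c(1) by (simp add: L_ops mult.assoc)
  qed
  fix x y z assume x: "x \<in> carrier L" and y: "y \<in> carrier L" and z: "z \<in> carrier L"
  obtain a s where a: "s \<notin> hp" "x = frac a s" using x by (rule L_E)
  obtain b t where b: "t \<notin> hp" "y = frac b t" using y by (rule L_E)
  obtain c w where c: "w \<notin> hp" "z = frac c w" using z by (rule L_E)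
  show "(x \<oplus>\<^bsub>L\<^esub> y) \<otimes>\<^bsub>L\<^esub> z = x \<otimes>\<^bsub>L\<^esub> z \<oplus>\<^bsub>L\<^esub> y \<otimes>\<^bsub>L\<^esub> z"
    unfolding a(2) b(2) c(2) L_ops(1)[OF a(1) c(1)] L_ops(1)[OF b(1) c(1)] L_ops(2)[OF a(1) b(1)]
      L_ops(1)[OF S_mult[OF a(1) b(1)] c(1)] L_ops(2)[OF S_mult[OF a(1) c(1)] S_mult[OF b(1) c(1)]]
    by (subst frac_eq) (use a(1) b(1) c(1) in \<open>auto intro!: frel_eqI simp: algebra_simps\<close>)
qed

sublocale L: cring L by (rule L_cring)

definition ext where "ext A = {frac a s | a s. a \<in> A \<and> s \<notin> hp}"

definition contr where "contr B = {a. frac a 1 \<in> B}"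

text \<open>The passage from localization to the language of factors outside the prime.\<close>

lemma frac_ext_iff:
  assumes A: "idl.subspace A" "hker \<subseteq> A" and s: "s \<notin> hp"
  shows "frac a s \<in> ext A \<longleftrightarrow> (\<exists>t. t \<notin> hp \<and> t * a \<in> A)"
proof
  assume "frac a s \<in> ext A"
  then obtain b t where b: "frac a s = frac b t" "b \<in> A" "t \<notin> hp" unfolding ext_def by blast
  then obtain u where u: "u \<notin> hp" "u * (a * t - b * s) \<in> hker" using frac_eq[OF s b(3)] unfolding frel_def by auto
  have "u * (a * t - b * s) + (u * s) * b \<in> A"
    using u(2) A(2) by (intro idl.subspace_add[OF A(1) _ idl.subspace_scale[OF A(1) b(2)]]) blast
  hence "(u * t) * a \<in> A" by (simp add: algebra_simps)
  thus "\<exists>t. t \<notin> hp \<and> t * a \<in> A" using S_mult[OF u(1) b(3)] by blast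
next
  assume "\<exists>t. t \<notin> hp \<and> t * a \<in> A"
  then obtain t where t: "t \<notin> hp" "t * a \<in> A" by blast
  have "frac a s = frac (t * a) (t * s)" by (subst frac_eq) (use s t in \<open>auto intro!: frel_eqI simp: algebra_simps\<close>)
  thus "frac a s \<in> ext A" unfolding ext_def using t S_mult[OF t(1) s] by blast
qed

lemma ext_ideal:
  assumes A: "idl.subspace A"
  shows "ideal (ext A) L"
proof (rule idealI[OF L.ring_axioms])
  have sc: "y \<otimes>\<^bsub>L\<^esub> x \<in> ext A" if "x \<in> ext A" "y \<in> carrier L" for x y
  proof -
    obtain a s where a: "x = frac a s" "a \<in> A" "s \<notin> hp" using \<open>x \<in> ext A\<close> unfolding ext_def by blast
    obtain b t where b: "t \<notin> hp" "y = frac b t" using \<open>y \<in> carrier L\<close> by (rule L_E)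
    have "y \<otimes>\<^bsub>L\<^esub> x = frac (b * a) (t * s)" unfolding a(1) b(2) by (rule L_ops(1)[OF b(1) a(3)])
    thus ?thesis unfolding ext_def using idl.subspace_scale[OF A a(2)] S_mult[OF b(1) a(3)] by blast
  qed
  have sub: "ext A \<subseteq> carrier L" unfolding ext_def by auto
  show "subgroup (ext A) (add_monoid L)"
  proof (rule L.add.subgroupI)
    show "ext A \<subseteq> carrier L" by (rule sub)
    show "ext A \<noteq> {}" unfolding ext_def using idl.subspace_0[OF A] S_one by blast
    show "\<ominus>\<^bsub>L\<^esub> x \<in> ext A" if "x \<in> ext A" for x
    proof -
      have "(\<ominus>\<^bsub>L\<^esub> \<one>\<^bsub>L\<^esub>) \<otimes>\<^bsub>L\<^esub> x = \<ominus>\<^bsub>L\<^esub> x" using that sub by (simp add: L.l_minus subset_iff)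
      thus ?thesis using sc[OF that, of "\<ominus>\<^bsub>L\<^esub> \<one>\<^bsub>L\<^esub>"] by simp
    qed
    show "x \<oplus>\<^bsub>L\<^esub> y \<in> ext A" if xy: "x \<in> ext A" "y \<in> ext A" for x y
    proof -
      obtain a s where a: "x = frac a s" "a \<in> A" "s \<notin> hp" using xy(1) unfolding ext_def by blast
      obtain b t where b: "y = frac b t" "b \<in> A" "t \<notin> hp" using xy(2) unfolding ext_def by blast
      have "x \<oplus>\<^bsub>L\<^esub> y = frac (a * t + b * s) (s * t)" unfolding a(1) b(1) by (rule L_ops(2)[OF a(3) b(3)])
      moreover have "a * t + b * s \<in> A"
        by (rule idl.subspace_add[OF A ideal_mult_right[OF A a(2)] ideal_mult_right[OF A b(2)]])
      ultimately show ?thesis unfolding ext_def using S_mult[OF a(3) b(3)] by blast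
    qed
  qed
  fix x y assume xy: "x \<in> ext A" "y \<in> carrier L"
  show "y \<otimes>\<^bsub>L\<^esub> x \<in> ext A" by (rule sc[OF xy])
  thus "x \<otimes>\<^bsub>L\<^esub> y \<in> ext A" using L.m_comm[of x y] xy sub by auto
qed

lemma contr_ideal:
  assumes B: "ideal B L"
  shows "idl.subspace (contr B)" "hker \<subseteq> contr B" "B = ext (contr B)"
proof -
  interpret B: ideal B L by (rule B)
  have ops: "frac a 1 \<oplus>\<^bsub>L\<^esub> frac b 1 = frac (a + b) 1" "frac a 1 \<otimes>\<^bsub>L\<^esub> frac b 1 = frac (a * b) 1" for a b
    by (simp_all add: L_ops)
  show "idl.subspace (contr B)"
  proof (rule idl.subspaceI)
    show "0 \<in> contr B" unfolding contr_def using B.zero_closed by (simp add: L_zero)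
    show "x + y \<in> contr B" if "x \<in> contr B" "y \<in> contr B" for x y
      using that B.a_closed unfolding contr_def by (simp flip: ops)
    show "c * x \<in> contr B" if "x \<in> contr B" for c x
      using that B.I_l_closed unfolding contr_def by (simp flip: ops)
  qed
  show "hker \<subseteq> contr B"
  proof
    fix a assume "a \<in> hker"
    hence "frac a 1 = frac 0 1" by (subst frac_eq) (auto intro!: frelI)
    thus "a \<in> contr B" unfolding contr_def using B.zero_closed by (simp add: L_zero)
  qed
  show "B = ext (contr B)"
  proof (rule Set.set_eqI)
    fix x
    have "frac a s \<in> B \<longleftrightarrow> a \<in> contr B" if s: "s \<notin> hp" for a s
    proof -
      have "frac a s = frac 1 s \<otimes>\<^bsub>L\<^esub> frac a 1" using L_ops(1)[OF s S_one, of 1 a] by simp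
      moreover have "frac s 1 \<otimes>\<^bsub>L\<^esub> frac a s = frac a 1"
        unfolding L_ops(1)[OF S_one s] by (subst frac_eq) (use s in \<open>auto intro!: frel_eqI\<close>)
      ultimately show ?thesis
        using B.I_l_closed[of "frac a 1" "frac 1 s"] B.I_l_closed[of "frac a s" "frac s 1"] s
        unfolding contr_def by auto
    qed
    thus "x \<in> B \<longleftrightarrow> x \<in> ext (contr B)" using B.a_subset unfolding L_carrier ext_def by blast
  qed
qed

lemma contr_ext:
  assumes "idl.subspace A" "hker \<subseteq> A"
  shows "a \<in> contr (ext A) \<longleftrightarrow> (\<exists>t. t \<notin> hp \<and> t * a \<in> A)"
  unfolding contr_def using frac_ext_iff[OF assms S_one] by simp

lemma Idl_frac:
  assumes W: "\<And>g s. (g, s) \<in> W \<Longrightarrow> s \<notin> hp"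
  shows "Idl\<^bsub>L\<^esub> ((\<lambda>(g, s). frac g s) ` W) = ext (idl.span (hker \<union> fst ` W))"
proof
  let ?F = "(\<lambda>(g, s). frac g s) ` W" and ?A = "idl.span (hker \<union> fst ` W)"
  have F: "?F \<subseteq> carrier L" using W by auto
  have "?F \<subseteq> ext ?A"
  proof
    fix x assume "x \<in> ?F"
    then obtain g s where gs: "(g, s) \<in> W" "x = frac g s" by auto
    have "g \<in> ?A" using gs(1) by (intro idl.span_base) force
    thus "x \<in> ext ?A" unfolding gs(2) ext_def using W[OF gs(1)] by blast
  qed
  thus "Idl\<^bsub>L\<^esub> ?F \<subseteq> ext ?A" by (rule L.genideal_minimal[OF ext_ideal[OF idl.subspace_span]])
  have B: "ideal (Idl\<^bsub>L\<^esub> ?F) L" by (rule L.genideal_ideal[OF F])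
  have "g \<in> contr (Idl\<^bsub>L\<^esub> ?F)" if gs: "(g, s) \<in> W" for g s
  proof -
    have "frac g s \<in> Idl\<^bsub>L\<^esub> ?F" using L.genideal_self[OF F] gs by force
    hence "frac s 1 \<otimes>\<^bsub>L\<^esub> frac g s \<in> Idl\<^bsub>L\<^esub> ?F" by (rule ideal.I_l_closed[OF B]) simp
    moreover have "frac s 1 \<otimes>\<^bsub>L\<^esub> frac g s = frac g 1"
      unfolding L_ops(1)[OF S_one W[OF gs]] by (subst frac_eq) (use W[OF gs] in \<open>auto intro!: frel_eqI\<close>)
    ultimately show ?thesis unfolding contr_def by simp
  qed
  hence "fst ` W \<subseteq> contr (Idl\<^bsub>L\<^esub> ?F)" by auto
  hence "?A \<subseteq> contr (Idl\<^bsub>L\<^esub> ?F)" using contr_ideal[OF B] by (intro idl.span_minimal) auto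
  hence "ext ?A \<subseteq> ext (contr (Idl\<^bsub>L\<^esub> ?F))" unfolding ext_def by blast
  thus "ext ?A \<subseteq> Idl\<^bsub>L\<^esub> ?F" using contr_ideal(3)[OF B] by simp
qed

lemma ext_ideal_eq:
  assumes A: "idl.subspace A" "hker \<subseteq> A"
  shows "ext_ideal R p (h ` A) = ext A"
proof -
  have "loc_map R p ` h ` A = (\<lambda>(g, s). frac g s) ` (A \<times> {1})"
    unfolding image_image loc_map_frac by auto
  moreover have "hker \<union> fst ` (A \<times> {1::'p}) = A" using A(2) by force
  ultimately show ?thesis
    unfolding ext_ideal_def using Idl_frac[of "A \<times> {1}"] A(1) by (simp add: idl.span_eq_iff[THEN iffD2])
qed

lemma contr_prime:
  assumes "primeideal B L"
  shows "prime_id (contr B)"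
proof -
  interpret B: primeideal B L by fact
  have "frac 1 1 \<notin> B" using B.one_imp_carrier B.I_notcarr unfolding L_one by blast
  moreover have "a \<in> contr B \<or> b \<in> contr B" if "a * b \<in> contr B" for a b
  proof -
    have "frac a 1 \<otimes>\<^bsub>L\<^esub> frac b 1 \<in> B" using that unfolding contr_def by (simp add: L_ops)
    thus ?thesis using B.I_prime[of "frac a 1" "frac b 1"] unfolding contr_def by simp
  qed
  ultimately show ?thesis
    unfolding prime_id_def using contr_ideal(1)[OF B.is_ideal] by (auto simp: contr_def)
qed

lemma pchain_contr:
  "prime_chain L n P \<Longrightarrow> pchain (contr (P 0)) n (contr (P n))"
proof (induction n)
  case 0
  thus ?case using contr_prime by (auto simp: prime_chain_def intro: pchain_refl)
next
  case (Suc n)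
  hence P: "primeideal (P n) L" "primeideal (P (Suc n)) L" "P n \<subset> P (Suc n)" "prime_chain L n P"
    by (auto simp: prime_chain_def)
  have "P n = ext (contr (P n))" "P (Suc n) = ext (contr (P (Suc n)))"
    using contr_ideal(3) P(1,2) primeideal.axioms(1) by blast+
  hence "contr (P n) \<noteq> contr (P (Suc n))" using P(3) by auto
  hence "contr (P n) \<subset> contr (P (Suc n))" using P(3) unfolding contr_def by blast
  thus ?case using pchain_step[OF Suc.IH[OF P(4)] contr_prime[OF P(2)]] by blast
qed

lemma contr_ext_prime:
  assumes Q: "prime_id Q" "hker \<subseteq> Q" "Q \<subseteq> hp"
  shows "contr (ext Q) = Q" "primeideal (ext Q) L"
proof -
  have QI: "idl.subspace Q" using prime_idD(1)[OF Q(1)] .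
  have *: "(\<exists>t. t \<notin> hp \<and> t * a \<in> Q) \<longleftrightarrow> a \<in> Q" for a
    using prime_idD(3)[OF Q(1)] Q(3) idl.subspace_scale[OF QI] S_one by blast
  thus "contr (ext Q) = Q" using contr_ext[OF QI Q(2)] by blast
  have mem: "frac a s \<in> ext Q \<longleftrightarrow> a \<in> Q" if "s \<notin> hp" for a s
    using frac_ext_iff[OF QI Q(2) that] * by simp
  show "primeideal (ext Q) L"
  proof (rule primeidealI[OF ext_ideal[OF QI] L_cring])
    show "carrier L \<noteq> ext Q" using mem[OF S_one, of 1] prime_idD(2)[OF Q(1)] L_I[OF S_one, of 1] by blast
    fix x y assume xy: "x \<in> carrier L" "y \<in> carrier L" "x \<otimes>\<^bsub>L\<^esub> y \<in> ext Q"
    obtain a s where a: "s \<notin> hp" "x = frac a s" using xy(1) by (rule L_E)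
    obtain b t where b: "t \<notin> hp" "y = frac b t" using xy(2) by (rule L_E)
    have "a * b \<in> Q" using xy(3) unfolding a(2) b(2) L_ops(1)[OF a(1) b(1)] mem[OF S_mult[OF a(1) b(1)]] .
    thus "x \<in> ext Q \<or> y \<in> ext Q" unfolding a(2) b(2) mem[OF a(1)] mem[OF b(1)] using prime_idD(3)[OF Q(1)] by blast
  qed
qed

end

section \<open>Heights, generators and symbolic powers\<close>

lemma Inf_enat_attained:
  assumes "Inf {f A | A. Q A} = enat d"
  shows "\<exists>A. Q A \<and> f A = enat d"
proof -
  have "{f A | A. Q A} \<noteq> {}" using assms by (metis Inf_enat_def infinity_ne_i0 enat.distinct(1))
  hence "Inf {f A | A. Q A} \<in> {f A | A. Q A}" unfolding Inf_enat_def by (metis (mono_tags, lifting) LeastI ex_in_conv)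
  thus ?thesis unfolding assms by force
qed

lemma pchain_drop:
  "n \<le> k \<Longrightarrow> pchain A k B \<Longrightarrow> \<exists>A'. A \<subseteq> A' \<and> pchain A' n B"
proof (induction n arbitrary: k B)
  case 0
  thus ?case using pchain_prime[of A k B] pchain_refl by auto
next
  case (Suc n)
  then obtain l where l: "k = Suc l" "n \<le> l" by (cases k) auto
  obtain C where C: "pchain A l C" "prime_id B" "C \<subset> B" using pchain_SucE[of A l B] Suc.prems(2) l by auto
  obtain A' where "A \<subseteq> A'" "pchain A' n C" using Suc.IH[OF l(2) C(1)] by blast
  thus ?case using pchain_step[OF _ C(2,3)] by blast
qed

context ring_cover_prime
begin

text \<open>The height of the extended ideal is at most that of an associated prime of
  \<open>Ih\<close> below the prime at hand, which is at most two by unmixedness.\<close>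

lemma length_le_two:
  assumes cm: "cm_height_two hker M d x Ih" and Ip: "Ih \<subseteq> hp"
    and ht: "height L (ext Ih) = enat n"
  shows "n \<le> 2"
proof -
  interpret cm_height_two hker M d x Ih by (rule cm)
  obtain c where c: "prime_id {r. r * c \<in> Ih}" "{r. r * c \<in> Ih} \<subseteq> hp"
    using assoc_below[OF hp(1) Ip] by blast
  let ?Q = "{r. r * c \<in> Ih}"
  have IQ: "Ih \<subseteq> ?Q" using ideal_mult_right[OF I_ideal] by blast
  have Q: "contr (ext ?Q) = ?Q" "primeideal (ext ?Q) L"
    using contr_ext_prime[OF c(1) _ c(2)] IQ J_I by blast+
  have "ext Ih \<subseteq> ext ?Q" using IQ unfolding ext_def by blast
  hence "height L (ext Ih) \<le> prime_height L (ext ?Q)"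
    unfolding height_def using Q(2) by (intro Inf_lower) blast
  hence "enat n \<le> Sup {enat k | k. \<exists>P. prime_chain L k P \<and> P k = ext ?Q}"
    unfolding ht prime_height_def .
  then consider "n = 0" | k P where "k \<ge> n" "prime_chain L k P" "P k = ext ?Q"
    using Sup_enat_ge[of n "\<lambda>k. \<exists>P. prime_chain L k P \<and> P k = ext ?Q"] by blast
  thus ?thesis
  proof cases
    case 2
    have "primeideal (P 0) L" using 2(2) unfolding prime_chain_def by blast
    hence "hker \<subseteq> contr (P 0)" using contr_ideal(2) primeideal.axioms(1) by blast
    moreover have "pchain (contr (P 0)) k ?Q" using pchain_contr[OF 2(2)] 2(3) Q(1) by simp
    ultimately have "k \<le> 2" using assoc_height[OF c(1)] by blast
    thus ?thesis using 2(1) by simp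
  qed simp
qed

text \<open>The regular sequence has at most two entries, and fewer than two would make the ideal
  locally principal. Its two entries are replaced by their numerators, which generate the same local
  ideals.\<close>

lemma complete_intersection_gens:
  assumes cm: "cm_height_two hker M d x Ih" and Ip: "Ih \<subseteq> hp"
    and ci: "complete_intersection L (ext Ih)"
  shows "\<exists>g1\<in>Ih. \<exists>g2\<in>Ih. g1 \<notin> hker \<and>
    (\<forall>a\<in>Ih. \<exists>s. s \<notin> hp \<and> s * a \<in> idl.span (insert g2 (insert g1 hker))) \<and>
    (\<forall>c. c * g2 \<in> idl.span (insert g1 hker) \<longrightarrow> (\<exists>s. s \<notin> hp \<and> s * c \<in> idl.span (insert g1 hker)))"
proof -
  interpret cm: cm_height_two hker M d x Ih by (rule cm)
  obtain xs where xs: "regular_sequence L xs" "Idl\<^bsub>L\<^esub> (set xs) = ext Ih" "height L (ext Ih) = enat (length xs)"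
    using ci unfolding complete_intersection_def by blast
  have len: "length xs \<le> 2" by (rule length_le_two[OF cm Ip xs(3)])
  have xsL: "set xs \<subseteq> carrier L" using xs(1) unfolding regular_sequence_def by blast
  have rep: "\<exists>g s. x = frac g s \<and> g \<in> Ih \<and> s \<notin> hp" if "x \<in> set xs" for x
    using L.genideal_self[OF xsL] xs(2) that unfolding ext_def by blast
  have loc: "\<exists>s. s \<notin> hp \<and> s * a \<in> A" if "idl.subspace A" "hker \<subseteq> A" "Idl\<^bsub>L\<^esub> (set xs) = ext A" "a \<in> Ih" for a A
    using frac_ext_iff[OF that(1,2) S_one, of a] that(3,4) S_one unfolding xs(2) ext_def by blast
  have Idl1: "Idl\<^bsub>L\<^esub> {frac g s} = ext (idl.span (insert g hker))" if "s \<notin> hp" for g s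
    using Idl_frac[of "{(g, s)}"] that by simp
  have principal: False if "g \<in> Ih" "Idl\<^bsub>L\<^esub> (set xs) = ext (idl.span (insert g hker))" for g
  proof (rule cm.not_locally_principal[OF that(1) hp(1) Ip])
    fix a assume "a \<in> Ih"
    thus "\<exists>s. s \<notin> hp \<and> s * a \<in> idl.span (insert g hker)"
      using idl.span_superset[of "insert g hker"] by (intro loc[OF idl.subspace_span _ that(2)]) auto
  qed
  consider "xs = []" | U where "xs = [U]" | U V where "xs = [U, V]"
    using len by (cases xs; cases "tl xs"; auto; metis length_0_conv list.exhaust)
  thus ?thesis
  proof cases
    \<comment> \<open>The empty sequence is the principal case with generator 0.\<close>
    case 1
    have "Idl\<^bsub>L\<^esub> (set xs) = ext (idl.span (insert 0 hker))"
      using Idl_frac[of "{}"] 1 idl.subspace_0[OF hker_subspace] by (simp add: insert_absorb)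
    hence False using principal[of 0] idl.subspace_0[OF cm.I_ideal] by blast
    thus ?thesis by simp
  next
    case 2
    then obtain g s where g: "U = frac g s" "g \<in> Ih" "s \<notin> hp" using rep by auto
    hence "Idl\<^bsub>L\<^esub> (set xs) = ext (idl.span (insert g hker))" using Idl1 2 by simp
    hence False using principal g(2) by blast
    thus ?thesis by simp
  next
    case 3
    obtain g1 s1 where g1: "U = frac g1 s1" "g1 \<in> Ih" "s1 \<notin> hp" using rep[of U] 3 by auto
    obtain g2 s2 where g2: "V = frac g2 s2" "g2 \<in> Ih" "s2 \<notin> hp" using rep[of V] 3 by auto
    have nz: "nonzerodivisor (L Quot Idl\<^bsub>L\<^esub> (set (take i xs))) (Idl\<^bsub>L\<^esub> (set (take i xs)) +>\<^bsub>L\<^esub> xs ! i)" if "i < 2" for i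
      using xs(1) that 3 unfolding regular_sequence_def Let_def by simp
    let ?A = "idl.span (insert g1 hker)"
    have A: "idl.subspace ?A" "hker \<subseteq> ?A" using idl.span_superset[of "insert g1 hker"] by auto
    have "Idl\<^bsub>L\<^esub> ((\<lambda>(g, s). frac g s) ` {(g1, s1), (g2, s2)})
        = ext (idl.span (hker \<union> fst ` {(g1, s1), (g2, s2)}))"
      by (rule Idl_frac) (use g1 g2 in auto)
    hence "Idl\<^bsub>L\<^esub> (set xs) = ext (idl.span (insert g2 (insert g1 hker)))"
      using g1(1) g2(1) 3 by (simp add: insert_commute)
    hence gen: "\<exists>s. s \<notin> hp \<and> s * a \<in> idl.span (insert g2 (insert g1 hker))" if "a \<in> Ih" for a
      using that idl.span_superset[of "insert g2 (insert g1 hker)"] by (intro loc[OF idl.subspace_span]) auto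
    have "g1 \<notin> hker"
    proof
      assume g: "g1 \<in> hker"
      have Z: "Idl\<^bsub>L\<^esub> {} = ext hker" using Idl_frac[of "{}"] hker_subspace by (simp add: idl.span_eq_iff[THEN iffD2])
      have "U \<otimes>\<^bsub>L\<^esub> frac 1 1 = U" using g1 by (simp add: L_ops)
      also have "U \<in> ext hker" using g g1 unfolding ext_def by blast
      finally have "U \<otimes>\<^bsub>L\<^esub> frac 1 1 \<in> Idl\<^bsub>L\<^esub> {}" using Z by simp
      hence "frac 1 1 \<in> Idl\<^bsub>L\<^esub> {}"
        using L.nonzerodivisor_quotD[of "Idl\<^bsub>L\<^esub> {}" U "frac 1 1"] nz[of 0] L.genideal_ideal[of "{}"] 3 xsL by simp
      then obtain t where "t \<notin> hp" "t * 1 \<in> hker"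
        unfolding Z using frac_ext_iff[OF hker_subspace subset_refl S_one] by blast
      thus False using hp(2) by auto
    qed
    moreover have "\<exists>s. s \<notin> hp \<and> s * c \<in> ?A" if c: "c * g2 \<in> ?A" for c
    proof -
      have E: "Idl\<^bsub>L\<^esub> {U} = ext ?A" using Idl1[OF g1(3)] g1(1) by simp
      have "V \<otimes>\<^bsub>L\<^esub> frac c 1 = frac (c * g2) s2" unfolding g2(1) L_ops(1)[OF g2(3) S_one] by (simp add: mult.commute)
      hence "V \<otimes>\<^bsub>L\<^esub> frac c 1 \<in> Idl\<^bsub>L\<^esub> {U}" unfolding E using c g2(3) unfolding ext_def by blast
      hence "frac c 1 \<in> Idl\<^bsub>L\<^esub> {U}"
        using L.nonzerodivisor_quotD[of "Idl\<^bsub>L\<^esub> {U}" V "frac c 1"] nz[of 1] L.genideal_ideal[of "{U}"] 3 xsL by simp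
      thus ?thesis unfolding E frac_ext_iff[OF A S_one] .
    qed
    ultimately show ?thesis using g1(2) g2(2) gen by blast
  qed
qed

end

context ring_cover
begin

lemma ring_cover_prime_image:
  assumes "prime_id Q" "hker \<subseteq> Q"
  shows "ring_cover_prime R h (h ` Q)" "ring_cover_prime.hp h (h ` Q) = Q"
proof -
  show c: "ring_cover_prime R h (h ` Q)"
    by (intro ring_cover_prime.intro ring_cover_prime_axioms.intro ring_cover_axioms prime_image assms)
  show "ring_cover_prime.hp h (h ` Q) = Q"
    unfolding ring_cover_prime.hp_def[OF c] by (rule preimage_image[OF prime_idD(1)[OF assms(1)] assms(2)])
qed

lemma symbolic_power_preimage:
  assumes I: "ideal I R"
  shows "h r \<in> symbolic_power R I n \<longleftrightarrow>
    (\<forall>Q c. prime_id Q \<longrightarrow> Q = {r. r * c \<in> h -` I} \<longrightarrow> (\<exists>s. s \<notin> Q \<and> s * r \<in> ipow hker (h -` I) n))"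
proof -
  let ?P = "ipow hker (h -` I) n"
  have P: "idl.subspace ?P" "hker \<subseteq> ?P" "h ` ?P = ideal_power R I n"
    using preimage_ideal_power[OF I, of n] ipow_subspace ipow_base image_preimage ideal_sub by metis+
  have loc: "loc_map R (h ` Q) (h r) \<in> ext_ideal R (h ` Q) (ideal_power R I n) \<longleftrightarrow> (\<exists>s. s \<notin> Q \<and> s * r \<in> ?P)"
    if Q: "prime_id Q" "Q = {r. r * c \<in> h -` I}" for Q c
  proof -
    have "hker \<subseteq> Q"
      unfolding Q(2) using preimage_subspace[OF I] ideal_mult_right[OF hker_subspace] by blast
    note c = ring_cover_prime_image[OF Q(1) this]
    interpret ring_cover_prime R h "h ` Q" by (rule c(1))
    show ?thesis
      using frac_ext_iff[OF P(1,2) S_one, of r] ext_ideal_eq[OF P(1,2)] unfolding P(3) loc_map_frac c(2) by simp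
  qed
  show ?thesis
  proof
    assume a: "h r \<in> symbolic_power R I n"
    show "\<forall>Q c. prime_id Q \<longrightarrow> Q = {r. r * c \<in> h -` I} \<longrightarrow> (\<exists>s. s \<notin> Q \<and> s * r \<in> ?P)"
    proof (intro allI impI)
      fix Q c assume Q: "prime_id Q" "Q = {r. r * c \<in> h -` I}"
      have "h ` Q \<in> associated_primes R I" unfolding associated_primes_preimage[OF I] using Q by blast
      hence "loc_map R (h ` Q) (h r) \<in> ext_ideal R (h ` Q) (ideal_power R I n)"
        using a unfolding symbolic_power_def by blast
      thus "\<exists>s. s \<notin> Q \<and> s * r \<in> ?P" unfolding loc[OF Q] .
    qed
  next
    assume a: "\<forall>Q c. prime_id Q \<longrightarrow> Q = {r. r * c \<in> h -` I} \<longrightarrow> (\<exists>s. s \<notin> Q \<and> s * r \<in> ?P)"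
    have "loc_map R p (h r) \<in> ext_ideal R p (ideal_power R I n)" if p: "p \<in> associated_primes R I" for p
    proof -
      obtain Q c where Q: "prime_id Q" "Q = {r. r * c \<in> h -` I}" "p = h ` Q"
        using p unfolding associated_primes_preimage[OF I] by blast
      show ?thesis unfolding Q(3) loc[OF Q(1,2)] using a Q(1,2) by blast
    qed
    thus "h r \<in> symbolic_power R I n" unfolding symbolic_power_def by simp
  qed
qed

lemma min_gens_preimage:
  assumes "min_gens R I = enat d"
  shows "\<exists>x. h -` I = idl.span (hker \<union> x ` {..<d}) \<and>
    (\<forall>i<d. x i \<notin> idl.span (hker \<union> x ` ({..<d} - {i})))"
proof -
  obtain A where A: "finite A" "A \<subseteq> carrier R" "Idl A = I" "card A = d"
    using Inf_enat_attained[of "\<lambda>A. enat (card A)" "\<lambda>A. finite A \<and> A \<subseteq> carrier R \<and> Idl A = I" d]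
      assms unfolding min_gens_def by auto
  obtain e where e: "bij_betw e {..<d} A"
    using ex_bij_betw_nat_finite[OF A(1)] A(4) by (auto simp: atLeast0LessThan)
  have "\<exists>y. i < d \<longrightarrow> h y = e i" for i using h_obtain[of "e i"] A(2) bij_betwE[OF e] by blast
  then obtain x where x: "\<And>i. i < d \<Longrightarrow> h (x i) = e i" by metis
  have hx: "h ` x ` {..<d} = A" using x bij_betw_imp_surj_on[OF e] by (auto simp: image_image)
  have I: "h -` I = idl.span (hker \<union> x ` {..<d})" using preimage_Idl[of "x ` {..<d}"] hx A(3) by simp
  have "x i \<notin> idl.span (hker \<union> x ` ({..<d} - {i}))" if i: "i < d" for i
  proof
    let ?S = "x ` ({..<d} - {i})"
    assume xi: "x i \<in> idl.span (hker \<union> ?S)"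
    have sup: "hker \<union> ?S \<subseteq> idl.span (hker \<union> ?S)" by (rule idl.span_superset)
    have "x j \<in> idl.span (hker \<union> ?S)" if "j < d" for j using xi sup that by (cases "j = i") auto
    hence "hker \<union> x ` {..<d} \<subseteq> idl.span (hker \<union> ?S)" using sup by auto
    hence "idl.span (hker \<union> x ` {..<d}) \<subseteq> idl.span (hker \<union> ?S)" by (intro idl.span_minimal) auto
    moreover have "idl.span (hker \<union> ?S) \<subseteq> idl.span (hker \<union> x ` {..<d})" by (intro idl.span_mono) auto
    ultimately have "h -` (Idl (h ` ?S)) = h -` I" unfolding preimage_Idl I by blast
    moreover have "Idl (h ` ?S) \<subseteq> carrier R" by (rule ideal_sub, rule genideal_ideal) auto
    moreover have "I \<subseteq> carrier R" using ideal_sub[OF genideal_ideal[OF A(2)]] A(3) by simp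
    ultimately have "Idl (h ` ?S) = I" using preimage_eq_iff(2) by blast
    hence "enat d \<le> enat (card (h ` ?S))"
      unfolding assms[symmetric] min_gens_def by (intro Inf_lower) auto
    hence "d \<le> card (h ` ?S)" by simp
    also have "\<dots> \<le> card ({..<d} - {i})"
      by (metis card_image_le finite_Diff finite_lessThan image_image)
    also have "\<dots> < d" using i by simp
    finally show False by simp
  qed
  thus ?thesis using I by blast
qed

text \<open>If \<open>t\<close> were not invertible, a proper ideal maximal among those containing
  it would map onto a maximal ideal, which is \<open>m\<close> by uniqueness.\<close>

lemma unit_outside_maximal:
  assumes local: "noetherian_local_ring R m" and t: "t \<notin> h -` m"
  shows "\<exists>u. t * u - 1 \<in> hker"
proof -
  interpret N: noetherian_local_ring R m by (rule local)
  have noeth: "noeth hker" by (rule noeth_hker) (rule N.noetherian_ring_axioms)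
  have "1 \<in> idl.span (insert t hker)"
  proof (rule ccontr)
    assume n: "1 \<notin> idl.span (insert t hker)"
    define F where "F = {A. idl.subspace A \<and> hker \<subseteq> A \<and> 1 \<notin> A \<and> t \<in> A}"
    have "idl.span (insert t hker) \<in> F"
      using n idl.span_superset[of "insert t hker"] unfolding F_def by auto
    hence ne: "F \<noteq> {}" by blast
    obtain A where A: "A \<in> F" "\<And>B. B \<in> F \<Longrightarrow> A \<subseteq> B \<Longrightarrow> B = A"
      by (rule noethD[OF noeth ne]) (auto simp: F_def)
    have AI: "idl.subspace A" "hker \<subseteq> A" "1 \<notin> A" "t \<in> A" using A(1) unfolding F_def by auto
    have pre: "h -` (h ` A) = A" by (rule preimage_image[OF AI(1,2)])
    have "maximalideal (h ` A) R"
    proof (rule maximalidealI[OF image_ideal[OF AI(1)]])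
      show "carrier R \<noteq> h ` A" using pre AI(3) h_closed[of 1] by blast
      fix B assume B: "ideal B R" "h ` A \<subseteq> B" "B \<subseteq> carrier R"
      show "B = h ` A \<or> B = carrier R"
      proof (cases "1 \<in> h -` B")
        case True
        thus ?thesis using ideal.one_imp_carrier[OF B(1)] h_one by auto
      next
        case False
        have "A \<subseteq> h -` B" using B(2) by blast
        moreover from this have "h -` B \<in> F"
          using False AI(4) preimage_subspace[OF B(1)] unfolding F_def by auto
        ultimately have "h -` B = A" using A(2) by blast
        thus ?thesis using image_preimage[OF B(3)] by auto
      qed
    qed
    hence "h ` A = m" by (rule N.m_unique)
    thus False using AI(4) t by blast
  qed
  then obtain k where "1 - k * t \<in> hker" using span_insert_ideal[OF hker_subspace] by blast
  hence "- (1 - k * t) \<in> hker" by (rule idl.subspace_neg[OF hker_subspace])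
  thus ?thesis by (intro exI[of _ k]) (simp add: mult.commute)
qed

lemma regular_quotient_preimage:
  assumes reg: "regular_local_ring R m" and dim: "krull_dim R = enat d" and d: "d > 0"
  shows "\<exists>x. regular_quotient hker (h -` m) d x"
proof -
  interpret N: regular_local_ring R m by (rule reg)
  have m: "primeideal m R" using N.m_maximal maximalideal_prime by blast
  have unit: "\<exists>u. t * u - 1 \<in> hker" if "t \<notin> h -` m" for t
    by (rule unit_outside_maximal[OF N.noetherian_local_ring_axioms that])
  obtain x where x: "h -` m = idl.span (hker \<union> x ` {..<d})"
    using min_gens_preimage[of m d] N.regular dim by auto
  have le: "k \<le> d" if "prime_chain R k P" for k P
    using dim Sup_enat_le[of "\<lambda>k. \<exists>P. prime_chain R k P" d k] that unfolding krull_dim_def by auto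
  have "d = 0 \<or> (\<exists>k\<ge>d. \<exists>P. prime_chain R k P)"
    by (rule Sup_enat_ge) (use dim in \<open>simp add: krull_dim_def\<close>)
  then obtain P where P: "prime_chain R d P" using d le by (metis gr_implies_not0 le_antisym)
  have c: "pchain (h -` P 0) d (h -` P d)" by (rule pchain_preimage[OF P])
  have K: "hker \<subseteq> h -` P 0" "prime_id (h -` P d)" "hker \<subseteq> h -` P d"
    using P prime_preimage unfolding prime_chain_def by auto
  have "h -` P d \<subseteq> h -` m"
  proof
    fix t assume t: "t \<in> h -` P d"
    show "t \<in> h -` m"
    proof (rule ccontr)
      assume "t \<notin> h -` m"
      then obtain u where "t * u - 1 \<in> hker" using unit by blast
      hence "t * u - (t * u - 1) \<in> h -` P d"
        using idl.subspace_diff[OF prime_idD(1)[OF K(2)] ideal_mult_right[OF prime_idD(1)[OF K(2)] t]] K(3) by blast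
      thus False using prime_idD(2)[OF K(2)] by simp
    qed
  qed
  \<comment> \<open>A chain of greatest length ends at \<open>m\<close>, since otherwise
    \<open>m\<close> could be appended.\<close>
  moreover have "\<not> h -` P d \<subset> h -` m"
  proof
    assume "h -` P d \<subset> h -` m"
    hence "pchain (h -` P 0) (Suc d) (h -` m)" by (rule pchain_step[OF c prime_preimage(1)[OF m]])
    then obtain P' where "prime_chain R (Suc d) P'" using pchain_image[OF _ K(1)] by blast
    thus False using le by fastforce
  qed
  ultimately have "h -` P d = h -` m" by blast
  hence "\<exists>A. hker \<subseteq> A \<and> pchain A d (h -` m)" using c K(1) by auto
  hence "regular_quotient hker (h -` m) d x"
    using noeth_hker[OF N.noetherian_ring_axioms] hker_subspace prime_preimage(1,2)[OF m] unit x
    by (intro regular_quotient.intro) auto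
  thus ?thesis by blast
qed

lemma cm_height_two_preimage:
  assumes rq: "regular_quotient hker (h -` m) d x" and d: "d > 2" and I: "ideal I R"
    and cm: "cohen_macaulay_ideal R I" and ht: "height R I = 2"
  shows "cm_height_two hker (h -` m) d x (h -` I)"
proof -
  interpret regular_quotient hker "h -` m" d x by (rule rq)
  have hI: "h ` (h -` I) = I" by (rule image_preimage[OF ideal_sub[OF I]])
  have ht2: "height R I = enat 2" using ht by (simp add: numeral_eq_enat)
  show ?thesis
  proof (intro cm_height_two.intro cm_height_two_axioms.intro rq preimage_subspace[OF I])
    show "3 \<le> d" using d by simp
    show "\<exists>A. hker \<subseteq> A \<and> pchain A 2 q" if q: "prime_id q" "h -` I \<subseteq> q" for q
    proof -
      have hq: "hker \<subseteq> q" using preimage_subspace(2)[OF I] q(2) by blast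
      have "I \<subseteq> h ` q" using hI q(2) by blast
      hence "height R I \<le> prime_height R (h ` q)"
        unfolding height_def using prime_image[OF q(1) hq] by (intro Inf_lower) blast
      hence "enat 2 \<le> Sup {enat k | k. \<exists>P. prime_chain R k P \<and> P k = h ` q}"
        unfolding ht2 prime_height_def .
      then obtain k P where k: "k \<ge> 2" "prime_chain R k P" "P k = h ` q" using Sup_enat_ge by force
      have c: "pchain (h -` P 0) k q"
        using pchain_preimage[OF k(2)] k(3) preimage_image[OF prime_idD(1)[OF q(1)] hq] by simp
      have "hker \<subseteq> h -` P 0" using k(2) prime_preimage(2) unfolding prime_chain_def by blast
      thus ?thesis using pchain_drop[OF k(1) c] by (meson order_trans)
    qed
    obtain p where p: "primeideal p R" "I \<subseteq> p" "prime_height R p = enat 2"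
      using Inf_enat_attained[of "prime_height R" "\<lambda>p. primeideal p R \<and> I \<subseteq> p" 2] ht2 unfolding height_def by auto
    have "n \<le> 2" if n: "hker \<subseteq> A" "pchain A n (h -` p)" for A n
    proof -
      obtain P where "prime_chain R n P" "P n = p"
        using pchain_image[OF n(2,1)] image_preimage[OF prime_preimage(3)[OF p(1)]] by auto
      thus ?thesis
        using p(3) Sup_enat_le[of "\<lambda>k. \<exists>P. prime_chain R k P \<and> P k = p" 2 n] unfolding prime_height_def by auto
    qed
    thus "\<exists>p. prime_id p \<and> h -` I \<subseteq> p \<and> (\<forall>A n. hker \<subseteq> A \<longrightarrow> pchain A n p \<longrightarrow> n \<le> 2)"
      using prime_preimage(1)[OF p(1)] p(2) by (intro exI[of _ "h -` p"]) auto
    fix p n B assume p: "prime_id p" "h -` I \<subseteq> p" "pchain p n B"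
    interpret Q: ring_cover "R Quot I" "\<lambda>x. I +> h x" by (rule quotient_cover[OF I])
    note Qker = quotient_cover(2)[OF I]
    obtain m' where m': "noetherian_local_ring (R Quot I) m'" "depth (R Quot I) m' = krull_dim (R Quot I)"
      using cm unfolding cohen_macaulay_ideal_def cohen_macaulay_local_ring_def by blast
    interpret Qm: noetherian_local_ring "R Quot I" m' by (rule m'(1))
    have m'p: "primeideal m' (R Quot I)" using Q.maximalideal_prime[OF Qm.m_maximal] .
    obtain P where "prime_chain (R Quot I) n P" using Q.pchain_image[OF p(3)] p(2) Qker by blast
    hence "enat n \<le> depth (R Quot I) m'" unfolding m'(2) krull_dim_def by (intro Sup_upper) blast
    moreover have "{enat (length xs) | xs. regular_sequence (R Quot I) xs \<and> set xs \<subseteq> m'} =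
        {enat k | k. \<exists>xs. length xs = k \<and> regular_sequence (R Quot I) xs \<and> set xs \<subseteq> m'}"
      by blast
    ultimately consider "n = 0" | xs where "n \<le> length xs" "regular_sequence (R Quot I) xs" "set xs \<subseteq> m'"
      unfolding depth_def using Sup_enat_ge[of n "\<lambda>k. \<exists>xs. length xs = k \<and> regular_sequence (R Quot I) xs \<and> set xs \<subseteq> m'"]
      by auto
    thus "\<exists>ys. rseq (h -` I) ys \<and> n \<le> length ys \<and> set ys \<subseteq> h -` m"
    proof cases
      case 1
      thus ?thesis by (intro exI[of _ "[]"]) simp
    next
      case 2
      have "\<forall>y\<in>set xs. \<exists>z. I +> h z = y" using 2(3) Q.prime_preimage(3)[OF m'p] Q.h_obtain by blast
      then obtain f where f: "\<And>y. y \<in> set xs \<Longrightarrow> I +> h (f y) = y" by metis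
      have "map (\<lambda>x. I +> h x) (map f xs) = xs" using f by (simp add: map_idI)
      hence "rseq (h -` I) (map f xs)" using Q.regular_sequence_rseq[of "map f xs"] 2(2) unfolding Qker by simp
      moreover have "set (map f xs) \<subseteq> (\<lambda>x. I +> h x) -` m'" using f 2(3) by auto
      \<comment> \<open>The maximal ideal of the quotient pulls back to a proper ideal above the
        kernel, and all of these lie below \<open>m\<close>.\<close>
      moreover have "(\<lambda>x. I +> h x) -` m' \<subseteq> h -` m"
        using Q.prime_preimage(1,2)[OF m'p] prime_idD(1,2)[OF Q.prime_preimage(1)[OF m'p]]
          preimage_subspace(2)[OF I] unfolding Qker by (intro proper_le_m) auto
      ultimately show ?thesis using 2(1) by (intro exI[of _ "map f xs"]) auto
    qed
  qed
qed

end

theorem theorem1p2: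
  fixes R :: "('a, 'b) ring_scheme" and m I :: "'a set" and d :: nat
  assumes "regular_local_ring R m"
    and "krull_dim R = enat d"
    and "d > 2"
    and "ideal I R"
    and "cohen_macaulay_ideal R I"
    and "height R I = 2"
    and "min_gens R I = enat d"
    and "locally_complete_intersection R m I"
  shows "(\<forall>i. 1 \<le> i \<and> i < d - 1 \<longrightarrow> ideal_power R I i = symbolic_power R I i)
       \<and> (\<forall>n. d - 1 \<le> n \<longrightarrow> ideal_power R I n \<noteq> symbolic_power R I n)"
proof -
  define h where "h = fring_map R"
  interpret reg: regular_local_ring R m by (rule assms(1))
  interpret ring_cover R h unfolding h_def by (rule reg.ring_cover_fring)
  define Ih where "Ih = h -` I"
  obtain x where rq: "regular_quotient hker (h -` m) d x"
    using regular_quotient_preimage[OF assms(1,2)] assms(3) by auto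
  have cm: "cm_height_two hker (h -` m) d x Ih"
    unfolding Ih_def by (rule cm_height_two_preimage[OF rq assms(3-6)])
  interpret cm: cm_height_two hker "h -` m" d x Ih by (rule cm)
  obtain f where f: "Ih = idl.span (hker \<union> f ` {..<d})"
    "\<And>i. i < d \<Longrightarrow> f i \<notin> idl.span (hker \<union> f ` ({..<d} - {i}))"
    using min_gens_preimage[OF assms(7)] unfolding Ih_def by blast
  interpret g: height_two_gens hker "h -` m" d x Ih f
    by unfold_locales (use f in auto)
  \<comment> \<open>Least size matters: it confines the coefficients of relations to the maximal
    ideal, which is what makes the syzygies free.\<close>
  obtain L where L: "g.syz_gen L" "\<And>L'. g.syz_gen L' \<Longrightarrow> card L \<le> card L'" using g.syz_gen_minimal by blast
  have indep: "indep hker L" by (rule g.syz_free[OF L])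
  have lci: "\<exists>g1\<in>Ih. \<exists>g2\<in>Ih. g1 \<notin> hker \<and>
      (\<forall>a\<in>Ih. \<exists>s. s \<notin> p \<and> s * a \<in> idl.span (insert g2 (insert g1 hker))) \<and>
      (\<forall>c. c * g2 \<in> idl.span (insert g1 hker) \<longrightarrow> (\<exists>s. s \<notin> p \<and> s * c \<in> idl.span (insert g1 hker)))"
    if p: "prime_id p" "Ih \<subseteq> p" "p \<noteq> h -` m" for p
  proof -
    have pk: "hker \<subseteq> p" using cm.J_I p(2) by blast
    note c = ring_cover_prime_image[OF p(1) pk]
    interpret P: ring_cover_prime R h "h ` p" by (rule c(1))
    have hI: "h ` Ih = I" unfolding Ih_def by (rule image_preimage[OF ideal_sub[OF assms(4)]])
    have "I \<subseteq> h ` p" using hI p(2) by blast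
    moreover have "h ` p \<noteq> m" using c(2) p(3) unfolding P.hp_def by auto
    ultimately have "complete_intersection P.L (ext_ideal R (h ` p) (h ` Ih))"
      using assms(8) P.p_prime unfolding locally_complete_intersection_def hI by blast
    hence "complete_intersection P.L (P.ext Ih)" unfolding P.ext_ideal_eq[OF cm.I_ideal cm.J_I] .
    thus ?thesis using P.complete_intersection_gens[OF cm] p(2) unfolding c(2) by blast
  qed
  interpret l: lci_gens hker "h -` m" d x Ih f L
    by unfold_locales (rule L(1), rule indep, rule lci)
  have pre: "h r \<in> ideal_power R I n \<longleftrightarrow> r \<in> ipow hker Ih n" for r n
    using preimage_ideal_power[OF assms(4), of n] unfolding Ih_def by blast
  have sub: "ideal_power R I n \<subseteq> carrier R" for n using preimage_ideal_power[OF assms(4)] ideal_sub by blast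
  note sym = symbolic_power_preimage[OF assms(4), folded Ih_def]
  show ?thesis
  proof (intro conjI allI impI)
    fix i assume i: "1 \<le> i \<and> i < d - 1"
    show "ideal_power R I i = symbolic_power R I i"
    proof
      show "ideal_power R I i \<subseteq> symbolic_power R I i"
      proof
        fix y assume y: "y \<in> ideal_power R I i"
        then obtain r where r: "y = h r" using sub h_obtain by blast
        have "1 * r \<in> ipow hker Ih i" using y unfolding r pre by simp
        thus "y \<in> symbolic_power R I i" unfolding r sym using prime_idD(2) by blast
      qed
      show "symbolic_power R I i \<subseteq> ideal_power R I i"
      proof
        fix y assume y: "y \<in> symbolic_power R I i"
        then obtain r where r: "y = h r" using h_obtain unfolding symbolic_power_def by blast
        have "r \<in> ipow hker Ih i"
          by (rule l.symbolic_power_equal) (use i y[unfolded r sym] in blast)+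
        thus "y \<in> ideal_power R I i" unfolding r pre .
      qed
    qed
  next
    fix n assume "d - 1 \<le> n"
    then obtain r where "r \<notin> ipow hker Ih n"
      "\<forall>Q c. prime_id Q \<longrightarrow> Q = {r. r * c \<in> Ih} \<longrightarrow> (\<exists>s. s \<notin> Q \<and> s * r \<in> ipow hker Ih n)"
      using l.symbolic_power_larger by blast
    hence "h r \<in> symbolic_power R I n" "h r \<notin> ideal_power R I n" unfolding sym pre by blast+
    thus "ideal_power R I n \<noteq> symbolic_power R I n" by blast
  qed
qed

end
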